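(* Let $(\varepsilon_i)_{i\in\mathbb{Z}}$ be a sequence of real-valued i.i.d. random variables in $\mathbf{L}^2$, let $(a_j)_{j\ge0}$ be real numbers with $\sum_{j\ge0}|a_j|<\infty$, and let $Y_k=\sum_{j\ge0}a_j\varepsilon_{k-j}$ for $k\in\mathbb{Z}$. Assume that $\varepsilon_0$ has a density bounded by a constant $K$ and that $|a_0|\neq0$. Moreover, assume that $$\sum_{k\ge0}\int_0^{(a_k)^2}\frac{Q_{|Y_0|}(u)}{\sqrt u}\,du<\infty .$$ Let $F_Y$ be the common distribution function of the $Y_k$ and $F_n(t)=\frac1n\sum_{i=1}^n\mathbf{1}_{Y_i\le t}$. Then $\{t\mapsto\sqrt n(F_n(t)-F_Y(t)),\ t\in\mathbb{R}\}$ converges in law in $\mathbf{L}^1(\lambda)$, as $n\to\infty$, to an $\mathbf{L}^1(\lambda)$-valued centered Gaussian random variable with covariance function: for any $f,g\in\mathbf{L}^\infty(\lambda)$, $$\Phi_\lambda(f,g)=\int_{\mathbb{R}^2}f(s)g(t)\,C(s,t)\,dt\,ds,$$ with $$C(s,t)=F_Y(t\wedge s)-F_Y(t)F_Y(s)+\sum_{k\ge1}\big(\mathbb{P}(Y_0\le t,Y_k\le s)+\mathbb{P}(Y_0\le s,Y_k\le t)-2F_Y(t)F_Y(s)\big).$$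
   Context: $\lambda$ is the Lebesgue measure on $\mathbb{R}$; $\mathbf{L}^1(\lambda)$ is the space of Lebesgue-integrable real functions with norm $\int_{\mathbb{R}}|x(t)|\,dt$, with dual $\mathbf{L}^\infty(\lambda)$ acting by $f(x)=\int_{\mathbb{R}} f(t)x(t)\,dt$. The covariance function of a centered Gaussian $G$ in $\mathbf{L}^1(\lambda)$ is $(f,g)\mapsto\mathbb{E}(f(G)g(G))$. $Q_{|Y_0|}$ is the quantile function of $|Y_0|$, i.e. the cadlag inverse of the tail function $x\mapsto\mathbb{P}(|Y_0|>x)$: $Q_{|Y_0|}(u)=\inf\{x\ge0:\mathbb{P}(|Y_0|>x)\le u\}$ (so it vanishes for $u\ge1$). *)

theory Defs
  imports "HOL-Probability.Probability"
begin

section \<open>The Banach space of Lebesgue-integrable functions on the line\<close>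

text \<open>
  Elements are almost-everywhere classes of Borel functions that are integrable with respect to
  Lebesgue measure. Every Lebesgue-measurable function agrees almost everywhere with a Borel one,
  so this is the usual space.
\<close>

definition l1_eq :: "(real \<Rightarrow> real) \<Rightarrow> (real \<Rightarrow> real) \<Rightarrow> bool" where
  "l1_eq x y \<longleftrightarrow> integrable lborel x \<and> integrable lborel y \<and> (AE t in lborel. x t = y t)"

quotient_type l1 = "real \<Rightarrow> real" / partial: l1_eq
proof (rule part_equivpI)
  show "\<exists>x. l1_eq x x"
    by (rule exI[of _ "\<lambda>_. 0"]) (simp add: l1_eq_def)
  show "symp l1_eq"
    by (rule sympI) (auto simp: l1_eq_def)
  show "transp l1_eq"
    by (rule transpI) (auto simp: l1_eq_def)
qed

instantiation l1 :: real_normed_vector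
begin

lift_definition zero_l1 :: l1 is "\<lambda>_. 0"
  by (simp add: l1_eq_def)

lift_definition plus_l1 :: "l1 \<Rightarrow> l1 \<Rightarrow> l1" is "\<lambda>x y t. x t + y t"
  by (auto simp: l1_eq_def)

lift_definition minus_l1 :: "l1 \<Rightarrow> l1 \<Rightarrow> l1" is "\<lambda>x y t. x t - y t"
  by (auto simp: l1_eq_def)

lift_definition uminus_l1 :: "l1 \<Rightarrow> l1" is "\<lambda>x t. - x t"
  by (auto simp: l1_eq_def)

lift_definition scaleR_l1 :: "real \<Rightarrow> l1 \<Rightarrow> l1" is "\<lambda>c x t. c * x t"
  by (auto simp: l1_eq_def)

lift_definition norm_l1 :: "l1 \<Rightarrow> real" is "\<lambda>x. \<integral>t. \<bar>x t\<bar> \<partial>lborel"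
  by (auto simp: l1_eq_def intro!: integral_cong_AE)

definition dist_l1 :: "l1 \<Rightarrow> l1 \<Rightarrow> real" where
  "dist_l1 x y = norm (x - y)"

definition sgn_l1 :: "l1 \<Rightarrow> l1" where
  "sgn_l1 x = inverse (norm x) *\<^sub>R x"

definition uniformity_l1 :: "(l1 \<times> l1) filter" where
  "uniformity_l1 = (INF e\<in>{0<..}. principal {(x, y). dist x y < e})"

definition open_l1 :: "l1 set \<Rightarrow> bool" where
  "open_l1 U \<longleftrightarrow> (\<forall>x\<in>U. eventually (\<lambda>(x', y). x' = x \<longrightarrow> y \<in> U) uniformity)"

instance
proof
  fix x y z :: l1 and c d :: real
  show "x + y + z = x + (y + z)"
    by transfer (auto simp: l1_eq_def algebra_simps)
  show "x + y = y + x"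
    by transfer (auto simp: l1_eq_def algebra_simps)
  show "0 + x = x"
    by transfer (auto simp: l1_eq_def)
  show "- x + x = 0"
    by transfer (auto simp: l1_eq_def)
  show "x - y = x + - y"
    by transfer (auto simp: l1_eq_def)
  show "c *\<^sub>R (x + y) = c *\<^sub>R x + c *\<^sub>R y"
    by transfer (auto simp: l1_eq_def algebra_simps)
  show "(c + d) *\<^sub>R x = c *\<^sub>R x + d *\<^sub>R x"
    by transfer (auto simp: l1_eq_def algebra_simps)
  show "c *\<^sub>R d *\<^sub>R x = (c * d) *\<^sub>R x"
    by transfer (auto simp: l1_eq_def algebra_simps)
  show "1 *\<^sub>R x = x"
    by transfer (auto simp: l1_eq_def)
  show "dist x y = norm (x - y)"
    by (rule dist_l1_def)
  show "sgn x = inverse (norm x) *\<^sub>R x"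
    by (rule sgn_l1_def)
  show "uniformity = (INF e\<in>{0<..}. principal {(x, y :: l1). dist x y < e})"
    by (rule uniformity_l1_def)
  show "open U \<longleftrightarrow> (\<forall>x\<in>U. eventually (\<lambda>(x', y). x' = x \<longrightarrow> y \<in> U) uniformity)" for U :: "l1 set"
    by (rule open_l1_def)
  show "norm x = 0 \<longleftrightarrow> x = 0"
    by transfer (auto simp: l1_eq_def integral_nonneg_eq_0_iff_AE)
  show "norm (x + y) \<le> norm x + norm y"
  proof transfer
    fix x y :: "real \<Rightarrow> real"
    assume "l1_eq x x" "l1_eq y y"
    then have i: "integrable lborel x" "integrable lborel y"
      by (auto simp: l1_eq_def)
    have "(\<integral>t. \<bar>x t + y t\<bar> \<partial>lborel) \<le> (\<integral>t. \<bar>x t\<bar> + \<bar>y t\<bar> \<partial>lborel)"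
      using i by (intro integral_mono) auto
    then show "(\<integral>t. \<bar>x t + y t\<bar> \<partial>lborel) \<le> (\<integral>t. \<bar>x t\<bar> \<partial>lborel) + (\<integral>t. \<bar>y t\<bar> \<partial>lborel)"
      using i by simp
  qed
  show "norm (c *\<^sub>R x) = \<bar>c\<bar> * norm x"
    by transfer (simp add: abs_mult)
qed

end

text \<open>
  The essentially bounded functions and their action on the space above as its dual. For
  \<open>f\<close> in \<open>L_infty\<close>, the value of \<open>dual_pairing f\<close> does not depend on the representative that
  \<open>rep_l1\<close> picks.
\<close>

definition L_infty :: "(real \<Rightarrow> real) set" where
  "L_infty = {f \<in> borel_measurable borel. \<exists>B. AE t in lborel. \<bar>f t\<bar> \<le> B}"

definition dual_pairing :: "(real \<Rightarrow> real) \<Rightarrow> l1 \<Rightarrow> real" where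
  "dual_pairing f x = (\<integral>t. f t * rep_l1 x t \<partial>lborel)"


section \<open>Convergence in law and Gaussian laws\<close>

definition converges_in_law ::
    "'a measure \<Rightarrow> (nat \<Rightarrow> 'a \<Rightarrow> 'b::topological_space) \<Rightarrow> 'b measure \<Rightarrow> bool" where
  "converges_in_law M X \<mu> \<longleftrightarrow>
     (\<forall>n. X n \<in> borel_measurable M) \<and>
     (\<forall>\<phi> :: 'b \<Rightarrow> real. continuous_on UNIV \<phi> \<longrightarrow> bounded (range \<phi>) \<longrightarrow>
        (\<lambda>n. \<integral>\<omega>. \<phi> (X n \<omega>) \<partial>M) \<longlonglongrightarrow> (\<integral>x. \<phi> x \<partial>\<mu>))"

text \<open>The centered normal law with standard deviation \<open>\<sigma>\<close>, including the degenerate case.\<close>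

definition centered_normal :: "real \<Rightarrow> real measure" where
  "centered_normal \<sigma> =
     (if \<sigma> = 0 then return borel 0 else density lborel (\<lambda>x. ennreal (normal_density 0 \<sigma> x)))"

definition centered_gaussian_l1 :: "l1 measure \<Rightarrow> bool" where
  "centered_gaussian_l1 \<mu> \<longleftrightarrow>
     prob_space \<mu> \<and> sets \<mu> = sets borel \<and>
     (\<forall>f\<in>L_infty. dual_pairing f \<in> borel_measurable \<mu> \<and>
        (\<exists>\<sigma>\<ge>0. distr \<mu> borel (dual_pairing f) = centered_normal \<sigma>))"

definition gaussian_covariance :: "l1 measure \<Rightarrow> (real \<Rightarrow> real) \<Rightarrow> (real \<Rightarrow> real) \<Rightarrow> real" where
  "gaussian_covariance \<mu> f g = (\<integral>x. dual_pairing f x * dual_pairing g x \<partial>\<mu>)"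


section \<open>Quantile function and empirical process\<close>

text \<open>At \<open>u = 0\<close> the set below may be empty; its infimum is then an unspecified real number.\<close>

definition abs_quantile :: "'a measure \<Rightarrow> ('a \<Rightarrow> real) \<Rightarrow> real \<Rightarrow> real" where
  "abs_quantile M X u = Inf {x. 0 \<le> x \<and> \<P>(\<omega> in M. \<bar>X \<omega>\<bar> > x) \<le> u}"

definition dist_fun :: "'a measure \<Rightarrow> ('a \<Rightarrow> real) \<Rightarrow> real \<Rightarrow> real" where
  "dist_fun M X t = cdf (distr M borel X) t"

definition emp_cdf :: "(int \<Rightarrow> 'a \<Rightarrow> real) \<Rightarrow> nat \<Rightarrow> 'a \<Rightarrow> real \<Rightarrow> real" where
  "emp_cdf Y n \<omega> t = (\<Sum>i=1..n. indicator {..t} (Y (int i) \<omega>)) / real n"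

definition emp_process :: "'a measure \<Rightarrow> (int \<Rightarrow> 'a \<Rightarrow> real) \<Rightarrow> nat \<Rightarrow> 'a \<Rightarrow> real \<Rightarrow> real" where
  "emp_process M Y n \<omega> t = sqrt (real n) * (emp_cdf Y n \<omega> t - dist_fun M (Y 0) t)"

definition lag_cov :: "'a measure \<Rightarrow> (int \<Rightarrow> 'a \<Rightarrow> real) \<Rightarrow> real \<Rightarrow> real \<Rightarrow> nat \<Rightarrow> real" where
  "lag_cov M Y s t k =
     \<P>(\<omega> in M. Y 0 \<omega> \<le> t \<and> Y (int k) \<omega> \<le> s) + \<P>(\<omega> in M. Y 0 \<omega> \<le> s \<and> Y (int k) \<omega> \<le> t)
       - 2 * dist_fun M (Y 0) t * dist_fun M (Y 0) s"

text \<open>The series runs over the lags \<open>k \<ge> 1\<close>, hence the shift.\<close>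

definition limit_cov :: "'a measure \<Rightarrow> (int \<Rightarrow> 'a \<Rightarrow> real) \<Rightarrow> real \<Rightarrow> real \<Rightarrow> real" where
  "limit_cov M Y s t =
     dist_fun M (Y 0) (min t s) - dist_fun M (Y 0) t * dist_fun M (Y 0) s
       + (\<Sum>k. lag_cov M Y s t (Suc k))"

end

theory Submission
  imports Defs
begin

text \<open>
  Only the law of the innovations matters, so one may work on the product space of sequences, where
  conditioning on the past means integrating out the other coordinates. Since \<open>\<epsilon>\<^sub>j\<close> has a bounded density
  and \<open>a\<^sub>0 \<noteq> 0\<close>, the conditional probability of \<open>Y\<^sub>j \<le> t\<close> given the past is Lipschitz in the past, so the
  martingale difference of this indicator at lag \<open>k\<close> has \<open>L\<^sup>2\<close> norm at most \<open>min (C \<bar>a\<^sub>k\<bar>) (b t)\<close>, where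
  \<open>b t\<^sup>2 = min (F t) (1 - F t)\<close>. Orthogonality of martingale differences turns this into the bound
  \<open>\<bar>Cov (Z\<^sub>n s) (Z\<^sub>n t)\<bar> \<le> \<Theta> s * \<Theta> t\<close> for the empirical process \<open>Z\<^sub>n\<close>, with \<open>\<Theta> t = (\<Sum>k. min (C \<bar>a\<^sub>k\<bar>) (b t))\<close>, and by
  Fubini the quantile condition makes \<open>\<Theta>\<close> integrable. Hence \<open>Z\<^sub>n\<close> is approximated in
  \<open>L\<^sup>1\<close>, uniformly in \<open>n\<close>, by step functions of finitely many \<open>Z\<^sub>n t\<close>, and only finite-dimensional
  convergence is left. That follows from a blocking argument in which the indicators of a block are
  replaced by those of the linear process truncated to the innovations of the block, so that the blocks
  become exactly independent.
\<close>

subsection \<open>Conditional expectations and martingale differences on a product space\<close>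

text \<open>An expected norm in \<open>l1\<close> is the integral over t of expected absolute
  values, so L2 bounds at single points t suffice; they take the place of tightness and of any
  maximal inequality. The quantile enters through sqrt m = integral of 1 / (2 sqrt u) over (0, m):
  for m = min (a_k^2, P(|Y_0| > x)) and after exchanging integrals, the x > 0 with P(|Y_0| > x) > u
  lie below Q(u), which produces Q(u) / sqrt u. The limit has to be constructed as a law on
  \<open>l1\<close>. Its values at rational points are a Gaussian sequence obtained from
  \<open>C\<close> by Cholesky factorization, and the estimates that approximate the empirical
  process by step functions also make the step functions of this sequence Cauchy in mean. Rational
  grid points keep the index set countable, so that measurability is coordinatewise. The blocks need
  no gaps between them: keeping l lags at position l of a block is a poor approximation only near
  its start, and the average cost over a long block vanishes as a Cesaro mean.\<close>

definition mix :: "'i set \<Rightarrow> ('i \<Rightarrow> 'b) \<Rightarrow> ('i \<Rightarrow> 'b) \<Rightarrow> 'i \<Rightarrow> 'b" where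
  "mix A x y = (\<lambda>i. if i \<in> A then x i else y i)"

lemma mix_mix_left: "mix B (mix A x y) z = mix (A \<inter> B) x (mix B y z)"
  by (auto simp: mix_def)

locale iid_seq = D: prob_space D for D :: "real measure" +
  assumes sets_D [simp, measurable_cong]: "sets D = sets borel"
begin

lemma space_D [simp]: "space D = UNIV"
  using sets_eq_imp_space_eq[OF sets_D] by simp

definition P :: "(int \<Rightarrow> real) measure" where
  "P = PiM UNIV (\<lambda>_. D)"

lemma space_P [simp]: "space P = UNIV"
  by (simp add: P_def space_PiM)

sublocale pp: product_prob_space "\<lambda>_::int. D" UNIV
  by unfold_locales

sublocale P: prob_space P
  unfolding P_def by (rule prob_space_PiM) (rule D.prob_space_axioms)

sublocale PP: pair_prob_space P P
  by unfold_locales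

lemma prob_P [simp]: "measure P UNIV = 1"
  using P.prob_space by simp

lemma component_measurable: "(\<lambda>x. x i) \<in> borel_measurable P"
proof -
  have "(\<lambda>x. x i) \<in> measurable P D"
    unfolding P_def by simp
  then show ?thesis
    by (simp cong: measurable_cong_sets)
qed

lemma measurable_into_P:
  assumes "\<And>i. (\<lambda>x. f x i) \<in> borel_measurable N"
  shows "f \<in> measurable N P"
  unfolding P_def
proof (rule measurable_PiM_single')
  fix i :: int
  show "(\<lambda>x. f x i) \<in> measurable N D"
    using assms[of i] by (simp cong: measurable_cong_sets)
qed auto

lemma mix_measurable [measurable (raw)]:
  assumes [measurable]: "f \<in> measurable N P" "g \<in> measurable N P"
  shows "(\<lambda>z. mix A (f z) (g z)) \<in> measurable N P"
proof (rule measurable_into_P)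
  fix i
  have "(\<lambda>z. f z i) \<in> borel_measurable N" "(\<lambda>z. g z i) \<in> borel_measurable N"
    using measurable_compose[OF assms(1) component_measurable]
      measurable_compose[OF assms(2) component_measurable] by auto
  then show "(\<lambda>z. mix A (f z) (g z) i) \<in> borel_measurable N"
    by (cases "i \<in> A") (simp_all add: mix_def)
qed

text \<open>This plays the role of Fubini between the coordinates in \<open>A\<close> and the
  others: \<open>x\<close> supplies the former, an independent copy \<open>y\<close> the latter. A
  cylinder over \<open>J\<close> pulls back to a rectangle with one factor over
  \<open>J \<inter> A\<close> and one over \<open>J - A\<close>, so its probability still
  factorizes.\<close>

lemma distr_mix: "distr (P \<Otimes>\<^sub>M P) P (\<lambda>(x, y). mix A x y) = P"
proof -
  have "distr (P \<Otimes>\<^sub>M P) P (\<lambda>(x, y). mix A x y) = PiM UNIV (\<lambda>_. D)"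
  proof (rule pp.PiM_eq)
    show "sets (distr (P \<Otimes>\<^sub>M P) P (\<lambda>(x, y). mix A x y)) = sets (PiM UNIV (\<lambda>_. D))"
      by (simp add: P_def)
    fix J :: "int set" and F :: "int \<Rightarrow> real set"
    assume J: "finite J" "J \<subseteq> UNIV" and F: "\<And>j. j \<in> J \<Longrightarrow> F j \<in> sets D"
    let ?e = "\<lambda>J. prod_emb UNIV (\<lambda>_. D) J (\<Pi>\<^sub>E j\<in>J. F j)"
    have e: "?e K = {x. \<forall>j\<in>K. x j \<in> F j}" if "K \<subseteq> J" for K
      by (auto simp: prod_emb_def PiE_iff restrict_def extensional_def)
    have sets: "?e K \<in> sets P" if "K \<subseteq> J" for K
      unfolding P_def using J F that by (intro sets_PiM_I) (auto intro: finite_subset)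
    have em: "emeasure P (?e K) = (\<Prod>j\<in>K. emeasure D (F j))" if "K \<subseteq> J" for K
      unfolding P_def using J F that by (intro pp.emeasure_PiM_emb) (auto intro: finite_subset)
    have "emeasure (distr (P \<Otimes>\<^sub>M P) P (\<lambda>(x, y). mix A x y)) (?e J)
        = emeasure (P \<Otimes>\<^sub>M P) ((\<lambda>(x, y). mix A x y) -` ?e J \<inter> space (P \<Otimes>\<^sub>M P))"
      using sets[of J] by (intro emeasure_distr) auto
    also have "(\<lambda>(x, y). mix A x y) -` ?e J \<inter> space (P \<Otimes>\<^sub>M P) = ?e (J \<inter> A) \<times> ?e (J - A)"
      by (subst (1 2 3) e) (auto simp: mix_def space_pair_measure)
    also have "emeasure (P \<Otimes>\<^sub>M P) \<dots> = (\<Prod>j\<in>J \<inter> A. emeasure D (F j)) * (\<Prod>j\<in>J - A. emeasure D (F j))"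
      using sets by (subst P.emeasure_pair_measure_Times) (auto simp: em)
    also have "\<dots> = (\<Prod>j\<in>(J \<inter> A) \<union> (J - A). emeasure D (F j))"
      using J by (intro prod.union_disjoint[symmetric]) auto
    also have "(J \<inter> A) \<union> (J - A) = J" by auto
    finally show "emeasure (distr (P \<Otimes>\<^sub>M P) P (\<lambda>(x, y). mix A x y)) (?e J) = (\<Prod>j\<in>J. emeasure D (F j))" .
  qed
  then show ?thesis by (simp add: P_def)
qed

text \<open>The bound is required at every point because \<open>CE\<close> freezes coordinates at
  arbitrary values, which an almost sure bound would not survive. The class is closed under ring
  operations and \<open>CE\<close>, so it settles integrability throughout.\<close>

definition bm :: "((int \<Rightarrow> real) \<Rightarrow> real) \<Rightarrow> bool" where
  "bm X \<longleftrightarrow> X \<in> borel_measurable P \<and> (\<exists>B. \<forall>x. \<bar>X x\<bar> \<le> B)"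

lemma bmD: "bm X \<Longrightarrow> X \<in> borel_measurable P" by (simp add: bm_def)

lemma bm_integrable: "bm X \<Longrightarrow> integrable P X"
  unfolding bm_def by (elim conjE exE, rule P.integrable_const_bound, rule AE_I2) auto

lemma bm_const: "bm (\<lambda>_. c)" by (auto simp: bm_def)

lemma bm_add: assumes "bm X" "bm Y" shows "bm (\<lambda>x. X x + Y x)"
proof -
  from assms obtain B C where "\<And>x. \<bar>X x\<bar> \<le> B" "\<And>x. \<bar>Y x\<bar> \<le> C" by (auto simp: bm_def)
  then have "\<bar>X x + Y x\<bar> \<le> B + C" for x
    by (meson abs_triangle_ineq add_mono order_trans)
  then show ?thesis using assms by (auto simp: bm_def)
qed

lemma bm_mult: assumes "bm X" "bm Y" shows "bm (\<lambda>x. X x * Y x)"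
proof -
  from assms obtain B C where *: "\<And>x. \<bar>X x\<bar> \<le> B" "\<And>x. \<bar>Y x\<bar> \<le> C" by (auto simp: bm_def)
  have "\<bar>X x * Y x\<bar> \<le> B * C" for x
    unfolding abs_mult using *[of x] by (intro mult_mono) auto
  then show ?thesis using assms by (auto simp: bm_def)
qed

lemma bm_diff: assumes "bm X" "bm Y" shows "bm (\<lambda>x. X x - Y x)"
  using bm_add[OF assms(1) bm_mult[OF bm_const[of "-1"] assms(2)]] by simp

lemma bm_sum: "(\<And>i. i \<in> I \<Longrightarrow> bm (X i)) \<Longrightarrow> bm (\<lambda>x. \<Sum>i\<in>I. X i x)"
  by (induction I rule: infinite_finite_induct) (auto intro: bm_const bm_add)

lemmas bm_intros = bm_const bm_add bm_mult bm_diff bm_sum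

text \<open>A version of the conditional expectation of \<open>X\<close> given the coordinates in \<open>A\<close> that is defined at every point.\<close>

definition CE :: "int set \<Rightarrow> ((int \<Rightarrow> real) \<Rightarrow> real) \<Rightarrow> (int \<Rightarrow> real) \<Rightarrow> real" where
  "CE A X x = (\<integral>y. X (mix A x y) \<partial>P)"

lemma measurable_mix1: "X \<in> borel_measurable P \<Longrightarrow> (\<lambda>y. X (mix A x y)) \<in> borel_measurable P"
  by (rule measurable_compose[of _ P P]) auto

lemma measurable_mix2: "X \<in> borel_measurable P \<Longrightarrow> (\<lambda>(x, y). X (mix A x y)) \<in> borel_measurable (P \<Otimes>\<^sub>M P)"
  unfolding case_prod_beta
  by (rule measurable_compose[of _ "P \<Otimes>\<^sub>M P" P]) auto

lemma bm_mix1: "bm X \<Longrightarrow> bm (\<lambda>y. X (mix A x y))"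
  using measurable_mix1 by (auto simp: bm_def)

lemma bm_mix2_integrable: assumes "bm X" shows "integrable (P \<Otimes>\<^sub>M P) (\<lambda>(x, y). X (mix A x y))"
proof -
  from assms obtain B where "\<And>x. \<bar>X x\<bar> \<le> B" by (auto simp: bm_def)
  then show ?thesis
    using measurable_mix2[OF bmD[OF assms]] by (intro PP.integrable_const_bound[of _ B]) auto
qed

lemma bm_CE: assumes "bm X" shows "bm (CE A X)"
proof -
  from assms obtain B where B: "\<And>x. \<bar>X x\<bar> \<le> B" by (auto simp: bm_def)
  have "CE A X \<in> borel_measurable P"
    unfolding CE_def[abs_def]
    using measurable_mix2[OF bmD[OF assms]] by (rule P.borel_measurable_lebesgue_integral)
  moreover have "\<bar>CE A X x\<bar> \<le> B" for x
  proof -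
    have "\<bar>CE A X x\<bar> \<le> (\<integral>y. \<bar>X (mix A x y)\<bar> \<partial>P)" unfolding CE_def by (rule integral_abs_bound)
    also have "\<dots> \<le> (\<integral>y. B \<partial>P)"
      using bm_integrable[OF bm_mix1[OF assms, of A x]] B
      by (intro integral_mono) auto
    finally show ?thesis by simp
  qed
  ultimately show ?thesis by (auto simp: bm_def)
qed

lemma integral_mix:
  fixes X :: "(int \<Rightarrow> real) \<Rightarrow> real"
  assumes X: "X \<in> borel_measurable P"
  shows "(\<integral>x. X x \<partial>P) = (\<integral>(x, y). X (mix A x y) \<partial>(P \<Otimes>\<^sub>M P))"
proof -
  have "(\<integral>x. X x \<partial>P) = (\<integral>x. X x \<partial>distr (P \<Otimes>\<^sub>M P) P (\<lambda>(x, y). mix A x y))"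
    by (simp add: distr_mix)
  also have "\<dots> = (\<integral>z. X (case z of (x, y) \<Rightarrow> mix A x y) \<partial>(P \<Otimes>\<^sub>M P))"
    by (rule integral_distr[OF _ X]) (simp add: case_prod_beta)
  finally show ?thesis by (simp add: case_prod_unfold)
qed

lemma integral_CE: assumes "bm X" shows "(\<integral>x. CE A X x \<partial>P) = (\<integral>x. X x \<partial>P)"
  unfolding integral_mix[OF bmD[OF assms], of A] CE_def
  using PP.integral_fst'[OF bm_mix2_integrable[OF assms, of A]] by simp

text \<open>Once the coordinates in \<open>A \<inter> B\<close> are frozen, what remains is one
  fresh sequence, glued from \<open>y\<close> on \<open>B\<close> and \<open>z\<close> elsewhere,
  and by \<open>distr_mix\<close> gluing does not change the law. Independence of the coordinates
  allows sets that are not nested.\<close>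

lemma CE_CE: assumes "bm X" shows "CE A (CE B X) x = CE (A \<inter> B) X x"
proof -
  have "CE A (CE B X) x = (\<integral>y. (\<integral>z. X (mix (A \<inter> B) x (mix B y z)) \<partial>P) \<partial>P)"
    by (simp add: CE_def mix_mix_left)
  also have "\<dots> = (\<integral>w. X (mix (A \<inter> B) x w) \<partial>P)"
    using integral_CE[OF bm_mix1[OF assms, of "A \<inter> B" x], of B] by (simp add: CE_def)
  finally show ?thesis by (simp add: CE_def)
qed

lemma CE_pull_out:
  assumes U: "\<And>x y. U (mix A x y) = U x"
  shows "CE A (\<lambda>x. U x * X x) x = U x * CE A X x"
  by (simp add: CE_def U)

lemma CE_mix: "CE A X (mix A x y) = CE A X x"
  by (auto simp: CE_def mix_def fun_eq_iff intro!: Bochner_Integration.integral_cong arg_cong[where f=X])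

text \<open>The source of orthogonality of martingale differences: \<open>CE A X\<close> behaves as
  a constant under conditioning on \<open>A\<close>, and the tower property lowers \<open>B\<close>
  to \<open>A\<close> in the other factor.\<close>

lemma integral_CE_mult:
  assumes "bm X" "bm X'" "A \<subseteq> B"
  shows "(\<integral>x. CE A X x * CE B X' x \<partial>P) = (\<integral>x. CE A X x * CE A X' x \<partial>P)"
proof -
  have AB: "A \<inter> B = A" using assms by auto
  have "(\<integral>x. CE A X x * CE B X' x \<partial>P) = (\<integral>x. CE A (\<lambda>x. CE A X x * CE B X' x) x \<partial>P)"
    using assms by (intro integral_CE[symmetric] bm_intros bm_CE)
  also have "\<dots> = (\<integral>x. CE A X x * CE A (CE B X') x \<partial>P)"
    by (subst CE_pull_out) (simp_all add: CE_mix)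
  finally show ?thesis using assms by (simp add: CE_CE AB)
qed

lemma CE_add: "bm X \<Longrightarrow> bm Y \<Longrightarrow> CE A (\<lambda>x. X x + Y x) x = CE A X x + CE A Y x"
  unfolding CE_def by (intro Bochner_Integration.integral_add bm_integrable bm_mix1)

lemma CE_cmult: "CE A (\<lambda>x. c * X x) x = c * CE A X x"
  unfolding CE_def by simp

lemma CE_const: "CE A (\<lambda>x. c) x = c"
  unfolding CE_def by simp

lemma CE_diff: "bm X \<Longrightarrow> bm Y \<Longrightarrow> CE A (\<lambda>x. X x - Y x) x = CE A X x - CE A Y x"
  unfolding CE_def by (intro Bochner_Integration.integral_diff bm_integrable bm_mix1)

lemma CE_empty: "CE {} X x = (\<integral>y. X y \<partial>P)"
  by (simp add: CE_def mix_def)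

lemma integral_sq_CE_le:
  assumes "bm X" "A \<subseteq> B"
  shows "(\<integral>x. (CE B X x - CE A X x)\<^sup>2 \<partial>P) = (\<integral>x. (CE B X x)\<^sup>2 \<partial>P) - (\<integral>x. (CE A X x)\<^sup>2 \<partial>P)"
    and "(\<integral>x. (CE B X x)\<^sup>2 \<partial>P) \<le> (\<integral>x. (X x)\<^sup>2 \<partial>P)"
proof -
  have *: "(\<integral>x. (CE B X x - CE A X x)\<^sup>2 \<partial>P) = (\<integral>x. (CE B X x)\<^sup>2 \<partial>P) - (\<integral>x. (CE A X x)\<^sup>2 \<partial>P)"
    if "bm X" "A \<subseteq> B" for A B
  proof -
    note i = bm_integrable[OF bm_mult[OF bm_CE bm_CE], OF that(1) that(1)]
    have "(\<integral>x. (CE B X x - CE A X x)\<^sup>2 \<partial>P)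
      = (\<integral>x. CE B X x * CE B X x + CE A X x * CE A X x - 2 * (CE A X x * CE B X x) \<partial>P)"
      by (intro Bochner_Integration.integral_cong) (auto simp: power2_eq_square algebra_simps)
    also have "\<dots> = (\<integral>x. CE B X x * CE B X x \<partial>P) + (\<integral>x. CE A X x * CE A X x \<partial>P)
       - 2 * (\<integral>x. CE A X x * CE A X x \<partial>P)"
      using integral_CE_mult[OF that(1,1,2)] i by simp
    finally show ?thesis by (simp add: power2_eq_square)
  qed
  show "(\<integral>x. (CE B X x - CE A X x)\<^sup>2 \<partial>P) = (\<integral>x. (CE B X x)\<^sup>2 \<partial>P) - (\<integral>x. (CE A X x)\<^sup>2 \<partial>P)"
    by (rule * [OF assms])
  \<comment> \<open>Conditioning on every coordinate is the identity, so the contraction property is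
    the Pythagorean identity with \<open>UNIV\<close> as the larger set.\<close>
  have "CE UNIV X = X" by (auto simp: CE_def mix_def)
  then have "(\<integral>x. (X x)\<^sup>2 \<partial>P) - (\<integral>x. (CE B X x)\<^sup>2 \<partial>P) = (\<integral>x. (CE UNIV X x - CE B X x)\<^sup>2 \<partial>P)"
    using *[OF assms(1), of B UNIV] by simp
  moreover have "0 \<le> (\<integral>x. (CE UNIV X x - CE B X x)\<^sup>2 \<partial>P)" by (intro Bochner_Integration.integral_nonneg) auto
  ultimately have "0 \<le> (\<integral>x. (X x)\<^sup>2 \<partial>P) - (\<integral>x. (CE B X x)\<^sup>2 \<partial>P)" by simp
  then show "(\<integral>x. (CE B X x)\<^sup>2 \<partial>P) \<le> (\<integral>x. (X x)\<^sup>2 \<partial>P)" by simp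
qed

text \<open>The martingale difference at time \<open>i\<close> for the filtration generated by the
  coordinates up to \<open>i\<close>.\<close>

definition proj :: "int \<Rightarrow> ((int \<Rightarrow> real) \<Rightarrow> real) \<Rightarrow> (int \<Rightarrow> real) \<Rightarrow> real" where
  "proj i X x = CE {..i} X x - CE {..<i} X x"

lemma bm_proj: "bm X \<Longrightarrow> bm (proj i X)"
  unfolding proj_def[abs_def] by (intro bm_intros bm_CE)

lemma integral_proj_mult:
  assumes "bm X" "bm X'"
  shows "(\<integral>x. proj i X x * proj i X' x \<partial>P)
     = (\<integral>x. CE {..i} X x * CE {..i} X' x \<partial>P) - (\<integral>x. CE {..<i} X x * CE {..<i} X' x \<partial>P)"
proof -
  note i = bm_integrable[OF bm_mult[OF bm_CE bm_CE], OF assms]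
  have s: "{..<i} \<subseteq> {..i}" by auto
  have "(\<integral>x. proj i X x * proj i X' x \<partial>P)
    = (\<integral>x. CE {..i} X x * CE {..i} X' x - CE {..<i} X x * CE {..i} X' x
       - CE {..i} X x * CE {..<i} X' x + CE {..<i} X x * CE {..<i} X' x \<partial>P)"
    by (intro Bochner_Integration.integral_cong) (auto simp: proj_def algebra_simps)
  also have "\<dots> = (\<integral>x. CE {..i} X x * CE {..i} X' x \<partial>P) - (\<integral>x. CE {..<i} X x * CE {..i} X' x \<partial>P)
      - (\<integral>x. CE {..i} X x * CE {..<i} X' x \<partial>P) + (\<integral>x. CE {..<i} X x * CE {..<i} X' x \<partial>P)"
    by (simp add: i)
  finally show ?thesis
    using integral_CE_mult[OF assms s] integral_CE_mult[OF assms(2,1) s] by (simp add: mult.commute)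
qed

lemma telescope_proj:
  assumes "bm X" "bm X'"
  shows "(\<integral>x. CE {..m + int n} X x * CE {..m + int n} X' x \<partial>P) - (\<integral>x. CE {..m} X x * CE {..m} X' x \<partial>P)
     = (\<Sum>i\<in>{m<..m + int n}. (\<integral>x. proj i X x * proj i X' x \<partial>P))"
proof (induction n)
  case (Suc n)
  have e: "{m<..m + int (Suc n)} = insert (m + int (Suc n)) {m<..m + int n}"
    by auto
  have l: "{..<m + int (Suc n)} = {..m + int n}" by auto
  show ?case
    unfolding e using Suc integral_proj_mult[OF assms, of "m + int (Suc n)", unfolded l] by simp
qed simp

lemma integral_Cauchy_Schwarz:
  assumes "bm X" "bm Y"
  shows "\<bar>\<integral>x. X x * Y x \<partial>P\<bar> \<le> sqrt (\<integral>x. (X x)\<^sup>2 \<partial>P) * sqrt (\<integral>x. (Y x)\<^sup>2 \<partial>P)"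
proof -
  let ?a = "\<integral>x. (X x)\<^sup>2 \<partial>P" and ?b = "\<integral>x. X x * Y x \<partial>P" and ?c = "\<integral>x. (Y x)\<^sup>2 \<partial>P"
  have i: "integrable P (\<lambda>x. (X x)\<^sup>2)" "integrable P (\<lambda>x. X x * Y x)" "integrable P (\<lambda>x. (Y x)\<^sup>2)"
    unfolding power2_eq_square using assms by (auto intro!: bm_integrable bm_intros)
  have q: "0 \<le> s\<^sup>2 * ?a + 2 * s * t * ?b + t\<^sup>2 * ?c" for s t
  proof -
    have "0 \<le> (\<integral>x. (s * X x + t * Y x)\<^sup>2 \<partial>P)" by (intro Bochner_Integration.integral_nonneg) auto
    also have "\<dots> = (\<integral>x. s\<^sup>2 * (X x)\<^sup>2 + 2 * s * t * (X x * Y x) + t\<^sup>2 * (Y x)\<^sup>2 \<partial>P)"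
      by (intro Bochner_Integration.integral_cong) (auto simp: power2_eq_square algebra_simps)
    also have "\<dots> = s\<^sup>2 * ?a + 2 * s * t * ?b + t\<^sup>2 * ?c" using i by simp
    finally show ?thesis .
  qed
  have "?b\<^sup>2 \<le> ?a * ?c"
  proof (cases "?c = 0")
    case True
    have "?a \<ge> 0" by (intro Bochner_Integration.integral_nonneg) auto
    have "?b = 0"
    proof (rule ccontr)
      assume b: "?b \<noteq> 0"
      \<comment> \<open>With \<open>?c = 0\<close> the form is affine in the second weight, and this
        weight is chosen to give the value -1.\<close>
      have "0 \<le> ?a + 2 * (- (?a + 1) / (2 * ?b)) * ?b"
        using q[of 1 "- (?a + 1) / (2 * ?b)"] True by simp
      also have "\<dots> = - 1" using b by (simp add: field_simps)
      finally show False by simp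
    qed
    then show ?thesis using True by simp
  next
    case False
    have "?c \<ge> 0" by (intro Bochner_Integration.integral_nonneg) auto
    with False have c: "?c > 0" by linarith
    \<comment> \<open>Up to scaling, the weights \<open>?c\<close> and \<open>- ?b\<close> minimize
      the form, so its nonnegativity becomes the discriminant inequality.\<close>
    have "0 \<le> ?c\<^sup>2 * ?a + 2 * ?c * (- ?b) * ?b + (- ?b)\<^sup>2 * ?c" by (rule q)
    also have "\<dots> = ?c * (?a * ?c - ?b\<^sup>2)" by (simp add: power2_eq_square algebra_simps)
    finally show ?thesis using c by (simp add: zero_le_mult_iff)
  qed
  then have "sqrt (?b\<^sup>2) \<le> sqrt (?a * ?c)" by (rule real_sqrt_le_mono)
  then show ?thesis by (simp add: real_sqrt_mult)
qed

text \<open>Convergence in L1 of the reverse martingale to the mean. It stands in for a zero-one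
  law: for the indicators it follows by truncation to finitely many lags.\<close>

definition tail_trivial :: "((int \<Rightarrow> real) \<Rightarrow> real) \<Rightarrow> bool" where
  "tail_trivial X \<longleftrightarrow> (\<lambda>n. \<integral>x. \<bar>CE {..- int n} X x - (\<integral>y. X y \<partial>P)\<bar> \<partial>P) \<longlonglongrightarrow> 0"

lemma tail_trivial_add:
  assumes "bm X" "bm Y" "tail_trivial X" "tail_trivial Y"
  shows "tail_trivial (\<lambda>x. X x + c * Y x)"
  unfolding tail_trivial_def
proof (rule tendsto_sandwich[OF _ _ tendsto_const])
  have "(\<lambda>n. (\<integral>x. \<bar>CE {..- int n} X x - (\<integral>y. X y \<partial>P)\<bar> \<partial>P)
      + \<bar>c\<bar> * (\<integral>x. \<bar>CE {..- int n} Y x - (\<integral>y. Y y \<partial>P)\<bar> \<partial>P)) \<longlonglongrightarrow> 0 + \<bar>c\<bar> * 0"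
    using assms(3,4) unfolding tail_trivial_def by (intro tendsto_intros)
  then show "(\<lambda>n. (\<integral>x. \<bar>CE {..- int n} X x - (\<integral>y. X y \<partial>P)\<bar> \<partial>P)
      + \<bar>c\<bar> * (\<integral>x. \<bar>CE {..- int n} Y x - (\<integral>y. Y y \<partial>P)\<bar> \<partial>P)) \<longlonglongrightarrow> 0" by simp
  have b: "bm (\<lambda>x. CE {..- int n} X x - (\<integral>y. X y \<partial>P))" "bm (\<lambda>x. CE {..- int n} Y x - (\<integral>y. Y y \<partial>P))" for n
    using assms by (auto intro!: bm_intros bm_CE)
  show "\<forall>\<^sub>F n in sequentially. (\<integral>x. \<bar>CE {..- int n} (\<lambda>x. X x + c * Y x) x - (\<integral>y. X y + c * Y y \<partial>P)\<bar> \<partial>P)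
     \<le> (\<integral>x. \<bar>CE {..- int n} X x - (\<integral>y. X y \<partial>P)\<bar> \<partial>P)
      + \<bar>c\<bar> * (\<integral>x. \<bar>CE {..- int n} Y x - (\<integral>y. Y y \<partial>P)\<bar> \<partial>P)"
  proof (rule always_eventually, rule allI)
    fix n
    let ?U = "\<lambda>x. CE {..- int n} X x - (\<integral>y. X y \<partial>P)" and ?V = "\<lambda>x. CE {..- int n} Y x - (\<integral>y. Y y \<partial>P)"
    have "(\<integral>x. \<bar>CE {..- int n} (\<lambda>x. X x + c * Y x) x - (\<integral>y. X y + c * Y y \<partial>P)\<bar> \<partial>P)
       = (\<integral>x. \<bar>?U x + c * ?V x\<bar> \<partial>P)"
      using assms bm_integrable[OF assms(1)] bm_integrable[OF assms(2)]
      by (intro Bochner_Integration.integral_cong arg_cong[where f=abs])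
         (simp_all add: CE_add CE_cmult bm_intros algebra_simps)
    also have "\<dots> \<le> (\<integral>x. \<bar>?U x\<bar> + \<bar>c\<bar> * \<bar>?V x\<bar> \<partial>P)"
    proof (rule integral_mono)
      show "\<bar>?U x + c * ?V x\<bar> \<le> \<bar>?U x\<bar> + \<bar>c\<bar> * \<bar>?V x\<bar>" for x
        by (metis abs_mult abs_triangle_ineq)
    qed (use bm_integrable[OF b(1)[of n]] bm_integrable[OF b(2)[of n]] in auto)
    also have "\<dots> = (\<integral>x. \<bar>?U x\<bar> \<partial>P) + \<bar>c\<bar> * (\<integral>x. \<bar>?V x\<bar> \<partial>P)"
      using bm_integrable[OF b(1)[of n]] bm_integrable[OF b(2)[of n]] by simp
    finally show "(\<integral>x. \<bar>CE {..- int n} (\<lambda>x. X x + c * Y x) x - (\<integral>y. X y + c * Y y \<partial>P)\<bar> \<partial>P)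
       \<le> (\<integral>x. \<bar>?U x\<bar> \<partial>P) + \<bar>c\<bar> * (\<integral>x. \<bar>?V x\<bar> \<partial>P)" .
  qed
qed auto

text \<open>One factor stays bounded, so L1 convergence of the other carries the product.\<close>

lemma tail_trivial_CE_mult:
  assumes X: "bm X" "tail_trivial X" and Y: "bm Y" "tail_trivial Y"
  shows "(\<lambda>n. \<integral>x. CE {..- int n} X x * CE {..- int n} Y x \<partial>P) \<longlonglongrightarrow> (\<integral>x. X x \<partial>P) * (\<integral>x. Y x \<partial>P)"
proof -
  let ?mX = "\<integral>x. X x \<partial>P" and ?mY = "\<integral>x. Y x \<partial>P"
  from X obtain B where B: "\<And>x. \<bar>X x\<bar> \<le> B" by (auto simp: bm_def)
  have CB: "\<bar>CE A X x\<bar> \<le> B" for A x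
  proof -
    have "\<bar>CE A X x\<bar> \<le> (\<integral>y. \<bar>X (mix A x y)\<bar> \<partial>P)" unfolding CE_def by (rule integral_abs_bound)
    also have "\<dots> \<le> (\<integral>y. B \<partial>P)"
      using bm_integrable[OF bm_mix1[OF X(1), of A x]] B by (intro integral_mono) auto
    finally show ?thesis by simp
  qed
  have "(\<lambda>n. (\<integral>x. CE {..- int n} X x * CE {..- int n} Y x \<partial>P) - ?mX * ?mY) \<longlonglongrightarrow> 0"
  proof (rule Lim_null_comparison)
    show "(\<lambda>n. B * (\<integral>x. \<bar>CE {..- int n} Y x - ?mY\<bar> \<partial>P)) \<longlonglongrightarrow> 0"
      using Y(2) unfolding tail_trivial_def by (rule tendsto_mult_right_zero)
    show "\<forall>\<^sub>F n in sequentially. norm ((\<integral>x. CE {..- int n} X x * CE {..- int n} Y x \<partial>P) - ?mX * ?mY)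
       \<le> B * (\<integral>x. \<bar>CE {..- int n} Y x - ?mY\<bar> \<partial>P)"
    proof (rule always_eventually, rule allI)
      fix n
      let ?C = "\<lambda>X. CE {..- int n} X"
      have b: "bm (\<lambda>x. ?C Y x - ?mY)" using Y by (intro bm_intros bm_CE)
      \<comment> \<open>\<open>CE\<close> preserves the mean, so the product of the means is the
        integral of \<open>?C X\<close> times a constant.\<close>
      have "(\<integral>x. ?C X x * ?C Y x \<partial>P) - ?mX * ?mY = (\<integral>x. ?C X x * ?C Y x \<partial>P) - (\<integral>x. ?C X x * ?mY \<partial>P)"
        using integral_CE[OF X(1)] by simp
      also have "\<dots> = (\<integral>x. ?C X x * (?C Y x - ?mY) \<partial>P)"
        using X(1) Y(1) unfolding right_diff_distrib
        by (intro Bochner_Integration.integral_diff[symmetric] bm_integrable bm_intros bm_CE)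
      also have "norm \<dots> \<le> (\<integral>x. \<bar>?C X x * (?C Y x - ?mY)\<bar> \<partial>P)"
        unfolding real_norm_def by (rule integral_abs_bound)
      also have "\<dots> \<le> (\<integral>x. B * \<bar>?C Y x - ?mY\<bar> \<partial>P)"
      proof (rule integral_mono)
        show "integrable P (\<lambda>x. \<bar>?C X x * (?C Y x - ?mY)\<bar>)"
          using bm_integrable[OF bm_mult[OF bm_CE[OF X(1)] b]] by simp
        show "integrable P (\<lambda>x. B * \<bar>?C Y x - ?mY\<bar>)" using bm_integrable[OF b] by simp
        show "\<bar>?C X x * (?C Y x - ?mY)\<bar> \<le> B * \<bar>?C Y x - ?mY\<bar>" for x
          unfolding abs_mult by (intro mult_right_mono CB) auto
      qed
      finally show "norm ((\<integral>x. ?C X x * ?C Y x \<partial>P) - ?mX * ?mY) \<le> B * (\<integral>x. \<bar>?C Y x - ?mY\<bar> \<partial>P)" by simp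
    qed
  qed
  then show ?thesis by (rule LIM_zero_cancel)
qed

text \<open>Hannan's inequality: up to the remote past, the covariance is the sum over \<open>i\<close> of the expectations of
  \<open>proj i X * proj i Y\<close>, by orthogonality of martingale differences.\<close>

lemma covariance_bound:
  assumes X: "bm X" "tail_trivial X" "\<And>x. CE {..j} X x = X x"
    and Y: "bm Y" "tail_trivial Y" "\<And>x. CE {..j} Y x = Y x"
    and q: "\<And>i. i \<le> j \<Longrightarrow> \<bar>\<integral>x. proj i X x * proj i Y x \<partial>P\<bar> \<le> q i"
    and B: "\<And>n. (\<Sum>i\<in>{- int n<..j}. q i) \<le> B"
  shows "\<bar>(\<integral>x. X x * Y x \<partial>P) - (\<integral>x. X x \<partial>P) * (\<integral>x. Y x \<partial>P)\<bar> \<le> B"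
proof (rule Lim_bounded)
  show "(\<lambda>n. \<bar>(\<integral>x. X x * Y x \<partial>P) - (\<integral>x. CE {..- int n} X x * CE {..- int n} Y x \<partial>P)\<bar>)
     \<longlonglongrightarrow> \<bar>(\<integral>x. X x * Y x \<partial>P) - (\<integral>x. X x \<partial>P) * (\<integral>x. Y x \<partial>P)\<bar>"
    by (intro tendsto_intros tail_trivial_CE_mult X Y)
  show "\<forall>n\<ge>nat \<bar>j\<bar>. \<bar>(\<integral>x. X x * Y x \<partial>P) - (\<integral>x. CE {..- int n} X x * CE {..- int n} Y x \<partial>P)\<bar> \<le> B"
  proof (intro allI impI)
    fix n assume "n \<ge> nat \<bar>j\<bar>"
    then have j: "- int n + int (nat (j + int n)) = j" by simp
    have "\<bar>(\<integral>x. X x * Y x \<partial>P) - (\<integral>x. CE {..- int n} X x * CE {..- int n} Y x \<partial>P)\<bar>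
      = \<bar>\<Sum>i\<in>{- int n<..j}. (\<integral>x. proj i X x * proj i Y x \<partial>P)\<bar>"
      using telescope_proj[OF X(1) Y(1), of "- int n" "nat (j + int n)", unfolded j] by (simp add: X Y)
    also have "\<dots> \<le> (\<Sum>i\<in>{- int n<..j}. \<bar>\<integral>x. proj i X x * proj i Y x \<partial>P\<bar>)" by (rule sum_abs)
    also have "\<dots> \<le> (\<Sum>i\<in>{- int n<..j}. q i)"
      by (intro sum_mono q) auto
    also have "\<dots> \<le> B" by (rule B)
    finally show "\<bar>(\<integral>x. X x * Y x \<partial>P) - (\<integral>x. CE {..- int n} X x * CE {..- int n} Y x \<partial>P)\<bar> \<le> B" .
  qed
qed

text \<open>Martingale differences annihilate constants, so \<open>c\<close> is free. Choosing 0 or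
  1 for an indicator later yields a bound that is small in both tails.\<close>

lemma proj_sq_le:
  assumes "bm X"
  shows "(\<integral>x. (proj i X x)\<^sup>2 \<partial>P) \<le> (\<integral>x. (X x - c)\<^sup>2 \<partial>P)"
proof -
  have b: "bm (\<lambda>x. X x - c)" using assms by (intro bm_intros)
  have s: "{..<i} \<subseteq> {..i}" by auto
  have "proj i X = proj i (\<lambda>x. X x - c)"
    using assms by (auto simp: proj_def fun_eq_iff CE_diff bm_const CE_const)
  then have "(\<integral>x. (proj i X x)\<^sup>2 \<partial>P) = (\<integral>x. (CE {..i} (\<lambda>x. X x - c) x)\<^sup>2 \<partial>P) - (\<integral>x. (CE {..<i} (\<lambda>x. X x - c) x)\<^sup>2 \<partial>P)"
    using integral_sq_CE_le(1)[OF b s] by (simp add: proj_def)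
  also have "\<dots> \<le> (\<integral>x. (CE {..i} (\<lambda>x. X x - c) x)\<^sup>2 \<partial>P)" by simp
  also have "\<dots> \<le> (\<integral>x. (X x - c)\<^sup>2 \<partial>P)" by (rule integral_sq_CE_le(2)[OF b s])
  finally show ?thesis .
qed

end

text \<open>The junk value of a divergent series does not depend on the series. Changing one coordinate does not affect
  summability, hence the Lipschitz bound \<open>CE_Ind_Lipschitz\<close> below holds at every point and not only almost everywhere.\<close>

lemma suminf_not_summable: "\<not> summable f \<Longrightarrow> suminf f = (THE s. False)"
  by (auto simp: suminf_def summable_def)

text \<open>The bounded density is recorded as a bound for probabilities of intervals, the form in
  which it makes distribution functions Lipschitz.\<close>

locale lin_proc = iid_seq D for D :: "real measure" +
  fixes a :: "nat \<Rightarrow> real" and K :: real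
  assumes square_integrable_D: "integrable D (\<lambda>x. x\<^sup>2)"
    and a_summable: "summable (\<lambda>k. \<bar>a k\<bar>)"
    and a0: "a 0 \<noteq> 0"
    and D_interval: "\<And>u v. u \<le> v \<Longrightarrow> measure D {u..v} \<le> K * (v - u)"
begin

definition lin :: "(nat \<Rightarrow> real) \<Rightarrow> (int \<Rightarrow> real) \<Rightarrow> int \<Rightarrow> real" where
  "lin b x j = (\<Sum>k. b k * x (j - int k))"

text \<open>Bounds the density of \<open>a 0 * v\<close> for \<open>v\<close> with law
  \<open>D\<close>.\<close>

definition L :: real where "L = K / \<bar>a 0\<bar>"

definition m1 :: real where "m1 = (\<integral>x. \<bar>x\<bar> \<partial>D)"

text \<open>The truncations of \<open>a\<close>, used to make blocks independent, satisfy this together with \<open>a\<close> itself.\<close>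

definition sub :: "(nat \<Rightarrow> real) \<Rightarrow> bool" where
  "sub b \<longleftrightarrow> b 0 = a 0 \<and> (\<forall>k. \<bar>b k\<bar> \<le> \<bar>a k\<bar>)"

definition Ind :: "(nat \<Rightarrow> real) \<Rightarrow> real \<Rightarrow> int \<Rightarrow> (int \<Rightarrow> real) \<Rightarrow> real" where
  "Ind b t j x = indicator {..t} (lin b x j)"

lemma K_nonneg: "0 \<le> K"
  using order_trans[OF measure_nonneg D_interval[of 0 1]] by simp

lemma L_nonneg: "0 \<le> L"
  using K_nonneg by (simp add: L_def)

lemma borel_measurable_D: "borel_measurable D = borel_measurable borel"
  by (rule measurable_cong_sets) simp_all

lemma integrable_abs_D: "integrable D (\<lambda>x. \<bar>x\<bar>)"
proof -
  have "integrable D (\<lambda>x. 1 + x\<^sup>2)" using square_integrable_D by auto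
  then show ?thesis
  proof (rule Bochner_Integration.integrable_bound)
    have "\<bar>x\<bar> \<le> 1 + x\<^sup>2" for x :: real
      using sum_squares_bound[of 1 "\<bar>x\<bar>"] by simp
    then show "AE x in D. norm \<bar>x\<bar> \<le> norm (1 + x\<^sup>2)" by auto
  qed (simp add: borel_measurable_D)
qed

lemma m1_nonneg: "0 \<le> m1"
  unfolding m1_def by (intro Bochner_Integration.integral_nonneg) auto

lemma sub_a: "sub a" by (simp add: sub_def)

lemma sub_trunc: "sub b \<Longrightarrow> sub (\<lambda>k. if k \<le> l then b k else 0)"
  by (auto simp: sub_def)

lemma distr_component: "distr P D (\<lambda>x. x i) = D"
  unfolding P_def by (rule pp.PiM_component) simp

lemma component_measurable_D: "(\<lambda>x. x i) \<in> measurable P D"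
  unfolding P_def by simp

lemma integral_component:
  fixes f :: "real \<Rightarrow> real"
  assumes "f \<in> borel_measurable borel"
  shows "(\<integral>x. f (x i) \<partial>P) = (\<integral>v. f v \<partial>D)"
proof -
  have "f \<in> borel_measurable D" using assms by (simp only: borel_measurable_D)
  from integral_distr[OF component_measurable_D this, of i] show ?thesis
    unfolding distr_component by (rule sym)
qed

lemma integrable_component:
  fixes f :: "real \<Rightarrow> real"
  assumes "integrable D f"
  shows "integrable P (\<lambda>x. f (x i))"
  using integrable_distr[OF component_measurable_D[of i], of f] assms
  by (simp add: distr_component)

lemma lin_measurable [measurable (raw)]:
  assumes "f \<in> measurable N P"
  shows "(\<lambda>z. lin b (f z) j) \<in> borel_measurable N"
  unfolding lin_def
  by (intro borel_measurable_suminf borel_measurable_times borel_measurable_const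
      measurable_compose[OF assms component_measurable])

lemma lin_measurable_P [measurable]: "(\<lambda>x. lin b x j) \<in> borel_measurable P"
  by (rule lin_measurable) simp

lemma AE_summable:
  assumes "summable (\<lambda>k. \<bar>b k\<bar>)"
  shows "AE x in P. summable (\<lambda>k. b k * x (j - int k))"
proof -
  have "(\<integral>\<^sup>+x. (\<Sum>k. ennreal \<bar>b k * x (j - int k)\<bar>) \<partial>P) = (\<Sum>k. \<integral>\<^sup>+x. ennreal \<bar>b k * x (j - int k)\<bar> \<partial>P)"
    by (rule nn_integral_suminf) (intro measurable_compose[OF _ measurable_ennreal] borel_measurable_abs borel_measurable_times borel_measurable_const component_measurable)
  also have "\<dots> = (\<Sum>k. ennreal (\<bar>b k\<bar> * m1))"
  proof (rule suminf_cong)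
    fix k
    have "integrable P (\<lambda>x. \<bar>b k * x (j - int k)\<bar>)"
      using integrable_component[OF integrable_abs_D, of "j - int k"] by (simp add: abs_mult)
    then have "(\<integral>\<^sup>+x. ennreal \<bar>b k * x (j - int k)\<bar> \<partial>P) = ennreal (\<integral>x. \<bar>b k * x (j - int k)\<bar> \<partial>P)"
      by (rule nn_integral_eq_integral) auto
    also have "(\<integral>x. \<bar>b k * x (j - int k)\<bar> \<partial>P) = \<bar>b k\<bar> * m1"
      by (simp add: abs_mult m1_def integral_component)
    finally show "(\<integral>\<^sup>+x. ennreal \<bar>b k * x (j - int k)\<bar> \<partial>P) = ennreal (\<bar>b k\<bar> * m1)" .
  qed
  also have "\<dots> = ennreal (\<Sum>k. \<bar>b k\<bar> * m1)"
    using assms m1_nonneg by (intro suminf_ennreal2 summable_mult2) auto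
  also have "\<dots> < \<infinity>" by simp
  finally have "AE x in P. (\<Sum>k. ennreal \<bar>b k * x (j - int k)\<bar>) \<noteq> \<infinity>"
    by (intro nn_integral_noteq_infinite borel_measurable_suminf_order measurable_compose[OF _ measurable_ennreal] borel_measurable_abs borel_measurable_times borel_measurable_const component_measurable) simp
  then show ?thesis
  proof eventually_elim
    case (elim x)
    then have "summable (\<lambda>k. \<bar>b k * x (j - int k)\<bar>)"
      by (intro summable_suminf_not_top) auto
    then show ?case by (rule summable_rabs_cancel)
  qed
qed

lemma sub_summable: "sub b \<Longrightarrow> summable (\<lambda>k. \<bar>b k\<bar>)"
  unfolding sub_def by (intro summable_comparison_test[OF _ a_summable] exI[of _ 0]) simp

lemma bm_ind_lin: "B \<in> sets borel \<Longrightarrow> bm (\<lambda>x. indicator B (lin b x j) :: real)"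
  unfolding bm_def
  by (intro conjI exI[of _ 1] allI measurable_compose[OF lin_measurable_P borel_measurable_indicator])
     (simp_all split: split_indicator)

lemma bm_Ind: "bm (Ind b t j)"
  unfolding Ind_def[abs_def] by (rule bm_ind_lin) simp

lemma lin_mix_past: "{..j} \<subseteq> A \<Longrightarrow> lin b (mix A x y) j = lin b x j"
  unfolding lin_def by (intro suminf_cong) (simp add: mix_def subset_eq)

lemma CE_Ind: "CE {..j} (Ind b t j) x = Ind b t j x"
  by (simp add: CE_def Ind_def lin_mix_past)

subsection \<open>Smoothing by the innovation\<close>

text \<open>The contribution of the strict past to \<open>lin b x j\<close>; given that past, only
  the innovation at \<open>j\<close> is still random.\<close>

definition rest :: "(nat \<Rightarrow> real) \<Rightarrow> (int \<Rightarrow> real) \<Rightarrow> int \<Rightarrow> real" where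
  "rest b x j = (\<Sum>k. b (Suc k) * x (j - 1 - int k))"

lemma CE_ind_lin_summable:
  assumes b: "b 0 = a 0" and s: "summable (\<lambda>k. b (Suc k) * x (j - 1 - int k))"
    and B: "B \<in> sets borel"
  shows "CE {..<j} (\<lambda>x. indicator B (lin b x j)) x = measure D {v. a 0 * v + rest b x j \<in> B}"
proof -
  have m: "(\<lambda>v. indicator B (a 0 * v + rest b x j) :: real) \<in> borel_measurable borel"
    by (rule measurable_compose[OF _ borel_measurable_indicator[OF B]]) measurable
  have e: "lin b (mix {..<j} x y) j = a 0 * y j + rest b x j" for y
  proof -
    let ?f = "\<lambda>k. b k * mix {..<j} x y (j - int k)"
    have S: "?f (Suc k) = b (Suc k) * x (j - 1 - int k)" for k
      by (simp add: mix_def algebra_simps)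
    have "summable ?f" using s by (subst summable_Suc_iff[symmetric]) (simp only: S)
    from suminf_split_head[OF this] have "lin b (mix {..<j} x y) j = ?f 0 + (\<Sum>k. ?f (Suc k))"
      by (simp add: lin_def)
    also have "\<dots> = a 0 * y j + rest b x j"
      unfolding rest_def S by (simp add: b mix_def)
    finally show ?thesis .
  qed
  have "CE {..<j} (\<lambda>x. indicator B (lin b x j)) x = (\<integral>y. indicator B (a 0 * y j + rest b x j) \<partial>P)"
    by (simp add: CE_def e)
  also have "\<dots> = (\<integral>v. indicator B (a 0 * v + rest b x j) \<partial>D)"
    by (rule integral_component[OF m])
  also have "\<dots> = (\<integral>v. indicator {v. a 0 * v + rest b x j \<in> B} v \<partial>D)"
    by (intro Bochner_Integration.integral_cong) (auto simp: indicator_def)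
  also have "\<dots> = measure D {v. a 0 * v + rest b x j \<in> B}" by simp
  finally show ?thesis .
qed

lemma CE_ind_lin_not_summable:
  assumes s: "\<not> summable (\<lambda>k. b (Suc k) * x (j - 1 - int k))"
  shows "CE {..<j} (\<lambda>x. indicator B (lin b x j)) x = indicator B (THE s. False)"
proof -
  have "lin b (mix {..<j} x y) j = (THE s. False)" for y
  proof -
    let ?f = "\<lambda>k. b k * mix {..<j} x y (j - int k)"
    have S: "?f (Suc k) = b (Suc k) * x (j - 1 - int k)" for k
      by (simp add: mix_def algebra_simps)
    have "\<not> summable ?f"
    proof
      assume "summable ?f"
      then have "summable (\<lambda>k. ?f (Suc k))" by (subst summable_Suc_iff)
      then show False using s by (simp only: S)
    qed
    then show ?thesis by (simp add: lin_def suminf_not_summable)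
  qed
  then show ?thesis by (simp add: CE_def)
qed

lemma measure_scaled_interval:
  assumes "u \<le> v"
  shows "measure D {w. a 0 * w + s \<in> {u..v}} \<le> L * (v - u)"
proof (cases "a 0 > 0")
  case True
  then have "{w. a 0 * w + s \<in> {u..v}} = {(u - s) / a 0..(v - s) / a 0}"
    by (auto simp: field_simps)
  with D_interval[of "(u - s) / a 0" "(v - s) / a 0"] True assms
  show ?thesis by (simp add: L_def divide_right_mono flip: diff_divide_distrib)
next
  case False
  with a0 have n: "a 0 < 0" by simp
  then have "{w. a 0 * w + s \<in> {u..v}} = {(v - s) / a 0..(u - s) / a 0}"
    by (auto simp: field_simps)
  with D_interval[of "(v - s) / a 0" "(u - s) / a 0"] n assms
  show ?thesis by (simp add: L_def divide_right_mono_neg flip: diff_divide_distrib) (simp add: field_simps)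
qed

lemma measure_scaled_halfline_Lipschitz:
  "\<bar>measure D {w. a 0 * w + s \<in> {..t}} - measure D {w. a 0 * w + s' \<in> {..t}}\<bar> \<le> L * \<bar>s - s'\<bar>"
proof -
  have [measurable]: "{w. a 0 * w + s \<in> B} \<in> sets D" if "B \<in> sets borel" for s B
  proof -
    have "(\<lambda>w. a 0 * w + s) -` B \<inter> space borel \<in> sets borel"
      using that by (intro measurable_sets[of _ borel borel]) auto
    then show ?thesis by (simp add: vimage_def)
  qed
  have *: "\<bar>measure D {w. a 0 * w + s \<in> {..t}} - measure D {w. a 0 * w + s' \<in> {..t}}\<bar> \<le> L * \<bar>s - s'\<bar>"
    if "s \<le> s'" for s s'
  proof -
    have sub: "{w. a 0 * w + s' \<in> {..t}} \<subseteq> {w. a 0 * w + s \<in> {..t}}" using that by auto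
    have "measure D {w. a 0 * w + s \<in> {..t}} - measure D {w. a 0 * w + s' \<in> {..t}}
      = measure D ({w. a 0 * w + s \<in> {..t}} - {w. a 0 * w + s' \<in> {..t}})"
      using sub by (intro D.finite_measure_Diff[symmetric]) auto
    \<comment> \<open>On the difference set \<open>a 0 * w + s\<close> is at most \<open>t\<close>
      but exceeds \<open>t\<close> after adding \<open>s' - s\<close>, which confines it to an
      interval of length \<open>s' - s\<close>.\<close>
    also have "\<dots> \<le> measure D {w. a 0 * w + s \<in> {t - (s' - s)..t}}"
      by (intro D.finite_measure_mono) auto
    also have "\<dots> \<le> L * (s' - s)"
      using measure_scaled_interval[of "t - (s' - s)" t s] that by simp
    finally show ?thesis
      using D.finite_measure_mono[OF sub] that by simp
  qed
  show ?thesis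
    using *[of s s'] *[of s' s] by (cases "s \<le> s'") (auto simp: abs_minus_commute)
qed

lemma summable_fun_upd:
  fixes f :: "nat \<Rightarrow> real"
  shows "summable (f(n := c)) \<longleftrightarrow> summable f"
    and "summable f \<Longrightarrow> suminf (f(n := c)) = suminf f + (c - f n)"
proof -
  have e: "f(n := c) = (\<lambda>k. f k + (if k = n then c - f n else 0))" for f :: "nat \<Rightarrow> real" and c
    by auto
  have s: "(\<lambda>k. if k = n then d else 0) sums d" for d :: real
    using sums_single[of n "\<lambda>_. d"] by simp
  have *: "summable (f(n := c))" if "summable f" for f :: "nat \<Rightarrow> real" and c
    unfolding e using that s sums_summable by (intro summable_add) blast+
  show "summable (f(n := c)) \<longleftrightarrow> summable f"
    using *[of f c] *[of "f(n := c)" "f n"] by auto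
  show "suminf (f(n := c)) = suminf f + (c - f n)" if "summable f"
    unfolding e using sums_add[OF summable_sums[OF that] s] by (simp add: sums_iff)
qed

text \<open>A new value of coordinate \<open>i\<close> merely shifts \<open>rest\<close> by
  \<open>b (nat (j - i)) * (v - x i)\<close>, and averaging over the innovation at \<open>j\<close>
  turns the indicator into a Lipschitz function of the shift.\<close>

lemma CE_Ind_Lipschitz:
  assumes b: "b 0 = a 0" and i: "i < j"
  shows "\<bar>CE {..<j} (Ind b t j) x - CE {..<j} (Ind b t j) (x(i := v))\<bar> \<le> L * \<bar>b (nat (j - i))\<bar> * \<bar>x i - v\<bar>"
proof -
  let ?n = "nat (j - 1 - i)" and ?x = "x(i := v)"
  let ?f = "\<lambda>k. b (Suc k) * x (j - 1 - int k)"
  have n: "Suc ?n = nat (j - i)" "j - 1 - int ?n = i" using i by auto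
  have f: "(\<lambda>k. b (Suc k) * ?x (j - 1 - int k)) = ?f(?n := b (Suc ?n) * v)"
    using n by (auto simp: fun_eq_iff)
  have I: "Ind b t j = (\<lambda>x. indicator {..t} (lin b x j))" by (simp add: Ind_def fun_eq_iff)
  show ?thesis
  proof (cases "summable ?f")
    case True
    then have s': "summable (\<lambda>k. b (Suc k) * ?x (j - 1 - int k))"
      unfolding f by (simp only: summable_fun_upd)
    have r: "rest b ?x j = rest b x j + (b (Suc ?n) * v - b (Suc ?n) * x i)"
      unfolding rest_def f using summable_fun_upd(2)[OF True] by (simp only: n)
    have "\<bar>CE {..<j} (Ind b t j) x - CE {..<j} (Ind b t j) ?x\<bar> \<le> L * \<bar>rest b x j - rest b ?x j\<bar>"
      unfolding I CE_ind_lin_summable[OF b True atMost_borel] CE_ind_lin_summable[OF b s' atMost_borel]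
      by (rule measure_scaled_halfline_Lipschitz)
    also have "\<bar>rest b x j - rest b ?x j\<bar> = \<bar>b (nat (j - i))\<bar> * \<bar>x i - v\<bar>"
      unfolding r n by (simp add: abs_mult abs_minus_commute flip: right_diff_distrib)
    finally show ?thesis by (simp only: mult.assoc)
  next
    case False
    then have s': "\<not> summable (\<lambda>k. b (Suc k) * ?x (j - 1 - int k))"
      unfolding f summable_fun_upd .
    show ?thesis
      unfolding I CE_ind_lin_not_summable[of b x j, OF False] CE_ind_lin_not_summable[of b ?x j, OF s']
      using L_nonneg by simp
  qed
qed

text \<open>The two conditional expectations differ in coordinate \<open>i\<close> alone, which is
  \<open>x i\<close> in one and a fresh \<open>y i\<close> in the other. The Lipschitz bound is
  averaged over \<open>y i\<close>, and the mean of \<open>\<bar>x i - y i\<bar>\<close> is at most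
  \<open>\<bar>x i\<bar> + m1\<close>.\<close>

lemma proj_Ind_le:
  assumes b: "b 0 = a 0" and i: "i < j"
  shows "\<bar>proj i (Ind b t j) x\<bar> \<le> L * \<bar>b (nat (j - i))\<bar> * (\<bar>x i\<bar> + m1)"
proof -
  let ?V = "CE {..<j} (Ind b t j)" and ?c = "L * \<bar>b (nat (j - i))\<bar>"
  have c: "0 \<le> ?c" using L_nonneg by simp
  have V: "bm ?V" by (rule bm_CE[OF bm_Ind])
  \<comment> \<open>As \<open>i < j\<close>, conditioning on \<open>{..<j}\<close> may come first;
    this brings in the smoothed function \<open>?V\<close>.\<close>
  have "{..i} \<inter> {..<j} = {..i}" "{..<i} \<inter> {..<j} = {..<i}" using i by auto
  then have "proj i (Ind b t j) x = CE {..i} ?V x - CE {..<i} ?V x"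
    by (simp add: proj_def CE_CE[OF bm_Ind])
  also have "\<dots> = (\<integral>y. ?V (mix {..i} x y) - ?V (mix {..<i} x y) \<partial>P)"
    unfolding CE_def[of _ ?V]
    by (intro Bochner_Integration.integral_diff[symmetric] bm_integrable bm_mix1 V)
  finally have "\<bar>proj i (Ind b t j) x\<bar> = \<bar>\<integral>y. ?V (mix {..i} x y) - ?V (mix {..<i} x y) \<partial>P\<bar>" by simp
  also have "\<dots> \<le> (\<integral>y. \<bar>?V (mix {..i} x y) - ?V (mix {..<i} x y)\<bar> \<partial>P)"
    by (rule integral_abs_bound)
  also have "\<dots> \<le> (\<integral>y. ?c * (\<bar>x i\<bar> + \<bar>y i\<bar>) \<partial>P)"
  proof (rule integral_mono)
    show "integrable P (\<lambda>y. \<bar>?V (mix {..i} x y) - ?V (mix {..<i} x y)\<bar>)"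
      by (intro integrable_abs Bochner_Integration.integrable_diff bm_integrable bm_mix1 V)
    show "integrable P (\<lambda>y. ?c * (\<bar>x i\<bar> + \<bar>y i\<bar>))"
      using integrable_component[OF integrable_abs_D, of i] by simp
    fix y
    have m: "mix {..<i} x y = (mix {..i} x y)(i := y i)" by (auto simp: mix_def)
    have "\<bar>?V (mix {..i} x y) - ?V (mix {..<i} x y)\<bar> \<le> ?c * \<bar>mix {..i} x y i - y i\<bar>"
      unfolding m by (rule CE_Ind_Lipschitz[where i=i and j=j and b=b, OF b i])
    also have "\<dots> \<le> ?c * (\<bar>x i\<bar> + \<bar>y i\<bar>)"
      by (intro mult_left_mono c) (simp add: mix_def)
    finally show "\<bar>?V (mix {..i} x y) - ?V (mix {..<i} x y)\<bar> \<le> ?c * (\<bar>x i\<bar> + \<bar>y i\<bar>)" .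
  qed
  also have "\<dots> = ?c * (\<bar>x i\<bar> + m1)"
    using integrable_component[OF integrable_abs_D, of i]
    by (simp add: integral_component m1_def)
  finally show ?thesis .
qed

text \<open>Given the past, the innovation term is only translated by \<open>rest b x j\<close>, and
  the bound does not see translations, so it survives averaging. It is uniform over all truncations
  because they keep \<open>b 0 = a 0\<close>.\<close>

lemma prob_lin_interval:
  assumes b: "sub b" and uv: "u \<le> v"
  shows "measure P {x. lin b x j \<in> {u..v}} \<le> L * (v - u)"
proof -
  let ?X = "\<lambda>x. indicator {u..v} (lin b x j) :: real"
  have X: "bm ?X" by (rule bm_ind_lin) simp
  have "measure P {x. lin b x j \<in> {u..v}} = (\<integral>x. indicator {x. lin b x j \<in> {u..v}} x \<partial>P)"
    by simp
  also have "\<dots> = (\<integral>x. ?X x \<partial>P)"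
    by (intro Bochner_Integration.integral_cong) (auto simp: indicator_def)
  also have "\<dots> = (\<integral>x. CE {..<j} ?X x \<partial>P)" by (rule integral_CE[OF X, symmetric])
  also have "\<dots> \<le> (\<integral>x. L * (v - u) \<partial>P)"
  proof (rule integral_mono_AE)
    show "integrable P (CE {..<j} ?X)" by (rule bm_integrable[OF bm_CE[OF X]])
    have "summable (\<lambda>k. \<bar>b (Suc k)\<bar>)" using sub_summable[OF b] by (subst summable_Suc_iff)
    from AE_summable[OF this, of "j - 1"]
    show "AE x in P. CE {..<j} ?X x \<le> L * (v - u)"
    proof eventually_elim
      case (elim x)
      show ?case
        using measure_scaled_interval[OF uv, of "rest b x j"] b
        by (subst CE_ind_lin_summable[OF _ elim]) (auto simp: sub_def)
    qed
  qed simp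
  finally show ?thesis by simp
qed

lemma AE_lin_neq:
  assumes b: "sub b"
  shows "AE x in P. lin b x j \<noteq> t"
proof -
  have s: "{x. lin b x j = t} \<in> sets P"
    using measurable_sets[OF lin_measurable_P, of "{t}" b j] by (simp add: vimage_def)
  have "measure P {x. lin b x j = t} \<le> 0" using prob_lin_interval[OF b, of t t j] by simp
  then have "emeasure P {x. lin b x j = t} = 0"
    using measure_nonneg[of P] by (simp add: P.emeasure_eq_measure order_antisym)
  then show ?thesis using s by (intro AE_I[of _ _ "{x. lin b x j = t}"]) simp_all
qed

text \<open>The partial sums converge almost surely, and the indicator of a half-line is
  discontinuous only at \<open>t\<close>, a value that \<open>lin b x j\<close> takes with
  probability 0.\<close>

lemma Ind_trunc_tendsto:
  assumes b: "sub b"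
  shows "AE x in P. (\<lambda>m. Ind (\<lambda>k. if k \<le> m then b k else 0) t j x) \<longlonglongrightarrow> Ind b t j x"
  using AE_summable[OF sub_summable[OF b], of j] AE_lin_neq[OF b, of j t]
proof eventually_elim
  case (elim x)
  have e: "lin (\<lambda>k. if k \<le> m then b k else 0) x j = (\<Sum>k\<le>m. b k * x (j - int k))" for m
    unfolding lin_def by (subst suminf_finite[of "{..m}"]) (auto simp: not_le)
  have l: "(\<lambda>m. lin (\<lambda>k. if k \<le> m then b k else 0) x j) \<longlonglongrightarrow> lin b x j"
    unfolding e using summable_LIMSEQ'[OF elim(1)] by (simp add: lin_def)
  have "\<forall>\<^sub>F m in sequentially. Ind (\<lambda>k. if k \<le> m then b k else 0) t j x = Ind b t j x"
  proof (cases "lin b x j < t")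
    case True
    from order_tendstoD(2)[OF l True] show ?thesis
      by eventually_elim (use True in \<open>auto simp: Ind_def indicator_def\<close>)
  next
    case False
    then have "lin b x j > t" using elim by simp
    from order_tendstoD(1)[OF l this] show ?thesis
      by eventually_elim (use False elim in \<open>auto simp: Ind_def indicator_def\<close>)
  qed
  then show ?case by (rule tendsto_eventually)
qed

lemma integral_Ind_trunc_tendsto:
  assumes b: "sub b"
  shows "(\<lambda>m. \<integral>x. \<bar>Ind b t j x - Ind (\<lambda>k. if k \<le> m then b k else 0) t j x\<bar> \<partial>P) \<longlonglongrightarrow> 0"
proof -
  have [measurable]: "Ind b t j \<in> borel_measurable P" for b using bmD[OF bm_Ind] .
  have "(\<lambda>m. \<integral>x. \<bar>Ind b t j x - Ind (\<lambda>k. if k \<le> m then b k else 0) t j x\<bar> \<partial>P) \<longlonglongrightarrow> (\<integral>x. 0 \<partial>P)"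
  proof (rule integral_dominated_convergence[where w="\<lambda>_. 1"])
    show "AE x in P. (\<lambda>m. \<bar>Ind b t j x - Ind (\<lambda>k. if k \<le> m then b k else 0) t j x\<bar>) \<longlonglongrightarrow> 0"
      using Ind_trunc_tendsto[OF b, of t j]
    proof eventually_elim
      case (elim x)
      from tendsto_rabs[OF tendsto_diff[OF tendsto_const[of "Ind b t j x"] elim]] show ?case by simp
    qed
    show "AE x in P. norm \<bar>Ind b t j x - Ind (\<lambda>k. if k \<le> m then b k else 0) t j x\<bar> \<le> 1" for m
      by (auto simp: Ind_def indicator_def)
  qed auto
  then show ?thesis by simp
qed

lemma integral_abs_CE_diff_le:
  assumes "bm X" "bm Y"
  shows "(\<integral>x. \<bar>CE A X x - CE A Y x\<bar> \<partial>P) \<le> (\<integral>x. \<bar>X x - Y x\<bar> \<partial>P)"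
proof -
  have d: "bm (\<lambda>x. \<bar>X x - Y x\<bar>)"
    using bm_diff[OF assms] unfolding bm_def by auto
  have "(\<integral>x. \<bar>CE A X x - CE A Y x\<bar> \<partial>P) \<le> (\<integral>x. CE A (\<lambda>x. \<bar>X x - Y x\<bar>) x \<partial>P)"
  proof (rule integral_mono)
    show "integrable P (\<lambda>x. \<bar>CE A X x - CE A Y x\<bar>)"
      by (intro integrable_abs bm_integrable bm_intros bm_CE assms)
    show "integrable P (CE A (\<lambda>x. \<bar>X x - Y x\<bar>))" by (intro bm_integrable bm_CE d)
    show "\<bar>CE A X x - CE A Y x\<bar> \<le> CE A (\<lambda>x. \<bar>X x - Y x\<bar>) x" for x
      unfolding CE_diff[OF assms, symmetric] unfolding CE_def by (rule integral_abs_bound)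
  qed
  also have "\<dots> = (\<integral>x. \<bar>X x - Y x\<bar> \<partial>P)" by (rule integral_CE[OF d])
  finally show ?thesis .
qed

text \<open>A truncated indicator depends on finitely many coordinates, so conditioning on a remote
  enough past returns its mean exactly. The truncation error is paid twice, under
  \<open>CE {..- int n}\<close> and under \<open>CE {}\<close>, which is the mean; both contract
  L1.\<close>

lemma tail_trivial_Ind:
  assumes b: "sub b"
  shows "tail_trivial (Ind b t j)"
  unfolding tail_trivial_def
proof (rule LIMSEQ_I)
  fix r :: real assume r: "0 < r"
  let ?b = "\<lambda>m k. if k \<le> m then b k else 0"
  let ?d = "\<lambda>m. \<integral>x. \<bar>Ind b t j x - Ind (?b m) t j x\<bar> \<partial>P"
  have "\<forall>\<^sub>F m in sequentially. ?d m < r / 2"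
    using integral_Ind_trunc_tendsto[OF b, of t j] r by (intro order_tendstoD(2)) auto
  then obtain m where m: "?d m < r / 2" by (auto simp: eventually_sequentially)
  let ?X = "Ind b t j" and ?Y = "Ind (?b m) t j"
  \<comment> \<open>For such \<open>n\<close> the lowest coordinate involved,
    \<open>j - int m\<close>, lies above \<open>- int n\<close>.\<close>
  have Y: "CE {..- int n} ?Y x = (\<integral>x. ?Y x \<partial>P)" if n: "n > nat (int m - j)" for n x
  proof -
    have "lin (?b m) (mix {..- int n} x y) j = lin (?b m) y j" for y
      unfolding lin_def using n by (intro suminf_cong) (auto simp: mix_def)
    then show ?thesis by (simp add: CE_def Ind_def)
  qed
  have "norm ((\<integral>x. \<bar>CE {..- int n} ?X x - (\<integral>y. ?X y \<partial>P)\<bar> \<partial>P) - 0) < r" if n: "n > nat (int m - j)" for n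
  proof -
    have "(\<integral>x. \<bar>CE {..- int n} ?X x - (\<integral>y. ?X y \<partial>P)\<bar> \<partial>P)
      \<le> (\<integral>x. \<bar>CE {..- int n} ?X x - CE {..- int n} ?Y x\<bar> + \<bar>CE {} ?Y x - CE {} ?X x\<bar> \<partial>P)"
      by (intro integral_mono integrable_abs Bochner_Integration.integrable_add bm_integrable bm_intros bm_CE bm_Ind)
         (auto simp: Y[OF n] CE_empty)
    also have "\<dots> = (\<integral>x. \<bar>CE {..- int n} ?X x - CE {..- int n} ?Y x\<bar> \<partial>P) + (\<integral>x. \<bar>CE {} ?Y x - CE {} ?X x\<bar> \<partial>P)"
      by (intro Bochner_Integration.integral_add integrable_abs bm_integrable bm_intros bm_CE bm_Ind)
    also have "\<dots> \<le> ?d m + ?d m"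
      using integral_abs_CE_diff_le[OF bm_Ind bm_Ind, of "{..- int n}" b t j "?b m" t j]
        integral_abs_CE_diff_le[OF bm_Ind bm_Ind, of "{}" "?b m" t j b t j]
      by (intro add_mono) (auto simp: abs_minus_commute)
    also have "\<dots> < r" using m by simp
    moreover have "0 \<le> (\<integral>x. \<bar>CE {..- int n} ?X x - (\<integral>y. ?X y \<partial>P)\<bar> \<partial>P)"
      by (intro Bochner_Integration.integral_nonneg) auto
    ultimately show ?thesis by simp
  qed
  then show "\<exists>no. \<forall>n\<ge>no. norm ((\<integral>x. \<bar>CE {..- int n} ?X x - (\<integral>y. ?X y \<partial>P)\<bar> \<partial>P) - 0) < r"
    by (intro exI[of _ "Suc (nat (int m - j))"]) auto
qed

end

context lin_proc
begin

subsection \<open>Covariance bounds\<close>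

text \<open>The first summand is the L2 norm of the Lipschitz envelope at positive lags. The second
  ensures \<open>1 \<le> C0 * \<bar>a 0\<bar>\<close>, so that at lag 0 the trivial bound takes the
  same form as at the other lags.\<close>

definition C0 :: real where
  "C0 = L * sqrt (\<integral>u. (\<bar>u\<bar> + m1)\<^sup>2 \<partial>D) + 1 / \<bar>a 0\<bar>"

text \<open>Closed under linear combinations, and satisfied by the indicators of \<open>Y\<^sub>j \<le> t\<close> with \<open>A = 1\<close>.\<close>

definition adm :: "int \<Rightarrow> real \<Rightarrow> ((int \<Rightarrow> real) \<Rightarrow> real) \<Rightarrow> bool" where
  "adm j A X \<longleftrightarrow> X \<in> borel_measurable P \<and> tail_trivial X \<and> (\<forall>x. CE {..j} X x = X x) \<and> (\<forall>x. \<bar>X x\<bar> \<le> A) \<and>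
     (\<forall>i<j. \<forall>x. \<bar>proj i X x\<bar> \<le> A * L * \<bar>a (nat (j - i))\<bar> * (\<bar>x i\<bar> + m1))"

lemma adm_bm: "adm j A X \<Longrightarrow> bm X"
  unfolding adm_def bm_def by blast

lemma adm_nonneg: "adm j A X \<Longrightarrow> 0 \<le> A"
  unfolding adm_def by (meson abs_ge_zero order_trans)

lemma adm_Ind: assumes "sub b" shows "adm j 1 (Ind b t j)"
  unfolding adm_def
proof (intro conjI allI impI)
  show "Ind b t j \<in> borel_measurable P" by (rule bmD[OF bm_Ind])
  show "tail_trivial (Ind b t j)" by (rule tail_trivial_Ind[OF assms])
  show "CE {..j} (Ind b t j) x = Ind b t j x" for x by (rule CE_Ind)
  show "\<bar>Ind b t j x\<bar> \<le> 1" for x by (simp add: Ind_def)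
  fix i x assume i: "i < j"
  have b: "b 0 = a 0" "\<bar>b (nat (j - i))\<bar> \<le> \<bar>a (nat (j - i))\<bar>" using assms by (auto simp: sub_def)
  have "\<bar>proj i (Ind b t j) x\<bar> \<le> L * \<bar>b (nat (j - i))\<bar> * (\<bar>x i\<bar> + m1)"
    by (rule proj_Ind_le[where b=b and i=i and j=j, OF b(1) i])
  also have "\<dots> \<le> 1 * L * \<bar>a (nat (j - i))\<bar> * (\<bar>x i\<bar> + m1)"
    using b(2) L_nonneg m1_nonneg by (simp add: mult_left_mono mult_right_mono)
  finally show "\<bar>proj i (Ind b t j) x\<bar> \<le> 1 * L * \<bar>a (nat (j - i))\<bar> * (\<bar>x i\<bar> + m1)" .
qed

lemma proj_add: "bm X \<Longrightarrow> bm Y \<Longrightarrow> proj i (\<lambda>x. X x + Y x) x = proj i X x + proj i Y x"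
  by (simp add: proj_def CE_add)

lemma proj_cmult: "proj i (\<lambda>x. c * X x) x = c * proj i X x"
  by (simp add: proj_def CE_cmult right_diff_distrib)

lemma proj_sum: "(\<And>k. k \<in> I \<Longrightarrow> bm (X k)) \<Longrightarrow> proj i (\<lambda>x. \<Sum>k\<in>I. X k x) x = (\<Sum>k\<in>I. proj i (X k) x)"
proof (induction I rule: infinite_finite_induct)
  case (insert k I)
  then show ?case by (simp add: proj_add bm_sum)
qed (simp_all add: proj_def CE_const)

lemma adm_zero: "adm j 0 (\<lambda>_. 0)"
  by (simp add: adm_def tail_trivial_def CE_const proj_def)

lemma adm_add_cmult:
  assumes "adm j A X" "adm j B Y"
  shows "adm j (A + \<bar>c\<bar> * B) (\<lambda>x. X x + c * Y x)"
proof -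
  note X = adm_bm[OF assms(1)] and Y = adm_bm[OF assms(2)]
  have cY: "bm (\<lambda>x. c * Y x)" by (intro bm_intros Y)
  show ?thesis
    unfolding adm_def
  proof (intro conjI allI impI)
    show "(\<lambda>x. X x + c * Y x) \<in> borel_measurable P" by (intro bmD bm_add X cY)
    show "tail_trivial (\<lambda>x. X x + c * Y x)"
      using assms by (intro tail_trivial_add X Y) (auto simp: adm_def)
    show "CE {..j} (\<lambda>x. X x + c * Y x) x = X x + c * Y x" for x
      using assms by (simp add: CE_add X cY CE_cmult adm_def)
    show "\<bar>X x + c * Y x\<bar> \<le> A + \<bar>c\<bar> * B" for x
    proof -
      have "\<bar>X x + c * Y x\<bar> \<le> \<bar>X x\<bar> + \<bar>c\<bar> * \<bar>Y x\<bar>" by (metis abs_mult abs_triangle_ineq)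
      also have "\<dots> \<le> A + \<bar>c\<bar> * B"
        using assms by (intro add_mono mult_left_mono) (auto simp: adm_def)
      finally show ?thesis .
    qed
    fix i x assume i: "i < j"
    let ?r = "L * \<bar>a (nat (j - i))\<bar> * (\<bar>x i\<bar> + m1)"
    have "\<bar>proj i (\<lambda>x. X x + c * Y x) x\<bar> \<le> \<bar>proj i X x\<bar> + \<bar>c\<bar> * \<bar>proj i Y x\<bar>"
      unfolding proj_add[OF X cY] proj_cmult by (metis abs_mult abs_triangle_ineq)
    also have "\<dots> \<le> A * ?r + \<bar>c\<bar> * (B * ?r)"
      using assms i by (intro add_mono mult_left_mono) (auto simp: adm_def mult.assoc)
    also have "\<dots> = (A + \<bar>c\<bar> * B) * L * \<bar>a (nat (j - i))\<bar> * (\<bar>x i\<bar> + m1)"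
      by (simp add: algebra_simps)
    finally show "\<bar>proj i (\<lambda>x. X x + c * Y x) x\<bar> \<le> (A + \<bar>c\<bar> * B) * L * \<bar>a (nat (j - i))\<bar> * (\<bar>x i\<bar> + m1)" .
  qed
qed

lemma adm_cmult: "adm j A X \<Longrightarrow> adm j (\<bar>c\<bar> * A) (\<lambda>x. c * X x)"
  using adm_add_cmult[OF adm_zero, of j A X c] by simp

lemma adm_diff: "adm j A X \<Longrightarrow> adm j B Y \<Longrightarrow> adm j (A + B) (\<lambda>x. X x - Y x)"
  using adm_add_cmult[of j A X B Y "-1"] by simp

lemma adm_mono: assumes "adm j A X" "A \<le> B" shows "adm j B X"
  unfolding adm_def
proof (intro conjI allI impI)
  show "\<bar>X x\<bar> \<le> B" for x using assms unfolding adm_def by (meson order_trans)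
  fix i x assume i: "i < j"
  have "\<bar>proj i X x\<bar> \<le> A * L * \<bar>a (nat (j - i))\<bar> * (\<bar>x i\<bar> + m1)"
    using assms i by (simp add: adm_def)
  also have "\<dots> \<le> B * L * \<bar>a (nat (j - i))\<bar> * (\<bar>x i\<bar> + m1)"
    using assms(2) L_nonneg m1_nonneg by (intro mult_right_mono) auto
  finally show "\<bar>proj i X x\<bar> \<le> B * L * \<bar>a (nat (j - i))\<bar> * (\<bar>x i\<bar> + m1)" .
qed (use assms in \<open>auto simp: adm_def\<close>)

lemma adm_lincomb:
  assumes "finite I" "\<And>k. k \<in> I \<Longrightarrow> adm j A (X k)"
  shows "adm j ((\<Sum>k\<in>I. \<bar>c k\<bar>) * A) (\<lambda>x. \<Sum>k\<in>I. c k * X k x)"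
  using assms
proof (induction I rule: finite_induct)
  case (insert k I)
  from insert have "adm j ((\<Sum>k\<in>I. \<bar>c k\<bar>) * A + \<bar>c k\<bar> * A) (\<lambda>x. (\<Sum>k\<in>I. c k * X k x) + c k * X k x)"
    by (intro adm_add_cmult) auto
  with insert show ?case by (simp add: algebra_simps)
qed (simp add: adm_zero)

lemma proj_future:
  assumes "adm j A X" "j < i" shows "proj i X x = 0"
proof -
  have X: "bm X" by (rule adm_bm[OF assms(1)])
  have "CE {..j} X = X" using assms by (auto simp: adm_def)
  moreover have "{..i} \<inter> {..j} = {..j}" "{..<i} \<inter> {..j} = {..j}" using assms by auto
  ultimately show ?thesis
    using CE_CE[OF X, of "{..i}" "{..j}" x] CE_CE[OF X, of "{..<i}" "{..j}" x] by (simp add: proj_def)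
qed

lemma adm_CE:
  assumes "adm j A X" "j \<le> i" shows "CE {..i} X x = X x"
proof -
  have "CE {..j} X = X" using assms by (auto simp: adm_def)
  moreover have "{..i} \<inter> {..j} = {..j}" using assms by auto
  ultimately show ?thesis
    using CE_CE[OF adm_bm[OF assms(1)], of "{..i}" "{..j}" x] by simp
qed

lemma integrable_envelope: "integrable D (\<lambda>u. (\<bar>u\<bar> + m1)\<^sup>2)"
proof -
  have "(\<lambda>u. (\<bar>u\<bar> + m1)\<^sup>2) = (\<lambda>u. u\<^sup>2 + 2 * m1 * \<bar>u\<bar> + m1\<^sup>2)"
    by (auto simp: power2_eq_square algebra_simps abs_mult_self_eq)
  then show ?thesis using square_integrable_D integrable_abs_D by simp
qed

lemma C0_pos: "0 < C0"
proof -
  have "0 \<le> L * sqrt (\<integral>u. (\<bar>u\<bar> + m1)\<^sup>2 \<partial>D)" using L_nonneg by simp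
  moreover have "0 < 1 / \<bar>a 0\<bar>" using a0 by simp
  ultimately show ?thesis unfolding C0_def by linarith
qed

text \<open>\<open>wt j A \<beta> i\<close> bounds the \<open>L\<^sup>2\<close> norm of \<open>proj i X\<close> for \<open>adm j A X\<close> with \<open>L\<^sup>2\<close> distance at most \<open>\<beta>\<close> from a constant,
  and \<open>th A \<beta>\<close> is its sum over \<open>i\<close>.\<close>

definition wt :: "int \<Rightarrow> real \<Rightarrow> real \<Rightarrow> int \<Rightarrow> real" where
  "wt j A \<beta> i = (if i \<le> j then min (A * C0 * \<bar>a (nat (j - i))\<bar>) \<beta> else 0)"

definition th :: "real \<Rightarrow> real \<Rightarrow> real" where
  "th A \<beta> = (\<Sum>k. min (A * C0 * \<bar>a k\<bar>) \<beta>)"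

lemma integral_proj_sq_le:
  assumes X: "adm j A X" and i: "i \<le> j"
    and \<beta>: "(\<integral>x. (X x - c)\<^sup>2 \<partial>P) \<le> \<beta>\<^sup>2" "0 \<le> \<beta>"
  shows "(\<integral>x. (proj i X x)\<^sup>2 \<partial>P) \<le> (wt j A \<beta> i)\<^sup>2"
proof -
  have bm: "bm X" by (rule adm_bm[OF X])
  have A: "0 \<le> A" by (rule adm_nonneg[OF X])
  let ?k = "nat (j - i)" and ?S = "\<integral>u. (\<bar>u\<bar> + m1)\<^sup>2 \<partial>D"
  have S: "0 \<le> ?S" by simp
  have 1: "(\<integral>x. (proj i X x)\<^sup>2 \<partial>P) \<le> \<beta>\<^sup>2"
    using proj_sq_le[OF bm, of i c] \<beta>(1) by linarith
  have 2: "(\<integral>x. (proj i X x)\<^sup>2 \<partial>P) \<le> (A * C0 * \<bar>a ?k\<bar>)\<^sup>2"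
  proof (cases "i = j")
    case True
    have "(\<integral>x. (proj i X x)\<^sup>2 \<partial>P) \<le> (\<integral>x. (X x - 0)\<^sup>2 \<partial>P)" by (rule proj_sq_le[OF bm])
    also have "\<dots> \<le> (\<integral>x. A\<^sup>2 \<partial>P)"
    proof (rule integral_mono)
      show "integrable P (\<lambda>x. (X x - 0)\<^sup>2)" using bm_integrable[OF bm_mult[OF bm bm]] by (simp add: power2_eq_square)
      show "(X x - 0)\<^sup>2 \<le> A\<^sup>2" for x
        using X power_mono[of "\<bar>X x\<bar>" A 2] by (simp add: adm_def)
    qed simp
    also have "\<dots> = A\<^sup>2" by simp
    also have "\<dots> \<le> (A * C0 * \<bar>a ?k\<bar>)\<^sup>2"
    proof (intro power_mono A)
      have "1 / \<bar>a 0\<bar> \<le> C0" using L_nonneg by (simp add: C0_def)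
      then have "1 \<le> C0 * \<bar>a 0\<bar>" using a0 by (simp add: field_simps)
      then have "A * 1 \<le> A * (C0 * \<bar>a 0\<bar>)" using A by (intro mult_left_mono) auto
      then show "A \<le> A * C0 * \<bar>a ?k\<bar>" using True by (simp add: mult.assoc)
    qed
    finally show ?thesis .
  next
    case False
    with i have i': "i < j" by simp
    have "(\<integral>x. (proj i X x)\<^sup>2 \<partial>P) \<le> (\<integral>x. (A * L * \<bar>a ?k\<bar>)\<^sup>2 * (\<bar>x i\<bar> + m1)\<^sup>2 \<partial>P)"
    proof (rule integral_mono)
      show "integrable P (\<lambda>x. (proj i X x)\<^sup>2)"
        using bm_integrable[OF bm_mult[OF bm_proj[OF bm] bm_proj[OF bm], of i i]] by (simp add: power2_eq_square)
      show "integrable P (\<lambda>x. (A * L * \<bar>a ?k\<bar>)\<^sup>2 * (\<bar>x i\<bar> + m1)\<^sup>2)"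
        using integrable_component[OF integrable_envelope, of i] by (intro integrable_mult_right)
      fix x
      have "\<bar>proj i X x\<bar> \<le> A * L * \<bar>a ?k\<bar> * (\<bar>x i\<bar> + m1)" using X i' by (simp add: adm_def)
      then have "\<bar>proj i X x\<bar>\<^sup>2 \<le> (A * L * \<bar>a ?k\<bar> * (\<bar>x i\<bar> + m1))\<^sup>2" by (intro power_mono) auto
      then show "(proj i X x)\<^sup>2 \<le> (A * L * \<bar>a ?k\<bar>)\<^sup>2 * (\<bar>x i\<bar> + m1)\<^sup>2" by (simp add: power_mult_distrib)
    qed
    also have "(\<integral>x. (A * L * \<bar>a ?k\<bar>)\<^sup>2 * (\<bar>x i\<bar> + m1)\<^sup>2 \<partial>P) = (A * L * \<bar>a ?k\<bar>)\<^sup>2 * ?S"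
      using integral_component[of "\<lambda>u. (\<bar>u\<bar> + m1)\<^sup>2" i] by simp
    also have "\<dots> = (A * (L * sqrt ?S) * \<bar>a ?k\<bar>)\<^sup>2" using S by (simp add: power_mult_distrib)
    also have "\<dots> \<le> (A * C0 * \<bar>a ?k\<bar>)\<^sup>2"
    proof (intro power_mono mult_right_mono mult_left_mono A)
      show "L * sqrt ?S \<le> C0" by (simp add: C0_def)
    qed (use A L_nonneg S in auto)
    finally show ?thesis .
  qed
  show ?thesis using 1 2 i by (simp add: wt_def min_def)
qed

lemma wt_nonneg: "0 \<le> A \<Longrightarrow> 0 \<le> \<beta> \<Longrightarrow> 0 \<le> wt j A \<beta> i"
  using C0_pos by (simp add: wt_def)

lemma th_summable: assumes "0 \<le> A" "0 \<le> \<beta>" shows "summable (\<lambda>k. min (A * C0 * \<bar>a k\<bar>) \<beta>)"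
proof (rule summable_comparison_test)
  show "summable (\<lambda>k. A * C0 * \<bar>a k\<bar>)" by (rule summable_mult[OF a_summable])
  show "\<exists>N. \<forall>n\<ge>N. norm (min (A * C0 * \<bar>a n\<bar>) \<beta>) \<le> A * C0 * \<bar>a n\<bar>"
    using assms C0_pos by auto
qed

lemma th_nonneg: "0 \<le> A \<Longrightarrow> 0 \<le> \<beta> \<Longrightarrow> 0 \<le> th A \<beta>"
  unfolding th_def using C0_pos by (intro suminf_nonneg th_summable) auto

lemma th_mono: "0 \<le> A \<Longrightarrow> 0 \<le> \<beta> \<Longrightarrow> \<beta> \<le> \<beta>' \<Longrightarrow> th A \<beta> \<le> th A \<beta>'"
  unfolding th_def by (intro suminf_le th_summable) auto

text \<open>The weight depends on \<open>j\<close> and \<open>i\<close> only through the lag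
  \<open>j - i\<close>, so summing over either index collects terms of the same nonnegative
  series.\<close>

lemma sum_wt_le:
  assumes "finite I" "0 \<le> A" "0 \<le> \<beta>"
  shows "(\<Sum>i\<in>I. wt j A \<beta> i) \<le> th A \<beta>" and "(\<Sum>j\<in>I. wt j A \<beta> i) \<le> th A \<beta>"
proof -
  let ?f = "\<lambda>k. min (A * C0 * \<bar>a k\<bar>) \<beta>"
  have f: "0 \<le> ?f k" for k using assms C0_pos by auto
  have *: "(\<Sum>n\<in>N. ?f n) \<le> th A \<beta>" if "finite N" for N
    unfolding th_def by (intro sum_le_suminf th_summable assms that f ballI)
  have "(\<Sum>i\<in>I. wt j A \<beta> i) = (\<Sum>i\<in>I \<inter> {..j}. ?f (nat (j - i)))"
    using assms by (intro sum.mono_neutral_cong_right) (auto simp: wt_def)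
  also have "\<dots> = (\<Sum>n\<in>(\<lambda>i. nat (j - i)) ` (I \<inter> {..j}). ?f n)"
    by (subst sum.reindex) (auto simp: inj_on_def)
  also have "\<dots> \<le> th A \<beta>" using assms by (intro *) auto
  finally show "(\<Sum>i\<in>I. wt j A \<beta> i) \<le> th A \<beta>" .
  have "(\<Sum>j\<in>I. wt j A \<beta> i) = (\<Sum>j\<in>I \<inter> {i..}. ?f (nat (j - i)))"
    using assms by (intro sum.mono_neutral_cong_right) (auto simp: wt_def)
  also have "\<dots> = (\<Sum>n\<in>(\<lambda>j. nat (j - i)) ` (I \<inter> {i..}). ?f n)"
    by (subst sum.reindex) (auto simp: inj_on_def)
  also have "\<dots> \<le> th A \<beta>" using assms by (intro *) auto
  finally show "(\<Sum>j\<in>I. wt j A \<beta> i) \<le> th A \<beta>" .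
qed

lemma tail_trivial_sum: "(\<And>k. k \<in> I \<Longrightarrow> bm (X k) \<and> tail_trivial (X k)) \<Longrightarrow> tail_trivial (\<lambda>x. \<Sum>k\<in>I. X k x)"
proof (induction I rule: infinite_finite_induct)
  case (insert k I)
  have "tail_trivial (\<lambda>x. (\<Sum>k\<in>I. X k x) + 1 * X k x)"
    using insert by (intro tail_trivial_add bm_sum) auto
  with insert show ?case by (simp add: add.commute)
qed (auto simp: tail_trivial_def CE_const)

lemma CE_sum: "(\<And>k. k \<in> I \<Longrightarrow> bm (X k)) \<Longrightarrow> CE A (\<lambda>x. \<Sum>k\<in>I. X k x) x = (\<Sum>k\<in>I. CE A (X k) x)"
proof (induction I rule: infinite_finite_induct)
  case (insert k I)
  then show ?case by (simp add: CE_add bm_sum)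
qed (simp_all add: CE_const)

text \<open>For fixed \<open>i\<close> the weights of the second family sum to at most
  \<open>th A' \<beta>'\<close>, however many members it has; this is why two sums of n terms have
  covariance of order n and not n^2. The \<open>\<beta> j\<close> may vary in the first family
  because the truncation inside a block varies with the position.\<close>

lemma covariance_sums_bound:
  assumes fin: "finite J" "finite J'"
    and X: "\<And>j. j \<in> J \<Longrightarrow> adm j A (X j)" "\<And>j. j \<in> J \<Longrightarrow> (\<integral>x. (X j x - c j)\<^sup>2 \<partial>P) \<le> (\<beta> j)\<^sup>2"
    and X': "\<And>j. j \<in> J' \<Longrightarrow> adm j A' (X' j)" "\<And>j. j \<in> J' \<Longrightarrow> (\<integral>x. (X' j x - c' j)\<^sup>2 \<partial>P) \<le> \<beta>'\<^sup>2"
    and nn: "0 \<le> A" "0 \<le> A'" "\<And>j. 0 \<le> \<beta> j" "0 \<le> \<beta>'"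
  shows "\<bar>(\<integral>x. (\<Sum>j\<in>J. X j x) * (\<Sum>k\<in>J'. X' k x) \<partial>P)
      - (\<integral>x. (\<Sum>j\<in>J. X j x) \<partial>P) * (\<integral>x. (\<Sum>k\<in>J'. X' k x) \<partial>P)\<bar> \<le> (\<Sum>j\<in>J. th A (\<beta> j)) * th A' \<beta>'"
proof -
  \<comment> \<open>A common time by which all summands are determined; the 0 keeps the set
    nonempty.\<close>
  define m where "m = Max (insert 0 (J \<union> J'))"
  have m: "j \<le> m" if "j \<in> J \<union> J'" for j unfolding m_def using fin that by (intro Max_ge) auto
  have bX: "bm (X j)" if "j \<in> J" for j using adm_bm[OF X(1)[OF that]] .
  have bX': "bm (X' j)" if "j \<in> J'" for j using adm_bm[OF X'(1)[OF that]] .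
  let ?S = "\<lambda>x. \<Sum>j\<in>J. X j x" and ?S' = "\<lambda>x. \<Sum>j\<in>J'. X' j x"
  let ?q = "\<lambda>i. (\<Sum>j\<in>J. wt j A (\<beta> j) i) * (\<Sum>k\<in>J'. wt k A' \<beta>' i)"
  have *: "\<bar>\<integral>x. proj i (X j) x * proj i (X' k) x \<partial>P\<bar> \<le> wt j A (\<beta> j) i * wt k A' \<beta>' i"
    if j: "j \<in> J" and k: "k \<in> J'" for i j k
  proof -
    consider "j < i" | "k < i" | "i \<le> j" "i \<le> k" by linarith
    then show ?thesis
    proof cases
      case 1 then show ?thesis using proj_future[OF X(1)[OF j]] nn by (simp add: wt_nonneg)
    next
      case 2 then show ?thesis using proj_future[OF X'(1)[OF k]] nn by (simp add: wt_nonneg)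
    next
      case 3
      have "\<bar>\<integral>x. proj i (X j) x * proj i (X' k) x \<partial>P\<bar>
          \<le> sqrt (\<integral>x. (proj i (X j) x)\<^sup>2 \<partial>P) * sqrt (\<integral>x. (proj i (X' k) x)\<^sup>2 \<partial>P)"
        by (rule integral_Cauchy_Schwarz[OF bm_proj[OF bX[OF j]] bm_proj[OF bX'[OF k]]])
      also have "\<dots> \<le> wt j A (\<beta> j) i * wt k A' \<beta>' i"
        using integral_proj_sq_le[OF X(1)[OF j] 3(1) X(2)[OF j] nn(3)]
          integral_proj_sq_le[OF X'(1)[OF k] 3(2) X'(2)[OF k] nn(4)] nn
        by (intro mult_mono real_le_lsqrt wt_nonneg) auto
      finally show ?thesis .
    qed
  qed
  show ?thesis
  proof (rule covariance_bound[where j=m and q="?q"])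
    show "bm ?S" "bm ?S'" by (auto intro: bm_sum bX bX')
    show "tail_trivial ?S" "tail_trivial ?S'"
      using bX bX' X(1) X'(1) by (auto intro!: tail_trivial_sum simp: adm_def)
    show "CE {..m} ?S x = ?S x" for x
      using adm_CE[OF X(1)] m by (simp add: CE_sum bX)
    show "CE {..m} ?S' x = ?S' x" for x
      using adm_CE[OF X'(1)] m by (simp add: CE_sum bX')
    show "\<bar>\<integral>x. proj i ?S x * proj i ?S' x \<partial>P\<bar> \<le> ?q i" for i
    proof -
      have "(\<integral>x. proj i ?S x * proj i ?S' x \<partial>P) = (\<integral>x. (\<Sum>j\<in>J. \<Sum>k\<in>J'. proj i (X j) x * proj i (X' k) x) \<partial>P)"
        by (simp add: proj_sum bX bX' sum_product)
      also have "\<dots> = (\<Sum>j\<in>J. \<integral>x. (\<Sum>k\<in>J'. proj i (X j) x * proj i (X' k) x) \<partial>P)"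
        by (intro Bochner_Integration.integral_sum bm_integrable bm_sum bm_mult bm_proj bX bX')
      also have "\<dots> = (\<Sum>j\<in>J. \<Sum>k\<in>J'. \<integral>x. proj i (X j) x * proj i (X' k) x \<partial>P)"
        by (intro sum.cong refl Bochner_Integration.integral_sum bm_integrable bm_mult bm_proj bX bX')
      finally have e: "(\<integral>x. proj i ?S x * proj i ?S' x \<partial>P) = (\<Sum>j\<in>J. \<Sum>k\<in>J'. \<integral>x. proj i (X j) x * proj i (X' k) x \<partial>P)" .
      show ?thesis
        unfolding e sum_product by (intro order_trans[OF sum_abs] sum_mono *)
    qed
    show "(\<Sum>i\<in>{- int n<..m}. ?q i) \<le> (\<Sum>j\<in>J. th A (\<beta> j)) * th A' \<beta>'" for n
    proof -
      \<comment> \<open>The second family is summed at fixed \<open>i\<close>; only then is the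
        order exchanged and the first family summed over \<open>i\<close>.\<close>
      have "(\<Sum>i\<in>{- int n<..m}. ?q i) \<le> (\<Sum>i\<in>{- int n<..m}. (\<Sum>j\<in>J. wt j A (\<beta> j) i) * th A' \<beta>')"
        by (intro sum_mono mult_left_mono sum_wt_le sum_nonneg wt_nonneg nn fin)
      also have "\<dots> = (\<Sum>j\<in>J. \<Sum>i\<in>{- int n<..m}. wt j A (\<beta> j) i) * th A' \<beta>'"
        by (subst sum.swap) (simp add: sum_distrib_right)
      also have "\<dots> \<le> (\<Sum>j\<in>J. th A (\<beta> j)) * th A' \<beta>'"
        by (intro mult_right_mono sum_mono sum_wt_le th_nonneg nn) auto
      finally show ?thesis .
    qed
  qed
qed

end

section \<open>Covariances of the empirical process and their limit\<close>

lemma cesaro_mean_tendsto: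
  fixes f :: "nat \<Rightarrow> real"
  assumes "f \<longlonglongrightarrow> l"
  shows "(\<lambda>n. (\<Sum>k<n. f k) / real n) \<longlonglongrightarrow> l"
proof (rule LIMSEQ_I)
  fix r :: real assume r: "0 < r"
  from LIMSEQ_D[OF assms, of "r / 2"] r obtain N where N: "\<And>n. n \<ge> N \<Longrightarrow> \<bar>f n - l\<bar> < r / 2" by auto
  define B where "B = (\<Sum>k<N. \<bar>f k - l\<bar>)"
  obtain M where M: "real M > 2 * B / r" using reals_Archimedean2 by blast
  have "norm ((\<Sum>k<n. f k) / real n - l) < r" if n: "n \<ge> Suc (max N M)" for n
  proof -
    have n0: "real n > 0" using n by simp
    have "(\<Sum>k<n. f k) / real n - l = (\<Sum>k<n. f k - l) / real n"
      using n0 by (simp add: sum_subtractf field_simps)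
    also have "\<bar>\<dots>\<bar> \<le> (\<Sum>k<n. \<bar>f k - l\<bar>) / real n"
      using n0 by (simp add: divide_right_mono sum_abs)
    finally have 1: "\<bar>(\<Sum>k<n. f k) / real n - l\<bar> \<le> (\<Sum>k<n. \<bar>f k - l\<bar>) / real n" .
    have e: "{..<n} = {..<N} \<union> {N..<n}" using n by auto
    have "(\<Sum>k<n. \<bar>f k - l\<bar>) = B + (\<Sum>k\<in>{N..<n}. \<bar>f k - l\<bar>)"
      unfolding B_def e by (rule sum.union_disjoint) auto
    also have "(\<Sum>k\<in>{N..<n}. \<bar>f k - l\<bar>) \<le> (\<Sum>k\<in>{N..<n}. r / 2)"
      using N by (intro sum_mono less_imp_le) auto
    also have "\<dots> \<le> real n * (r / 2)" using r by (simp add: mult_right_mono)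
    finally have 2: "(\<Sum>k<n. \<bar>f k - l\<bar>) / real n \<le> (B + real n * (r / 2)) / real n"
      using n0 by (simp add: divide_right_mono)
    note order_trans[OF 1 2]
    also have "\<dots> = B / real n + r / 2" using n0 by (simp add: field_simps)
    also have "B / real n < r / 2"
    proof -
      have "2 * B / r < real n" using M n by linarith
      then show ?thesis using r n0 by (simp add: field_simps)
    qed
    finally show ?thesis by simp
  qed
  then show "\<exists>no. \<forall>n\<ge>no. norm ((\<Sum>k<n. f k) / real n - l) < r" by blast
qed

context lin_proc
begin

lemma distr_shift: "distr P P (\<lambda>x i. x (i + c)) = P"
proof -
  have "distr (PiM UNIV (\<lambda>_::int. D)) (PiM UNIV (\<lambda>_. D)) (\<lambda>\<omega>. \<lambda>n\<in>UNIV. \<omega> (n + c)) = PiM UNIV (\<lambda>_. D)"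
    by (rule distr_PiM_reindex[where f="\<lambda>i. i + c" and I=UNIV and K=UNIV and M="\<lambda>_. D", simplified])
       (auto intro: D.prob_space_axioms simp: inj_on_def)
  then show ?thesis by (simp add: P_def restrict_UNIV)
qed

lemma integral_shift:
  fixes X :: "(int \<Rightarrow> real) \<Rightarrow> real"
  assumes "X \<in> borel_measurable P"
  shows "(\<integral>x. X (\<lambda>i. x (i + c)) \<partial>P) = (\<integral>x. X x \<partial>P)"
proof -
  have "(\<lambda>x i. x (i + c)) \<in> measurable P P"
    by (rule measurable_into_P) (rule component_measurable)
  from integral_distr[OF this assms] show ?thesis unfolding distr_shift by simp
qed

lemma lin_shift: "lin b (\<lambda>i. x (i + c)) j = lin b x (j + c)"
  unfolding lin_def by (simp add: algebra_simps)

lemma Ind_shift: "Ind b t j (\<lambda>i. x (i + c)) = Ind b t (j + c) x"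
  by (simp add: Ind_def lin_shift)

definition Yp :: "int \<Rightarrow> (int \<Rightarrow> real) \<Rightarrow> real" where
  "Yp k x = lin a x k"

definition F :: "real \<Rightarrow> real" where
  "F t = dist_fun P (Yp 0) t"

definition C :: "real \<Rightarrow> real \<Rightarrow> real" where
  "C s t = limit_cov P Yp s t"

lemma Yp_measurable [measurable]: "Yp k \<in> borel_measurable P"
  unfolding Yp_def[abs_def] by measurable

lemma Ind_measurable [measurable]: "Ind b t j \<in> borel_measurable P"
  by (rule bmD[OF bm_Ind])

lemma prob_eq_integral_Ind: "measure P {x. Yp k x \<le> t} = (\<integral>x. Ind a t k x \<partial>P)"
proof -
  have "(\<integral>x. Ind a t k x \<partial>P) = (\<integral>x. indicator {x. Yp k x \<le> t} x \<partial>P)"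
    by (intro Bochner_Integration.integral_cong) (auto simp: Ind_def Yp_def indicator_def)
  then show ?thesis by simp
qed

lemma prob_eq_integral_Ind2:
  "measure P {x. Yp j x \<le> s \<and> Yp k x \<le> t} = (\<integral>x. Ind a s j x * Ind a t k x \<partial>P)"
proof -
  have "(\<integral>x. Ind a s j x * Ind a t k x \<partial>P) = (\<integral>x. indicator {x. Yp j x \<le> s \<and> Yp k x \<le> t} x \<partial>P)"
    by (intro Bochner_Integration.integral_cong) (auto simp: Ind_def Yp_def indicator_def)
  then show ?thesis by simp
qed

lemma F_eq: "F t = measure P {x. Yp 0 x \<le> t}"
  unfolding F_def dist_fun_def cdf_def
  by (subst measure_distr) (auto simp: vimage_def)

lemma integral_Ind: "(\<integral>x. Ind a t j x \<partial>P) = F t"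
  using integral_shift[OF Ind_measurable, of a t 0 j]
  by (simp add: Ind_shift F_eq prob_eq_integral_Ind)

lemma integral_Ind2_shift:
  "(\<integral>x. Ind a s (j + c) x * Ind a t (k + c) x \<partial>P) = (\<integral>x. Ind a s j x * Ind a t k x \<partial>P)"
  using integral_shift[of "\<lambda>x. Ind a s j x * Ind a t k x" c] by (simp add: Ind_shift)

definition cv :: "real \<Rightarrow> real \<Rightarrow> int \<Rightarrow> int \<Rightarrow> real" where
  "cv s t j k = (\<integral>x. Ind a s j x * Ind a t k x \<partial>P) - F s * F t"

lemma cv_shift: "cv s t (j + c) (k + c) = cv s t j k"
  by (simp add: cv_def integral_Ind2_shift)

lemma lag_cov_eq: "lag_cov P Yp s t k = cv t s 0 (int k) + cv s t 0 (int k)"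
  by (simp add: lag_cov_def cv_def prob_eq_integral_Ind2 F_def)

lemma cv_same: "cv s t j j = F (min t s) - F t * F s"
proof -
  have "(\<integral>x. Ind a s j x * Ind a t j x \<partial>P) = (\<integral>x. Ind a (min t s) j x \<partial>P)"
    by (intro Bochner_Integration.integral_cong) (auto simp: Ind_def indicator_def)
  then show ?thesis by (simp add: cv_def integral_Ind)
qed

lemma F_range: "0 \<le> F t" "F t \<le> 1"
  by (simp_all add: F_eq P.prob_le_1)

lemma Ind_sq: "(Ind b t j x)\<^sup>2 = Ind b t j x"
  by (simp add: Ind_def indicator_def)

lemma integral_Ind_sq: "(\<integral>x. (Ind a t j x - 0)\<^sup>2 \<partial>P) = F t"
  by (simp add: Ind_sq integral_Ind)

lemma integral_Ind_sq': "(\<integral>x. (Ind a t j x - 1)\<^sup>2 \<partial>P) = 1 - F t"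
proof -
  have "(\<integral>x. (Ind a t j x - 1)\<^sup>2 \<partial>P) = (\<integral>x. 1 - Ind a t j x \<partial>P)"
    by (intro Bochner_Integration.integral_cong) (auto simp: Ind_def indicator_def)
  then show ?thesis using bm_integrable[OF bm_Ind] by (simp add: integral_Ind)
qed

text \<open>One indicator at time 0 is paired with the later ones weighted by the signs of their
  covariances, so that the covariance of the two sums is the sum of absolute values. Its bound is
  independent of \<open>n\<close> since the first family has a single member.\<close>

lemma sum_cv_bound: "(\<Sum>k\<in>{1..n}. \<bar>cv s t 0 (int k)\<bar>) \<le> th 1 1 * th 1 1"
proof -
  let ?e = "\<lambda>k. sgn (cv s t 0 k)"
  let ?J = "int ` {1..n}"
  have i: "integrable P (\<lambda>x. Ind a s 0 x * Ind a t k x)" "integrable P (Ind a t k)" for k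
    by (auto intro: bm_integrable bm_mult bm_Ind)
  have "\<bar>(\<integral>x. (\<Sum>j\<in>{0}. Ind a s j x) * (\<Sum>k\<in>?J. ?e k * Ind a t k x) \<partial>P)
      - (\<integral>x. (\<Sum>j\<in>{0}. Ind a s j x) \<partial>P) * (\<integral>x. (\<Sum>k\<in>?J. ?e k * Ind a t k x) \<partial>P)\<bar> \<le> (\<Sum>j\<in>{0::int}. th 1 1) * th 1 1"
  proof (rule covariance_sums_bound)
    show "adm j 1 (Ind a s j)" for j by (rule adm_Ind[OF sub_a])
    show "adm j 1 (\<lambda>x. ?e j * Ind a t j x)" for j
      using adm_cmult[OF adm_Ind[OF sub_a, of j t], of "?e j"] by (rule adm_mono) (simp add: sgn_if)
    show "(\<integral>x. (Ind a s j x - 0)\<^sup>2 \<partial>P) \<le> 1\<^sup>2" for j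
      using F_range by (simp only: integral_Ind_sq) simp
    show "(\<integral>x. (?e j * Ind a t j x - 0)\<^sup>2 \<partial>P) \<le> 1\<^sup>2" for j
    proof -
      have "(\<integral>x. (?e j * Ind a t j x - 0)\<^sup>2 \<partial>P) = (?e j)\<^sup>2 * F t"
        by (simp add: power_mult_distrib Ind_sq integral_Ind)
      also have "\<dots> \<le> 1 * 1" using F_range by (intro mult_mono) (auto simp: sgn_if)
      finally show ?thesis by simp
    qed
  qed auto
  also have "(\<integral>x. (\<Sum>j\<in>{0}. Ind a s j x) * (\<Sum>k\<in>?J. ?e k * Ind a t k x) \<partial>P)
      = (\<Sum>k\<in>?J. ?e k * (\<integral>x. Ind a s 0 x * Ind a t k x \<partial>P))"
  proof -
    have "(\<integral>x. (\<Sum>j\<in>{0}. Ind a s j x) * (\<Sum>k\<in>?J. ?e k * Ind a t k x) \<partial>P)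
       = (\<integral>x. (\<Sum>k\<in>?J. ?e k * (Ind a s 0 x * Ind a t k x)) \<partial>P)"
      by (simp add: sum_distrib_left mult_ac)
    also have "\<dots> = (\<Sum>k\<in>?J. \<integral>x. ?e k * (Ind a s 0 x * Ind a t k x) \<partial>P)"
      by (intro Bochner_Integration.integral_sum integrable_mult_right i)
    finally show ?thesis by simp
  qed
  also have "(\<integral>x. (\<Sum>j\<in>{0}. Ind a s j x) \<partial>P) = F s" by (simp add: integral_Ind)
  also have "(\<integral>x. (\<Sum>k\<in>?J. ?e k * Ind a t k x) \<partial>P) = (\<Sum>k\<in>?J. ?e k * F t)"
    using i by (subst Bochner_Integration.integral_sum) (auto simp: integral_Ind)
  also have "(\<Sum>k\<in>?J. ?e k * (\<integral>x. Ind a s 0 x * Ind a t k x \<partial>P)) - F s * (\<Sum>k\<in>?J. ?e k * F t)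
     = (\<Sum>k\<in>?J. \<bar>cv s t 0 k\<bar>)"
  proof -
    have "?e k * (\<integral>x. Ind a s 0 x * Ind a t k x \<partial>P) - F s * (?e k * F t) = \<bar>cv s t 0 k\<bar>" for k
    proof -
      have "?e k * (\<integral>x. Ind a s 0 x * Ind a t k x \<partial>P) - F s * (?e k * F t)
        = ?e k * ((\<integral>x. Ind a s 0 x * Ind a t k x \<partial>P) - F s * F t)"
        by (simp only: right_diff_distrib mult_ac)
      also have "\<dots> = ?e k * cv s t 0 k" by (simp only: cv_def)
      also have "\<dots> = \<bar>cv s t 0 k\<bar>" by (simp add: sgn_if)
      finally show ?thesis .
    qed
    then show ?thesis unfolding sum_distrib_left sum_subtractf[symmetric] by simp
  qed
  also have "\<bar>\<dots>\<bar> = (\<Sum>k\<in>{1..n}. \<bar>cv s t 0 (int k)\<bar>)"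
    by (subst sum.reindex) (auto simp: sum_nonneg)
  finally show ?thesis by simp
qed

lemma summable_cv: "summable (\<lambda>k. \<bar>cv s t 0 (int (Suc k))\<bar>)"
proof (rule bounded_imp_summable)
  show "(\<Sum>k\<le>n. \<bar>cv s t 0 (int (Suc k))\<bar>) \<le> th 1 1 * th 1 1" for n
  proof -
    have "(\<Sum>k\<le>n. \<bar>cv s t 0 (int (Suc k))\<bar>) = (\<Sum>k\<in>Suc ` {..n}. \<bar>cv s t 0 (int k)\<bar>)"
      by (subst sum.reindex) auto
    also have "Suc ` {..n} = {1..Suc n}" by (auto simp: image_iff Bex_def) presburger
    finally show ?thesis using sum_cv_bound[of s t "Suc n"] by simp
  qed
qed simp

lemma summable_lag_cov: "summable (\<lambda>k. lag_cov P Yp s t (Suc k))"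
  unfolding lag_cov_eq by (intro summable_add summable_rabs_cancel[OF summable_cv])

definition Z :: "nat \<Rightarrow> real \<Rightarrow> (int \<Rightarrow> real) \<Rightarrow> real" where
  "Z n t x = (\<Sum>j\<in>{1..int n}. Ind a t j x - F t) / sqrt (real n)"

lemma bm_Z: "bm (Z n t)"
  unfolding Z_def[abs_def] divide_inverse by (intro bm_intros bm_Ind)

lemma Z_measurable [measurable]: "Z n t \<in> borel_measurable P"
  by (rule bmD[OF bm_Z])

lemma integral_centered_mult:
  assumes "bm X" "bm Y"
  shows "(\<integral>x. (X x - (\<integral>x. X x \<partial>P)) * (Y x - (\<integral>x. Y x \<partial>P)) \<partial>P) = (\<integral>x. X x * Y x \<partial>P) - (\<integral>x. X x \<partial>P) * (\<integral>x. Y x \<partial>P)"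
proof -
  let ?a = "\<integral>x. X x \<partial>P" and ?b = "\<integral>x. Y x \<partial>P"
  have i: "integrable P (\<lambda>x. X x * Y x)" "integrable P X" "integrable P Y"
    using assms by (auto intro: bm_integrable bm_mult)
  have "(\<integral>x. (X x - ?a) * (Y x - ?b) \<partial>P) = (\<integral>x. X x * Y x - ?b * X x - ?a * Y x + ?a * ?b \<partial>P)"
    by (intro Bochner_Integration.integral_cong) (auto simp: algebra_simps)
  also have "\<dots> = (\<integral>x. X x * Y x \<partial>P) - ?b * ?a - ?a * ?b + ?a * ?b"
    using i by simp
  finally show ?thesis by simp
qed

text \<open>Sorting the pairs of times by the larger one displays the double sum as a sum of partial
  sums of the series in \<open>limit_cov\<close>; its normalized limit is then a Cesaro
  limit.\<close>

lemma integral_Z_mult: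
  "(\<integral>x. Z n s x * Z n t x \<partial>P) = (\<Sum>m<n. cv s t 0 0 + (\<Sum>d\<in>{1..m}. lag_cov P Yp s t d)) / real n"
proof -
  let ?c = "\<lambda>j k x. (Ind a s j x - F s) * (Ind a t k x - F t)"
  have c: "bm (?c j k)" for j k by (intro bm_intros bm_Ind)
  have e: "(\<integral>x. ?c j k x \<partial>P) = cv s t j k" for j k
    using integral_centered_mult[OF bm_Ind bm_Ind, of a s j a t k] by (simp add: integral_Ind cv_def)
  have "(\<integral>x. Z n s x * Z n t x \<partial>P) = (\<integral>x. (\<Sum>j\<in>{1..int n}. \<Sum>k\<in>{1..int n}. ?c j k x) / real n \<partial>P)"
    unfolding Z_def by (intro Bochner_Integration.integral_cong) (auto simp: sum_product)
  also have "\<dots> = (\<Sum>j\<in>{1..int n}. \<Sum>k\<in>{1..int n}. cv s t j k) / real n"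
    by (simp add: Bochner_Integration.integral_sum bm_integrable bm_sum c e)
  also have "(\<Sum>j\<in>{1..int n}. \<Sum>k\<in>{1..int n}. cv s t j k) = (\<Sum>m<n. cv s t 0 0 + (\<Sum>d\<in>{1..m}. lag_cov P Yp s t d))"
  proof (induction n)
    case (Suc n)
    \<comment> \<open>Enlarging the square by one row and one column adds the diagonal term and
      every lag from 1 to \<open>n\<close> in both orders, hence exactly one more partial
      sum.\<close>
    have i: "{1..int (Suc n)} = insert (int n + 1) {1..int n}" by auto
    have r: "(\<Sum>j\<in>{1..int n}. f (int n + 1 - j)) = (\<Sum>d\<in>{1..n}. f (int d))" for f :: "int \<Rightarrow> real"
      by (rule sum.reindex_bij_witness[where i="\<lambda>d. int n + 1 - int d" and j="\<lambda>j. nat (int n + 1 - j)"]) auto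
    have 1: "cv s t j (int n + 1) = cv s t 0 (int n + 1 - j)" for j
      using cv_shift[of s t 0 j "int n + 1 - j"] by simp
    have 2: "cv s t (int n + 1) j = cv t s 0 (int n + 1 - j)" for j
    proof -
      have "cv s t (int n + 1) j = cv s t (int n + 1 - j) 0" using cv_shift[of s t "int n + 1 - j" j 0] by simp
      then show ?thesis by (simp add: cv_def mult.commute)
    qed
    have "(\<Sum>j\<in>{1..int (Suc n)}. \<Sum>k\<in>{1..int (Suc n)}. cv s t j k)
       = (\<Sum>j\<in>{1..int n}. \<Sum>k\<in>{1..int n}. cv s t j k) + cv s t (int n + 1) (int n + 1)
         + (\<Sum>j\<in>{1..int n}. cv s t j (int n + 1)) + (\<Sum>j\<in>{1..int n}. cv s t (int n + 1) j)"
      unfolding i by (simp add: sum.distrib)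
    also have "cv s t (int n + 1) (int n + 1) = cv s t 0 0" by (simp add: cv_same)
    also have "(\<Sum>j\<in>{1..int n}. cv s t j (int n + 1)) = (\<Sum>d\<in>{1..n}. cv s t 0 (int d))"
      unfolding 1 by (rule r)
    also have "(\<Sum>j\<in>{1..int n}. cv s t (int n + 1) j) = (\<Sum>d\<in>{1..n}. cv t s 0 (int d))"
      unfolding 2 by (rule r)
    finally show ?case using Suc by (simp add: lag_cov_eq sum.distrib algebra_simps)
  qed simp
  finally show ?thesis .
qed

lemma integral_Z_mult_tendsto: "(\<lambda>n. \<integral>x. Z n s x * Z n t x \<partial>P) \<longlonglongrightarrow> C s t"
  unfolding integral_Z_mult
proof (rule cesaro_mean_tendsto)
  have "(\<lambda>m. cv s t 0 0 + (\<Sum>k<m. lag_cov P Yp s t (Suc k))) \<longlonglongrightarrow> cv s t 0 0 + (\<Sum>k. lag_cov P Yp s t (Suc k))"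
    by (intro tendsto_intros summable_LIMSEQ summable_lag_cov)
  moreover have "(\<Sum>k<m. lag_cov P Yp s t (Suc k)) = (\<Sum>d\<in>{1..m}. lag_cov P Yp s t d)" for m
    by (rule sum.reindex_bij_witness[where i="\<lambda>d. d - 1" and j=Suc]) auto
  moreover have "cv s t 0 0 + (\<Sum>k. lag_cov P Yp s t (Suc k)) = C s t"
    by (simp add: C_def limit_cov_def cv_same F_def mult.commute)
  ultimately show "(\<lambda>m. cv s t 0 0 + (\<Sum>d\<in>{1..m}. lag_cov P Yp s t d)) \<longlonglongrightarrow> C s t" by simp
qed

lemma C_sym: "C s t = C t s"
  by (rule LIMSEQ_unique[OF integral_Z_mult_tendsto]) (use integral_Z_mult_tendsto[of t s] in \<open>simp add: mult.commute\<close>)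

text \<open>The covariance of the sums themselves is at most \<open>n\<close> times the right-hand
  side, and the two factors \<open>sqrt (real n)\<close> cancel this \<open>n\<close>.\<close>

lemma integral_normalized_sums_bound:
  assumes X: "\<And>j. adm j A (X j)" "\<And>j. (\<integral>x. (X j x - c)\<^sup>2 \<partial>P) \<le> \<beta>\<^sup>2"
    and X': "\<And>j. adm j A' (X' j)" "\<And>j. (\<integral>x. (X' j x - c')\<^sup>2 \<partial>P) \<le> \<beta>'\<^sup>2"
    and nn: "0 \<le> \<beta>" "0 \<le> \<beta>'"
    and m: "\<And>j. (\<integral>x. X j x \<partial>P) = m" "\<And>j. (\<integral>x. X' j x \<partial>P) = m'"
  shows "\<bar>\<integral>x. ((\<Sum>j\<in>{1..int n}. X j x - m) / sqrt (real n)) * ((\<Sum>j\<in>{1..int n}. X' j x - m') / sqrt (real n)) \<partial>P\<bar>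
     \<le> th A \<beta> * th A' \<beta>'"
proof (cases "n = 0")
  case True
  then show ?thesis using th_nonneg nn adm_nonneg[OF X(1)] adm_nonneg[OF X'(1)] by simp
next
  case False
  let ?J = "{1..int n}"
  let ?S = "\<lambda>x. \<Sum>j\<in>?J. X j x" and ?S' = "\<lambda>x. \<Sum>j\<in>?J. X' j x"
  have b: "bm (X j)" "bm (X' j)" for j using adm_bm[OF X(1)] adm_bm[OF X'(1)] by auto
  have S: "bm ?S" "bm ?S'" by (intro bm_sum b)+
  have mS: "(\<integral>x. ?S x \<partial>P) = real n * m" "(\<integral>x. ?S' x \<partial>P) = real n * m'"
    using b m by (simp_all add: Bochner_Integration.integral_sum bm_integrable)
  have "(\<integral>x. ((\<Sum>j\<in>?J. X j x - m) / sqrt (real n)) * ((\<Sum>j\<in>?J. X' j x - m') / sqrt (real n)) \<partial>P)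
     = (\<integral>x. (?S x - (\<integral>x. ?S x \<partial>P)) * (?S' x - (\<integral>x. ?S' x \<partial>P)) / real n \<partial>P)"
    unfolding mS by (intro Bochner_Integration.integral_cong) (auto simp: sum_subtractf)
  also have "\<dots> = ((\<integral>x. ?S x * ?S' x \<partial>P) - (\<integral>x. ?S x \<partial>P) * (\<integral>x. ?S' x \<partial>P)) / real n"
    by (simp add: integral_centered_mult[OF S])
  finally have e: "(\<integral>x. ((\<Sum>j\<in>?J. X j x - m) / sqrt (real n)) * ((\<Sum>j\<in>?J. X' j x - m') / sqrt (real n)) \<partial>P)
     = ((\<integral>x. ?S x * ?S' x \<partial>P) - (\<integral>x. ?S x \<partial>P) * (\<integral>x. ?S' x \<partial>P)) / real n" .
  have "\<bar>(\<integral>x. ?S x * ?S' x \<partial>P) - (\<integral>x. ?S x \<partial>P) * (\<integral>x. ?S' x \<partial>P)\<bar> \<le> (\<Sum>j\<in>?J. th A \<beta>) * th A' \<beta>'"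
    using adm_nonneg[OF X(1)] adm_nonneg[OF X'(1)]
    by (intro covariance_sums_bound[where c="\<lambda>_. c" and c'="\<lambda>_. c'"] X X' nn) auto
  also have "\<dots> = real n * (th A \<beta> * th A' \<beta>')" by simp
  finally show ?thesis unfolding e using False by (simp add: field_simps)
qed

text \<open>The \<open>L\<^sup>2\<close> distance of the indicator of \<open>Y\<^sub>j \<le> t\<close> from the nearer of the constants 0 and 1.
  It decays in both tails.\<close>

definition bt :: "real \<Rightarrow> real" where
  "bt t = sqrt (min (F t) (1 - F t))"

lemma bt_nonneg: "0 \<le> bt t" using F_range[of t] by (simp add: bt_def)

lemma integral_Ind_bt: "(\<integral>x. (Ind a t j x - (if F t \<le> 1 - F t then 0 else 1))\<^sup>2 \<partial>P) \<le> (bt t)\<^sup>2"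
proof -
  have "(bt t)\<^sup>2 = min (F t) (1 - F t)" using F_range[of t] by (simp add: bt_def)
  note bt = this
  show ?thesis
  proof (cases "F t \<le> 1 - F t")
    case True
    show ?thesis unfolding if_P[OF True] integral_Ind_sq bt using True by simp
  next
    case False
    show ?thesis unfolding if_not_P[OF False] integral_Ind_sq' bt using False by simp
  qed
qed

definition Th :: "real \<Rightarrow> real" where "Th t = th 1 (bt t)"

text \<open>Bounds the L2 modulus of continuity of \<open>Z n\<close>, uniformly in
  \<open>n\<close>: 2 is the admissibility constant of a difference of two indicators, and
  \<open>sqrt (L * d)\<close> bounds the L2 norm of that difference.\<close>

definition kap :: "real \<Rightarrow> real" where "kap d = th 2 (sqrt (L * d))"

lemma Th_nonneg: "0 \<le> Th t"
  unfolding Th_def by (intro th_nonneg bt_nonneg) simp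

lemma kap_nonneg: "0 \<le> d \<Longrightarrow> 0 \<le> kap d"
  unfolding kap_def using L_nonneg by (intro th_nonneg) auto

lemma F_increment: assumes "s \<le> t" shows "F t - F s \<le> L * (t - s)" "F s \<le> F t"
proof -
  have s: "{x. Yp 0 x \<le> u} \<in> sets P" for u
    using measurable_sets[OF Yp_measurable, of "{..u}" 0] by (simp add: vimage_def)
  have sub: "{x. Yp 0 x \<le> s} \<subseteq> {x. Yp 0 x \<le> t}" using assms by auto
  show "F s \<le> F t" unfolding F_eq by (intro P.finite_measure_mono sub s)
  have s2: "{x. lin a x 0 \<in> {s..t}} \<in> sets P"
    using measurable_sets[OF lin_measurable_P, of "{s..t}" a 0] by (simp add: vimage_def)
  have "F t - F s = measure P ({x. Yp 0 x \<le> t} - {x. Yp 0 x \<le> s})"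
    unfolding F_eq by (intro P.finite_measure_Diff[symmetric] sub s)
  also have "\<dots> \<le> measure P {x. lin a x 0 \<in> {s..t}}"
    by (intro P.finite_measure_mono s2) (auto simp: Yp_def)
  also have "\<dots> \<le> L * (t - s)" by (rule prob_lin_interval[OF sub_a assms])
  finally show "F t - F s \<le> L * (t - s)" .
qed

lemma integral_Ind_diff_sq: "(\<integral>x. (Ind a t j x - Ind a s j x - 0)\<^sup>2 \<partial>P) \<le> (sqrt (L * \<bar>t - s\<bar>))\<^sup>2"
proof -
  have *: "(\<integral>x. (Ind a t j x - Ind a s j x - 0)\<^sup>2 \<partial>P) \<le> L * (t - s)" if "s \<le> t" for s t
  proof -
    have "(\<integral>x. (Ind a t j x - Ind a s j x - 0)\<^sup>2 \<partial>P) = (\<integral>x. Ind a t j x - Ind a s j x \<partial>P)"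
      using that by (intro Bochner_Integration.integral_cong) (auto simp: Ind_def indicator_def)
    also have "\<dots> = F t - F s" using bm_integrable[OF bm_Ind] by (simp add: integral_Ind)
    also have "\<dots> \<le> L * (t - s)" by (rule F_increment[OF that])
    finally show ?thesis .
  qed
  have "(sqrt (L * \<bar>t - s\<bar>))\<^sup>2 = L * \<bar>t - s\<bar>" using L_nonneg by simp
  then show ?thesis
    using *[of s t] *[of t s] by (cases "s \<le> t") (simp_all add: power2_commute)
qed

lemma Z_diff: "Z n t x - Z n s x = (\<Sum>j\<in>{1..int n}. (Ind a t j x - Ind a s j x) - (F t - F s)) / sqrt (real n)"
  unfolding Z_def diff_divide_distrib[symmetric] sum_subtractf[symmetric]
  by (intro arg_cong2[where f="(/)"] sum.cong refl) simp

lemma integral_Ind_diff: "(\<integral>x. Ind a t j x - Ind a s j x \<partial>P) = F t - F s"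
  using bm_integrable[OF bm_Ind] by (simp add: integral_Ind)

lemma adm_Ind_diff: "adm j 2 (\<lambda>x. Ind a t j x - Ind a s j x)"
  using adm_diff[OF adm_Ind[OF sub_a] adm_Ind[OF sub_a], of j t s] by simp

lemma integral_Z_mult_bound: "\<bar>\<integral>x. Z n s x * Z n t x \<partial>P\<bar> \<le> Th s * Th t"
  unfolding Z_def Th_def
  by (rule integral_normalized_sums_bound[OF adm_Ind[OF sub_a] integral_Ind_bt adm_Ind[OF sub_a] integral_Ind_bt
        bt_nonneg bt_nonneg integral_Ind integral_Ind])

lemma integral_Z_diff_mult_bound: "\<bar>\<integral>x. (Z n t x - Z n s x) * Z n r x \<partial>P\<bar> \<le> kap \<bar>t - s\<bar> * Th r"
  unfolding Z_diff unfolding Z_def Th_def kap_def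
  by (rule integral_normalized_sums_bound[OF adm_Ind_diff integral_Ind_diff_sq adm_Ind[OF sub_a] integral_Ind_bt
        _ bt_nonneg integral_Ind_diff integral_Ind]) (use L_nonneg in simp)

lemma integral_Z_diff_sq_bound: "(\<integral>x. (Z n t x - Z n s x)\<^sup>2 \<partial>P) \<le> (kap \<bar>t - s\<bar>)\<^sup>2"
proof -
  have "\<bar>\<integral>x. (Z n t x - Z n s x) * (Z n t x - Z n s x) \<partial>P\<bar> \<le> kap \<bar>t - s\<bar> * kap \<bar>t - s\<bar>"
    unfolding Z_diff unfolding kap_def
    by (rule integral_normalized_sums_bound[OF adm_Ind_diff integral_Ind_diff_sq adm_Ind_diff integral_Ind_diff_sq
        _ _ integral_Ind_diff integral_Ind_diff]) (use L_nonneg in simp_all)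
  then show ?thesis by (simp add: power2_eq_square abs_le_iff)
qed

lemma C_bound: "\<bar>C s t\<bar> \<le> Th s * Th t"
  by (rule LIMSEQ_le_const2[OF tendsto_rabs[OF integral_Z_mult_tendsto]]) (auto intro: integral_Z_mult_bound)

lemma C_diff_bound: "\<bar>C t r - C s r\<bar> \<le> kap \<bar>t - s\<bar> * Th r"
proof (rule LIMSEQ_le_const2[OF tendsto_rabs[OF tendsto_diff[OF integral_Z_mult_tendsto integral_Z_mult_tendsto]]])
  have "(\<integral>x. Z n t x * Z n r x \<partial>P) - (\<integral>x. Z n s x * Z n r x \<partial>P) = (\<integral>x. (Z n t x - Z n s x) * Z n r x \<partial>P)" for n
    unfolding left_diff_distrib
    by (intro Bochner_Integration.integral_diff[symmetric] bm_integrable bm_mult bm_Z)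
  then show "\<exists>N. \<forall>n\<ge>N. \<bar>(\<integral>x. Z n t x * Z n r x \<partial>P) - (\<integral>x. Z n s x * Z n r x \<partial>P)\<bar> \<le> kap \<bar>t - s\<bar> * Th r"
    using integral_Z_diff_mult_bound by auto
qed

lemma integral_Z_diff_sq_tendsto: "(\<lambda>n. \<integral>x. (Z n t x - Z n s x)\<^sup>2 \<partial>P) \<longlonglongrightarrow> C t t - 2 * C s t + C s s"
proof -
  have "(\<integral>x. (Z n t x - Z n s x)\<^sup>2 \<partial>P)
     = (\<integral>x. Z n t x * Z n t x \<partial>P) - 2 * (\<integral>x. Z n s x * Z n t x \<partial>P) + (\<integral>x. Z n s x * Z n s x \<partial>P)" for n
  proof -
    have i: "integrable P (\<lambda>x. Z n s x * Z n t x)" for s t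
      by (intro bm_integrable bm_mult bm_Z)
    have "(\<integral>x. (Z n t x - Z n s x)\<^sup>2 \<partial>P) = (\<integral>x. Z n t x * Z n t x - 2 * (Z n s x * Z n t x) + Z n s x * Z n s x \<partial>P)"
      by (intro Bochner_Integration.integral_cong) (auto simp: power2_eq_square algebra_simps)
    then show ?thesis using i by simp
  qed
  moreover have "(\<lambda>n. (\<integral>x. Z n t x * Z n t x \<partial>P) - 2 * (\<integral>x. Z n s x * Z n t x \<partial>P) + (\<integral>x. Z n s x * Z n s x \<partial>P))
     \<longlonglongrightarrow> C t t - 2 * C s t + C s s"
    by (intro tendsto_intros integral_Z_mult_tendsto)
  ultimately show ?thesis by simp
qed

lemma C_increment_bound: "C t t - 2 * C s t + C s s \<le> (kap \<bar>t - s\<bar>)\<^sup>2"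
  by (rule LIMSEQ_le_const2[OF integral_Z_diff_sq_tendsto]) (auto intro: integral_Z_diff_sq_bound)

text \<open>Inherited in the limit from second moments of linear combinations. The family
  \<open>f\<close> may repeat values, as enumerations of the rationals do.\<close>

lemma C_psd: "0 \<le> (\<Sum>s\<in>I. \<Sum>t\<in>I. c s * c t * C (f s) (f t))"
proof (rule LIMSEQ_le_const)
  show "(\<lambda>n. \<Sum>s\<in>I. \<Sum>t\<in>I. c s * c t * (\<integral>x. Z n (f s) x * Z n (f t) x \<partial>P)) \<longlonglongrightarrow> (\<Sum>s\<in>I. \<Sum>t\<in>I. c s * c t * C (f s) (f t))"
    by (intro tendsto_intros integral_Z_mult_tendsto)
  have "(\<Sum>s\<in>I. \<Sum>t\<in>I. c s * c t * (\<integral>x. Z n (f s) x * Z n (f t) x \<partial>P)) = (\<integral>x. (\<Sum>s\<in>I. c s * Z n (f s) x)\<^sup>2 \<partial>P)" for n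
  proof -
    have "(\<integral>x. (\<Sum>s\<in>I. c s * Z n (f s) x)\<^sup>2 \<partial>P) = (\<integral>x. (\<Sum>s\<in>I. \<Sum>t\<in>I. c s * c t * (Z n (f s) x * Z n (f t) x)) \<partial>P)"
      by (simp add: power2_eq_square sum_product mult_ac)
    also have "\<dots> = (\<Sum>s\<in>I. \<integral>x. (\<Sum>t\<in>I. c s * c t * (Z n (f s) x * Z n (f t) x)) \<partial>P)"
      by (intro Bochner_Integration.integral_sum bm_integrable bm_intros bm_Z)
    also have "\<dots> = (\<Sum>s\<in>I. \<Sum>t\<in>I. \<integral>x. c s * c t * (Z n (f s) x * Z n (f t) x) \<partial>P)"
      by (intro sum.cong refl Bochner_Integration.integral_sum bm_integrable bm_intros bm_Z)
    finally show ?thesis by simp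
  qed
  then show "\<exists>N. \<forall>n\<ge>N. 0 \<le> (\<Sum>s\<in>I. \<Sum>t\<in>I. c s * c t * (\<integral>x. Z n (f s) x * Z n (f t) x \<partial>P))"
    by simp
qed

end

section \<open>Characteristic functions and independence of blocks of coordinates\<close>

lemma norm_iexp_diff_le: "norm (iexp x - iexp y) \<le> \<bar>x - y\<bar>"
proof -
  have "iexp y * iexp (x - y) = iexp x"
    by (simp add: exp_add[symmetric] algebra_simps)
  then have "iexp x - iexp y = iexp y * (iexp (x - y) - 1)"
    by (simp only: right_diff_distrib mult_1_right)
  then have "norm (iexp x - iexp y) = norm (iexp (x - y) - 1)" by (simp add: norm_mult)
  also have "\<dots> \<le> \<bar>x - y\<bar>" using iexp_approx1[of "x - y" 0] by simp
  finally show ?thesis .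
qed

context iid_seq
begin

lemma integrable_iexp: "X \<in> borel_measurable P \<Longrightarrow> integrable P (\<lambda>x. iexp (X x))"
  by (rule P.integrable_iexp) auto

lemma norm_integral_iexp_diff_le:
  assumes "bm X" "bm Y"
  shows "norm ((\<integral>x. iexp (X x) \<partial>P) - (\<integral>x. iexp (Y x) \<partial>P)) \<le> (\<integral>x. \<bar>X x - Y x\<bar> \<partial>P)"
proof -
  note [measurable] = bmD[OF assms(1)] bmD[OF assms(2)]
  have i: "integrable P (\<lambda>x. iexp (X x))" "integrable P (\<lambda>x. iexp (Y x))"
    by (auto intro: integrable_iexp)
  have "norm ((\<integral>x. iexp (X x) \<partial>P) - (\<integral>x. iexp (Y x) \<partial>P)) = norm (\<integral>x. iexp (X x) - iexp (Y x) \<partial>P)"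
    using i by simp
  also have "\<dots> \<le> (\<integral>x. norm (iexp (X x) - iexp (Y x)) \<partial>P)" by (rule integral_norm_bound)
  also have "\<dots> \<le> (\<integral>x. \<bar>X x - Y x\<bar> \<partial>P)"
    using i bm_integrable[OF bm_diff[OF assms]]
    by (intro integral_mono norm_iexp_diff_le) auto
  finally show ?thesis .
qed

lemma bm_abs: "bm X \<Longrightarrow> bm (\<lambda>x. \<bar>X x\<bar>)"
  unfolding bm_def by auto

lemma integral_abs_le_sqrt: "bm X \<Longrightarrow> (\<integral>x. \<bar>X x\<bar> \<partial>P) \<le> sqrt (\<integral>x. (X x)\<^sup>2 \<partial>P)"
  using integral_Cauchy_Schwarz[OF bm_abs bm_const, of X 1] by (simp add: abs_le_iff)

lemma indep_coordinates: "P.indep_vars (\<lambda>_. D) (\<lambda>i x. x i) UNIV"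
proof -
  have m: "(\<lambda>x. x i) \<in> measurable P D" for i unfolding P_def by simp
  have d: "distr P D (\<lambda>x. x i) = D" for i unfolding P_def by (rule pp.PiM_component) simp
  have "distr P (PiM UNIV (\<lambda>_. D)) (\<lambda>x. \<lambda>i\<in>UNIV. x i) = distr P P (\<lambda>x. x)"
    by (simp add: P_def restrict_UNIV)
  also have "\<dots> = PiM UNIV (\<lambda>i. distr P D (\<lambda>x. x i))"
    by (simp only: distr_id d) (simp only: P_def)
  finally show ?thesis
    using m by (subst P.indep_vars_iff_distr_eq_PiM) auto
qed

lemma indep_blocks:
  fixes U :: "nat \<Rightarrow> (int \<Rightarrow> real) \<Rightarrow> real"
  assumes U: "\<And>b. U b \<in> borel_measurable P"
    and dep: "\<And>b x y. (\<And>i. i \<in> B b \<Longrightarrow> x i = y i) \<Longrightarrow> U b x = U b y"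
    and dis: "disjoint_family B"
  shows "P.indep_vars (\<lambda>_. borel) U UNIV"
proof -
  have 1: "P.indep_vars (\<lambda>b. PiM (B b) (\<lambda>_. D)) (\<lambda>b x. restrict (\<lambda>i. x i) (B b)) UNIV"
    by (rule P.indep_vars_restrict[OF indep_coordinates]) (use dis in auto)
  \<comment> \<open>\<open>?e\<close> extends a function on the block by 0, so that
    \<open>U b\<close> can be read as a map on the product over the block; by \<open>dep\<close> the
    values outside do not matter.\<close>
  let ?e = "\<lambda>b z i. if i \<in> B b then z i else (0::real)"
  have 2: "(\<lambda>z. U b (?e b z)) \<in> borel_measurable (PiM (B b) (\<lambda>_. D))" for b
  proof (rule measurable_compose[OF measurable_into_P U])
    fix i
    show "(\<lambda>z. ?e b z i) \<in> borel_measurable (PiM (B b) (\<lambda>_. D))"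
    proof (cases "i \<in> B b")
      case True
      have "(\<lambda>z. z i) \<in> measurable (PiM (B b) (\<lambda>_. D)) D" using True by (rule measurable_component_singleton)
      with True show ?thesis by (simp cong: measurable_cong_sets)
    qed simp
  qed
  have "P.indep_vars (\<lambda>_. borel) (\<lambda>b x. U b (?e b (restrict (\<lambda>i. x i) (B b)))) UNIV"
    by (rule P.indep_vars_compose2[OF 1]) (rule 2)
  moreover have "U b (?e b (restrict (\<lambda>i. x i) (B b))) = U b x" for b x
    by (rule dep) auto
  ultimately show ?thesis by simp
qed

end

context lin_proc
begin

text \<open>Every term of the series vanishes and \<open>A * C0 * \<bar>a k\<bar>\<close> dominates,
  so Tannery's theorem exchanges limit and sum. This converts smallness in L2 into smallness of the
  covariance bounds.\<close>

lemma th_tendsto_0: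
  assumes "f \<longlonglongrightarrow> 0" "\<And>n. 0 \<le> f n" "0 \<le> A"
  shows "(\<lambda>n. th A (f n)) \<longlonglongrightarrow> 0"
proof -
  have "((\<lambda>n. \<Sum>k. min (A * C0 * \<bar>a k\<bar>) (f n)) \<longlongrightarrow> (\<Sum>k. 0::real)) sequentially"
  proof (rule tannerys_theorem[THEN conjunct2, THEN conjunct2])
    show "((\<lambda>n. min (A * C0 * \<bar>a k\<bar>) (f n)) \<longlongrightarrow> 0) sequentially" for k
      using tendsto_min[OF tendsto_const[of "A * C0 * \<bar>a k\<bar>"] assms(1)] assms(3) C0_pos by simp
    show "\<forall>\<^sub>F (k, n) in at_top \<times>\<^sub>F sequentially. norm (min (A * C0 * \<bar>a k\<bar>) (f n)) \<le> A * C0 * \<bar>a k\<bar>"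
      using assms(2,3) C0_pos by (intro always_eventually) auto
    show "summable (\<lambda>k. A * C0 * \<bar>a k\<bar>)" by (rule summable_mult[OF a_summable])
  qed simp
  then show ?thesis by (simp add: th_def)
qed

definition tr :: "nat \<Rightarrow> nat \<Rightarrow> real" where "tr l k = (if k \<le> l then a k else 0)"

lemma sub_tr: "sub (tr l)"
  using sub_trunc[OF sub_a, of l] by (simp add: tr_def[abs_def])

lemma sum_lessThan_blocks:
  fixes f :: "nat \<Rightarrow> real"
  shows "(\<Sum>i<q * p. f i) = (\<Sum>b<q. \<Sum>l<p. f (b * p + l))"
proof (induction q)
  case (Suc q)
  have "(\<Sum>i<m + p. f i) = (\<Sum>i<m. f i) + (\<Sum>l<p. f (m + l))" for m
    by (induction p) (simp_all add: add.assoc)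
  from this[of "q * p"] Suc show ?case by (simp add: add.commute)
qed simp

lemma sum_int_atLeastAtMost: "(\<Sum>j\<in>{1..int n}. f j) = (\<Sum>i<n. f (int i + 1))"
  by (rule sum.reindex_bij_witness[where i="\<lambda>i. int i + 1" and j="\<lambda>j. nat (j - 1)"]) auto

end

subsection \<open>Central limit theorem for linear combinations\<close>

text \<open>Fixing coefficients and points is the Cramer-Wold reduction: the joint behaviour of the
  values \<open>Z n (T t)\<close> is captured by the characteristic function at 1 of all such
  combinations.\<close>

locale lin_proc_comb = lin_proc D a K for D a K +
  fixes I :: "'i set" and c :: "'i \<Rightarrow> real" and T :: "'i \<Rightarrow> real"
  assumes finite_I: "finite I"
begin

definition A0 :: real where "A0 = (\<Sum>t\<in>I. \<bar>c t\<bar>)"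

definition G :: "(nat \<Rightarrow> real) \<Rightarrow> int \<Rightarrow> (int \<Rightarrow> real) \<Rightarrow> real" where
  "G b j x = (\<Sum>t\<in>I. c t * Ind b (T t) j x)"

definition m0 :: real where "m0 = (\<Sum>t\<in>I. c t * F (T t))"

definition Zc :: "nat \<Rightarrow> (int \<Rightarrow> real) \<Rightarrow> real" where
  "Zc n x = (\<Sum>t\<in>I. c t * Z n (T t) x)"

definition s2 :: real where "s2 = (\<Sum>s\<in>I. \<Sum>t\<in>I. c s * c t * C (T s) (T t))"

lemma A0_nonneg: "0 \<le> A0" by (simp add: A0_def sum_nonneg)

lemma adm_G: "sub b \<Longrightarrow> adm j A0 (G b j)"
  using adm_lincomb[where I=I and X="\<lambda>t. Ind b (T t) j" and c=c and A=1, OF finite_I adm_Ind] by (simp add: A0_def G_def[abs_def])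

lemma bm_G: "bm (G b j)"
  unfolding G_def[abs_def] by (intro bm_intros bm_Ind)

lemma G_shift: "G b j (\<lambda>i. x (i + k)) = G b (j + k) x"
  by (simp add: G_def Ind_shift)

lemma integral_G: "(\<integral>x. G a j x \<partial>P) = m0"
proof -
  have "(\<integral>x. G a j x \<partial>P) = (\<Sum>t\<in>I. \<integral>x. c t * Ind a (T t) j x \<partial>P)"
    unfolding G_def by (intro Bochner_Integration.integral_sum bm_integrable bm_intros bm_Ind)
  then show ?thesis by (simp add: integral_Ind m0_def)
qed

lemma Zc_eq: "Zc n x = (\<Sum>i<n. G a (int i + 1) x - m0) / sqrt (real n)"
proof -
  have "Zc n x = (\<Sum>t\<in>I. \<Sum>i<n. c t * (Ind a (T t) (int i + 1) x - F (T t))) / sqrt (real n)"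
    by (simp add: Zc_def Z_def sum_int_atLeastAtMost sum_distrib_left sum_divide_distrib)
  also have "(\<Sum>t\<in>I. \<Sum>i<n. c t * (Ind a (T t) (int i + 1) x - F (T t))) = (\<Sum>i<n. G a (int i + 1) x - m0)"
    by (subst sum.swap) (simp add: G_def m0_def sum_subtractf right_diff_distrib)
  finally show ?thesis .
qed

lemma bm_Zc: "bm (Zc n)"
  unfolding Zc_def[abs_def] by (intro bm_intros bm_Z)

lemma integral_Zc_sq_tendsto: "(\<lambda>n. \<integral>x. (Zc n x)\<^sup>2 \<partial>P) \<longlonglongrightarrow> s2"
proof -
  have "(\<integral>x. (Zc n x)\<^sup>2 \<partial>P) = (\<Sum>s\<in>I. \<Sum>t\<in>I. c s * c t * (\<integral>x. Z n (T s) x * Z n (T t) x \<partial>P))" for n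
  proof -
    have "(\<integral>x. (Zc n x)\<^sup>2 \<partial>P) = (\<integral>x. (\<Sum>s\<in>I. \<Sum>t\<in>I. c s * c t * (Z n (T s) x * Z n (T t) x)) \<partial>P)"
      unfolding Zc_def by (simp add: power2_eq_square sum_product mult_ac)
    also have "\<dots> = (\<Sum>s\<in>I. \<integral>x. (\<Sum>t\<in>I. c s * c t * (Z n (T s) x * Z n (T t) x)) \<partial>P)"
      by (intro Bochner_Integration.integral_sum bm_integrable bm_intros bm_Z)
    also have "\<dots> = (\<Sum>s\<in>I. \<Sum>t\<in>I. \<integral>x. c s * c t * (Z n (T s) x * Z n (T t) x) \<partial>P)"
      by (intro sum.cong refl Bochner_Integration.integral_sum bm_integrable bm_intros bm_Z)
    finally show ?thesis by simp
  qed
  then show ?thesis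
    unfolding s2_def by (simp only:) (intro tendsto_intros integral_Z_mult_tendsto)
qed

definition W :: "nat \<Rightarrow> int \<Rightarrow> (int \<Rightarrow> real) \<Rightarrow> real" where
  "W l j x = G a j x - G (tr l) j x"

definition be :: "nat \<Rightarrow> real" where "be l = sqrt (\<integral>x. (W l 0 x)\<^sup>2 \<partial>P)"

lemma adm_W: "adm j (2 * A0) (W l j)"
  using adm_diff[OF adm_G[OF sub_a] adm_G[OF sub_tr], of j l] by (simp add: W_def[abs_def])

lemma bm_W: "bm (W l j)" by (rule adm_bm[OF adm_W])

lemma be_nonneg: "0 \<le> be l"
  by (simp add: be_def)

lemma integral_W_sq: "(\<integral>x. (W l j x - 0)\<^sup>2 \<partial>P) \<le> (be l)\<^sup>2"
proof -
  have "(\<integral>x. (W l j x)\<^sup>2 \<partial>P) = (\<integral>x. (W l 0 x)\<^sup>2 \<partial>P)"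
    using integral_shift[of "\<lambda>x. (W l 0 x)\<^sup>2" j] bmD[OF bm_mult[OF bm_W bm_W]]
    by (simp add: W_def G_shift power2_eq_square)
  then show ?thesis by (simp add: be_def)
qed

lemma abs_W_le: "\<bar>W l j x\<bar> \<le> 2 * A0"
  using adm_W[of j l] by (simp add: adm_def)

text \<open>\<open>W\<close> is bounded by \<open>2 * A0\<close>, so its second moment is at most
  this bound times its first absolute moment, which vanishes as the truncation is lifted.\<close>

lemma be_tendsto_0: "be \<longlonglongrightarrow> 0"
proof -
  have *: "(\<lambda>l. \<integral>x. (W l 0 x)\<^sup>2 \<partial>P) \<longlonglongrightarrow> 0"
  proof (rule tendsto_sandwich[OF _ _ tendsto_const])
    have "(\<lambda>l. 2 * A0 * (\<Sum>t\<in>I. \<bar>c t\<bar> * (\<integral>x. \<bar>Ind a (T t) 0 x - Ind (tr l) (T t) 0 x\<bar> \<partial>P)))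
       \<longlonglongrightarrow> 2 * A0 * (\<Sum>t\<in>I. \<bar>c t\<bar> * 0)"
      unfolding tr_def[abs_def] by (intro tendsto_intros integral_Ind_trunc_tendsto sub_a)
    then show "(\<lambda>l. 2 * A0 * (\<Sum>t\<in>I. \<bar>c t\<bar> * (\<integral>x. \<bar>Ind a (T t) 0 x - Ind (tr l) (T t) 0 x\<bar> \<partial>P))) \<longlonglongrightarrow> 0"
      by simp
    show "\<forall>\<^sub>F l in sequentially. (\<integral>x. (W l 0 x)\<^sup>2 \<partial>P)
        \<le> 2 * A0 * (\<Sum>t\<in>I. \<bar>c t\<bar> * (\<integral>x. \<bar>Ind a (T t) 0 x - Ind (tr l) (T t) 0 x\<bar> \<partial>P))"
    proof (rule always_eventually, rule allI)
      fix l
      let ?d = "\<lambda>t x. \<bar>Ind a (T t) 0 x - Ind (tr l) (T t) 0 x\<bar>"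
      have d: "bm (?d t)" for t by (intro bm_abs bm_intros bm_Ind)
      have "(\<integral>x. (W l 0 x)\<^sup>2 \<partial>P) \<le> (\<integral>x. 2 * A0 * (\<Sum>t\<in>I. \<bar>c t\<bar> * ?d t x) \<partial>P)"
      proof (rule integral_mono)
        show "integrable P (\<lambda>x. (W l 0 x)\<^sup>2)"
          unfolding power2_eq_square by (intro bm_integrable bm_mult bm_W)
        show "integrable P (\<lambda>x. 2 * A0 * (\<Sum>t\<in>I. \<bar>c t\<bar> * ?d t x))"
          by (intro bm_integrable bm_intros d)
        fix x
        have "W l 0 x = (\<Sum>t\<in>I. c t * (Ind a (T t) 0 x - Ind (tr l) (T t) 0 x))"
          by (simp add: W_def G_def sum_subtractf right_diff_distrib)
        also have "\<bar>\<Sum>t\<in>I. c t * (Ind a (T t) 0 x - Ind (tr l) (T t) 0 x)\<bar> \<le> (\<Sum>t\<in>I. \<bar>c t\<bar> * ?d t x)"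
          by (rule order_trans[OF sum_abs]) (simp add: abs_mult)
        finally have "\<bar>W l 0 x\<bar> * \<bar>W l 0 x\<bar> \<le> 2 * A0 * (\<Sum>t\<in>I. \<bar>c t\<bar> * ?d t x)"
          using abs_W_le[of l 0 x] A0_nonneg by (intro mult_mono) auto
        then show "(W l 0 x)\<^sup>2 \<le> 2 * A0 * (\<Sum>t\<in>I. \<bar>c t\<bar> * ?d t x)"
          by (simp add: power2_eq_square)
      qed
      also have "\<dots> = 2 * A0 * (\<Sum>t\<in>I. \<bar>c t\<bar> * (\<integral>x. ?d t x \<partial>P))"
        using bm_integrable[OF d] by (simp add: Bochner_Integration.integral_sum)
      finally show "(\<integral>x. (W l 0 x)\<^sup>2 \<partial>P) \<le> 2 * A0 * (\<Sum>t\<in>I. \<bar>c t\<bar> * (\<integral>x. ?d t x \<partial>P))" .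
    qed
  qed auto
  show ?thesis using tendsto_real_sqrt[OF *] by (simp add: be_def[abs_def])
qed

definition om :: "nat \<Rightarrow> real" where "om l = th (2 * A0) (be l)"

lemma om_tendsto_0: "om \<longlonglongrightarrow> 0"
  unfolding om_def[abs_def] using be_tendsto_0 be_nonneg A0_nonneg by (intro th_tendsto_0) auto

text \<open>In the block \<open>{b * p + 1..b * p + p}\<close> the process at position \<open>l\<close> is truncated after \<open>l\<close> lags, so that
  \<open>U p b\<close> depends on the innovations of this block only.\<close>

definition U :: "nat \<Rightarrow> nat \<Rightarrow> (int \<Rightarrow> real) \<Rightarrow> real" where
  "U p b x = (\<Sum>l<p. G (tr l) (int (b * p + l) + 1) x - (\<integral>x. G (tr l) 0 x \<partial>P))"

lemma bm_U: "bm (U p b)"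
  unfolding U_def[abs_def] by (intro bm_intros bm_G)

lemma integral_G_shift: "(\<integral>x. G b j x \<partial>P) = (\<integral>x. G b 0 x \<partial>P)"
  using integral_shift[OF bmD[OF bm_G], of b 0 j] by (simp add: G_shift)

lemma integral_U: "(\<integral>x. U p b x \<partial>P) = 0"
proof -
  have i: "integrable P (G b j)" for b j by (rule bm_integrable[OF bm_G])
  have "(\<integral>x. U p b x \<partial>P) = (\<Sum>l<p. (\<integral>x. G (tr l) (int (b * p + l) + 1) x \<partial>P) - (\<integral>x. G (tr l) 0 x \<partial>P))"
    unfolding U_def using i by (subst Bochner_Integration.integral_sum) auto
  moreover have "(\<integral>x. G (tr l) (int (b * p + l) + 1) x \<partial>P) = (\<integral>x. G (tr l) 0 x \<partial>P)" for l
    by (rule integral_G_shift)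
  ultimately show ?thesis by simp
qed

lemma U_shift: "U p b x = U p 0 (\<lambda>i. x (i + int (b * p)))"
  by (simp add: U_def G_shift algebra_simps)

lemma distr_U: "distr P borel (U p b) = distr P borel (U p 0)"
proof -
  have "distr P borel (U p b) = distr P borel (U p 0 \<circ> (\<lambda>x i. x (i + int (b * p))))"
    by (intro arg_cong[where f="distr P borel"] ext) (simp only: comp_def U_shift[of p b])
  also have "\<dots> = distr (distr P P (\<lambda>x i. x (i + int (b * p)))) borel (U p 0)"
    by (rule distr_distr[symmetric])
       (auto intro: bmD[OF bm_U] measurable_into_P component_measurable)
  finally show ?thesis by (simp only: distr_shift)
qed

lemma indep_U: "P.indep_vars (\<lambda>_. borel) (U p) UNIV"
proof (rule indep_blocks[where B="\<lambda>b. {int (b * p)<..int (b * p) + int p}"])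
  show "U p b \<in> borel_measurable P" for b by (rule bmD[OF bm_U])
  have lt: "int (b * p) + int p \<le> int (b' * p)" if "b < b'" for b b'
  proof -
    have "(b + 1) * p \<le> b' * p" using that by (intro mult_right_mono) auto
    then show ?thesis by (simp add: algebra_simps flip: of_nat_add of_nat_mult)
  qed
  show "disjoint_family (\<lambda>b. {int (b * p)<..int (b * p) + int p})"
    unfolding disjoint_family_on_def
  proof (intro ballI impI)
    fix b b' :: nat assume "b \<noteq> b'"
    then show "{int (b * p)<..int (b * p) + int p} \<inter> {int (b' * p)<..int (b' * p) + int p} = {}"
      using lt[of b b'] lt[of b' b] by (cases "b < b'") auto
  qed
  fix b and x y :: "int \<Rightarrow> real"
  assume xy: "\<And>i. i \<in> {int (b * p)<..int (b * p) + int p} \<Longrightarrow> x i = y i"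
  \<comment> \<open>From position \<open>b * p + l + 1\<close>, at most \<open>l\<close> lags reach
    back to \<open>b * p + 1\<close>, the first position of the block.\<close>
  have "lin (tr l) x (int (b * p + l) + 1) = lin (tr l) y (int (b * p + l) + 1)" if "l < p" for l
    unfolding lin_def tr_def using that by (intro suminf_cong) (auto intro!: xy)
  then show "U p b x = U p b y"
    unfolding U_def G_def Ind_def by (intro sum.cong refl arg_cong2[where f="(-)"]) auto
qed

definition v :: "nat \<Rightarrow> real" where "v p = (\<integral>x. (U p 0 x)\<^sup>2 \<partial>P)"

lemma integral_U_sq: "(\<integral>x. (U p b x)\<^sup>2 \<partial>P) = v p"
proof -
  have "(\<lambda>x. (U p 0 x)\<^sup>2) \<in> borel_measurable P" using bmD[OF bm_U] by measurable
  from integral_shift[OF this, of "int (b * p)"] show ?thesis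
    unfolding v_def U_shift[of p b] .
qed

lemma v_nonneg: "0 \<le> v p"
  unfolding v_def by (intro Bochner_Integration.integral_nonneg) auto

lemma integral_U_mult: assumes "b \<noteq> b'" shows "(\<integral>x. U p b x * U p b' x \<partial>P) = 0"
proof -
  have "(\<integral>x. (\<Prod>i\<in>{b, b'}. U p i x) \<partial>P) = (\<Prod>i\<in>{b, b'}. \<integral>x. U p i x \<partial>P)"
    by (rule P.indep_vars_lebesgue_integral)
       (auto intro: P.indep_vars_subset[OF indep_U] bm_integrable[OF bm_U])
  with assms show ?thesis by (simp add: integral_U)
qed

lemma integral_sum_U_sq: "(\<integral>x. (\<Sum>b<q. U p b x)\<^sup>2 \<partial>P) = real q * v p"
proof -
  have "(\<integral>x. (\<Sum>b<q. U p b x)\<^sup>2 \<partial>P) = (\<integral>x. (\<Sum>b<q. \<Sum>b'<q. U p b x * U p b' x) \<partial>P)"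
    by (simp add: power2_eq_square sum_product)
  also have "\<dots> = (\<Sum>b<q. \<integral>x. (\<Sum>b'<q. U p b x * U p b' x) \<partial>P)"
    by (intro Bochner_Integration.integral_sum bm_integrable bm_intros bm_U)
  also have "\<dots> = (\<Sum>b<q. \<Sum>b'<q. \<integral>x. U p b x * U p b' x \<partial>P)"
    by (intro sum.cong refl Bochner_Integration.integral_sum bm_integrable bm_intros bm_U)
  also have "\<dots> = (\<Sum>b<q. \<Sum>b'<q. if b' = b then v p else 0)"
    by (intro sum.cong refl) (use integral_U_mult integral_U_sq in \<open>auto simp: power2_eq_square\<close>)
  finally show ?thesis by simp
qed

text \<open>\<open>Om p\<close> bounds the mean square cost of the truncation per block of length \<open>p\<close>. Since \<open>om l\<close> tends to 0, it is \<open>o(p)\<close>.\<close>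

definition Om :: "nat \<Rightarrow> real" where "Om p = (\<Sum>l<p. om l) * th (2 * A0) (2 * A0)"

lemma Om_nonneg: "0 \<le> Om p"
  unfolding Om_def om_def using A0_nonneg by (intro mult_nonneg_nonneg sum_nonneg th_nonneg be_nonneg) auto

text \<open>The errors in all blocks form a single sum of terms \<open>W l j\<close>, with
  \<open>l\<close> the position in the block. In the covariance bound only one factor has to be
  small: it takes the bounds \<open>be l\<close>, which vary with \<open>j\<close>, and the other
  the crude bound \<open>2 * A0\<close>.\<close>

lemma integral_block_error:
  "(\<integral>x. ((\<Sum>i<q * p. G a (int i + 1) x - m0) - (\<Sum>b<q. U p b x))\<^sup>2 \<partial>P) \<le> real q * Om p"
proof -
  let ?J = "{1..int (q * p)}" and ?l = "\<lambda>j. nat (j - 1) mod p"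
  let ?S = "\<lambda>x. \<Sum>j\<in>?J. W (?l j) j x"
  have S: "bm ?S" by (intro bm_sum bm_W)
  have i: "integrable P (G b j)" "integrable P (W l j)" for b j l by (rule bm_integrable[OF bm_G] bm_integrable[OF bm_W])+
  have mW: "(\<integral>x. W l j x \<partial>P) = m0 - (\<integral>x. G (tr l) 0 x \<partial>P)" for l j
    unfolding W_def using i by (simp add: integral_G integral_G_shift[of "tr l" j])
  have blocks: "(\<Sum>j\<in>?J. f (?l j) j) = (\<Sum>b<q. \<Sum>l<p. f l (int (b * p + l) + 1))" for f :: "nat \<Rightarrow> int \<Rightarrow> real"
  proof -
    have n: "nat (int m + 1 - 1) = m" for m by simp
    show ?thesis
      unfolding sum_int_atLeastAtMost sum_lessThan_blocks n
      by (intro sum.cong refl) (simp only: mod_mult_self3 mod_less lessThan_iff)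
  qed
  have mS: "(\<integral>x. ?S x \<partial>P) = (\<Sum>b<q. \<Sum>l<p. m0 - (\<integral>x. G (tr l) 0 x \<partial>P))"
  proof -
    have "(\<integral>x. ?S x \<partial>P) = (\<Sum>j\<in>?J. m0 - (\<integral>x. G (tr (?l j)) 0 x \<partial>P))"
      using i by (simp add: Bochner_Integration.integral_sum mW)
    also have "\<dots> = (\<Sum>b<q. \<Sum>l<p. m0 - (\<integral>x. G (tr l) 0 x \<partial>P))"
      by (rule blocks)
    finally show ?thesis .
  qed
  have e: "(\<Sum>i<q * p. G a (int i + 1) x - m0) - (\<Sum>b<q. U p b x) = ?S x - (\<integral>x. ?S x \<partial>P)" for x
    unfolding mS blocks[of "\<lambda>l j. W l j x"]
    unfolding sum_lessThan_blocks U_def sum_subtractf[symmetric] W_def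
    by (intro sum.cong refl) simp
  have "(\<integral>x. ((\<Sum>i<q * p. G a (int i + 1) x - m0) - (\<Sum>b<q. U p b x))\<^sup>2 \<partial>P)
     = (\<integral>x. ?S x * ?S x \<partial>P) - (\<integral>x. ?S x \<partial>P) * (\<integral>x. ?S x \<partial>P)"
    unfolding e power2_eq_square by (rule integral_centered_mult[OF S S])
  also have "\<dots> \<le> (\<Sum>j\<in>?J. th (2 * A0) (be (?l j))) * th (2 * A0) (2 * A0)"
  proof (rule abs_le_D1[OF covariance_sums_bound[where c="\<lambda>_. 0" and c'="\<lambda>_. 0"]])
    show "(\<integral>x. (W (?l j) j x - 0)\<^sup>2 \<partial>P) \<le> (2 * A0)\<^sup>2" for j
    proof -
      have "(\<integral>x. (W (?l j) j x - 0)\<^sup>2 \<partial>P) \<le> (\<integral>x. (2 * A0)\<^sup>2 \<partial>P)"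
      proof (rule integral_mono)
        show "integrable P (\<lambda>x. (W (?l j) j x - 0)\<^sup>2)"
          unfolding power2_eq_square by (intro bm_integrable bm_intros bm_W)
        show "(W (?l j) j x - 0)\<^sup>2 \<le> (2 * A0)\<^sup>2" for x
          using power_mono[OF abs_W_le[of "?l j" j x], of 2] by simp
      qed simp
      then show ?thesis by simp
    qed
  qed (use adm_W integral_W_sq A0_nonneg be_nonneg in auto)
  also have "(\<Sum>j\<in>?J. th (2 * A0) (be (?l j))) = real q * (\<Sum>l<p. om l)"
    unfolding blocks[of "\<lambda>l _. th (2 * A0) (be l)"] om_def by simp
  finally show ?thesis by (simp add: Om_def)
qed

lemma char_block_sum_tendsto:
  assumes p: "0 < p"
  shows "(\<lambda>q. \<integral>x. iexp ((\<Sum>b<q. U p b x) / sqrt (real (q * p))) \<partial>P) \<longlonglongrightarrow> exp (- (v p / real p) / 2)"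
proof (cases "v p = 0")
  case True
  \<comment> \<open>The central limit theorem asks for positive variance. With variance 0 all block
    sums vanish almost surely and both sides equal 1.\<close>
  have z: "AE x in P. U p b x = 0" for b
  proof -
    have "integrable P (\<lambda>x. (U p b x)\<^sup>2)" unfolding power2_eq_square by (intro bm_integrable bm_mult bm_U)
    from integral_nonneg_eq_0_iff_AE[OF this] integral_U_sq[of p b] True show ?thesis by simp
  qed
  have "AE x in P. \<forall>b. U p b x = 0" using z by (simp add: AE_all_countable)
  then have "(\<integral>x. iexp ((\<Sum>b<q. U p b x) / sqrt (real (q * p))) \<partial>P) = (\<integral>x. 1 \<partial>P)" for q
  proof (intro integral_cong_AE)
    show "(\<lambda>x. iexp ((\<Sum>b<q. U p b x) / sqrt (real (q * p)))) \<in> borel_measurable P"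
      using bmD[OF bm_U] by measurable
  qed (auto elim!: eventually_mono)
  then show ?thesis using True by simp
next
  case False
  with v_nonneg[of p] have v: "0 < v p" by simp
  let ?s = "sqrt (v p)"
  have "weak_conv_m (\<lambda>n. distr P borel (\<lambda>x. (\<Sum>i<n. U p i x) / sqrt (n * ?s\<^sup>2))) std_normal_distribution"
  proof (rule P.central_limit_theorem_zero_mean[where \<mu>="distr P borel (U p 0)"])
    show "P.indep_vars (\<lambda>_. borel) (U p) UNIV" by (rule indep_U)
    show "0 < ?s" using v by simp
    show "(\<integral>x. U p n x \<partial>P) = 0" for n by (rule integral_U)
    show "integrable P (\<lambda>x. (U p n x)\<^sup>2)" for n
      unfolding power2_eq_square by (intro bm_integrable bm_mult bm_U)
    show "P.variance (U p n) = ?s\<^sup>2" for n using v by (simp add: integral_U integral_U_sq)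
    show "distr P borel (U p n) = distr P borel (U p 0)" for n by (rule distr_U)
  qed
  \<comment> \<open>Evaluation at \<open>sqrt (v p / p)\<close> converts the normalization by
    \<open>sqrt (n * v p)\<close> into the one by \<open>sqrt (n * p)\<close>.\<close>
  then have "(\<lambda>n. char (distr P borel (\<lambda>x. (\<Sum>i<n. U p i x) / sqrt (n * ?s\<^sup>2))) (sqrt (v p / p)))
     \<longlonglongrightarrow> char std_normal_distribution (sqrt (v p / p))"
  proof (rule levy_continuity1[rotated 2])
    show "real_distribution (distr P borel (\<lambda>x. (\<Sum>i<n. U p i x) / sqrt (n * ?s\<^sup>2)))" for n
      by (rule P.real_distribution_distr) (use bmD[OF bm_U] in measurable)
  qed (rule real_dist_normal_dist)
  moreover have "char std_normal_distribution (sqrt (v p / p)) = exp (- (v p / real p) / 2)"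
    using v by (simp add: char_std_normal_distribution exp_of_real)
  moreover have "char (distr P borel (\<lambda>x. (\<Sum>i<n. U p i x) / sqrt (n * ?s\<^sup>2))) (sqrt (v p / p))
      = (\<integral>x. iexp ((\<Sum>b<n. U p b x) / sqrt (real (n * p))) \<partial>P)" for n
  proof -
    have "sqrt (v p / p) * (S / sqrt (n * ?s\<^sup>2)) = S / sqrt (real (n * p))" for S
      using v by (simp add: real_sqrt_mult real_sqrt_divide mult.commute)
    then show ?thesis
      unfolding char_def using bmD[OF bm_U]
      by (subst integral_distr) (auto intro!: borel_measurable_continuous_onI continuous_intros)
  qed
  ultimately show ?thesis by simp
qed

lemma Om_tendsto_0: "(\<lambda>p. Om p / real p) \<longlonglongrightarrow> 0"
proof -
  have "(\<lambda>p. (\<Sum>l<p. om l) / real p * th (2 * A0) (2 * A0)) \<longlonglongrightarrow> 0 * th (2 * A0) (2 * A0)"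
    by (intro tendsto_intros cesaro_mean_tendsto om_tendsto_0)
  then show ?thesis by (simp add: Om_def)
qed

definition er :: "nat \<Rightarrow> real" where "er p = sqrt (Om p / real p)"

lemma er_nonneg: "0 \<le> er p" using Om_nonneg by (simp add: er_def)

lemma er_tendsto_0: "er \<longlonglongrightarrow> 0"
  using tendsto_real_sqrt[OF Om_tendsto_0] by (simp add: er_def[abs_def])

text \<open>As the number of blocks of fixed length grows, the second moment of \<open>Zc\<close>
  tends to \<open>s2\<close>, while that of the normalized block sums is always
  \<open>v p / p\<close>. The two variables differ by at most \<open>er p\<close> in L2. The cross
  term is taken with \<open>Zc\<close>, so that the bound involves \<open>s2\<close> and not
  \<open>v p\<close>.\<close>

lemma block_variance_bound:
  assumes p: "0 < p"
  shows "\<bar>s2 - v p / real p\<bar> \<le> 2 * er p * sqrt s2 + (er p)\<^sup>2"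
proof -
  define z where "z q = (\<integral>x. (Zc (q * p) x)\<^sup>2 \<partial>P)" for q
  have "strict_mono (\<lambda>q. q * p)" using p by (auto intro: strict_monoI)
  from LIMSEQ_subseq_LIMSEQ[OF integral_Zc_sq_tendsto this]
  have z: "z \<longlonglongrightarrow> s2" by (simp add: z_def[abs_def] comp_def)
  show ?thesis
  proof (rule LIMSEQ_le)
    show "(\<lambda>q. \<bar>z q - v p / real p\<bar>) \<longlonglongrightarrow> \<bar>s2 - v p / real p\<bar>" by (intro tendsto_intros z)
    show "(\<lambda>q. 2 * er p * sqrt (z q) + (er p)\<^sup>2) \<longlonglongrightarrow> 2 * er p * sqrt s2 + (er p)\<^sup>2"
      by (intro tendsto_intros z)
    have "\<bar>z q - v p / real p\<bar> \<le> 2 * er p * sqrt (z q) + (er p)\<^sup>2" if q: "1 \<le> q" for q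
    proof -
      let ?n = "q * p"
      define B where "B x = (\<Sum>b<q. U p b x) / sqrt (real ?n)" for x
      define R where "R x = Zc ?n x - B x" for x
      have n: "0 < ?n" using p q by simp
      have bB: "bm B" unfolding B_def[abs_def] divide_inverse by (intro bm_intros bm_U)
      have bR: "bm R" unfolding R_def[abs_def] by (intro bm_diff bB bm_Zc)
      have R: "R x = ((\<Sum>i<?n. G a (int i + 1) x - m0) - (\<Sum>b<q. U p b x)) / sqrt (real ?n)" for x
        by (simp add: R_def B_def Zc_eq diff_divide_distrib)
      have R2: "(\<integral>x. (R x)\<^sup>2 \<partial>P) \<le> (er p)\<^sup>2"
      proof -
        have "(\<integral>x. (R x)\<^sup>2 \<partial>P) = (\<integral>x. ((\<Sum>i<?n. G a (int i + 1) x - m0) - (\<Sum>b<q. U p b x))\<^sup>2 \<partial>P) / real ?n"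
          unfolding R power_divide real_sqrt_pow2[OF of_nat_0_le_iff] by simp
        also have "\<dots> \<le> real q * Om p / real ?n"
          by (intro divide_right_mono integral_block_error) simp
        also have "\<dots> = (er p)\<^sup>2" using q p Om_nonneg[of p] by (simp add: er_def)
        finally show ?thesis .
      qed
      have B2: "(\<integral>x. (B x)\<^sup>2 \<partial>P) = v p / real p"
      proof -
        have "(\<integral>x. (B x)\<^sup>2 \<partial>P) = (\<integral>x. (\<Sum>b<q. U p b x)\<^sup>2 \<partial>P) / real ?n"
          unfolding B_def power_divide real_sqrt_pow2[OF of_nat_0_le_iff] by simp
        then show ?thesis using q by (simp add: integral_sum_U_sq)
      qed
      have i: "integrable P (\<lambda>x. (B x)\<^sup>2)" "integrable P (\<lambda>x. R x * Zc ?n x)" "integrable P (\<lambda>x. (R x)\<^sup>2)"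
        unfolding power2_eq_square by (intro bm_integrable bm_mult bB bR bm_Zc)+
      have "z q = (\<integral>x. (B x)\<^sup>2 + 2 * (R x * Zc ?n x) - (R x)\<^sup>2 \<partial>P)"
        unfolding z_def by (intro Bochner_Integration.integral_cong) (auto simp: R_def power2_eq_square algebra_simps)
      also have "\<dots> = v p / real p + 2 * (\<integral>x. R x * Zc ?n x \<partial>P) - (\<integral>x. (R x)\<^sup>2 \<partial>P)"
        using i by (simp add: B2)
      finally have 1: "z q - v p / real p = 2 * (\<integral>x. R x * Zc ?n x \<partial>P) - (\<integral>x. (R x)\<^sup>2 \<partial>P)" by simp
      have "\<bar>\<integral>x. R x * Zc ?n x \<partial>P\<bar> \<le> sqrt (\<integral>x. (R x)\<^sup>2 \<partial>P) * sqrt (z q)"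
        unfolding z_def by (rule integral_Cauchy_Schwarz[OF bR bm_Zc])
      also have "\<dots> \<le> er p * sqrt (z q)"
        by (intro mult_right_mono real_le_lsqrt R2 er_nonneg) (auto simp: z_def)
      finally have 2: "\<bar>\<integral>x. R x * Zc ?n x \<partial>P\<bar> \<le> er p * sqrt (z q)" .
      have 3: "0 \<le> (\<integral>x. (R x)\<^sup>2 \<partial>P)" by simp
      show ?thesis unfolding 1
        using abs_le_D1[OF 2] abs_le_D2[OF 2] R2 3 by (intro abs_leI) linarith+
    qed
    then show "\<exists>N. \<forall>q\<ge>N. \<bar>z q - v p / real p\<bar> \<le> 2 * er p * sqrt (z q) + (er p)\<^sup>2" by blast
  qed
qed

lemma block_variance_tendsto: "(\<lambda>p. v p / real p) \<longlonglongrightarrow> s2"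
proof -
  have "(\<lambda>p. 2 * er p * sqrt s2 + (er p)\<^sup>2) \<longlonglongrightarrow> 2 * 0 * sqrt s2 + 0\<^sup>2"
    by (intro tendsto_intros er_tendsto_0)
  then have "(\<lambda>p. 2 * er p * sqrt s2 + (er p)\<^sup>2) \<longlonglongrightarrow> 0" by simp
  moreover have "\<forall>\<^sub>F p in sequentially. norm (v p / real p - s2) \<le> 2 * er p * sqrt s2 + (er p)\<^sup>2"
    using eventually_gt_at_top[of 0]
    by eventually_elim (use block_variance_bound in \<open>simp add: abs_minus_commute\<close>)
  ultimately show ?thesis by (rule Lim_null_comparison[THEN LIM_zero_cancel, rotated])
qed

text \<open>The three summands are the truncation inside the blocks, the fewer than \<open>p\<close>
  terms after the last complete block, and the change of normalization from \<open>sqrt n\<close> to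
  \<open>sqrt (q * p)\<close>, which costs at most the L2 norm of the block sums times the
  difference \<open>d\<close> of the inverse roots.\<close>

lemma Zc_block_approx:
  assumes p: "0 < p" and n: "p \<le> n"
  defines "q \<equiv> n div p"
  shows "(\<integral>x. \<bar>Zc n x - (\<Sum>b<q. U p b x) / sqrt (real (q * p))\<bar> \<partial>P)
     \<le> er p + 2 * A0 * real p / sqrt (real n) + sqrt (v p / real p) * (1 - sqrt (real (q * p) / real n))"
proof -
  have q: "1 \<le> q" using n p by (simp add: q_def div_greater_zero_iff Suc_le_eq)
  have qp: "q * p \<le> n" "n - q * p < p" using p by (simp_all add: q_def minus_div_mult_eq_mod)
  have n0: "0 < real n" using n p by simp
  define S where "S x = (\<Sum>b<q. U p b x)" for x
  define E where "E x = ((\<Sum>i<q * p. G a (int i + 1) x - m0) - S x) / sqrt (real n)" for x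
  define R where "R x = (\<Sum>i\<in>{q * p..<n}. G a (int i + 1) x - m0) / sqrt (real n)" for x
  define d where "d = 1 / sqrt (real (q * p)) - 1 / sqrt (real n)"
  have "0 < sqrt (real (q * p))" "sqrt (real (q * p)) \<le> sqrt (real n)"
    using q p qp by (simp_all del: of_nat_mult)
  then have d: "0 \<le> d" unfolding d_def
    using frac_le[of 1 1 "sqrt (real (q * p))" "sqrt (real n)"] by linarith
  have bS: "bm S" unfolding S_def[abs_def] by (intro bm_intros bm_U)
  have bE: "bm E" unfolding E_def[abs_def] divide_inverse by (intro bm_intros bS bm_G)
  have bR: "bm R" unfolding R_def[abs_def] divide_inverse by (intro bm_intros bm_G)
  have m0: "\<bar>m0\<bar> \<le> A0"
  proof -
    have "\<bar>m0\<bar> \<le> (\<Sum>t\<in>I. \<bar>c t * F (T t)\<bar>)" unfolding m0_def by (rule sum_abs)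
    also have "\<dots> \<le> A0" unfolding A0_def using F_range by (intro sum_mono) (auto simp: abs_mult intro: mult_left_le)
    finally show ?thesis .
  qed
  have e: "Zc n x - S x / sqrt (real (q * p)) = E x + R x - d * S x" for x
  proof -
    have "(\<Sum>i<n. G a (int i + 1) x - m0) = (\<Sum>i<q * p. G a (int i + 1) x - m0) + (\<Sum>i\<in>{q * p..<n}. G a (int i + 1) x - m0)"
      unfolding lessThan_atLeast0 using qp(1) by (intro sum.atLeastLessThan_concat[symmetric]) auto
    then show ?thesis
      unfolding Zc_eq E_def R_def d_def diff_divide_distrib by (simp add: add_divide_distrib left_diff_distrib)
  qed
  have "(\<integral>x. \<bar>Zc n x - S x / sqrt (real (q * p))\<bar> \<partial>P) \<le> (\<integral>x. \<bar>E x\<bar> + 2 * A0 * real p / sqrt (real n) + d * \<bar>S x\<bar> \<partial>P)"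
  proof (rule integral_mono)
    show "integrable P (\<lambda>x. \<bar>Zc n x - S x / sqrt (real (q * p))\<bar>)"
      unfolding e by (intro bm_integrable bm_abs bm_intros bE bR bS)
    show "integrable P (\<lambda>x. \<bar>E x\<bar> + 2 * A0 * real p / sqrt (real n) + d * \<bar>S x\<bar>)"
      by (intro bm_integrable bm_intros bm_abs bE bS)
    fix x
    have "\<bar>\<Sum>i\<in>{q * p..<n}. G a (int i + 1) x - m0\<bar> \<le> (\<Sum>i\<in>{q * p..<n}. 2 * A0)"
    proof (rule order_trans[OF sum_abs], rule sum_mono)
      fix i
      have "\<bar>G a (int i + 1) x\<bar> \<le> A0" using adm_G[OF sub_a, of "int i + 1"] by (simp add: adm_def)
      then show "\<bar>G a (int i + 1) x - m0\<bar> \<le> 2 * A0" using m0 by linarith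
    qed
    also have "\<dots> = real (n - q * p) * (2 * A0)" by simp
    also have "\<dots> \<le> real p * (2 * A0)" using qp(2) A0_nonneg
      by (intro mult_right_mono) (simp_all only: of_nat_le_iff less_imp_le mult_nonneg_nonneg zero_le_numeral)
    finally have "\<bar>R x\<bar> \<le> 2 * A0 * real p / sqrt (real n)"
      using n0 by (simp add: R_def divide_right_mono mult.commute)
    then show "\<bar>Zc n x - S x / sqrt (real (q * p))\<bar> \<le> \<bar>E x\<bar> + 2 * A0 * real p / sqrt (real n) + d * \<bar>S x\<bar>"
      unfolding e using d abs_mult[of d "S x"] by linarith
  qed
  also have "\<dots> = (\<integral>x. \<bar>E x\<bar> \<partial>P) + 2 * A0 * real p / sqrt (real n) + d * (\<integral>x. \<bar>S x\<bar> \<partial>P)"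
    using bm_integrable[OF bm_abs[OF bE]] bm_integrable[OF bm_abs[OF bS]] by simp
  also have "(\<integral>x. \<bar>E x\<bar> \<partial>P) \<le> er p"
  proof -
    have "(\<integral>x. (E x)\<^sup>2 \<partial>P) = (\<integral>x. ((\<Sum>i<q * p. G a (int i + 1) x - m0) - S x)\<^sup>2 \<partial>P) / real n"
      unfolding E_def power_divide real_sqrt_pow2[OF of_nat_0_le_iff] by simp
    also have "\<dots> \<le> real q * Om p / real n"
      unfolding S_def by (intro divide_right_mono integral_block_error) simp
    also have "\<dots> \<le> real q * Om p / real (q * p)"
      using q p qp Om_nonneg[of p] n0 by (intro divide_left_mono) (auto simp del: of_nat_mult)
    also have "\<dots> = Om p / real p" using q by simp
    finally have "sqrt (\<integral>x. (E x)\<^sup>2 \<partial>P) \<le> er p" unfolding er_def by (rule real_sqrt_le_mono)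
    with integral_abs_le_sqrt[OF bE] show ?thesis by linarith
  qed
  also have "d * (\<integral>x. \<bar>S x\<bar> \<partial>P) \<le> d * sqrt (real q * v p)"
    using integral_abs_le_sqrt[OF bS] d unfolding S_def integral_sum_U_sq by (intro mult_left_mono)
  also have "d * sqrt (real q * v p) = sqrt (v p / real p) * (1 - sqrt (real (q * p) / real n))"
    unfolding d_def using q p n0 by (simp add: real_sqrt_mult real_sqrt_divide field_simps)
  finally show ?thesis unfolding S_def by simp
qed

lemma div_mult_ratio_tendsto:
  assumes p: "0 < p" shows "(\<lambda>n. real (n div p * p) / real n) \<longlonglongrightarrow> 1"
proof -
  have "(\<lambda>n. real (n div p * p) / real n - 1) \<longlonglongrightarrow> 0"
  proof (rule Lim_null_comparison)
    show "(\<lambda>n. real p / real n) \<longlonglongrightarrow> 0" by (rule lim_const_over_n)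
    show "\<forall>\<^sub>F n in sequentially. norm (real (n div p * p) / real n - 1) \<le> real p / real n"
      using eventually_gt_at_top[of 0]
    proof eventually_elim
      case (elim n)
      have "real n = real (n div p * p) + real (n mod p)"
        by (metis div_mult_mod_eq of_nat_add)
      moreover have "real (n mod p) \<le> real p" using p by (simp add: less_imp_le)
      ultimately have "\<bar>real (n div p * p) - real n\<bar> \<le> real p" by linarith
      then have "\<bar>real (n div p * p) - real n\<bar> / real n \<le> real p / real n"
        by (intro divide_right_mono) auto
      moreover have "real (n div p * p) / real n - 1 = (real (n div p * p) - real n) / real n"
        using elim by (simp add: field_simps)
      ultimately show ?case by simp
    qed
  qed
  then show ?thesis by (rule LIM_zero_cancel)
qed

text \<open>The block length is fixed first, making the truncation error and the error in the
  variance small. Only then does \<open>n\<close> grow, which removes the incomplete block and the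
  change of normalization.\<close>

theorem char_Zc_tendsto: "(\<lambda>n. \<integral>x. iexp (Zc n x) \<partial>P) \<longlonglongrightarrow> complex_of_real (exp (- s2 / 2))"
proof (rule LIMSEQ_I)
  fix r :: real assume r: "0 < r"
  have "(\<lambda>p. exp (- (v p / real p) / 2)) \<longlonglongrightarrow> exp (- s2 / 2)"
    by (intro tendsto_intros block_variance_tendsto) simp
  then have "\<forall>\<^sub>F p in sequentially. dist (exp (- (v p / real p) / 2)) (exp (- s2 / 2)) < r / 4"
    using r by (intro tendstoD) auto
  moreover have "\<forall>\<^sub>F p in sequentially. er p < r / 4"
    using er_tendsto_0 r by (intro order_tendstoD(2)) auto
  ultimately have "\<forall>\<^sub>F p in sequentially. dist (exp (- (v p / real p) / 2)) (exp (- s2 / 2)) < r / 4 \<and> er p < r / 4 \<and> 0 < p"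
    using eventually_gt_at_top[of 0] by eventually_elim simp
  then obtain p where p: "dist (exp (- (v p / real p) / 2)) (exp (- s2 / 2)) < r / 4" "er p < r / 4" "0 < p"
    by (auto simp: eventually_sequentially)
  let ?B = "\<lambda>q x. (\<Sum>b<q. U p b x) / sqrt (real (q * p))"
  have bB: "bm (?B q)" for q unfolding divide_inverse by (intro bm_intros bm_U)
  have fl: "filterlim (\<lambda>n. n div p) sequentially sequentially"
    unfolding filterlim_at_top
  proof
    fix m
    show "\<forall>\<^sub>F n in sequentially. m \<le> n div p"
      using eventually_ge_at_top[of "m * p"] by eventually_elim (use p in \<open>simp add: less_eq_div_iff_mult_less_eq\<close>)
  qed
  have "(\<lambda>n. \<integral>x. iexp (?B (n div p) x) \<partial>P) \<longlonglongrightarrow> exp (- (v p / real p) / 2)"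
    by (rule filterlim_compose[OF char_block_sum_tendsto[OF p(3)] fl])
  then have 1: "\<forall>\<^sub>F n in sequentially. dist (\<integral>x. iexp (?B (n div p) x) \<partial>P) (exp (- (v p / real p) / 2)) < r / 4"
    using r by (intro tendstoD) auto
  have "(\<lambda>n. 2 * A0 * real p / sqrt (real n) + sqrt (v p / real p) * (1 - sqrt (real (n div p * p) / real n)))
     \<longlonglongrightarrow> 0 + sqrt (v p / real p) * (1 - sqrt 1)"
  proof (intro tendsto_intros div_mult_ratio_tendsto p)
    show "(\<lambda>n. 2 * A0 * real p / sqrt (real n)) \<longlonglongrightarrow> 0"
      by (rule tendsto_divide_0[OF tendsto_const filterlim_at_top_imp_at_infinity])
         (rule filterlim_compose[OF sqrt_at_top filterlim_real_sequentially])
  qed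
  then have 2: "\<forall>\<^sub>F n in sequentially. 2 * A0 * real p / sqrt (real n) + sqrt (v p / real p) * (1 - sqrt (real (n div p * p) / real n)) < r / 4"
    using r by (intro order_tendstoD(2)) auto
  have "\<forall>\<^sub>F n in sequentially. norm ((\<integral>x. iexp (Zc n x) \<partial>P) - complex_of_real (exp (- s2 / 2))) < r"
    using 1 2 eventually_ge_at_top[of p]
  proof eventually_elim
    case (elim n)
    have "norm ((\<integral>x. iexp (Zc n x) \<partial>P) - (\<integral>x. iexp (?B (n div p) x) \<partial>P)) < r / 2"
      using norm_integral_iexp_diff_le[OF bm_Zc bB, of n "n div p"] Zc_block_approx[OF p(3) elim(3)] elim(2) p(2)
      by linarith
    moreover have "norm ((\<integral>x. iexp (?B (n div p) x) \<partial>P) - complex_of_real (exp (- (v p / real p) / 2))) < r / 4"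
      using elim(1) by (simp add: dist_norm)
    moreover have "norm (complex_of_real (exp (- (v p / real p) / 2)) - complex_of_real (exp (- s2 / 2))) < r / 4"
      using p(1) unfolding dist_real_def by (simp only: norm_of_real flip: of_real_diff)
    ultimately show ?case
      using norm_triangle_ineq[of "(\<integral>x. iexp (Zc n x) \<partial>P) - (\<integral>x. iexp (?B (n div p) x) \<partial>P)"
          "(\<integral>x. iexp (?B (n div p) x) \<partial>P) - complex_of_real (exp (- (v p / real p) / 2))"]
        norm_triangle_ineq[of "(\<integral>x. iexp (Zc n x) \<partial>P) - complex_of_real (exp (- (v p / real p) / 2))"
          "complex_of_real (exp (- (v p / real p) / 2)) - complex_of_real (exp (- s2 / 2))"]
      by simp
  qed
  then show "\<exists>no. \<forall>n\<ge>no. norm ((\<integral>x. iexp (Zc n x) \<partial>P) - complex_of_real (exp (- s2 / 2))) < r"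
    by (simp add: eventually_sequentially)
qed

end

subsection \<open>Finite-dimensional convergence from characteristic functions\<close>

definition lin_form :: "(('i \<Rightarrow> real) \<Rightarrow> real) \<Rightarrow> bool" where
  "lin_form f \<longleftrightarrow> (\<exists>I u. finite I \<and> f = (\<lambda>x. \<Sum>i\<in>I. u i * x i))"

lemma lin_form_add: assumes "lin_form f" "lin_form g" shows "lin_form (\<lambda>x. f x + c * g x)"
proof -
  obtain I u J w where I: "finite I" "f = (\<lambda>x. \<Sum>i\<in>I. u i * x i)" and J: "finite J" "g = (\<lambda>x. \<Sum>i\<in>J. w i * x i)"
    using assms by (auto simp: lin_form_def)
  let ?z = "\<lambda>i. (if i \<in> I then u i else 0) + c * (if i \<in> J then w i else 0)"
  have "f x + c * g x = (\<Sum>i\<in>I \<union> J. ?z i * x i)" for x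
  proof -
    have "(\<Sum>i\<in>I. u i * x i) = (\<Sum>i\<in>I \<union> J. (if i \<in> I then u i else 0) * x i)"
      using I J by (intro sum.mono_neutral_cong_left) auto
    moreover have "(\<Sum>i\<in>J. w i * x i) = (\<Sum>i\<in>I \<union> J. (if i \<in> J then w i else 0) * x i)"
      using I J by (intro sum.mono_neutral_cong_left) auto
    ultimately show ?thesis
      by (simp add: I J sum_distrib_left sum.distrib[symmetric] algebra_simps)
  qed
  then show ?thesis unfolding lin_form_def using I(1) J(1)
    by (intro exI[of _ "I \<union> J"] exI[of _ ?z]) auto
qed

text \<open>Trigonometric polynomials in linear forms. The phase \<open>b\<close> covers the sines,
  so cosines alone suffice, and the product-to-sum formula keeps products in the class, as
  Stone-Weierstrass requires.\<close>

inductive trig :: "(('i \<Rightarrow> real) \<Rightarrow> real) \<Rightarrow> bool" where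
  trig_cos: "lin_form f \<Longrightarrow> trig (\<lambda>x. c * cos (f x + b))"
| trig_add: "trig p \<Longrightarrow> trig q \<Longrightarrow> trig (\<lambda>x. p x + q x)"

lemma trig_const: "trig (\<lambda>_. c)"
proof -
  have "lin_form (\<lambda>_. 0)" by (auto simp: lin_form_def intro: exI[of _ "{}"])
  from trig_cos[OF this, of c 0] show ?thesis by simp
qed

lemma trig_mult_cos:
  assumes f: "lin_form f" and q: "trig q"
  shows "trig (\<lambda>x. c * cos (f x + b) * q x)"
  using q
proof induction
  case (trig_cos g d e)
  have "c * cos (f x + b) * (d * cos (g x + e))
      = (c * d / 2) * cos ((f x + (-1) * g x) + (b - e)) + (c * d / 2) * cos ((f x + 1 * g x) + (b + e))" for x
  proof -
    have "cos (f x + b) * cos (g x + e) = (cos ((f x + b) - (g x + e)) + cos ((f x + b) + (g x + e))) / 2"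
      by (rule cos_times_cos)
    moreover have "(f x + b) - (g x + e) = (f x + (-1) * g x) + (b - e)"
      "(f x + b) + (g x + e) = (f x + 1 * g x) + (b + e)" by simp_all
    ultimately have e: "cos (f x + b) * cos (g x + e)
        = (cos ((f x + (-1) * g x) + (b - e)) + cos ((f x + 1 * g x) + (b + e))) / 2" by (simp only:)
    have "c * cos (f x + b) * (d * cos (g x + e)) = c * d * (cos (f x + b) * cos (g x + e))" by simp
    also have "\<dots> = (c * d / 2) * cos ((f x + (-1) * g x) + (b - e)) + (c * d / 2) * cos ((f x + 1 * g x) + (b + e))"
      unfolding e by (simp add: field_simps)
    finally show ?thesis .
  qed
  moreover have "trig (\<lambda>x. (c * d / 2) * cos ((f x + (-1) * g x) + (b - e)) + (c * d / 2) * cos ((f x + 1 * g x) + (b + e)))"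
    using trig_cos f by (intro trig_add trig.trig_cos lin_form_add)
  ultimately show ?case by (simp only:)
next
  case (trig_add p q)
  then have "trig (\<lambda>x. c * cos (f x + b) * p x + c * cos (f x + b) * q x)" by (intro trig.trig_add)
  then show ?case by (simp add: distrib_left)
qed

lemma trig_mult:
  assumes p: "trig p" and q: "trig q"
  shows "trig (\<lambda>x. p x * q x)"
  using p
proof induction
  case (trig_cos f c b)
  then show ?case using trig_mult_cos[OF _ q] by blast
next
  case (trig_add p p')
  then have "trig (\<lambda>x. p x * q x + p' x * q x)" by (intro trig.trig_add)
  then show ?case by (simp add: distrib_right)
qed

lemma cos_eq_Re_iexp: "cos (y + b) = Re (iexp b * iexp y)"
  by (simp add: exp_add[symmetric] Re_exp add.commute)

text \<open>Tychonoff: the index type may be infinite, and functions carry the product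
  topology.\<close>

lemma compact_cube: "compact {s :: 'i \<Rightarrow> real. \<forall>i. \<bar>s i\<bar> \<le> 1}"
proof -
  have "compactin (product_topology (\<lambda>_::'i. euclideanreal) UNIV) (PiE UNIV (\<lambda>_. {-1..1}))"
    by (simp add: compactin_PiE)
  moreover have "PiE UNIV (\<lambda>_. {-1..1}) = {s :: 'i \<Rightarrow> real. \<forall>i. \<bar>s i\<bar> \<le> 1}"
    by (auto simp: PiE_iff abs_le_iff minus_le_iff)
  ultimately show ?thesis by (simp add: euclidean_product_topology)
qed

text \<open>Chebyshev's inequality in integrated form: a pointwise error measured by squares of the
  coordinates is controlled by second moments.\<close>

lemma (in prob_space) abs_integral_diff_le:
  fixes f g :: "'a \<Rightarrow> real" and V :: "'a \<Rightarrow> 'i \<Rightarrow> real"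
  assumes f: "f \<in> borel_measurable M" "\<And>\<omega>. \<bar>f \<omega>\<bar> \<le> B"
    and g: "g \<in> borel_measurable M" "\<And>\<omega>. \<bar>g \<omega>\<bar> \<le> B'"
    and V: "\<And>i. integrable M (\<lambda>\<omega>. (V \<omega> i)\<^sup>2)" "\<And>i. (\<integral>\<omega>. (V \<omega> i)\<^sup>2 \<partial>M) \<le> b i"
    and fg: "\<And>\<omega>. \<bar>f \<omega> - g \<omega>\<bar> \<le> k * (\<Sum>i\<in>J. (V \<omega> i)\<^sup>2) + e" and k: "0 \<le> k"
  shows "\<bar>(\<integral>\<omega>. f \<omega> \<partial>M) - (\<integral>\<omega>. g \<omega> \<partial>M)\<bar> \<le> k * (\<Sum>i\<in>J. b i) + e"
proof -
  have i: "integrable M f" "integrable M g"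
    using f g by (auto intro: integrable_const_bound[of f B] integrable_const_bound[of g B'])
  have "\<bar>(\<integral>\<omega>. f \<omega> \<partial>M) - (\<integral>\<omega>. g \<omega> \<partial>M)\<bar> = \<bar>\<integral>\<omega>. f \<omega> - g \<omega> \<partial>M\<bar>"
    using i by simp
  also have "\<dots> \<le> (\<integral>\<omega>. \<bar>f \<omega> - g \<omega>\<bar> \<partial>M)" by (rule integral_abs_bound)
  also have "\<dots> \<le> (\<integral>\<omega>. k * (\<Sum>i\<in>J. (V \<omega> i)\<^sup>2) + e \<partial>M)"
    using i V(1) by (intro integral_mono fg) auto
  also have "\<dots> = k * (\<Sum>i\<in>J. \<integral>\<omega>. (V \<omega> i)\<^sup>2 \<partial>M) + e"
    using V(1) by (simp add: Bochner_Integration.integral_sum prob_space)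
  also have "\<dots> \<le> k * (\<Sum>i\<in>J. b i) + e"
    using k by (intro add_mono mult_left_mono sum_mono V) auto
  finally show ?thesis .
qed

text \<open>For countable \<open>'i\<close> the Borel sets of \<open>'i \<Rightarrow> real\<close>
  are generated by the coordinates, so measurability is checked coordinatewise. The bounded second
  moments take the place of tightness.\<close>

locale cf_convergence =
  M: prob_space M + N: prob_space N for M :: "'a measure" and N :: "'b measure" +
  fixes X :: "nat \<Rightarrow> 'a \<Rightarrow> 'i::countable \<Rightarrow> real" and Y :: "'b \<Rightarrow> 'i \<Rightarrow> real"
  assumes X_measurable: "\<And>n i. (\<lambda>\<omega>. X n \<omega> i) \<in> borel_measurable M"
    and Y_measurable: "\<And>i. (\<lambda>\<omega>. Y \<omega> i) \<in> borel_measurable N"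
    and char: "\<And>I c. finite I \<Longrightarrow> (\<lambda>n. \<integral>\<omega>. iexp (\<Sum>i\<in>I. c i * X n \<omega> i) \<partial>M) \<longlonglongrightarrow> (\<integral>\<omega>. iexp (\<Sum>i\<in>I. c i * Y \<omega> i) \<partial>N)"
    and X_sq: "\<And>i. \<exists>B. \<forall>n. integrable M (\<lambda>\<omega>. (X n \<omega> i)\<^sup>2) \<and> (\<integral>\<omega>. (X n \<omega> i)\<^sup>2 \<partial>M) \<le> B"
    and Y_sq: "\<And>i. integrable N (\<lambda>\<omega>. (Y \<omega> i)\<^sup>2)"
begin

lemma X_borel: "X n \<in> borel_measurable M"
  using X_measurable by (intro measurable_coordinatewise_then_product) auto

lemma Y_borel: "Y \<in> borel_measurable N"
  using Y_measurable by (intro measurable_coordinatewise_then_product) auto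

lemma comp_borel:
  fixes g :: "('i \<Rightarrow> real) \<Rightarrow> real"
  assumes "continuous_on UNIV g"
  shows "(\<lambda>\<omega>. g (X n \<omega>)) \<in> borel_measurable M" "(\<lambda>\<omega>. g (Y \<omega>)) \<in> borel_measurable N"
  using measurable_compose[OF X_borel borel_measurable_continuous_onI[OF assms]]
    measurable_compose[OF Y_borel borel_measurable_continuous_onI[OF assms]] by auto

lemma trig_converges:
  assumes "trig p"
  shows "continuous_on UNIV p \<and> (\<exists>B. \<forall>x. \<bar>p x\<bar> \<le> B) \<and> (\<lambda>n. \<integral>\<omega>. p (X n \<omega>) \<partial>M) \<longlonglongrightarrow> (\<integral>\<omega>. p (Y \<omega>) \<partial>N)"
  using assms
proof induction
  case (trig_cos f c b)
  then obtain I u where I: "finite I" and f: "f = (\<lambda>x. \<Sum>i\<in>I. u i * x i)" by (auto simp: lin_form_def)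
  have cont: "continuous_on UNIV f"
    unfolding f by (intro continuous_intros continuous_on_product_coordinates)
  have iM: "integrable M (\<lambda>\<omega>. iexp (f (X n \<omega>)))" for n
    using comp_borel(1)[OF cont] by (intro M.integrable_iexp) auto
  have iN: "integrable N (\<lambda>\<omega>. iexp (f (Y \<omega>)))"
    using comp_borel(2)[OF cont] by (intro N.integrable_iexp) auto
  have 1: "(\<integral>\<omega>. c * cos (f (X n \<omega>) + b) \<partial>M) = c * Re (iexp b * (\<integral>\<omega>. iexp (f (X n \<omega>)) \<partial>M))" for n
  proof -
    have "(\<integral>\<omega>. c * cos (f (X n \<omega>) + b) \<partial>M) = c * (\<integral>\<omega>. Re (iexp b * iexp (f (X n \<omega>))) \<partial>M)"
      unfolding cos_eq_Re_iexp by simp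
    also have "(\<integral>\<omega>. Re (iexp b * iexp (f (X n \<omega>))) \<partial>M) = Re (\<integral>\<omega>. iexp b * iexp (f (X n \<omega>)) \<partial>M)"
      by (intro integral_Re integrable_mult_right iM)
    finally show ?thesis by simp
  qed
  have 2: "(\<integral>\<omega>. c * cos (f (Y \<omega>) + b) \<partial>N) = c * Re (iexp b * (\<integral>\<omega>. iexp (f (Y \<omega>)) \<partial>N))"
  proof -
    have "(\<integral>\<omega>. c * cos (f (Y \<omega>) + b) \<partial>N) = c * (\<integral>\<omega>. Re (iexp b * iexp (f (Y \<omega>))) \<partial>N)"
      unfolding cos_eq_Re_iexp by simp
    also have "(\<integral>\<omega>. Re (iexp b * iexp (f (Y \<omega>))) \<partial>N) = Re (\<integral>\<omega>. iexp b * iexp (f (Y \<omega>)) \<partial>N)"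
      by (intro integral_Re integrable_mult_right iN)
    finally show ?thesis by simp
  qed
  have "\<bar>c * cos (f x + b)\<bar> \<le> \<bar>c\<bar>" for x
    using abs_cos_le_one[of "f x + b"] by (simp add: abs_mult mult_left_le)
  moreover have "(\<lambda>n. c * Re (iexp b * (\<integral>\<omega>. iexp (f (X n \<omega>)) \<partial>M))) \<longlonglongrightarrow> c * Re (iexp b * (\<integral>\<omega>. iexp (f (Y \<omega>)) \<partial>N))"
    unfolding f by (intro tendsto_intros char I)
  moreover have "continuous_on UNIV (\<lambda>x. c * cos (f x + b))" by (intro continuous_intros cont)
  ultimately show ?case unfolding 1 2 by blast
next
  case (trig_add p q)
  then obtain B B' where B: "\<And>x. \<bar>p x\<bar> \<le> B" "\<And>x. \<bar>q x\<bar> \<le> B'" by blast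
  have c: "continuous_on UNIV p" "continuous_on UNIV q" using trig_add by auto
  have i: "integrable M (\<lambda>\<omega>. r (X n \<omega>))" "integrable N (\<lambda>\<omega>. r (Y \<omega>))"
    if "continuous_on UNIV r" "\<And>x. \<bar>r x\<bar> \<le> C" for r :: "('i \<Rightarrow> real) \<Rightarrow> real" and C n
    using that(2) comp_borel[OF that(1)]
    by (auto intro!: M.integrable_const_bound[where B=C] N.integrable_const_bound[where B=C])
  note i = i[OF c(1) B(1)] i[OF c(2) B(2)]
  have "\<bar>p x + q x\<bar> \<le> B + B'" for x using B(1)[of x] B(2)[of x] by linarith
  moreover have "(\<lambda>n. \<integral>\<omega>. p (X n \<omega>) + q (X n \<omega>) \<partial>M) \<longlonglongrightarrow> (\<integral>\<omega>. p (Y \<omega>) + q (Y \<omega>) \<partial>N)"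
    using i trig_add by (auto intro!: tendsto_intros)
  ultimately show ?case using c by (blast intro: continuous_on_add)
qed

text \<open>On \<open>{-R..R}\<close> the map \<open>\<lambda>x. arcsin (sin (\<theta> * x)) / \<theta>\<close> with \<open>\<theta> = pi / (2 * R)\<close> is the identity. Inserting it makes \<open>\<psi>\<close> a
  continuous function of \<open>sin (\<theta> * x)\<close> on a compact cube, which trigonometric polynomials approximate uniformly by
  Stone-Weierstrass; the set where it is not the identity is controlled by Chebyshev's inequality.\<close>

lemma finite_dim_convergence:
  fixes \<psi> :: "('i \<Rightarrow> real) \<Rightarrow> real"
  assumes \<psi>: "continuous_on UNIV \<psi>" and B: "\<And>x. \<bar>\<psi> x\<bar> \<le> B"
    and J: "finite J" "\<And>x y. (\<And>i. i \<in> J \<Longrightarrow> x i = y i) \<Longrightarrow> \<psi> x = \<psi> y"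
  shows "(\<lambda>n. \<integral>\<omega>. \<psi> (X n \<omega>) \<partial>M) \<longlonglongrightarrow> (\<integral>\<omega>. \<psi> (Y \<omega>) \<partial>N)"
proof (rule LIMSEQ_I)
  fix r :: real assume r: "0 < r"
  have B0: "0 \<le> B" using B[of "\<lambda>_. 0"] by linarith
  obtain b where b: "\<And>i n. integrable M (\<lambda>\<omega>. (X n \<omega> i)\<^sup>2)" "\<And>i n. (\<integral>\<omega>. (X n \<omega> i)\<^sup>2 \<partial>M) \<le> b i"
    using X_sq by metis
  define b' where "b' i = max (b i) (\<integral>\<omega>. (Y \<omega> i)\<^sup>2 \<partial>N)" for i
  have b'0: "0 \<le> b' i" for i
    unfolding b'_def by (intro max.coboundedI2 Bochner_Integration.integral_nonneg) auto
  define c where "c = 2 * B * (\<Sum>i\<in>J. b' i)"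
  have c0: "0 \<le> c" unfolding c_def using B0 b'0 by (intro mult_nonneg_nonneg sum_nonneg) auto
  \<comment> \<open>This makes the Chebyshev term \<open>c / R\<^sup>2\<close> at most
    \<open>r / 6\<close>; the summand 1 keeps \<open>R\<close> positive when
    \<open>c = 0\<close>.\<close>
  define R where "R = sqrt ((c + 1) * 6 / r)"
  have R: "0 < R" using c0 r by (simp add: R_def)
  have cR: "c / R\<^sup>2 \<le> r / 6"
  proof -
    have "R\<^sup>2 = (c + 1) * 6 / r" using c0 r by (simp add: R_def)
    then have "c * 6 \<le> r * R\<^sup>2" using r by simp
    then show ?thesis using R by (simp add: field_simps)
  qed
  define \<theta> where "\<theta> = pi / (2 * R)"
  let ?S = "{s :: 'i \<Rightarrow> real. \<forall>i. \<bar>s i\<bar> \<le> 1}"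
  define h where "h s = \<psi> (\<lambda>i. arcsin (s i) / \<theta>)" for s
  define \<sigma> where "\<sigma> x = (\<lambda>i. sin (\<theta> * x i))" for x :: "'i \<Rightarrow> real"
  have \<theta>: "0 < \<theta>" using R by (simp add: \<theta>_def)
  have \<sigma>S: "\<sigma> x \<in> ?S" for x by (simp add: \<sigma>_def)
  have cs: "continuous_on ?S (\<lambda>s. s i)" for i
    by (rule continuous_on_subset[OF continuous_on_product_coordinates]) simp
  have hc: "continuous_on ?S h"
    unfolding h_def
  proof (rule continuous_on_compose2[OF \<psi>])
    show "continuous_on ?S (\<lambda>s i. arcsin (s i) / \<theta>)"
    proof (rule continuous_on_coordinatewise_then_product)
      fix i
      have "\<forall>s\<in>?S. - 1 \<le> s i \<and> s i \<le> 1" by (auto simp: abs_le_iff minus_le_iff)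
      from continuous_on_arcsin[OF cs this] show "continuous_on ?S (\<lambda>s. arcsin (s i) / \<theta>)"
        using \<theta> by (intro continuous_on_divide continuous_on_const) auto
    qed
  qed simp
  have cov: "\<bar>\<psi> x - h (\<sigma> x)\<bar> \<le> 2 * B * (\<Sum>i\<in>J. (x i)\<^sup>2) / R\<^sup>2" for x
  proof (cases "\<forall>i\<in>J. \<bar>x i\<bar> \<le> R")
    case True
    have "\<psi> x = h (\<sigma> x)"
      unfolding h_def
    proof (rule J(2))
      fix i assume "i \<in> J"
      with True have i: "\<bar>x i\<bar> \<le> R" by blast
      have "\<theta> * \<bar>x i\<bar> \<le> \<theta> * R" using i \<theta> by (intro mult_left_mono) auto
      moreover have "\<theta> * R = pi / 2" using R by (simp add: \<theta>_def)
      moreover have "\<bar>\<theta> * x i\<bar> = \<theta> * \<bar>x i\<bar>" using \<theta> by (simp add: abs_mult)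
      ultimately have "\<bar>\<theta> * x i\<bar> \<le> pi / 2" by linarith
      then have "arcsin (\<sigma> x i) = \<theta> * x i" unfolding \<sigma>_def by (intro arcsin_sin) auto
      then show "x i = arcsin (\<sigma> x i) / \<theta>" using \<theta> by simp
    qed
    then show ?thesis using B0 by (simp add: sum_nonneg)
  next
    case False
    then obtain i where i: "i \<in> J" "R < \<bar>x i\<bar>" by auto
    have "R\<^sup>2 \<le> \<bar>x i\<bar>\<^sup>2" using i R by (intro power_mono) auto
    also have "\<dots> \<le> (\<Sum>i\<in>J. (x i)\<^sup>2)" using J(1) i member_le_sum[of i J "\<lambda>i. (x i)\<^sup>2"] by simp
    finally have "1 \<le> (\<Sum>i\<in>J. (x i)\<^sup>2) / R\<^sup>2" using R by simp
    then have "2 * B * 1 \<le> 2 * B * ((\<Sum>i\<in>J. (x i)\<^sup>2) / R\<^sup>2)" using B0 by (intro mult_left_mono) auto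
    moreover have "\<bar>\<psi> x - h (\<sigma> x)\<bar> \<le> 2 * B"
      using B[of x] B[of "\<lambda>i. arcsin (\<sigma> x i) / \<theta>"] unfolding h_def by linarith
    ultimately show ?thesis by simp
  qed
  interpret fr: function_ring_on "{p. continuous_on ?S p \<and> trig (\<lambda>x. p (\<sigma> x))}" ?S
  proof
    show "compact ?S" by (rule compact_cube)
    fix x y :: "'i \<Rightarrow> real" assume "x \<noteq> y"
    then obtain i where i: "x i \<noteq> y i" by auto
    \<comment> \<open>The sine is the cosine with phase \<open>- (pi / 2)\<close>, so the
      coordinates of the cube, which separate its points, belong to the algebra.\<close>
    have "lin_form (\<lambda>x. \<Sum>j\<in>{i}. \<theta> * x j)"
      unfolding lin_form_def by (intro exI[of _ "{i}"] exI[of _ "\<lambda>_. \<theta>"]) simp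
    from trig_cos[OF this, of 1 "- (pi / 2)"] have "trig (\<lambda>x. \<sigma> x i)"
      by (simp add: \<sigma>_def cos_diff)
    with i cs show "\<exists>f\<in>{p. continuous_on ?S p \<and> trig (\<lambda>x. p (\<sigma> x))}. f x \<noteq> f y"
      by (intro bexI[of _ "\<lambda>s. s i"]) simp_all
  qed (auto intro: continuous_intros trig_add trig_mult trig_const)
  obtain p where p: "continuous_on ?S p" "trig (\<lambda>x. p (\<sigma> x))" and hp: "\<And>s. s \<in> ?S \<Longrightarrow> \<bar>h s - p s\<bar> < r / 6"
    using fr.Stone_Weierstrass_basic[OF hc, of "r / 6"] r by auto
  let ?q = "\<lambda>x. p (\<sigma> x)"
  have q: "continuous_on UNIV ?q" "(\<lambda>n. \<integral>\<omega>. ?q (X n \<omega>) \<partial>M) \<longlonglongrightarrow> (\<integral>\<omega>. ?q (Y \<omega>) \<partial>N)"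
    using trig_converges[OF p(2)] by auto
  obtain Bq where Bq: "\<And>x. \<bar>?q x\<bar> \<le> Bq" using trig_converges[OF p(2)] by auto
  have \<psi>q: "\<bar>\<psi> x - ?q x\<bar> \<le> 2 * B / R\<^sup>2 * (\<Sum>i\<in>J. (x i)\<^sup>2) + r / 6" for x
  proof -
    have "2 * B / R\<^sup>2 * (\<Sum>i\<in>J. (x i)\<^sup>2) = 2 * B * (\<Sum>i\<in>J. (x i)\<^sup>2) / R\<^sup>2" by simp
    then show ?thesis using cov[of x] hp[OF \<sigma>S[of x]] by linarith
  qed
  have k: "0 \<le> 2 * B / R\<^sup>2" using B0 by simp
  have kr: "2 * B / R\<^sup>2 * (\<Sum>i\<in>J. b' i) + r / 6 \<le> r / 3"
    using cR by (simp add: c_def)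
  have 1: "\<bar>(\<integral>\<omega>. \<psi> (X n \<omega>) \<partial>M) - (\<integral>\<omega>. ?q (X n \<omega>) \<partial>M)\<bar> \<le> r / 3" for n
    by (rule order_trans[OF M.abs_integral_diff_le[where V="X n" and J=J and b=b', OF comp_borel(1)[OF \<psi>] B comp_borel(1)[OF q(1)] Bq _ _ \<psi>q k] kr])
       (use b in \<open>auto simp: b'_def le_max_iff_disj\<close>)
  have 2: "\<bar>(\<integral>\<omega>. \<psi> (Y \<omega>) \<partial>N) - (\<integral>\<omega>. ?q (Y \<omega>) \<partial>N)\<bar> \<le> r / 3"
    by (rule order_trans[OF N.abs_integral_diff_le[where V=Y and J=J and b=b', OF comp_borel(2)[OF \<psi>] B comp_borel(2)[OF q(1)] Bq _ _ \<psi>q k] kr])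
       (use Y_sq in \<open>auto simp: b'_def\<close>)
  from LIMSEQ_D[OF q(2), of "r / 3"] r obtain n0
    where n0: "\<And>n. n \<ge> n0 \<Longrightarrow> \<bar>(\<integral>\<omega>. ?q (X n \<omega>) \<partial>M) - (\<integral>\<omega>. ?q (Y \<omega>) \<partial>N)\<bar> < r / 3" by auto
  have "norm ((\<integral>\<omega>. \<psi> (X n \<omega>) \<partial>M) - (\<integral>\<omega>. \<psi> (Y \<omega>) \<partial>N)) < r" if "n \<ge> n0" for n
    using 1[of n] 2 n0[OF that] unfolding real_norm_def abs_le_iff abs_less_iff by linarith
  then show "\<exists>no. \<forall>n\<ge>no. norm ((\<integral>\<omega>. \<psi> (X n \<omega>) \<partial>M) - (\<integral>\<omega>. \<psi> (Y \<omega>) \<partial>N)) < r" by blast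
qed

end

subsection \<open>Gaussian sequences with a given covariance\<close>

lemma char_centered_normal: assumes "0 \<le> \<sigma>" shows "char (centered_normal \<sigma>) t = complex_of_real (exp (- (\<sigma>\<^sup>2 * t\<^sup>2) / 2))"
  and "real_distribution (centered_normal \<sigma>)"
  and "integrable (centered_normal \<sigma>) (\<lambda>x. x\<^sup>2)"
  and "(\<integral>x. x\<^sup>2 \<partial>centered_normal \<sigma>) = \<sigma>\<^sup>2"
proof -
  interpret S: real_distribution std_normal_distribution by (rule real_dist_normal_dist)
  \<comment> \<open>Both cases of the definition, the degenerate one included, are images of the
    standard normal law under scaling, whose moments and characteristic function are known.\<close>
  have e: "centered_normal \<sigma> = distr std_normal_distribution borel (\<lambda>x. \<sigma> * x)"
  proof (cases "\<sigma> = 0")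
    case True
    then show ?thesis
      using S.emeasure_space_1 by (simp add: centered_normal_def S.distr_const)
  next
    case False
    with assms have s: "0 < \<sigma>" by simp
    have "distributed std_normal_distribution lborel (\<lambda>x. x) std_normal_density"
      by (simp add: distributed_def distr_id2)
    then have "distributed std_normal_distribution lborel (\<lambda>x. ((\<sigma> * x) - 0) / \<sigma>) std_normal_density"
      using s by simp
    then have "distributed std_normal_distribution lborel (\<lambda>x. \<sigma> * x) (normal_density 0 \<sigma>)"
      using S.normal_standard_normal_convert[OF s, of "\<lambda>x. \<sigma> * x" 0] by simp
    then have "distr std_normal_distribution lborel (\<lambda>x. \<sigma> * x) = density lborel (\<lambda>x. ennreal (normal_density 0 \<sigma> x))"
      by (rule distributed_distr_eq_density)
    moreover have "distr std_normal_distribution lborel (\<lambda>x. \<sigma> * x) = distr std_normal_distribution borel (\<lambda>x. \<sigma> * x)"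
      by (rule distr_cong) auto
    ultimately show ?thesis using s by (simp add: centered_normal_def)
  qed
  have m: "(\<lambda>x. \<sigma> * x) \<in> borel_measurable std_normal_distribution" by measurable
  have "char (centered_normal \<sigma>) t = char std_normal_distribution (t * \<sigma>)"
    unfolding e char_def
    by (subst integral_distr[OF m]) (auto intro!: borel_measurable_continuous_onI continuous_intros simp: mult.assoc)
  then show "char (centered_normal \<sigma>) t = complex_of_real (exp (- (\<sigma>\<^sup>2 * t\<^sup>2) / 2))"
    by (simp add: char_std_normal_distribution power_mult_distrib mult.commute)
  show "real_distribution (centered_normal \<sigma>)" unfolding e by (rule S.real_distribution_distr[OF m])
  show "integrable (centered_normal \<sigma>) (\<lambda>x. x\<^sup>2)"
    unfolding e using integrable_std_normal_distribution_moment[of 2]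
    by (subst integrable_distr_eq[OF m]) (auto simp: power_mult_distrib)
  show "(\<integral>x. x\<^sup>2 \<partial>centered_normal \<sigma>) = \<sigma>\<^sup>2"
    unfolding e using std_normal_distribution_even_moments(1)[of 1]
    by (subst integral_distr[OF m]) (auto simp: power_mult_distrib)
qed

text \<open>The second moment is read off from the identified law. Hence for a limit of Gaussian
  variables convergence of characteristic functions is enough, with no argument about uniform
  integrability.\<close>

lemma (in prob_space) distr_eq_centered_normal:
  assumes X: "X \<in> borel_measurable M" and s: "0 \<le> \<sigma>"
    and char: "\<And>t. (\<integral>\<omega>. iexp (t * X \<omega>) \<partial>M) = complex_of_real (exp (- (\<sigma>\<^sup>2 * t\<^sup>2) / 2))"
  shows "distr M borel X = centered_normal \<sigma>"
    and "integrable M (\<lambda>\<omega>. (X \<omega>)\<^sup>2)" and "(\<integral>\<omega>. (X \<omega>)\<^sup>2 \<partial>M) = \<sigma>\<^sup>2"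
proof -
  show d: "distr M borel X = centered_normal \<sigma>"
  proof (rule Levy_uniqueness)
    show "real_distribution (distr M borel X)" using X by (rule real_distribution_distr)
    show "char (distr M borel X) = char (centered_normal \<sigma>)"
    proof
      fix t
      have "char (distr M borel X) t = (\<integral>\<omega>. iexp (t * X \<omega>) \<partial>M)"
        unfolding char_def
        by (rule integral_distr[OF X]) (auto intro!: borel_measurable_continuous_onI continuous_intros)
      also have "\<dots> = complex_of_real (exp (- (\<sigma>\<^sup>2 * t\<^sup>2) / 2))" by (rule char)
      also have "\<dots> = char (centered_normal \<sigma>) t" by (rule char_centered_normal(1)[OF s, symmetric])
      finally show "char (distr M borel X) t = char (centered_normal \<sigma>) t" .
    qed
  qed (rule char_centered_normal(2)[OF s])
  show "integrable M (\<lambda>\<omega>. (X \<omega>)\<^sup>2)"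
    using char_centered_normal(3)[OF s] unfolding d[symmetric] by (subst (asm) integrable_distr_eq[OF X]) auto
  show "(\<integral>\<omega>. (X \<omega>)\<^sup>2 \<partial>M) = \<sigma>\<^sup>2"
    using char_centered_normal(4)[OF s] unfolding d[symmetric] by (subst (asm) integral_distr[OF X]) auto
qed

subsection \<open>Cholesky factorization\<close>

definition psd :: "(nat \<Rightarrow> nat \<Rightarrow> real) \<Rightarrow> bool" where
  "psd g \<longleftrightarrow> (\<forall>i j. g i j = g j i) \<and> (\<forall>I c. finite I \<longrightarrow> 0 \<le> (\<Sum>i\<in>I. \<Sum>j\<in>I. c i * c j * g i j))"

text \<open>For positive semidefinite \<open>g\<close> a zero pivot has a zero column, so the junk value of the division by \<open>sqrt 0\<close> is the
  right one and semidefinite matrices need no separate treatment.\<close>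

definition pivot :: "nat \<Rightarrow> (nat \<Rightarrow> nat \<Rightarrow> real) \<Rightarrow> nat \<Rightarrow> real" where
  "pivot k g i = g i k / sqrt (g k k)"

definition schur :: "nat \<Rightarrow> (nat \<Rightarrow> nat \<Rightarrow> real) \<Rightarrow> nat \<Rightarrow> nat \<Rightarrow> real" where
  "schur k g i j = g i j - pivot k g i * pivot k g j"

lemma psdD: "psd g \<Longrightarrow> finite I \<Longrightarrow> 0 \<le> (\<Sum>i\<in>I. \<Sum>j\<in>I. c i * c j * g i j)"
  by (simp add: psd_def)

lemma psd_diag: assumes "psd g" shows "0 \<le> g i i"
  using psdD[OF assms, of "{i}" "\<lambda>_. 1"] by simp

lemma psd_two: assumes "psd g" "i \<noteq> k" shows "0 \<le> x\<^sup>2 * g i i + 2 * x * y * g i k + y\<^sup>2 * g k k"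
proof -
  let ?c = "\<lambda>j. if j = i then x else y"
  have "0 \<le> (\<Sum>a\<in>{i, k}. \<Sum>b\<in>{i, k}. ?c a * ?c b * g a b)" by (rule psdD[OF assms(1)]) simp
  moreover have "g k i = g i k" using assms by (simp add: psd_def)
  ultimately show ?thesis using assms(2) by (simp add: power2_eq_square algebra_simps)
qed

text \<open>A nonzero entry \<open>g i k\<close> over a zero diagonal would make the form affine in
  the weight at \<open>k\<close>, and the weight chosen below gives it the value -1.\<close>

lemma psd_zero_pivot: assumes g: "psd g" and z: "g k k = 0" shows "g i k = 0"
proof (cases "i = k")
  case False
  show ?thesis
  proof (rule ccontr)
    assume n: "g i k \<noteq> 0"
    have "0 \<le> g i i + 2 * (- (g i i + 1) / (2 * g i k)) * g i k"
      using psd_two[OF g False, of 1 "- (g i i + 1) / (2 * g i k)"] z by simp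
    also have "\<dots> = - 1" using n by (simp add: field_simps)
    finally show False by simp
  qed
qed (simp add: z)

text \<open>Since \<open>k\<close> may already belong to \<open>I\<close>, the vector with the
  single entry \<open>x\<close> at \<open>k\<close> is added to \<open>c\<close> and does not
  replace an entry.\<close>

lemma psd_quadratic_add:
  assumes g: "psd g" and I: "finite I"
  shows "0 \<le> (\<Sum>i\<in>I. \<Sum>j\<in>I. c i * c j * g i j) + 2 * x * (\<Sum>i\<in>I. c i * g i k) + x\<^sup>2 * g k k"
proof -
  let ?J = "insert k I"
  let ?a = "\<lambda>i. if i \<in> I then c i else 0" and ?b = "\<lambda>i. if i = k then x else 0"
  let ?c = "\<lambda>i. ?a i + ?b i"
  have 0: "0 \<le> (\<Sum>i\<in>?J. \<Sum>j\<in>?J. ?c i * ?c j * g i j)" by (rule psdD[OF g]) (simp add: I)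
  have a: "(\<Sum>j\<in>?J. ?a j * f j) = (\<Sum>j\<in>I. c j * f j)" for f
    using I by (intro sum.mono_neutral_cong_right) auto
  have b: "(\<Sum>j\<in>?J. ?b j * f j) = x * f k" for f
    using I by (simp add: if_distrib[of "\<lambda>z. z * _"] cong: if_cong)
  have "(\<Sum>i\<in>?J. \<Sum>j\<in>?J. ?c i * ?c j * g i j) = (\<Sum>i\<in>?J. ?c i * (\<Sum>j\<in>?J. ?c j * g i j))"
    by (simp only: sum_distrib_left mult.assoc)
  also have "\<dots> = (\<Sum>i\<in>?J. ?c i * ((\<Sum>j\<in>I. c j * g i j) + x * g i k))"
    unfolding distrib_right sum.distrib a b ..
  also have "\<dots> = (\<Sum>i\<in>I. c i * ((\<Sum>j\<in>I. c j * g i j) + x * g i k)) + x * ((\<Sum>j\<in>I. c j * g k j) + x * g k k)"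
    unfolding distrib_right[of "?a _"] sum.distrib a b ..
  also have "(\<Sum>j\<in>I. c j * g k j) = (\<Sum>i\<in>I. c i * g i k)" using g by (simp add: psd_def)
  also have "(\<Sum>i\<in>I. c i * ((\<Sum>j\<in>I. c j * g i j) + x * g i k))
     = (\<Sum>i\<in>I. \<Sum>j\<in>I. c i * c j * g i j) + x * (\<Sum>i\<in>I. c i * g i k)"
    by (simp add: distrib_left sum.distrib sum_distrib_left mult_ac)
  finally show ?thesis using 0 by (simp add: power2_eq_square algebra_simps)
qed

lemma psd_schur: assumes g: "psd g" shows "psd (schur k g)"
  unfolding psd_def
proof (intro conjI allI impI)
  show "schur k g i j = schur k g j i" for i j using g by (simp add: schur_def psd_def mult.commute)
  fix I :: "nat set" and c :: "nat \<Rightarrow> real" assume I: "finite I"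
  let ?q = "\<Sum>i\<in>I. \<Sum>j\<in>I. c i * c j * g i j" and ?s = "\<Sum>i\<in>I. c i * g i k"
  have e: "(\<Sum>i\<in>I. \<Sum>j\<in>I. c i * c j * schur k g i j) = ?q - (?s / sqrt (g k k))\<^sup>2"
  proof -
    have p: "(\<Sum>i\<in>I. c i * pivot k g i) = ?s / sqrt (g k k)" by (simp add: pivot_def sum_divide_distrib)
    have "(\<Sum>i\<in>I. \<Sum>j\<in>I. c i * c j * schur k g i j) = ?q - (\<Sum>i\<in>I. \<Sum>j\<in>I. (c i * pivot k g i) * (c j * pivot k g j))"
      unfolding sum_subtractf[symmetric] by (intro sum.cong refl) (simp add: schur_def algebra_simps)
    then show ?thesis unfolding p[symmetric] power2_eq_square sum_product .
  qed
  show "0 \<le> (\<Sum>i\<in>I. \<Sum>j\<in>I. c i * c j * schur k g i j)"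
  proof (cases "g k k = 0")
    case True
    have "0 \<le> ?q" using g I by (simp add: psd_def)
    then show ?thesis unfolding e using True by simp
  next
    case False
    with psd_diag[OF g, of k] have p: "0 < g k k" by simp
    \<comment> \<open>This weight minimizes the quadratic polynomial of
      \<open>psd_quadratic_add\<close>, and the minimum is the form of the Schur complement.\<close>
    have "0 \<le> ?q + 2 * (- ?s / g k k) * ?s + (- ?s / g k k)\<^sup>2 * g k k"
      by (rule psd_quadratic_add[OF g I])
    also have "\<dots> = ?q - ?s\<^sup>2 / g k k" using p by (simp add: power2_eq_square field_simps)
    also have "\<dots> = ?q - (?s / sqrt (g k k))\<^sup>2" using p by (simp add: power_divide)
    finally show ?thesis unfolding e .
  qed
qed

lemma schur_zero: assumes "psd g" shows "schur k g k j = 0" "schur k g j k = 0"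
proof -
  have "g k k = sqrt (g k k) * sqrt (g k k)" using psd_diag[OF assms, of k] by simp
  moreover have "g k j = g j k" using assms by (simp add: psd_def)
  ultimately show "schur k g k j = 0" "schur k g j k = 0"
    using psd_zero_pivot[OF assms, of k j] by (cases "g k k = 0"; auto simp: schur_def pivot_def field_simps)+
qed

primrec residual :: "(nat \<Rightarrow> nat \<Rightarrow> real) \<Rightarrow> nat \<Rightarrow> nat \<Rightarrow> nat \<Rightarrow> real" where
  "residual g 0 = g"
| "residual g (Suc k) = schur k (residual g k)"

definition chol :: "(nat \<Rightarrow> nat \<Rightarrow> real) \<Rightarrow> nat \<Rightarrow> nat \<Rightarrow> real" where
  "chol g i k = pivot k (residual g k) i"

lemma psd_residual: "psd g \<Longrightarrow> psd (residual g k)"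
  by (induction k) (auto intro: psd_schur)

lemma residual_zero:
  assumes g: "psd g" and i: "i < n" shows "residual g n i j = 0"
  using i
proof (induction n arbitrary: j)
  case (Suc n)
  show ?case
  proof (cases "i = n")
    case True
    then show ?thesis by (simp add: schur_zero[OF psd_residual[OF g]])
  next
    case False
    with Suc have "residual g n i j = 0" for j by simp
    then show ?thesis by (simp add: schur_def pivot_def)
  qed
qed simp

text \<open>The eliminations telescope, and row \<open>i\<close> of the residual is zero from step
  \<open>i + 1\<close> on. No size of the matrix is fixed in advance, which suits an infinite index
  set.\<close>

lemma chol_sum:
  assumes g: "psd g" and n: "i < n"
  shows "g i j = (\<Sum>k<n. chol g i k * chol g j k)"
proof -
  have "residual g n i j = g i j - (\<Sum>k<n. chol g i k * chol g j k)" for n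
    by (induction n) (auto simp: schur_def chol_def)
  from this[of n] show ?thesis using residual_zero[OF g n] by simp
qed

definition noise :: "(nat \<Rightarrow> real) measure" where
  "noise = PiM UNIV (\<lambda>_. std_normal_distribution)"

text \<open>The factor is lower triangular, so each variable of the infinite Gaussian sequence is a
  finite combination of independent standard normals.\<close>

definition gseq :: "(nat \<Rightarrow> nat \<Rightarrow> real) \<Rightarrow> nat \<Rightarrow> (nat \<Rightarrow> real) \<Rightarrow> real" where
  "gseq g i \<omega> = (\<Sum>k\<le>i. chol g i k * \<omega> k)"

lemma prob_space_std_normal: "prob_space std_normal_distribution"
  using real_dist_normal_dist unfolding real_distribution_def by simp

lemma prob_space_noise: "prob_space noise"
  unfolding noise_def by (rule prob_space_PiM[OF prob_space_std_normal])

lemma noise_component_measurable: "(\<lambda>\<omega>. \<omega> k) \<in> borel_measurable noise"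
proof -
  have "(\<lambda>\<omega>. \<omega> k) \<in> measurable noise std_normal_distribution" unfolding noise_def by simp
  then show ?thesis by (simp cong: measurable_cong_sets)
qed

lemma gseq_measurable: "gseq g i \<in> borel_measurable noise"
  unfolding gseq_def[abs_def]
  by (intro borel_measurable_sum borel_measurable_times borel_measurable_const noise_component_measurable)

lemma chol_upper_zero: assumes g: "psd g" and "i < k" shows "chol g i k = 0"
  using residual_zero[OF assms] by (simp add: chol_def pivot_def)

lemma char_noise:
  assumes "finite A"
  shows "(\<integral>\<omega>. iexp (\<Sum>k\<in>A. d k * \<omega> k) \<partial>noise) = complex_of_real (exp (- (\<Sum>k\<in>A. (d k)\<^sup>2) / 2))"
proof -
  interpret Q: prob_space noise by (rule prob_space_noise)
  interpret S: prob_space std_normal_distribution by (rule prob_space_std_normal)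
  interpret pp: product_prob_space "\<lambda>_::nat. std_normal_distribution" UNIV by unfold_locales
  have m: "(\<lambda>\<omega>. \<omega> k) \<in> measurable noise std_normal_distribution" for k unfolding noise_def by simp
  have dd: "distr noise std_normal_distribution (\<lambda>\<omega>. \<omega> k) = std_normal_distribution" for k
    unfolding noise_def by (rule pp.PiM_component) simp
  have "distr noise (PiM UNIV (\<lambda>_. std_normal_distribution)) (\<lambda>x. \<lambda>i\<in>UNIV. x i) = distr noise noise (\<lambda>x. x)"
    by (simp add: noise_def restrict_UNIV)
  also have "\<dots> = PiM UNIV (\<lambda>i. distr noise std_normal_distribution (\<lambda>x. x i))"
    by (simp only: distr_id dd) (simp only: noise_def)
  finally have "Q.indep_vars (\<lambda>_. std_normal_distribution) (\<lambda>i x. x i) UNIV"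
    using m by (subst Q.indep_vars_iff_distr_eq_PiM) auto
  then have "Q.indep_vars (\<lambda>_. borel) (\<lambda>k \<omega>. d k * \<omega> k) UNIV"
    by (rule Q.indep_vars_compose2) measurable
  then have ind: "Q.indep_vars (\<lambda>_. borel) (\<lambda>k \<omega>. d k * \<omega> k) A"
    by (rule Q.indep_vars_subset) simp
  have sm: "(\<lambda>\<omega>. \<Sum>k\<in>A. d k * \<omega> k) \<in> borel_measurable noise"
    by (intro borel_measurable_sum borel_measurable_times borel_measurable_const noise_component_measurable)
  have ib: "(\<lambda>x. iexp (c * x)) \<in> borel_measurable borel" for c
    by (intro borel_measurable_continuous_onI continuous_intros)
  have "(\<integral>\<omega>. iexp (\<Sum>k\<in>A. d k * \<omega> k) \<partial>noise) = char (distr noise borel (\<lambda>\<omega>. \<Sum>k\<in>A. d k * \<omega> k)) 1"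
    unfolding char_def using integral_distr[OF sm ib[of 1]] by simp
  also have "\<dots> = (\<Prod>k\<in>A. char (distr noise borel (\<lambda>\<omega>. d k * \<omega> k)) 1)"
    by (rule Q.char_distr_sum[OF ind])
  also have "\<dots> = (\<Prod>k\<in>A. complex_of_real (exp (- (d k)\<^sup>2 / 2)))"
  proof (intro prod.cong refl)
    fix k
    have mk: "(\<lambda>\<omega>. d k * \<omega> k) \<in> borel_measurable noise"
      by (intro borel_measurable_times borel_measurable_const noise_component_measurable)
    have "char (distr noise borel (\<lambda>\<omega>. d k * \<omega> k)) 1 = (\<integral>\<omega>. iexp (d k * \<omega> k) \<partial>noise)"
      unfolding char_def using integral_distr[OF mk ib[of 1]] by simp
    also have "\<dots> = (\<integral>x. iexp (d k * x) \<partial>distr noise std_normal_distribution (\<lambda>\<omega>. \<omega> k))"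
      using ib[of "d k"] by (intro integral_distr[symmetric] m) (simp cong: measurable_cong_sets)
    also have "\<dots> = char std_normal_distribution (d k)" unfolding dd char_def ..
    finally show "char (distr noise borel (\<lambda>\<omega>. d k * \<omega> k)) 1 = complex_of_real (exp (- (d k)\<^sup>2 / 2))"
      by (simp add: char_std_normal_distribution)
  qed
  also have "\<dots> = complex_of_real (\<Prod>k\<in>A. exp (- (d k)\<^sup>2 / 2))" by simp
  also have "(\<Prod>k\<in>A. exp (- (d k)\<^sup>2 / 2)) = exp (- (\<Sum>k\<in>A. (d k)\<^sup>2) / 2)"
    using assms by (simp add: exp_sum[symmetric] sum_negf sum_divide_distrib)
  finally show ?thesis .
qed

lemma char_gseq:
  assumes g: "psd g" and I: "finite I"
  shows "(\<integral>\<omega>. iexp (\<Sum>i\<in>I. c i * gseq g (e i) \<omega>) \<partial>noise)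
     = complex_of_real (exp (- (\<Sum>i\<in>I. \<Sum>j\<in>I. c i * c j * g (e i) (e j)) / 2))"
proof -
  \<comment> \<open>A common size for all indices that occur. By triangularity every
    \<open>gseq g (e i)\<close> may be summed over \<open>k < n\<close>, which allows the sums to be
    exchanged.\<close>
  define n where "n = Suc (Max (insert 0 (e ` I)))"
  have n: "e i < n" if "i \<in> I" for i
    unfolding n_def less_Suc_eq_le using I that by (intro Max_ge) auto
  let ?d = "\<lambda>k. \<Sum>i\<in>I. c i * chol g (e i) k"
  have gs: "gseq g (e i) \<omega> = (\<Sum>k<n. chol g (e i) k * \<omega> k)" if "i \<in> I" for i \<omega>
    unfolding gseq_def using n[OF that] chol_upper_zero[OF g]
    by (intro sum.mono_neutral_left) (auto simp: not_le)
  have 1: "(\<Sum>i\<in>I. c i * gseq g (e i) \<omega>) = (\<Sum>k<n. ?d k * \<omega> k)" for \<omega>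
  proof -
    have "(\<Sum>i\<in>I. c i * gseq g (e i) \<omega>) = (\<Sum>i\<in>I. \<Sum>k<n. c i * chol g (e i) k * \<omega> k)"
      by (intro sum.cong refl) (simp add: gs sum_distrib_left mult.assoc)
    also have "\<dots> = (\<Sum>k<n. ?d k * \<omega> k)" by (subst sum.swap) (simp add: sum_distrib_right)
    finally show ?thesis .
  qed
  have "(\<Sum>k<n. (?d k)\<^sup>2) = (\<Sum>k<n. \<Sum>i\<in>I. \<Sum>j\<in>I. c i * c j * (chol g (e i) k * chol g (e j) k))"
    by (simp add: power2_eq_square sum_product mult_ac)
  also have "\<dots> = (\<Sum>i\<in>I. \<Sum>j\<in>I. \<Sum>k<n. c i * c j * (chol g (e i) k * chol g (e j) k))"
    by (subst sum.swap, intro sum.cong refl, subst sum.swap) simp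
  also have "\<dots> = (\<Sum>i\<in>I. \<Sum>j\<in>I. c i * c j * g (e i) (e j))"
    by (intro sum.cong refl) (simp add: chol_sum[OF g n] sum_distrib_left)
  finally have 2: "(\<Sum>k<n. (?d k)\<^sup>2) = (\<Sum>i\<in>I. \<Sum>j\<in>I. c i * c j * g (e i) (e j))" .
  show ?thesis unfolding 1 using char_noise[of "{..<n}" ?d] by (simp only: 2 finite_lessThan)
qed

lemma gseq_comb_moment:
  fixes c :: "'i \<Rightarrow> real" and e :: "'i \<Rightarrow> nat"
  assumes g: "psd g" and I: "finite I"
  defines "s \<equiv> (\<Sum>i\<in>I. \<Sum>j\<in>I. c i * c j * g (e i) (e j))"
  shows "integrable noise (\<lambda>\<omega>. (\<Sum>i\<in>I. c i * gseq g (e i) \<omega>)\<^sup>2)"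
    and "(\<integral>\<omega>. (\<Sum>i\<in>I. c i * gseq g (e i) \<omega>)\<^sup>2 \<partial>noise) = s"
    and "0 \<le> s"
proof -
  interpret prob_space noise by (rule prob_space_noise)
  let ?X = "\<lambda>\<omega>. \<Sum>i\<in>I. c i * gseq g (e i) \<omega>"
  have X: "?X \<in> borel_measurable noise"
    by (intro borel_measurable_sum borel_measurable_times borel_measurable_const gseq_measurable)
  \<comment> \<open>Nonnegativity comes from a characteristic function having modulus at most 1; in
    this way repeated indices \<open>e i\<close> need not be merged.\<close>
  show s: "0 \<le> s"
  proof -
    have "\<bar>exp (- s / 2)\<bar> = norm (\<integral>\<omega>. iexp (?X \<omega>) \<partial>noise)"
      unfolding char_gseq[OF g I] s_def by simp
    also have "\<dots> \<le> (\<integral>\<omega>. norm (iexp (?X \<omega>)) \<partial>noise)" by (rule integral_norm_bound)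
    also have "\<dots> = 1" by (simp add: prob_space)
    finally have "exp (- s / 2) \<le> 1" by simp
    then show ?thesis by simp
  qed
  have c: "(\<integral>\<omega>. iexp (t * ?X \<omega>) \<partial>noise) = complex_of_real (exp (- ((sqrt s)\<^sup>2 * t\<^sup>2) / 2))" for t
  proof -
    have "(\<integral>\<omega>. iexp (t * ?X \<omega>) \<partial>noise) = (\<integral>\<omega>. iexp (\<Sum>i\<in>I. (t * c i) * gseq g (e i) \<omega>) \<partial>noise)"
      by (simp only: sum_distrib_left mult.assoc)
    also have "\<dots> = complex_of_real (exp (- (\<Sum>i\<in>I. \<Sum>j\<in>I. (t * c i) * (t * c j) * g (e i) (e j)) / 2))"
      by (rule char_gseq[OF g I])
    also have "(\<Sum>i\<in>I. \<Sum>j\<in>I. (t * c i) * (t * c j) * g (e i) (e j)) = s * t\<^sup>2"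
      by (simp add: s_def sum_distrib_left sum_distrib_right power2_eq_square mult_ac)
    finally show ?thesis using s by simp
  qed
  show "integrable noise (\<lambda>\<omega>. (?X \<omega>)\<^sup>2)" "(\<integral>\<omega>. (?X \<omega>)\<^sup>2 \<partial>noise) = s"
    using distr_eq_centered_normal(2,3)[OF X _ c] s by auto
qed

subsection \<open>The space \<open>l1\<close>\<close>

lemma l1_eq_refl: "l1_eq x x \<longleftrightarrow> integrable lborel x"
  by (auto simp: l1_eq_def)

lemma abs_rep_l1: "abs_l1 (rep_l1 x) = x"
  by (rule Quotient3_abs_rep[OF Quotient3_l1])

lemma integrable_rep_l1: "integrable lborel (rep_l1 x)"
  using Quotient3_rep_reflp[OF Quotient3_l1, of x] by (simp add: l1_eq_def)

lemma rep_abs_l1: "integrable lborel x \<Longrightarrow> AE t in lborel. rep_l1 (abs_l1 x) t = x t"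
  using Quotient3_rel[OF Quotient3_l1, of "rep_l1 (abs_l1 x)" x]
  by (simp add: l1_eq_def integrable_rep_l1 abs_rep_l1)

lemma add_abs_l1: "integrable lborel x \<Longrightarrow> integrable lborel y \<Longrightarrow> abs_l1 x + abs_l1 y = abs_l1 (\<lambda>t. x t + y t)"
  by (simp add: plus_l1.abs_eq l1_eq_refl)

lemma diff_abs_l1: "integrable lborel x \<Longrightarrow> integrable lborel y \<Longrightarrow> abs_l1 x - abs_l1 y = abs_l1 (\<lambda>t. x t - y t)"
  by (simp add: minus_l1.abs_eq l1_eq_refl)

lemma scaleR_abs_l1: "integrable lborel x \<Longrightarrow> c *\<^sub>R abs_l1 x = abs_l1 (\<lambda>t. c * x t)"
  by (simp add: scaleR_l1.abs_eq l1_eq_refl)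

lemma norm_abs_l1: "integrable lborel x \<Longrightarrow> norm (abs_l1 x) = (\<integral>t. \<bar>x t\<bar> \<partial>lborel)"
  by (simp add: norm_l1.abs_eq l1_eq_refl)

lemma sum_abs_l1:
  "finite I \<Longrightarrow> (\<And>i. i \<in> I \<Longrightarrow> integrable lborel (x i)) \<Longrightarrow> (\<Sum>i\<in>I. abs_l1 (x i)) = abs_l1 (\<lambda>t. \<Sum>i\<in>I. x i t)"
  by (induction I rule: finite_induct) (simp_all add: add_abs_l1 zero_l1_def)

lemma norm_l1_rep: "norm x = (\<integral>t. \<bar>rep_l1 x t\<bar> \<partial>lborel)"
  using norm_abs_l1[OF integrable_rep_l1, of x] by (simp add: abs_rep_l1)

lemma L_infty_bound:
  assumes "f \<in> L_infty"
  obtains B where "0 \<le> B" "AE t in lborel. \<bar>f t\<bar> \<le> B"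
proof -
  from assms obtain B where "AE t in lborel. \<bar>f t\<bar> \<le> B" by (auto simp: L_infty_def)
  then have "AE t in lborel. \<bar>f t\<bar> \<le> max B 0" by eventually_elim auto
  then show ?thesis using that[of "max B 0"] by simp
qed

lemma L_infty_measurable: "f \<in> L_infty \<Longrightarrow> f \<in> borel_measurable borel"
  by (simp add: L_infty_def)

lemma integrable_L_infty_mult:
  assumes f: "f \<in> L_infty" and x: "integrable lborel x"
  shows "integrable lborel (\<lambda>t. f t * x t)"
proof -
  obtain B where B: "0 \<le> B" "AE t in lborel. \<bar>f t\<bar> \<le> B" using L_infty_bound[OF f] .
  have [measurable]: "f \<in> borel_measurable borel" by (rule L_infty_measurable[OF f])
  have [measurable]: "x \<in> borel_measurable borel" using borel_measurable_integrable[OF x] by simp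
  show ?thesis
  proof (rule Bochner_Integration.integrable_bound)
    show "integrable lborel (\<lambda>t. B * \<bar>x t\<bar>)" using x by simp
    show "AE t in lborel. norm (f t * x t) \<le> norm (B * \<bar>x t\<bar>)"
      using B(2) by eventually_elim (use B(1) in \<open>simp add: abs_mult mult_right_mono\<close>)
  qed measurable
qed

lemma dual_pairing_abs_l1:
  assumes f: "f \<in> L_infty" and x: "integrable lborel x"
  shows "dual_pairing f (abs_l1 x) = (\<integral>t. f t * x t \<partial>lborel)"
  unfolding dual_pairing_def
proof (rule integral_cong_AE)
  show "AE t in lborel. f t * rep_l1 (abs_l1 x) t = f t * x t"
    using rep_abs_l1[OF x] by eventually_elim simp
qed (use borel_measurable_integrable[OF integrable_L_infty_mult[OF f x]]
      borel_measurable_integrable[OF integrable_L_infty_mult[OF f integrable_rep_l1]] in auto)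

lemma bounded_linear_dual_pairing:
  assumes f: "f \<in> L_infty"
  shows "bounded_linear (dual_pairing f)"
proof -
  obtain B where B: "0 \<le> B" "AE t in lborel. \<bar>f t\<bar> \<le> B" using L_infty_bound[OF f] .
  note i = integrable_L_infty_mult[OF f integrable_rep_l1]
  show ?thesis
  proof (rule bounded_linear_intro)
    show "dual_pairing f (x + y) = dual_pairing f x + dual_pairing f y" for x y
    proof -
      have "x + y = abs_l1 (\<lambda>t. rep_l1 x t + rep_l1 y t)"
        using add_abs_l1[OF integrable_rep_l1 integrable_rep_l1, of x y] by (simp add: abs_rep_l1)
      then have "dual_pairing f (x + y) = (\<integral>t. f t * (rep_l1 x t + rep_l1 y t) \<partial>lborel)"
        using integrable_rep_l1 by (simp add: dual_pairing_abs_l1[OF f])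
      also have "\<dots> = dual_pairing f x + dual_pairing f y"
        unfolding dual_pairing_def distrib_left by (rule Bochner_Integration.integral_add[OF i i])
      finally show ?thesis .
    qed
    show "dual_pairing f (r *\<^sub>R x) = r *\<^sub>R dual_pairing f x" for r x
    proof -
      have "r *\<^sub>R x = abs_l1 (\<lambda>t. r * rep_l1 x t)"
        using scaleR_abs_l1[OF integrable_rep_l1, of r x] by (simp add: abs_rep_l1)
      then have "dual_pairing f (r *\<^sub>R x) = (\<integral>t. f t * (r * rep_l1 x t) \<partial>lborel)"
        using integrable_rep_l1 by (simp add: dual_pairing_abs_l1[OF f])
      also have "\<dots> = (\<integral>t. r * (f t * rep_l1 x t) \<partial>lborel)" by (simp add: mult.left_commute)
      also have "\<dots> = r * dual_pairing f x" unfolding dual_pairing_def by simp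
      finally show ?thesis by simp
    qed
    show "norm (dual_pairing f x) \<le> norm x * B" for x
    proof -
      have "norm (dual_pairing f x) \<le> (\<integral>t. norm (f t * rep_l1 x t) \<partial>lborel)"
        unfolding dual_pairing_def by (rule integral_norm_bound)
      also have "\<dots> \<le> (\<integral>t. B * \<bar>rep_l1 x t\<bar> \<partial>lborel)"
      proof (rule integral_mono_AE)
        show "AE t in lborel. norm (f t * rep_l1 x t) \<le> B * \<bar>rep_l1 x t\<bar>"
          using B(2) by eventually_elim (simp add: abs_mult mult_right_mono)
      qed (use i integrable_rep_l1 in auto)
      finally show ?thesis by (simp add: norm_l1_rep mult.commute)
    qed
  qed
qed

lemma continuous_dual_pairing: "f \<in> L_infty \<Longrightarrow> continuous_on UNIV (dual_pairing f)"
  by (rule bounded_linear.continuous_on[OF bounded_linear_dual_pairing continuous_on_id])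

lemma dual_pairing_add_fun:
  assumes "f \<in> L_infty" "g \<in> L_infty"
  shows "dual_pairing (\<lambda>t. f t + g t) x = dual_pairing f x + dual_pairing g x"
  unfolding dual_pairing_def distrib_right
  by (intro Bochner_Integration.integral_add integrable_L_infty_mult assms integrable_rep_l1)

lemma L_infty_add: assumes "f \<in> L_infty" "g \<in> L_infty" shows "(\<lambda>t. f t + g t) \<in> L_infty"
proof -
  have m: "f \<in> borel_measurable borel" "g \<in> borel_measurable borel" using assms by (auto simp: L_infty_def)
  obtain B where B: "AE t in lborel. \<bar>f t\<bar> \<le> B" using assms by (auto simp: L_infty_def)
  obtain B' where B': "AE t in lborel. \<bar>g t\<bar> \<le> B'" using assms by (auto simp: L_infty_def)
  have "AE t in lborel. \<bar>f t + g t\<bar> \<le> B + B'" using B B' by eventually_elim linarith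
  then show ?thesis using m by (auto simp: L_infty_def)
qed

text \<open>Riesz-Fischer in the form that absolutely convergent series converge: the
  representatives are summable almost everywhere by Tonelli, and the class of their sum is the limit
  since the norms of the remainders are dominated by tails of the series of norms.\<close>

lemma l1_complete:
  fixes x :: "nat \<Rightarrow> l1"
  assumes s: "summable (\<lambda>n. norm (x n))"
  shows "summable x"
proof -
  let ?f = "\<lambda>n. rep_l1 (x n)"
  have i: "integrable lborel (?f n)" for n by (rule integrable_rep_l1)
  have [measurable]: "?f n \<in> borel_measurable borel" for n
    using borel_measurable_integrable[OF i] by simp
  have n: "(\<integral>t. norm (?f n t) \<partial>lborel) = norm (x n)" for n by (simp add: norm_l1_rep)
  have "(\<integral>\<^sup>+t. (\<Sum>n. ennreal \<bar>?f n t\<bar>) \<partial>lborel) = (\<Sum>n. \<integral>\<^sup>+t. ennreal \<bar>?f n t\<bar> \<partial>lborel)"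
    by (rule nn_integral_suminf) measurable
  also have "\<dots> = (\<Sum>n. ennreal (norm (x n)))"
    using i n by (intro suminf_cong) (simp add: nn_integral_eq_integral)
  also have "\<dots> = ennreal (\<Sum>n. norm (x n))" by (rule suminf_ennreal2[OF _ s]) simp
  also have "\<dots> \<noteq> \<infinity>" by simp
  finally have "AE t in lborel. (\<Sum>n. ennreal \<bar>?f n t\<bar>) \<noteq> \<infinity>"
    by (intro nn_integral_noteq_infinite) auto
  then have ae: "AE t in lborel. summable (\<lambda>n. norm (?f n t))"
    by eventually_elim (auto intro: summable_suminf_not_top)
  have si: "summable (\<lambda>n. \<integral>t. norm (?f n t) \<partial>lborel)" unfolding n by (rule s)
  define S where "S t = (\<Sum>n. ?f n t)" for t
  have S: "integrable lborel S" unfolding S_def[abs_def] by (rule integrable_suminf[OF i ae si])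
  have bound: "norm (abs_l1 S - (\<Sum>n<N. x n)) \<le> (\<Sum>n. norm (x (n + N)))" for N
  proof -
    have "(\<Sum>n<N. x n) = abs_l1 (\<lambda>t. \<Sum>n<N. ?f n t)"
      using sum_abs_l1[of "{..<N}" ?f, OF _ i] by (simp add: abs_rep_l1)
    then have "norm (abs_l1 S - (\<Sum>n<N. x n)) = (\<integral>t. \<bar>S t - (\<Sum>n<N. ?f n t)\<bar> \<partial>lborel)"
      using S i by (simp add: diff_abs_l1 norm_abs_l1)
    also have "\<dots> \<le> (\<integral>t. (\<Sum>n. norm (?f (n + N) t)) \<partial>lborel)"
    proof (rule integral_mono_AE)
      show "integrable lborel (\<lambda>t. \<bar>S t - (\<Sum>n<N. ?f n t)\<bar>)" using S i by auto
      show "integrable lborel (\<lambda>t. \<Sum>n. norm (?f (n + N) t))"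
      proof (rule integrable_suminf)
        show "AE t in lborel. summable (\<lambda>n. norm (norm (?f (n + N) t)))"
          using ae by eventually_elim (simp add: summable_iff_shift[of "\<lambda>n. \<bar>?f n _\<bar>"])
        show "summable (\<lambda>n. \<integral>t. norm (norm (?f (n + N) t)) \<partial>lborel)"
          using si by (simp add: summable_iff_shift[of "\<lambda>n. \<integral>t. \<bar>?f n t\<bar> \<partial>lborel"])
      qed (use i in simp)
      show "AE t in lborel. \<bar>S t - (\<Sum>n<N. ?f n t)\<bar> \<le> (\<Sum>n. norm (?f (n + N) t))"
        using ae
      proof eventually_elim
        case (elim t)
        have "S t - (\<Sum>n<N. ?f n t) = (\<Sum>n. ?f (n + N) t)"
          unfolding S_def using suminf_minus_initial_segment[OF summable_norm_cancel[OF elim], of N] by simp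
        moreover have "norm (\<Sum>n. ?f (n + N) t) \<le> (\<Sum>n. norm (?f (n + N) t))"
          using elim by (intro summable_norm) (simp add: summable_iff_shift[of "\<lambda>n. \<bar>?f n t\<bar>"])
        ultimately show ?case by simp
      qed
    qed
    also have "\<dots> = (\<Sum>n. \<integral>t. norm (?f (n + N) t) \<partial>lborel)"
    proof (rule integral_suminf)
      show "AE t in lborel. summable (\<lambda>n. norm (norm (?f (n + N) t)))"
        using ae by eventually_elim (simp add: summable_iff_shift[of "\<lambda>n. \<bar>?f n _\<bar>"])
      show "summable (\<lambda>n. \<integral>t. norm (norm (?f (n + N) t)) \<partial>lborel)"
        using si by (simp add: summable_iff_shift[of "\<lambda>n. \<integral>t. \<bar>?f n t\<bar> \<partial>lborel"])
    qed (use i in simp)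
    also have "\<dots> = (\<Sum>n. norm (x (n + N)))" by (simp only: n)
    finally show ?thesis .
  qed
  have "(\<lambda>N. \<Sum>n<N. x n) \<longlonglongrightarrow> abs_l1 S"
  proof (rule LIM_zero_cancel, rule Lim_null_comparison)
    show "\<forall>\<^sub>F N in sequentially. norm ((\<Sum>n<N. x n) - abs_l1 S) \<le> (\<Sum>n. norm (x (n + N)))"
      using bound by (simp add: norm_minus_commute)
    show "(\<lambda>N. \<Sum>n. norm (x (n + N))) \<longlonglongrightarrow> 0" by (rule suminf_exist_split2[OF s])
  qed
  then show ?thesis by (auto simp: summable_def sums_def)
qed

subsection \<open>Lipschitz test functions suffice for convergence in law\<close>

text \<open>\<open>\<psi> k\<close> is the Pasch-Hausdorff envelope, the largest Lipschitz function
  with constant \<open>k\<close> below \<open>\<phi>\<close>. Boundedness keeps the infimum finite,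
  and for large \<open>k\<close> the penalty leaves only points near \<open>x\<close>, where
  continuity applies.\<close>

lemma Lipschitz_lower_approx:
  fixes \<phi> :: "'b::metric_space \<Rightarrow> real"
  assumes c: "continuous_on UNIV \<phi>" and B: "\<And>x. \<bar>\<phi> x\<bar> \<le> B"
  defines "\<psi> \<equiv> \<lambda>k x. INF y. \<phi> y + real k * dist x y"
  shows "\<And>k x y. \<bar>\<psi> k x - \<psi> k y\<bar> \<le> real k * dist x y"
    and "\<And>k x. \<psi> k x \<le> \<phi> x" and "\<And>k x. - B \<le> \<psi> k x"
    and "\<And>x. (\<lambda>k. \<psi> k x) \<longlonglongrightarrow> \<phi> x"
proof -
  have lb: "- B \<le> \<phi> y + real k * dist x y" for k x y
    using B[of y] by (smt (verit) mult_nonneg_nonneg of_nat_0_le_iff zero_le_dist)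
  have bdd: "bdd_below (range (\<lambda>y. \<phi> y + real k * dist x y))" for k x
    using lb by (intro bdd_belowI2)
  have le: "\<psi> k x \<le> \<phi> y + real k * dist x y" for k x y
    unfolding \<psi>_def by (rule cINF_lower[OF bdd]) simp
  have ge: "z \<le> \<psi> k x" if "\<And>y. z \<le> \<phi> y + real k * dist x y" for k x z
    unfolding \<psi>_def by (rule cINF_greatest) (use that in auto)
  show le': "\<psi> k x \<le> \<phi> x" for k x using le[of k x x] by simp
  show ge': "- B \<le> \<psi> k x" for k x by (rule ge[OF lb])
  have "\<psi> k x - real k * dist x y \<le> \<psi> k y" for k x y
  proof (rule ge)
    fix z
    have "\<psi> k x \<le> \<phi> z + real k * dist x z" by (rule le)
    also have "\<dots> \<le> \<phi> z + real k * (dist x y + dist y z)"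
      by (intro add_left_mono mult_left_mono dist_triangle) auto
    finally show "\<psi> k x - real k * dist x y \<le> \<phi> z + real k * dist y z" by (simp add: algebra_simps)
  qed
  then show "\<bar>\<psi> k x - \<psi> k y\<bar> \<le> real k * dist x y" for k x y
    by (smt (verit) dist_commute)
  show "(\<lambda>k. \<psi> k x) \<longlonglongrightarrow> \<phi> x" for x
  proof (rule LIMSEQ_I)
    fix r :: real assume r: "0 < r"
    from c have "isCont \<phi> x" by (simp add: continuous_on_eq_continuous_at)
    then obtain d where d: "0 < d" "\<And>y. dist y x < d \<Longrightarrow> dist (\<phi> y) (\<phi> x) < r / 2"
      unfolding continuous_at_eps_delta using r by (metis half_gt_zero)
    \<comment> \<open>For \<open>k \<ge> k0\<close> the penalty at distance \<open>d\<close> is at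
      least \<open>2 * B\<close>, the largest possible oscillation of \<open>\<phi>\<close>.\<close>
    obtain k0 where k0: "2 * B / d < real k0" using reals_Archimedean2 by blast
    have "norm (\<psi> k x - \<phi> x) < r" if k: "k \<ge> k0" for k
    proof -
      have "\<phi> x - r / 2 \<le> \<psi> k x"
      proof (rule ge)
        fix y
        show "\<phi> x - r / 2 \<le> \<phi> y + real k * dist x y"
        proof (cases "dist y x < d")
          case True
          from d(2)[OF True] have "\<phi> x - r / 2 \<le> \<phi> y" unfolding dist_real_def by linarith
          moreover have "0 \<le> real k * dist x y" by simp
          ultimately show ?thesis by linarith
        next
          case False
          have "2 * B \<le> real k0 * d" using k0 d(1) by (simp add: field_simps)
          also have "\<dots> \<le> real k * dist x y" using False k d(1) by (intro mult_mono) (auto simp: dist_commute)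
          finally show ?thesis using B[of x] B[of y] r by linarith
        qed
      qed
      then show ?thesis using le'[of k x] r by simp
    qed
    then show "\<exists>no. \<forall>n\<ge>no. norm (\<psi> n x - \<phi> x) < r" by blast
  qed
qed

text \<open>Lipschitz approximation from below controls the lower limit of the integrals of any
  bounded continuous function; applied to \<open>- \<phi>\<close> it controls the upper
  limit.\<close>

lemma converges_in_lawI_Lipschitz:
  fixes X :: "nat \<Rightarrow> 'a \<Rightarrow> 'b::metric_space"
  assumes M: "prob_space M" and \<mu>: "prob_space \<mu>" "sets \<mu> = sets borel"
    and X: "\<And>n. X n \<in> borel_measurable M"
    and conv: "\<And>(\<phi> :: 'b \<Rightarrow> real) k B. 0 \<le> k \<Longrightarrow> (\<And>x y. \<bar>\<phi> x - \<phi> y\<bar> \<le> k * dist x y) \<Longrightarrow> (\<And>x. \<bar>\<phi> x\<bar> \<le> B) \<Longrightarrow>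
      (\<lambda>n. \<integral>\<omega>. \<phi> (X n \<omega>) \<partial>M) \<longlonglongrightarrow> (\<integral>x. \<phi> x \<partial>\<mu>)"
  shows "converges_in_law M X \<mu>"
proof -
  interpret M: prob_space M by fact
  interpret \<mu>: prob_space \<mu> by fact
  have meas\<mu>: "\<phi> \<in> borel_measurable \<mu>" if "continuous_on UNIV \<phi>" for \<phi> :: "'b \<Rightarrow> real"
    using borel_measurable_continuous_onI[OF that] \<mu>(2) by (simp cong: measurable_cong_sets)
  have measM: "(\<lambda>\<omega>. \<phi> (X n \<omega>)) \<in> borel_measurable M" if "continuous_on UNIV \<phi>" for \<phi> :: "'b \<Rightarrow> real" and n
    using measurable_compose[OF X borel_measurable_continuous_onI[OF that]] .
  have lower: "\<forall>\<^sub>F n in sequentially. (\<integral>x. \<phi> x \<partial>\<mu>) - e < (\<integral>\<omega>. \<phi> (X n \<omega>) \<partial>M)"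
    if c: "continuous_on UNIV \<phi>" and B: "\<And>x. \<bar>\<phi> x\<bar> \<le> B" and e: "0 < e" for \<phi> :: "'b \<Rightarrow> real" and B e
  proof -
    define \<psi> where "\<psi> k x = (INF y. \<phi> y + real k * dist x y)" for k x
    note \<psi> = Lipschitz_lower_approx[OF c B, folded \<psi>_def]
    have \<psi>B: "\<bar>\<psi> k x\<bar> \<le> B" for k x using \<psi>(2)[where k=k and x=x] \<psi>(3)[where k=k and x=x] B[of x] by linarith
    have \<psi>c: "continuous_on UNIV (\<psi> k)" for k
    proof (rule continuous_onI)
      fix x :: 'b and e :: real assume e: "0 < e"
      have "dist (\<psi> k x') (\<psi> k x) \<le> e" if "dist x' x < e / (real k + 1)" for x'
      proof -
        have "dist (\<psi> k x') (\<psi> k x) \<le> real k * dist x' x" using \<psi>(1) by (simp add: dist_real_def)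
        also have "\<dots> \<le> (real k + 1) * (e / (real k + 1))" using that by (intro mult_mono) auto
        finally show ?thesis by simp
      qed
      then show "\<exists>d>0. \<forall>x'\<in>UNIV. dist x' x < d \<longrightarrow> dist (\<psi> k x') (\<psi> k x) \<le> e"
        using e by (intro exI[of _ "e / (real k + 1)"]) auto
    qed
    have "(\<lambda>k. \<integral>x. \<psi> k x \<partial>\<mu>) \<longlonglongrightarrow> (\<integral>x. \<phi> x \<partial>\<mu>)"
    proof (rule integral_dominated_convergence[where w="\<lambda>_. B"])
      show "AE x in \<mu>. (\<lambda>k. \<psi> k x) \<longlonglongrightarrow> \<phi> x" using \<psi>(4) by simp
      show "AE x in \<mu>. norm (\<psi> k x) \<le> B" for k using \<psi>B by simp
    qed (auto intro: meas\<mu> c \<psi>c)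
    then have "\<forall>\<^sub>F k in sequentially. (\<integral>x. \<phi> x \<partial>\<mu>) - e / 2 < (\<integral>x. \<psi> k x \<partial>\<mu>)"
      using e by (intro order_tendstoD(1)) auto
    then obtain k where k: "(\<integral>x. \<phi> x \<partial>\<mu>) - e / 2 < (\<integral>x. \<psi> k x \<partial>\<mu>)" by (auto simp: eventually_sequentially)
    have "(\<lambda>n. \<integral>\<omega>. \<psi> k (X n \<omega>) \<partial>M) \<longlonglongrightarrow> (\<integral>x. \<psi> k x \<partial>\<mu>)"
      by (rule conv[of "real k", OF _ \<psi>(1) \<psi>B]) simp
    then have "\<forall>\<^sub>F n in sequentially. (\<integral>x. \<psi> k x \<partial>\<mu>) - e / 2 < (\<integral>\<omega>. \<psi> k (X n \<omega>) \<partial>M)"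
      using e by (intro order_tendstoD(1)) auto
    then show ?thesis
    proof eventually_elim
      case (elim n)
      have "(\<integral>\<omega>. \<psi> k (X n \<omega>) \<partial>M) \<le> (\<integral>\<omega>. \<phi> (X n \<omega>) \<partial>M)"
        using \<psi>B B by (intro integral_mono \<psi>(2))
          (auto intro!: M.integrable_const_bound[where B=B] measM c \<psi>c)
      then show ?case using elim k by linarith
    qed
  qed
  show ?thesis
    unfolding converges_in_law_def
  proof (intro conjI allI impI X)
    fix \<phi> :: "'b \<Rightarrow> real" assume c: "continuous_on UNIV \<phi>" and "bounded (range \<phi>)"
    then obtain B where B: "\<And>x. \<bar>\<phi> x\<bar> \<le> B" by (auto simp: bounded_iff)
    show "(\<lambda>n. \<integral>\<omega>. \<phi> (X n \<omega>) \<partial>M) \<longlonglongrightarrow> (\<integral>x. \<phi> x \<partial>\<mu>)"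
    proof (rule order_tendstoI)
      fix u assume u: "u < (\<integral>x. \<phi> x \<partial>\<mu>)"
      from lower[OF c B, of "(\<integral>x. \<phi> x \<partial>\<mu>) - u"] u
      show "\<forall>\<^sub>F n in sequentially. u < (\<integral>\<omega>. \<phi> (X n \<omega>) \<partial>M)" by simp
    next
      fix u assume u: "(\<integral>x. \<phi> x \<partial>\<mu>) < u"
      have "continuous_on UNIV (\<lambda>x. - \<phi> x)" using c by (intro continuous_intros)
      from lower[OF this, of B "u - (\<integral>x. \<phi> x \<partial>\<mu>)"] u B
      show "\<forall>\<^sub>F n in sequentially. (\<integral>\<omega>. \<phi> (X n \<omega>) \<partial>M) < u" by simp
    qed
  qed
qed

section \<open>A square root as an integral, and expected norms by Fubini\<close>

lemma nn_integral_inverse_sqrt: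
  assumes "0 \<le> m"
  shows "(\<integral>\<^sup>+u. ennreal (1 / (2 * sqrt u)) * indicator {0<..<m} u \<partial>lborel) = ennreal (sqrt m)"
proof -
  \<comment> \<open>The integrand blows up at 0, hence the version of the fundamental theorem that
    asks for the derivative in the open interval only.\<close>
  have "((\<lambda>u. 1 / (2 * sqrt u)) has_integral (sqrt m - sqrt 0)) {0..m}"
  proof (rule fundamental_theorem_of_calculus_interior[OF assms])
    show "continuous_on {0..m} sqrt" by (intro continuous_intros)
    fix x assume "x \<in> {0<..<m}"
    then show "(sqrt has_vector_derivative 1 / (2 * sqrt x)) (at x)"
      by (auto intro!: derivative_eq_intros simp: has_real_derivative_iff_has_vector_derivative[symmetric] field_simps)
  qed
  then have "((\<lambda>u. 1 / (2 * sqrt u)) has_integral sqrt m) {0..m}" by simp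
  then have *: "((\<lambda>u. \<bar>1 / (2 * sqrt u)\<bar>) has_integral sqrt m) {0..m}"
    by (rule has_integral_eq[rotated]) auto
  have "(\<integral>\<^sup>+u. ennreal (1 / (2 * sqrt u)) * indicator {0<..<m} u \<partial>lborel)
      = (\<integral>\<^sup>+u. ennreal (indicator {0..m} u * \<bar>1 / (2 * sqrt u)\<bar>) \<partial>lborel)"
  proof (rule nn_integral_cong_AE)
    show "AE u in lborel. ennreal (1 / (2 * sqrt u)) * indicator {0<..<m} u = ennreal (indicator {0..m} u * \<bar>1 / (2 * sqrt u)\<bar>)"
      using AE_lborel_singleton[of 0] AE_lborel_singleton[of m]
      by eventually_elim (auto simp: indicator_def)
  qed
  also have "\<dots> = ennreal (sqrt m)"
  proof (rule nn_integral_has_integral_lborel)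
    have "((\<lambda>u. if u \<in> {0..m} then \<bar>1 / (2 * sqrt u)\<bar> else 0) has_integral sqrt m) UNIV"
      using * by (simp only: has_integral_restrict_UNIV)
    then show "((\<lambda>u. indicator {0..m} u * \<bar>1 / (2 * sqrt u)\<bar>) has_integral sqrt m) UNIV"
      by (rule has_integral_eq[rotated]) (auto simp: indicator_def)
  qed auto
  finally show ?thesis .
qed

lemma (in prob_space) nn_integral_l1_swap_le:
  fixes f :: "'a \<Rightarrow> real \<Rightarrow> real"
  assumes m: "(\<lambda>(x, t). f x t) \<in> borel_measurable (M \<Otimes>\<^sub>M lborel)"
    and i: "\<And>x. x \<in> space M \<Longrightarrow> integrable lborel (f x)"
    and b: "\<And>t. integrable M (\<lambda>x. f x t)" "\<And>t. (\<integral>x. \<bar>f x t\<bar> \<partial>M) \<le> b t"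
  shows "(\<integral>\<^sup>+x. ennreal (\<integral>t. \<bar>f x t\<bar> \<partial>lborel) \<partial>M) \<le> (\<integral>\<^sup>+t. ennreal (b t) \<partial>lborel)"
proof -
  interpret pair_sigma_finite M lborel ..
  have m': "(\<lambda>(x, t). ennreal \<bar>f x t\<bar>) \<in> borel_measurable (M \<Otimes>\<^sub>M lborel)"
    using m unfolding case_prod_beta by measurable
  have "(\<integral>\<^sup>+x. ennreal (\<integral>t. \<bar>f x t\<bar> \<partial>lborel) \<partial>M) = (\<integral>\<^sup>+x. \<integral>\<^sup>+t. ennreal \<bar>f x t\<bar> \<partial>lborel \<partial>M)"
    using i by (intro nn_integral_cong) (simp add: nn_integral_eq_integral)
  also have "\<dots> = (\<integral>\<^sup>+t. \<integral>\<^sup>+x. ennreal \<bar>f x t\<bar> \<partial>M \<partial>lborel)"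
    by (rule Fubini'[OF m', symmetric])
  also have "\<dots> \<le> (\<integral>\<^sup>+t. ennreal (b t) \<partial>lborel)"
    using b by (intro nn_integral_mono) (simp add: nn_integral_eq_integral ennreal_leI)
  finally show ?thesis .
qed

subsection \<open>Step functions\<close>

text \<open>Grid points are rationals, so that the step functions of every mesh are read off from
  one process with a countable index set.\<close>

definition grid :: "nat \<Rightarrow> int \<Rightarrow> rat" where "grid N i = of_int i / of_nat N"

definition cell :: "nat \<Rightarrow> int \<Rightarrow> real set" where "cell N i = {t. \<lfloor>real N * t\<rfloor> = i}"

text \<open>Since cells have width \<open>1 / N\<close>, these indices cover
  \<open>{- real N..<real N}\<close>: the mesh is refined and the window enlarged at the same
  time.\<close>

definition win :: "nat \<Rightarrow> int set" where "win N = {- (int N)\<^sup>2..<(int N)\<^sup>2}"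

definition Wf :: "nat \<Rightarrow> (rat \<Rightarrow> real) \<Rightarrow> real \<Rightarrow> real" where
  "Wf N x t = (\<Sum>i\<in>win N. x (grid N i) * indicator (cell N i) t)"

text \<open>Written as a combination of fixed elements of \<open>l1\<close>, not as the class of
  \<open>Wf N x\<close>, so that continuity in \<open>x\<close> for the product topology is
  immediate.\<close>

definition Vf :: "nat \<Rightarrow> (rat \<Rightarrow> real) \<Rightarrow> l1" where
  "Vf N x = (\<Sum>i\<in>win N. x (grid N i) *\<^sub>R abs_l1 (indicator (cell N i)))"

lemma finite_win: "finite (win N)" by (simp add: win_def)

lemma cell_eq: "1 \<le> N \<Longrightarrow> cell N i = {real_of_int i / real N..<(real_of_int i + 1) / real N}"
  unfolding cell_def by (auto simp: floor_eq_iff field_simps)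

lemma cell_measurable [measurable]: "cell N i \<in> sets borel"
  unfolding cell_def by measurable

lemma integrable_cell: "1 \<le> N \<Longrightarrow> integrable lborel (indicator (cell N i) :: real \<Rightarrow> real)"
  by (intro integrable_real_indicator) (auto simp: cell_eq divide_right_mono emeasure_lborel_Ico)

lemma Wf_eq: "Wf N x t = (if \<lfloor>real N * t\<rfloor> \<in> win N then x (grid N \<lfloor>real N * t\<rfloor>) else 0)"
proof -
  have "Wf N x t = (\<Sum>i\<in>win N. if i = \<lfloor>real N * t\<rfloor> then x (grid N i) else 0)"
    unfolding Wf_def by (intro sum.cong refl) (auto simp: cell_def indicator_def)
  then show ?thesis using finite_win by simp
qed

lemma integrable_Wf: "1 \<le> N \<Longrightarrow> integrable lborel (Wf N x)"
  unfolding Wf_def[abs_def] by (intro Bochner_Integration.integrable_sum integrable_mult_right integrable_cell)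

lemma Vf_eq: "1 \<le> N \<Longrightarrow> Vf N x = abs_l1 (Wf N x)"
  unfolding Vf_def Wf_def[abs_def]
  by (simp add: scaleR_abs_l1 integrable_cell sum_abs_l1 finite_win)

lemma continuous_Vf: "continuous_on UNIV (Vf N)"
  unfolding Vf_def[abs_def] by (intro continuous_intros continuous_on_product_coordinates)

lemma grid_error:
  assumes "1 \<le> N" shows "\<bar>t - of_rat (grid N \<lfloor>real N * t\<rfloor>)\<bar> \<le> 1 / real N"
    "of_rat (grid N \<lfloor>real N * t\<rfloor>) \<le> t"
proof -
  have g: "of_rat (grid N i) = real_of_int i / real N" for i
    by (simp add: grid_def of_rat_divide)
  have "real_of_int \<lfloor>real N * t\<rfloor> \<le> real N * t" "real N * t < real_of_int \<lfloor>real N * t\<rfloor> + 1" by linarith+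
  then have "real_of_int \<lfloor>real N * t\<rfloor> / real N \<le> t" "t \<le> real_of_int \<lfloor>real N * t\<rfloor> / real N + 1 / real N"
    using assms by (simp_all add: field_simps)
  then show "\<bar>t - of_rat (grid N \<lfloor>real N * t\<rfloor>)\<bar> \<le> 1 / real N"
    "of_rat (grid N \<lfloor>real N * t\<rfloor>) \<le> t" unfolding g by auto
qed

lemma win_iff: "\<lfloor>r\<rfloor> \<in> win N \<longleftrightarrow> - (real N)\<^sup>2 \<le> r \<and> r < (real N)\<^sup>2"
  unfolding win_def by (auto simp: le_floor_iff floor_less_iff)

lemma eventually_win: "\<forall>\<^sub>F N in sequentially. \<lfloor>real N * t\<rfloor> \<in> win N"
proof -
  obtain m where m: "\<bar>t\<bar> < real m" using reals_Archimedean2 by blast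
  show ?thesis
    using eventually_ge_at_top[of "max 1 m"]
  proof eventually_elim
    case (elim N)
    then have "\<bar>t\<bar> < real N" using m by linarith
    then have "real N * \<bar>t\<bar> < real N * real N" using elim by (intro mult_strict_left_mono) auto
    then have "\<bar>real N * t\<bar> < (real N)\<^sup>2" by (simp add: abs_mult power2_eq_square)
    then have "- (real N)\<^sup>2 \<le> real N * t" "real N * t < (real N)\<^sup>2" by linarith+
    then show ?case by (simp add: win_iff)
  qed
qed

lemma win_mono: assumes "N \<le> M" "\<lfloor>real N * t\<rfloor> \<in> win N" "1 \<le> N" shows "\<lfloor>real M * t\<rfloor> \<in> win M"
proof -
  have N: "0 < real N" "real N \<le> real M" using assms by auto
  from assms(2) have "real N * - real N \<le> real N * t" "real N * t < real N * real N"
    unfolding win_iff by (simp_all add: power2_eq_square)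
  then have "- real N \<le> t" "t < real N"
    using mult_left_le_imp_le[of "real N" "- real N" t] mult_left_less_imp_less[of "real N" t "real N"] N by simp_all
  then have t: "- real M \<le> t" "t < real M" using N by linarith+
  then have "real M * - real M \<le> real M * t" by (intro mult_left_mono) auto
  moreover have "real M * t < real M * real M" using t N by (intro mult_strict_left_mono) auto
  ultimately show ?thesis unfolding win_iff by (simp add: power2_eq_square)
qed

subsection \<open>Consequences of the quantile condition\<close>

locale lin_proc_q = lin_proc D a K for D a K +
  assumes quantile: "(\<Sum>k. \<integral>\<^sup>+u\<in>{0<..(a k)\<^sup>2}. ennreal (abs_quantile P (Yp 0) u / sqrt u) \<partial>lborel) < \<infinity>"
begin

definition H :: "real \<Rightarrow> real" where "H x = measure P {\<omega>. x < \<bar>Yp 0 \<omega>\<bar>}"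

lemma H_set: "{\<omega>. x < \<bar>Yp 0 \<omega>\<bar>} \<in> sets P"
proof -
  have "{\<omega> \<in> space P. x < \<bar>Yp 0 \<omega>\<bar>} \<in> sets P" by measurable
  then show ?thesis by simp
qed

lemma H_antimono: "x \<le> y \<Longrightarrow> H y \<le> H x"
  unfolding H_def by (intro P.finite_measure_mono H_set) auto

lemma H_range: "0 \<le> H x" "H x \<le> 1"
  by (simp_all add: H_def P.prob_le_1)

lemma H_measurable [measurable]: "H \<in> borel_measurable borel"
proof -
  have "(\<lambda>x. - H x) \<in> borel_measurable borel" by (rule borel_measurable_mono) (auto simp: mono_def H_antimono)
  then show ?thesis by simp
qed

lemma H_tendsto_0: "(\<lambda>n. H (real n)) \<longlonglongrightarrow> 0"
proof -
  have "(\<lambda>n. measure P {\<omega>. real n < \<bar>Yp 0 \<omega>\<bar>}) \<longlonglongrightarrow> measure P (\<Inter>n. {\<omega>. real n < \<bar>Yp 0 \<omega>\<bar>})"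
    by (rule P.finite_Lim_measure_decseq) (use H_set in \<open>auto simp: decseq_def\<close>)
  moreover have "(\<Inter>n. {\<omega>. real n < \<bar>Yp 0 \<omega>\<bar>}) = {}"
  proof (rule equals0I)
    fix \<omega> assume "\<omega> \<in> (\<Inter>n. {\<omega>. real n < \<bar>Yp 0 \<omega>\<bar>})"
    then have "real n < \<bar>Yp 0 \<omega>\<bar>" for n by auto
    moreover obtain n where "\<bar>Yp 0 \<omega>\<bar> \<le> real n" using real_arch_simple by blast
    ultimately show False by (meson linorder_not_less)
  qed
  ultimately show ?thesis by (simp add: H_def)
qed

text \<open>Points of the defining set have tail at most \<open>u\<close>, so monotonicity puts them
  to the right of \<open>x\<close>. The set is nonempty for \<open>u > 0\<close> because
  \<open>H\<close> tends to 0, hence its infimum is a genuine one.\<close>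

lemma le_abs_quantile:
  assumes u: "0 < u" and x: "u < H x"
  shows "x \<le> abs_quantile P (Yp 0) u" and "0 \<le> abs_quantile P (Yp 0) u"
proof -
  let ?S = "{x. 0 \<le> x \<and> H x \<le> u}"
  have e: "abs_quantile P (Yp 0) u = Inf ?S" by (simp add: abs_quantile_def H_def)
  have "\<forall>\<^sub>F n in sequentially. H (real n) < u" using H_tendsto_0 u by (intro order_tendstoD(2)) auto
  then obtain n where "H (real n) < u" by (auto simp: eventually_sequentially)
  then have ne: "?S \<noteq> {}" by (intro ex_in_conv[THEN iffD1] exI[of _ "real n"]) simp
  show "x \<le> abs_quantile P (Yp 0) u" unfolding e
  proof (rule cInf_greatest[OF ne])
    fix s assume "s \<in> ?S"
    then have "H s < H x" using x by simp
    then show "x \<le> s" using H_antimono[of s x] by linarith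
  qed
  show "0 \<le> abs_quantile P (Yp 0) u" unfolding e by (rule cInf_greatest[OF ne]) simp
qed

text \<open>The integrand is \<open>sqrt (min (\<alpha>\<^sup>2) (H x))\<close>, the integral of
  \<open>1 / (2 * sqrt u)\<close> up to that minimum. After the exchange of integrals the points
  \<open>x > 0\<close> with \<open>u < H x\<close> lie below the quantile at \<open>u\<close>, so
  the inner integral is at most the quantile times the weight.\<close>

lemma nn_integral_tail_le:
  "(\<integral>\<^sup>+x. ennreal (min \<bar>\<alpha>\<bar> (sqrt (H x))) * indicator {0<..} x \<partial>lborel)
    \<le> (\<integral>\<^sup>+u\<in>{0<..\<alpha>\<^sup>2}. ennreal (abs_quantile P (Yp 0) u / sqrt u) \<partial>lborel)"
proof -
  let ?f = "\<lambda>x u. ennreal (1 / (2 * sqrt u)) * indicator {0<..<min (\<alpha>\<^sup>2) (H x)} u * indicator {0<..} x"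
  let ?Q = "abs_quantile P (Yp 0)"
  have ind: "(indicator {0<..<min (\<alpha>\<^sup>2) (H x)} u :: ennreal) = indicator {u. 0 < u \<and> u < \<alpha>\<^sup>2} u * (if u < H x then 1 else 0)" for x u
    by (auto simp: indicator_def)
  have m: "(\<lambda>(x, u). ?f x u) \<in> borel_measurable (lborel \<Otimes>\<^sub>M lborel)"
    unfolding ind by measurable
  have "(\<integral>\<^sup>+x. ennreal (min \<bar>\<alpha>\<bar> (sqrt (H x))) * indicator {0<..} x \<partial>lborel) = (\<integral>\<^sup>+x. \<integral>\<^sup>+u. ?f x u \<partial>lborel \<partial>lborel)"
  proof (intro nn_integral_cong)
    fix x
    have "min \<bar>\<alpha>\<bar> (sqrt (H x)) = sqrt (min (\<alpha>\<^sup>2) (H x))"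
      by (simp add: min_def flip: real_sqrt_abs)
    then show "ennreal (min \<bar>\<alpha>\<bar> (sqrt (H x))) * indicator {0<..} x = (\<integral>\<^sup>+u. ?f x u \<partial>lborel)"
      using nn_integral_inverse_sqrt[of "min (\<alpha>\<^sup>2) (H x)"] H_range(1)[of x]
      by (subst nn_integral_multc) auto
  qed
  also have "\<dots> = (\<integral>\<^sup>+u. \<integral>\<^sup>+x. ?f x u \<partial>lborel \<partial>lborel)" by (rule lborel_pair.Fubini'[OF m, symmetric])
  also have "\<dots> \<le> (\<integral>\<^sup>+u\<in>{0<..\<alpha>\<^sup>2}. ennreal (?Q u / sqrt u) \<partial>lborel)"
  proof (rule nn_integral_mono)
    fix u :: real
    show "(\<integral>\<^sup>+x. ?f x u \<partial>lborel) \<le> ennreal (?Q u / sqrt u) * indicator {0<..\<alpha>\<^sup>2} u"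
    proof (cases "0 < u \<and> u < \<alpha>\<^sup>2")
      case True
      have le: "?f x u \<le> ennreal (1 / (2 * sqrt u)) * indicator {0..?Q u} x" for x
        using True le_abs_quantile[of u x] by (auto simp: indicator_def)
      have "(\<integral>\<^sup>+x. ?f x u \<partial>lborel) \<le> (\<integral>\<^sup>+x. ennreal (1 / (2 * sqrt u)) * indicator {0..?Q u} x \<partial>lborel)"
        by (rule nn_integral_mono) (rule le)
      also have "\<dots> = ennreal (1 / (2 * sqrt u)) * ennreal (?Q u)"
      proof -
        have "emeasure lborel {0..q} = ennreal q" for q :: real
          by (cases "0 \<le> q") (auto simp: ennreal_neg)
        then show ?thesis by (subst nn_integral_cmult) auto
      qed
      also have "\<dots> = ennreal (?Q u / (2 * sqrt u))"
        using True by (simp flip: ennreal_mult')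
      also have "\<dots> \<le> ennreal (?Q u / sqrt u)"
      proof (cases "0 \<le> ?Q u")
        case Q: True
        then show ?thesis using True by (intro ennreal_leI) (simp add: field_simps)
      next
        case Q: False
        then show ?thesis using True by (simp add: ennreal_neg divide_nonpos_pos)
      qed
      finally show ?thesis using True by (simp add: indicator_def)
    next
      case False
      then have "indicator {0<..<min (\<alpha>\<^sup>2) (H x)} u = (0 :: ennreal)" for x by (auto simp: indicator_def)
      then show ?thesis by simp
    qed
  qed
  finally show ?thesis .
qed

text \<open>Dominates \<open>Th s\<close> for all \<open>\<bar>s - t\<bar> \<le> 1\<close>, hence also the values of \<open>Th\<close> at the grid points next to \<open>t\<close>.\<close>

definition Thb :: "real \<Rightarrow> real" where "Thb t = th 1 (sqrt (H (\<bar>t\<bar> - 2)))"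

lemma Thb_nonneg: "0 \<le> Thb t"
  unfolding Thb_def using H_range by (intro th_nonneg) auto

lemma Thb_measurable [measurable]: "Thb \<in> borel_measurable borel"
  unfolding Thb_def[abs_def] th_def by measurable

text \<open>For \<open>\<bar>t\<bar> \<le> 2\<close> the argument of \<open>H\<close> gives no
  decay, and summability of \<open>a\<close> over an interval of length 4 suffices. Beyond it
  \<open>nn_integral_tail_le\<close> applies with \<open>x = \<bar>t\<bar> - 2\<close>, once for
  each tail, which explains the factor 2.\<close>

lemma nn_integral_Thb: "(\<integral>\<^sup>+t. ennreal (Thb t) \<partial>lborel) < \<infinity>"
proof -
  let ?c = "max 1 C0"
  let ?m = "\<lambda>k x. ennreal (min \<bar>a k\<bar> (sqrt (H x))) * indicator {0<..} x"
  let ?J = "\<lambda>k. \<integral>\<^sup>+x. ?m k x \<partial>lborel"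
  let ?Q = "\<lambda>k. \<integral>\<^sup>+u\<in>{0<..(a k)\<^sup>2}. ennreal (abs_quantile P (Yp 0) u / sqrt u) \<partial>lborel"
  have e: "ennreal (Thb t) = (\<Sum>k. ennreal (min (C0 * \<bar>a k\<bar>) (sqrt (H (\<bar>t\<bar> - 2)))))" for t
    unfolding Thb_def th_def using C0_pos H_range th_summable[of 1 "sqrt (H (\<bar>t\<bar> - 2))"]
    by (subst suminf_ennreal2) auto
  \<comment> \<open>The constant \<open>?c\<close> is at least 1 and at least \<open>C0\<close>, so
    it can be pulled out of the minimum. The sums \<open>-2 + 1 * t\<close> and
    \<open>-2 + (-1) * t\<close> are written for the affine substitution that follows.\<close>
  have pt: "ennreal (min (C0 * \<bar>a k\<bar>) (sqrt (H (\<bar>t\<bar> - 2))))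
     \<le> ennreal (C0 * \<bar>a k\<bar>) * indicator {-2..2} t + ennreal ?c * ?m k (-2 + 1 * t) + ennreal ?c * ?m k (-2 + (-1) * t)" for k t
  proof -
    have *: "min (C0 * \<bar>a k\<bar>) h \<le> ?c * min \<bar>a k\<bar> h" if "0 \<le> h" for h
    proof -
      have "C0 * \<bar>a k\<bar> \<le> ?c * \<bar>a k\<bar>" by (intro mult_right_mono) auto
      moreover have "1 * h \<le> ?c * h" using that by (intro mult_right_mono) auto
      ultimately show ?thesis by (auto simp: min_def)
    qed
    consider "\<bar>t\<bar> \<le> 2" | "2 < t" | "t < -2" by linarith
    then show ?thesis
    proof cases
      case 1
      then have "ennreal (min (C0 * \<bar>a k\<bar>) (sqrt (H (\<bar>t\<bar> - 2)))) \<le> ennreal (C0 * \<bar>a k\<bar>) * indicator {-2..2} t"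
        by (auto simp: indicator_def abs_le_iff intro!: ennreal_leI)
      then show ?thesis by (metis (no_types, lifting) add.assoc add_increasing2 zero_le)
    next
      case 2
      have "ennreal (min (C0 * \<bar>a k\<bar>) (sqrt (H (\<bar>t\<bar> - 2)))) \<le> ennreal (?c * min \<bar>a k\<bar> (sqrt (H (\<bar>t\<bar> - 2))))"
        using * H_range by (intro ennreal_leI) auto
      also have "\<dots> = ennreal ?c * ?m k (-2 + 1 * t)"
        using 2 H_range by (subst ennreal_mult) auto
      finally show ?thesis by (metis (no_types, lifting) add_increasing add_increasing2 zero_le)
    next
      case 3
      have e: "\<bar>t\<bar> - 2 = -2 + (-1) * t" using 3 by simp
      have "ennreal (min (C0 * \<bar>a k\<bar>) (sqrt (H (-2 + (-1) * t)))) \<le> ennreal (?c * min \<bar>a k\<bar> (sqrt (H (-2 + (-1) * t))))"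
        using * H_range by (intro ennreal_leI) auto
      also have "\<dots> = ennreal ?c * ?m k (-2 + (-1) * t)"
        using 3 H_range by (subst ennreal_mult) auto
      finally show ?thesis unfolding e by (metis (no_types, lifting) add_increasing zero_le)
    qed
  qed
  have mm: "?m k \<in> borel_measurable borel" for k by measurable
  have add3: "(\<integral>\<^sup>+t. f t + g t + h t \<partial>lborel) = (\<integral>\<^sup>+t. f t \<partial>lborel) + (\<integral>\<^sup>+t. g t \<partial>lborel) + (\<integral>\<^sup>+t. h t \<partial>lborel)"
    if "f \<in> borel_measurable lborel" "g \<in> borel_measurable lborel" "h \<in> borel_measurable lborel" for f g h :: "real \<Rightarrow> ennreal"
    using that by (simp add: nn_integral_add)
  have "(\<integral>\<^sup>+t. ennreal (Thb t) \<partial>lborel) = (\<Sum>k. \<integral>\<^sup>+t. ennreal (min (C0 * \<bar>a k\<bar>) (sqrt (H (\<bar>t\<bar> - 2)))) \<partial>lborel)"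
    unfolding e by (rule nn_integral_suminf) measurable
  also have "\<dots> \<le> (\<Sum>k. ennreal (4 * C0 * \<bar>a k\<bar>) + ennreal (2 * ?c) * ?Q k)"
  proof (rule suminf_le)
    fix k
    have J1: "(\<integral>\<^sup>+t. ?m k (-2 + 1 * t) \<partial>lborel) = ?J k"
      using nn_integral_real_affine[of "?m k" 1 "-2"] mm by simp
    have J2: "(\<integral>\<^sup>+t. ?m k (-2 + (-1) * t) \<partial>lborel) = ?J k"
      using nn_integral_real_affine[of "?m k" "-1" "-2"] mm by simp
    have "(\<integral>\<^sup>+t. ennreal (min (C0 * \<bar>a k\<bar>) (sqrt (H (\<bar>t\<bar> - 2)))) \<partial>lborel)
      \<le> (\<integral>\<^sup>+t. ennreal (C0 * \<bar>a k\<bar>) * indicator {-2..2} t + ennreal ?c * ?m k (-2 + 1 * t) + ennreal ?c * ?m k (-2 + (-1) * t) \<partial>lborel)"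
      by (rule nn_integral_mono) (rule pt)
    also have "\<dots> = (\<integral>\<^sup>+t. ennreal (C0 * \<bar>a k\<bar>) * indicator {-2..2::real} t \<partial>lborel)
        + (\<integral>\<^sup>+t. ennreal ?c * ?m k (-2 + 1 * t) \<partial>lborel) + (\<integral>\<^sup>+t. ennreal ?c * ?m k (-2 + (-1) * t) \<partial>lborel)"
      by (rule add3) measurable
    also have "(\<integral>\<^sup>+t. ennreal ?c * ?m k (-2 + 1 * t) \<partial>lborel) = ennreal ?c * ?J k"
      by (subst nn_integral_cmult, measurable) (simp only: J1)
    also have "(\<integral>\<^sup>+t. ennreal ?c * ?m k (-2 + (-1) * t) \<partial>lborel) = ennreal ?c * ?J k"
      by (subst nn_integral_cmult, measurable) (simp only: J2)
    also have "(\<integral>\<^sup>+t. ennreal (C0 * \<bar>a k\<bar>) * indicator {-2..2::real} t \<partial>lborel) = ennreal (4 * C0 * \<bar>a k\<bar>)"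
    proof -
      have "(\<integral>\<^sup>+t. ennreal (C0 * \<bar>a k\<bar>) * indicator {-2..2::real} t \<partial>lborel) = ennreal (C0 * \<bar>a k\<bar>) * ennreal 4"
        by (subst nn_integral_cmult) auto
      also have "\<dots> = ennreal (C0 * \<bar>a k\<bar> * 4)" using C0_pos by (intro ennreal_mult[symmetric]) auto
      finally show ?thesis by (simp only: mult.commute mult.left_commute)
    qed
    also have "ennreal (4 * C0 * \<bar>a k\<bar>) + ennreal ?c * ?J k + ennreal ?c * ?J k = ennreal (4 * C0 * \<bar>a k\<bar>) + ennreal (2 * ?c) * ?J k"
    proof -
      have "ennreal (2 * ?c) = ennreal ?c + ennreal ?c" by (subst ennreal_plus[symmetric]) auto
      then show ?thesis by (simp only: distrib_right add.assoc)
    qed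
    also have "\<dots> \<le> ennreal (4 * C0 * \<bar>a k\<bar>) + ennreal (2 * ?c) * ?Q k"
      by (intro add_left_mono mult_left_mono nn_integral_tail_le) auto
    finally show "(\<integral>\<^sup>+t. ennreal (min (C0 * \<bar>a k\<bar>) (sqrt (H (\<bar>t\<bar> - 2)))) \<partial>lborel) \<le> ennreal (4 * C0 * \<bar>a k\<bar>) + ennreal (2 * ?c) * ?Q k" .
  qed auto
  also have "\<dots> = (\<Sum>k. ennreal (4 * C0 * \<bar>a k\<bar>)) + ennreal (2 * ?c) * (\<Sum>k. ?Q k)"
    by (subst suminf_add[symmetric]) (auto simp: ennreal_suminf_cmult)
  also have "(\<Sum>k. ennreal (4 * C0 * \<bar>a k\<bar>)) = ennreal (\<Sum>k. 4 * C0 * \<bar>a k\<bar>)"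
    using C0_pos by (intro suminf_ennreal2 summable_mult a_summable) auto
  also have "ennreal (\<Sum>k. 4 * C0 * \<bar>a k\<bar>) + ennreal (2 * ?c) * (\<Sum>k. ?Q k) < \<infinity>"
    using quantile by (simp add: ennreal_mult_less_top)
  finally show ?thesis .
qed

lemma integrable_Thb: "integrable lborel Thb"
  using nn_integral_Thb Thb_nonneg by (intro integrableI_nonneg) auto

text \<open>The shift is 2 and not 1 because a value at most \<open>s < 0\<close> only yields
  \<open>\<bar>Yp 0 x\<bar> \<ge> \<bar>t\<bar> - 1\<close>, whereas \<open>H\<close> demands a
  strict inequality.\<close>

lemma bt_le: assumes "\<bar>s - t\<bar> \<le> 1" shows "bt s \<le> sqrt (H (\<bar>t\<bar> - 2))"
proof -
  have S: "{x. Yp 0 x \<le> u} \<in> sets P" for u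
    using measurable_sets[OF Yp_measurable, of "{..u}" 0] by (simp add: vimage_def)
  have "min (F s) (1 - F s) \<le> H (\<bar>t\<bar> - 2)"
  proof (cases "0 \<le> s")
    case True
    have "1 - F s = measure P (space P - {x. Yp 0 x \<le> s})"
      unfolding F_eq by (rule P.prob_compl[symmetric]) (rule S)
    also have "\<dots> \<le> H (\<bar>t\<bar> - 2)" unfolding H_def
      by (intro P.finite_measure_mono H_set) (use True assms in auto)
    finally show ?thesis by simp
  next
    case False
    have "F s \<le> H (\<bar>t\<bar> - 2)" unfolding H_def F_eq
      by (intro P.finite_measure_mono H_set) (use False assms in auto)
    then show ?thesis by simp
  qed
  then show ?thesis unfolding bt_def by (rule real_sqrt_le_mono)
qed

lemma Th_le_Thb: "\<bar>s - t\<bar> \<le> 1 \<Longrightarrow> Th s \<le> Thb t"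
  unfolding Th_def Thb_def by (intro th_mono bt_nonneg bt_le) auto

lemma F_mono: "s \<le> t \<Longrightarrow> F s \<le> F t" by (rule F_increment)

lemma F_measurable [measurable]: "F \<in> borel_measurable borel"
  by (rule borel_measurable_mono) (auto simp: mono_def F_mono)

lemma kap_tendsto_0: "(\<lambda>N. kap (1 / real N)) \<longlonglongrightarrow> 0"
  unfolding kap_def
proof (rule th_tendsto_0)
  have "(\<lambda>N. sqrt (L * (1 / real N))) \<longlonglongrightarrow> sqrt (L * 0)"
    by (intro tendsto_intros lim_1_over_n)
  then show "(\<lambda>N. sqrt (L * (1 / real N))) \<longlonglongrightarrow> 0" by simp
qed (use L_nonneg in auto)

lemma kap_mono: "0 \<le> d \<Longrightarrow> d \<le> e \<Longrightarrow> kap d \<le> kap e"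
  unfolding kap_def using L_nonneg by (intro th_mono) (auto intro: mult_left_mono)

text \<open>Bounds the mean error at \<open>t\<close> of the step function with mesh
  \<open>1 / N\<close>, uniformly in \<open>n\<close>. The entry with \<open>kap\<close> makes it
  vanish for each \<open>t\<close>, since every \<open>t\<close> eventually lies in the window; the
  entry \<open>2 * Thb t\<close> is an integrable majorant.\<close>

definition bN :: "nat \<Rightarrow> real \<Rightarrow> real" where
  "bN N t = (if \<lfloor>real N * t\<rfloor> \<in> win N then min (kap (1 / real N)) (2 * Thb t) else 2 * Thb t)"

lemma bN_range: "0 \<le> bN N t" "bN N t \<le> 2 * Thb t"
  using Thb_nonneg[of t] kap_nonneg[of "1 / real N"] by (auto simp: bN_def)

lemma bN_measurable [measurable]: "bN N \<in> borel_measurable borel"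
  unfolding bN_def[abs_def] win_iff by measurable

lemma integrable_bN: "integrable lborel (bN N)"
  by (rule Bochner_Integration.integrable_bound[of lborel "\<lambda>t. 2 * Thb t"])
     (use integrable_Thb bN_range Thb_nonneg in auto)

lemma integral_bN_tendsto_0: "(\<lambda>N. \<integral>t. bN N t \<partial>lborel) \<longlonglongrightarrow> 0"
proof -
  have "(\<lambda>N. \<integral>t. bN N t \<partial>lborel) \<longlonglongrightarrow> (\<integral>t. 0 \<partial>(lborel :: real measure))"
  proof (rule integral_dominated_convergence[where w="\<lambda>t. 2 * Thb t"])
    show "AE t in lborel. (\<lambda>N. bN N t) \<longlonglongrightarrow> 0"
    proof (rule AE_I2)
      fix t
      show "(\<lambda>N. bN N t) \<longlonglongrightarrow> 0"
      proof (rule tendsto_sandwich[OF _ _ tendsto_const kap_tendsto_0])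
        show "\<forall>\<^sub>F N in sequentially. bN N t \<le> kap (1 / real N)"
          using eventually_win[of t] by eventually_elim (simp add: bN_def)
      qed (use bN_range in auto)
    qed
    show "AE t in lborel. norm (bN N t) \<le> 2 * Thb t" for N using bN_range by simp
  qed (use integrable_Thb in auto)
  then show ?thesis by simp
qed

lemma integral_abs_Z_le: "(\<integral>x. \<bar>Z n t x\<bar> \<partial>P) \<le> Th t"
proof -
  have "(\<integral>x. (Z n t x)\<^sup>2 \<partial>P) \<le> (Th t)\<^sup>2"
    using integral_Z_mult_bound[of n t t] by (simp add: power2_eq_square abs_le_iff)
  then have "sqrt (\<integral>x. (Z n t x)\<^sup>2 \<partial>P) \<le> Th t" using Th_nonneg by (intro real_le_lsqrt) auto
  then show ?thesis using integral_abs_le_sqrt[OF bm_Z, of n t] by linarith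
qed

lemma integral_abs_Z_diff_le: "(\<integral>x. \<bar>Z n t x - Z n s x\<bar> \<partial>P) \<le> min (kap \<bar>t - s\<bar>) (Th t + Th s)"
proof -
  have "sqrt (\<integral>x. (Z n t x - Z n s x)\<^sup>2 \<partial>P) \<le> kap \<bar>t - s\<bar>"
    using integral_Z_diff_sq_bound by (intro real_le_lsqrt kap_nonneg) auto
  then have 1: "(\<integral>x. \<bar>Z n t x - Z n s x\<bar> \<partial>P) \<le> kap \<bar>t - s\<bar>"
    using integral_abs_le_sqrt[OF bm_diff[OF bm_Z bm_Z], of n t n s] by linarith
  have i: "integrable P (\<lambda>x. \<bar>Z n t x\<bar>)" for t by (intro bm_integrable bm_abs bm_Z)
  have "(\<integral>x. \<bar>Z n t x - Z n s x\<bar> \<partial>P) \<le> (\<integral>x. \<bar>Z n t x\<bar> + \<bar>Z n s x\<bar> \<partial>P)"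
    using i by (intro integral_mono bm_integrable bm_abs bm_intros bm_Z) auto
  also have "\<dots> \<le> Th t + Th s" using i integral_abs_Z_le[of n t] integral_abs_Z_le[of n s] by simp
  finally show ?thesis using 1 by simp
qed

lemma emp_process_eq: "emp_process P Yp n x t = Z n t x"
proof (cases "n = 0")
  case False
  have 1: "(\<Sum>i=1..n. indicator {..t} (Yp (int i) x)) = (\<Sum>j\<in>{1..int n}. Ind a t j x)"
    unfolding Ind_def Yp_def
    by (rule sum.reindex_bij_witness[where i=nat and j=int]) auto
  have "sqrt (real n) * (S / real n - f) = (S - real n * f) / sqrt (real n)" for S f
    using False by (simp add: field_simps real_sqrt_mult_self)
  then show ?thesis
    by (simp add: emp_process_def emp_cdf_def Z_def 1[simplified] sum_subtractf F_def)
qed (simp add: emp_process_def Z_def)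

text \<open>Replacing the jump at \<open>lin a x j\<close> by one at 0 changes the function on a
  bounded interval only; afterwards both tails are tails of \<open>F\<close>, which
  \<open>Thb\<close> dominates.\<close>

lemma integrable_Ind_F: "integrable lborel (\<lambda>t. Ind a t j x - F t)"
proof -
  let ?y = "lin a x j"
  have e: "Ind a t j x = indicator {?y..} t" for t by (simp add: Ind_def indicator_def)
  have 0: "integrable lborel (\<lambda>t. indicator {0..} t - F t)"
  proof (rule Bochner_Integration.integrable_bound[OF integrable_Thb])
    show "AE t in lborel. norm (indicator {0..} t - F t) \<le> norm (Thb t)"
    proof (rule AE_I2)
      fix t
      have b: "\<bar>indicator {0..} t - F t\<bar> \<le> H (\<bar>t\<bar> - 2)"
      proof (cases "0 \<le> t")
        case True
        have S: "{x. Yp 0 x \<le> t} \<in> sets P"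
          using measurable_sets[OF Yp_measurable, of "{..t}" 0] by (simp add: vimage_def)
        have "1 - F t = measure P (space P - {x. Yp 0 x \<le> t})"
          unfolding F_eq by (rule P.prob_compl[symmetric, OF S])
        also have "\<dots> \<le> H (\<bar>t\<bar> - 2)" unfolding H_def
          by (intro P.finite_measure_mono H_set) (use True in auto)
        finally show ?thesis using True F_range[of t] by simp
      next
        case False
        have "F t \<le> H (\<bar>t\<bar> - 2)" unfolding H_def F_eq
          by (intro P.finite_measure_mono H_set) (use False in auto)
        then show ?thesis using False F_range[of t] by simp
      qed
      also have "H (\<bar>t\<bar> - 2) \<le> sqrt (H (\<bar>t\<bar> - 2))"
        using H_range[of "\<bar>t\<bar> - 2"] by (intro real_le_rsqrt) (simp add: power2_eq_square mult_left_le)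
      \<comment> \<open>The term at lag 0 alone suffices: \<open>C0 * \<bar>a 0\<bar>\<close> is at
        least 1, so the minimum there is the square root.\<close>
      also have "\<dots> \<le> Thb t"
      proof -
        have "1 / \<bar>a 0\<bar> \<le> C0" using L_nonneg by (simp add: C0_def)
        then have "1 \<le> C0 * \<bar>a 0\<bar>" using a0 by (simp add: field_simps)
        moreover have "sqrt (H (\<bar>t\<bar> - 2)) \<le> 1" using H_range by simp
        ultimately have "sqrt (H (\<bar>t\<bar> - 2)) \<le> C0 * \<bar>a 0\<bar>" by linarith
        then have "sqrt (H (\<bar>t\<bar> - 2)) = (\<Sum>k\<in>{0}. min (1 * C0 * \<bar>a k\<bar>) (sqrt (H (\<bar>t\<bar> - 2))))" by (simp add: min_absorb2)
        also have "\<dots> \<le> Thb t" unfolding Thb_def th_def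
          using H_range C0_pos by (intro sum_le_suminf th_summable) auto
        finally show ?thesis .
      qed
      finally show "norm (indicator {0..} t - F t) \<le> norm (Thb t)" using Thb_nonneg[of t] by simp
    qed
  qed measurable
  have 1: "integrable lborel (\<lambda>t. indicator {?y..} t - indicator {0..} t :: real)"
  proof (rule Bochner_Integration.integrable_bound)
    show "integrable lborel (indicator {min ?y 0..max ?y 0} :: real \<Rightarrow> real)" by simp
    show "AE t in lborel. norm (indicator {?y..} t - indicator {0..} t :: real) \<le> norm (indicator {min ?y 0..max ?y 0} t :: real)"
      by (auto simp: indicator_def)
  qed measurable
  show ?thesis unfolding e using Bochner_Integration.integrable_add[OF 1 0] by simp
qed

lemma integrable_Z: "integrable lborel (\<lambda>t. Z n t x)"
  unfolding Z_def divide_inverse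
  by (intro integrable_mult_left Bochner_Integration.integrable_sum integrable_Ind_F)

definition Zr :: "nat \<Rightarrow> (int \<Rightarrow> real) \<Rightarrow> rat \<Rightarrow> real" where
  "Zr n x r = Z n (of_rat r) x"

lemma Z_measurable_pair: "(\<lambda>(x, t). Z n t x) \<in> borel_measurable (P \<Otimes>\<^sub>M lborel)"
proof -
  have [measurable]: "(\<lambda>z. lin a (fst z) j) \<in> borel_measurable (P \<Otimes>\<^sub>M lborel)" for j by measurable
  have "(\<lambda>z. Ind a (snd z) j (fst z)) = (\<lambda>z. if lin a (fst z) j \<le> snd z then 1 else 0)" for j
    by (auto simp: Ind_def indicator_def)
  then have [measurable]: "(\<lambda>z. Ind a (snd z) j (fst z)) \<in> borel_measurable (P \<Otimes>\<^sub>M lborel)" for j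
    by simp
  show ?thesis unfolding Z_def case_prod_beta by measurable
qed

lemma integral_abs_Z_Wf_le:
  assumes N: "1 \<le> N"
  shows "(\<integral>x. \<bar>Z n t x - Wf N (Zr n x) t\<bar> \<partial>P) \<le> bN N t"
proof (cases "\<lfloor>real N * t\<rfloor> \<in> win N")
  case True
  let ?s = "of_rat (grid N \<lfloor>real N * t\<rfloor>) :: real"
  have s: "\<bar>t - ?s\<bar> \<le> 1 / real N" by (rule grid_error(1)[OF N])
  also have "\<dots> \<le> 1" using N by simp
  finally have s1: "\<bar>t - ?s\<bar> \<le> 1" .
  have "(\<integral>x. \<bar>Z n t x - Z n ?s x\<bar> \<partial>P) \<le> min (kap \<bar>t - ?s\<bar>) (Th t + Th ?s)" by (rule integral_abs_Z_diff_le)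
  also have "\<dots> \<le> min (kap (1 / real N)) (2 * Thb t)"
    using kap_mono[OF _ s] Th_le_Thb[of t t] Th_le_Thb[of ?s t] s1 by (intro min.mono) (auto simp: abs_minus_commute)
  finally show ?thesis using True by (simp add: Wf_eq bN_def Zr_def)
next
  case False
  have "(\<integral>x. \<bar>Z n t x\<bar> \<partial>P) \<le> 2 * Thb t"
    using integral_abs_Z_le[of n t] Th_le_Thb[of t t] Thb_nonneg[of t] by simp
  then show ?thesis using False by (simp add: Wf_eq bN_def)
qed

text \<open>The left side is a nonnegative integral because monotonicity then applies to the norm of
  an \<open>l1\<close>-valued difference without a measurability argument.\<close>

lemma l1_approx:
  assumes N: "1 \<le> N"
  shows "(\<integral>\<^sup>+x. ennreal (norm (abs_l1 (\<lambda>t. Z n t x) - Vf N (Zr n x))) \<partial>P) \<le> ennreal (\<integral>t. bN N t \<partial>lborel)"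
proof -
  have "norm (abs_l1 (\<lambda>t. Z n t x) - Vf N (Zr n x)) = (\<integral>t. \<bar>Z n t x - Wf N (Zr n x) t\<bar> \<partial>lborel)" for x
    using integrable_Z[of n x] integrable_Wf[OF N, of "Zr n x"]
    by (simp add: Vf_eq[OF N] diff_abs_l1 norm_abs_l1)
  then have "(\<integral>\<^sup>+x. ennreal (norm (abs_l1 (\<lambda>t. Z n t x) - Vf N (Zr n x))) \<partial>P)
     = (\<integral>\<^sup>+x. ennreal (\<integral>t. \<bar>Z n t x - Wf N (Zr n x) t\<bar> \<partial>lborel) \<partial>P)" by simp
  also have "\<dots> \<le> (\<integral>\<^sup>+t. ennreal (bN N t) \<partial>lborel)"
  proof (rule P.nn_integral_l1_swap_le)
    have "(\<lambda>(x, t). Wf N (Zr n x) t) \<in> borel_measurable (P \<Otimes>\<^sub>M lborel)"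
      unfolding Wf_def Zr_def case_prod_beta by measurable
    then show "(\<lambda>(x, t). Z n t x - Wf N (Zr n x) t) \<in> borel_measurable (P \<Otimes>\<^sub>M lborel)"
      using Z_measurable_pair[of n] unfolding case_prod_beta by (intro borel_measurable_diff)
    show "integrable lborel (\<lambda>t. Z n t x - Wf N (Zr n x) t)" for x
      by (intro Bochner_Integration.integrable_diff integrable_Z integrable_Wf N)
    show "integrable P (\<lambda>x. Z n t x - Wf N (Zr n x) t)" for t
      unfolding Wf_eq Zr_def by (cases "\<lfloor>real N * t\<rfloor> \<in> win N") (auto intro!: bm_integrable bm_diff bm_Z)
    show "(\<integral>x. \<bar>Z n t x - Wf N (Zr n x) t\<bar> \<partial>P) \<le> bN N t" for t by (rule integral_abs_Z_Wf_le[OF N])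
  qed
  also have "\<dots> = ennreal (\<integral>t. bN N t \<partial>lborel)"
    using integrable_bN bN_range by (intro nn_integral_eq_integral) auto
  finally show ?thesis .
qed

end

lemma (in prob_space) integral_abs_le_sqrt_second_moment:
  fixes X :: "'a \<Rightarrow> real"
  assumes X: "X \<in> borel_measurable M" "integrable M (\<lambda>\<omega>. (X \<omega>)\<^sup>2)"
  shows "integrable M X" "(\<integral>\<omega>. \<bar>X \<omega>\<bar> \<partial>M) \<le> sqrt (\<integral>\<omega>. (X \<omega>)\<^sup>2 \<partial>M)"
proof -
  show i: "integrable M X" by (rule square_integrable_imp_integrable[OF X])
  have "0 \<le> variance (\<lambda>\<omega>. \<bar>X \<omega>\<bar>)" by (rule variance_positive)
  also have "\<dots> = (\<integral>\<omega>. (\<bar>X \<omega>\<bar>)\<^sup>2 \<partial>M) - (\<integral>\<omega>. \<bar>X \<omega>\<bar> \<partial>M)\<^sup>2"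
    using X i by (intro variance_eq) auto
  finally show "(\<integral>\<omega>. \<bar>X \<omega>\<bar> \<partial>M) \<le> sqrt (\<integral>\<omega>. (X \<omega>)\<^sup>2 \<partial>M)"
    by (intro real_le_rsqrt) simp
qed

lemma integrable_tensor:
  fixes u w :: "real \<Rightarrow> real"
  assumes u: "integrable lborel u" and w: "integrable lborel w"
  shows "integrable (lborel \<Otimes>\<^sub>M lborel) (\<lambda>(s, t). u s * w t)"
    and "(\<integral>(s, t). u s * w t \<partial>(lborel \<Otimes>\<^sub>M lborel)) = (\<integral>s. u s \<partial>lborel) * (\<integral>t. w t \<partial>lborel)"
proof -
  have [measurable]: "u \<in> borel_measurable borel" "w \<in> borel_measurable borel"
    using borel_measurable_integrable[OF u] borel_measurable_integrable[OF w] by auto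
  show i: "integrable (lborel \<Otimes>\<^sub>M lborel) (\<lambda>(s, t). u s * w t)"
  proof (rule lborel_pair.Fubini_integrable)
    show "integrable lborel (\<lambda>s. \<integral>t. norm (case (s, t) of (s, t) \<Rightarrow> u s * w t) \<partial>lborel)"
      using u w by (simp add: abs_mult)
    show "AE s in lborel. integrable lborel (\<lambda>t. case (s, t) of (s, t) \<Rightarrow> u s * w t)"
      using w by simp
  qed measurable
  show "(\<integral>(s, t). u s * w t \<partial>(lborel \<Otimes>\<^sub>M lborel)) = (\<integral>s. u s \<partial>lborel) * (\<integral>t. w t \<partial>lborel)"
    using lborel_pair.integral_fst'[OF i] by simp
qed

section \<open>A Gaussian process on the rationals with covariance \<open>C\<close>\<close>

context lin_proc_q
begin

text \<open>\<open>from_nat\<close> is total, so this is positive semidefinite on all of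
  \<open>nat\<close> even where several indices name the same rational.\<close>

definition Gam :: "nat \<Rightarrow> nat \<Rightarrow> real" where
  "Gam i j = C (of_rat (from_nat i)) (of_rat (from_nat j))"

definition xi :: "(nat \<Rightarrow> real) \<Rightarrow> rat \<Rightarrow> real" where
  "xi \<omega> r = gseq Gam (to_nat r) \<omega>"

lemma psd_Gam: "psd Gam"
  unfolding psd_def Gam_def
proof (intro conjI allI impI)
  show "C (of_rat (from_nat i)) (of_rat (from_nat j)) = C (of_rat (from_nat j)) (of_rat (from_nat i))" for i j :: nat
    by (rule C_sym)
  show "0 \<le> (\<Sum>i\<in>I. \<Sum>j\<in>I. c i * c j * C (of_rat (from_nat i)) (of_rat (from_nat j)))" for I :: "nat set" and c
    by (rule C_psd)
qed

lemma Gam_to_nat: "Gam (to_nat q) (to_nat r) = C (of_rat q) (of_rat r)"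
  by (simp add: Gam_def)

lemma char_xi:
  assumes "finite I"
  shows "(\<integral>\<omega>. iexp (\<Sum>i\<in>I. c i * xi \<omega> (q i)) \<partial>noise)
     = complex_of_real (exp (- (\<Sum>i\<in>I. \<Sum>j\<in>I. c i * c j * C (of_rat (q i)) (of_rat (q j))) / 2))"
  unfolding xi_def using char_gseq[OF psd_Gam assms, of c "\<lambda>i. to_nat (q i)"] by (simp only: Gam_to_nat)

lemma xi_measurable: "(\<lambda>\<omega>. xi \<omega> r) \<in> borel_measurable noise"
  unfolding xi_def by (rule gseq_measurable)

lemma xi_borel: "xi \<in> borel_measurable noise"
  by (rule measurable_coordinatewise_then_product) (rule xi_measurable)

lemma xi_sq: "integrable noise (\<lambda>\<omega>. (xi \<omega> r)\<^sup>2)" "(\<integral>\<omega>. (xi \<omega> r)\<^sup>2 \<partial>noise) = C (of_rat r) (of_rat r)"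
  using gseq_comb_moment(1,2)[OF psd_Gam, of "{r}" "\<lambda>_. 1" to_nat] by (simp_all add: xi_def Gam_to_nat)

lemma xi_diff_sq:
  "integrable noise (\<lambda>\<omega>. (xi \<omega> r - xi \<omega> s)\<^sup>2)"
  "(\<integral>\<omega>. (xi \<omega> r - xi \<omega> s)\<^sup>2 \<partial>noise) = C (of_rat r) (of_rat r) - 2 * C (of_rat s) (of_rat r) + C (of_rat s) (of_rat s)"
proof -
  have *: "integrable noise (\<lambda>\<omega>. (xi \<omega> r - xi \<omega> s)\<^sup>2) \<and>
    (\<integral>\<omega>. (xi \<omega> r - xi \<omega> s)\<^sup>2 \<partial>noise) = C (of_rat r) (of_rat r) - 2 * C (of_rat s) (of_rat r) + C (of_rat s) (of_rat s)"
  proof (cases "r = s")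
    case True
    then show ?thesis by simp
  next
    case False
    let ?c = "\<lambda>i. if i = r then 1 else - 1 :: real"
    have e: "(\<Sum>i\<in>{r, s}. ?c i * gseq Gam (to_nat i) \<omega>) = xi \<omega> r - xi \<omega> s" for \<omega>
      using False by (auto simp: xi_def)
    have m: "(\<Sum>i\<in>{r, s}. \<Sum>j\<in>{r, s}. ?c i * ?c j * Gam (to_nat i) (to_nat j))
       = C (of_rat r) (of_rat r) - 2 * C (of_rat s) (of_rat r) + C (of_rat s) (of_rat s)"
      using False C_sym[of "of_rat r" "of_rat s"] by (auto simp: Gam_to_nat)
    show ?thesis
      using gseq_comb_moment(1,2)[OF psd_Gam, of "{r, s}" ?c to_nat] unfolding e m by simp
  qed
  then show "integrable noise (\<lambda>\<omega>. (xi \<omega> r - xi \<omega> s)\<^sup>2)"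
    "(\<integral>\<omega>. (xi \<omega> r - xi \<omega> s)\<^sup>2 \<partial>noise) = C (of_rat r) (of_rat r) - 2 * C (of_rat s) (of_rat r) + C (of_rat s) (of_rat s)"
    by auto
qed

sublocale Q: prob_space noise by (rule prob_space_noise)

lemma integrable_xi: "integrable noise (\<lambda>\<omega>. xi \<omega> r)"
  by (rule Q.integral_abs_le_sqrt_second_moment(1)[OF xi_measurable xi_sq(1)])

lemma integral_abs_xi_le: "(\<integral>\<omega>. \<bar>xi \<omega> r\<bar> \<partial>noise) \<le> Th (of_rat r)"
proof -
  have "sqrt (C (of_rat r) (of_rat r)) \<le> Th (of_rat r)"
    using C_bound[of "of_rat r" "of_rat r"] by (intro real_le_lsqrt Th_nonneg) (simp add: power2_eq_square abs_le_iff)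
  then show ?thesis
    using Q.integral_abs_le_sqrt_second_moment(2)[OF xi_measurable xi_sq(1), of r] by (simp add: xi_sq)
qed

lemma integral_abs_xi_diff_le:
  "(\<integral>\<omega>. \<bar>xi \<omega> r - xi \<omega> s\<bar> \<partial>noise) \<le> min (kap \<bar>of_rat r - of_rat s\<bar>) (Th (of_rat r) + Th (of_rat s))"
proof -
  have "sqrt (C (of_rat r) (of_rat r) - 2 * C (of_rat s) (of_rat r) + C (of_rat s) (of_rat s)) \<le> kap \<bar>of_rat r - of_rat s\<bar>"
    using C_increment_bound by (intro real_le_lsqrt kap_nonneg) auto
  then have 1: "(\<integral>\<omega>. \<bar>xi \<omega> r - xi \<omega> s\<bar> \<partial>noise) \<le> kap \<bar>of_rat r - of_rat s\<bar>"
    using Q.integral_abs_le_sqrt_second_moment(2)[OF borel_measurable_diff[OF xi_measurable xi_measurable] xi_diff_sq(1), of r s]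
    by (simp add: xi_diff_sq(2))
  have "(\<integral>\<omega>. \<bar>xi \<omega> r - xi \<omega> s\<bar> \<partial>noise) \<le> (\<integral>\<omega>. \<bar>xi \<omega> r\<bar> + \<bar>xi \<omega> s\<bar> \<partial>noise)"
    using integrable_xi by (intro integral_mono) auto
  also have "\<dots> \<le> Th (of_rat r) + Th (of_rat s)"
    using integrable_xi integral_abs_xi_le[of r] integral_abs_xi_le[of s] by simp
  finally show ?thesis using 1 by simp
qed

lemma cf_convergence: "cf_convergence P noise Zr xi"
proof
  show "(\<lambda>\<omega>. Zr n \<omega> i) \<in> borel_measurable P" for n i unfolding Zr_def by measurable
  show "(\<lambda>\<omega>. xi \<omega> i) \<in> borel_measurable noise" for i by (rule xi_measurable)
  show "integrable noise (\<lambda>\<omega>. (xi \<omega> i)\<^sup>2)" for i by (rule xi_sq)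
  show "\<exists>B. \<forall>n. integrable P (\<lambda>\<omega>. (Zr n \<omega> i)\<^sup>2) \<and> (\<integral>\<omega>. (Zr n \<omega> i)\<^sup>2 \<partial>P) \<le> B" for i
  proof (intro exI allI conjI)
    fix n
    show "integrable P (\<lambda>\<omega>. (Zr n \<omega> i)\<^sup>2)"
      unfolding Zr_def power2_eq_square by (intro bm_integrable bm_mult bm_Z)
    show "(\<integral>\<omega>. (Zr n \<omega> i)\<^sup>2 \<partial>P) \<le> Th (of_rat i) * Th (of_rat i)"
      unfolding Zr_def power2_eq_square by (rule abs_le_D1[OF integral_Z_mult_bound])
  qed
  fix I :: "rat set" and c :: "rat \<Rightarrow> real" assume I: "finite I"
  \<comment> \<open>The limiting variance \<open>comb.s2\<close> is the quadratic form of
    \<open>C\<close>, which is also the exponent in the characteristic function of the Gaussian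
    combination.\<close>
  interpret comb: lin_proc_comb D a K I c of_rat
    by unfold_locales (rule I)
  have "(\<integral>\<omega>. iexp (\<Sum>i\<in>I. c i * xi \<omega> i) \<partial>noise) = complex_of_real (exp (- comb.s2 / 2))"
    using char_xi[OF I, of c "\<lambda>i. i"] by (simp only: comb.s2_def)
  then show "(\<lambda>n. \<integral>\<omega>. iexp (\<Sum>i\<in>I. c i * Zr n \<omega> i) \<partial>P) \<longlonglongrightarrow> (\<integral>\<omega>. iexp (\<Sum>i\<in>I. c i * xi \<omega> i) \<partial>noise)"
    using comb.char_Zc_tendsto unfolding comb.Zc_def Zr_def by (simp only:)
qed

subsection \<open>The Gaussian limit\<close>

text \<open>Both grid points lie to the left of \<open>t\<close>, the coarser at distance at most
  \<open>1 / N\<close>, the finer no further away than its own mesh; so they are within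
  \<open>1 / N\<close> of each other and the bound \<open>bN N\<close> of the empirical process
  serves again.\<close>

lemma integral_abs_Wf_diff_le:
  assumes N: "1 \<le> N" "N \<le> M"
  shows "(\<integral>\<omega>. \<bar>Wf M (xi \<omega>) t - Wf N (xi \<omega>) t\<bar> \<partial>noise) \<le> bN N t"
proof (cases "\<lfloor>real M * t\<rfloor> \<in> win M")
  case M: True
  let ?r = "grid M \<lfloor>real M * t\<rfloor>" and ?s = "grid N \<lfloor>real N * t\<rfloor>"
  have r: "\<bar>t - of_rat ?r\<bar> \<le> 1 / real M" "of_rat ?r \<le> t" using N by (auto intro: grid_error)
  have s: "\<bar>t - of_rat ?s\<bar> \<le> 1 / real N" "of_rat ?s \<le> t" using N by (auto intro: grid_error)
  have "1 / real M \<le> 1 / real N" "1 / real N \<le> 1" using N by (auto simp: frac_le)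
  then have d: "\<bar>of_rat ?r - of_rat ?s\<bar> \<le> 1 / real N" and r1: "\<bar>of_rat ?r - t\<bar> \<le> 1" and s1: "\<bar>of_rat ?s - t\<bar> \<le> 1"
    using r s by (auto simp: abs_le_iff)
  show ?thesis
  proof (cases "\<lfloor>real N * t\<rfloor> \<in> win N")
    case True
    have "(\<integral>\<omega>. \<bar>xi \<omega> ?r - xi \<omega> ?s\<bar> \<partial>noise) \<le> min (kap \<bar>of_rat ?r - of_rat ?s\<bar>) (Th (of_rat ?r) + Th (of_rat ?s))"
      by (rule integral_abs_xi_diff_le)
    also have "\<dots> \<le> min (kap (1 / real N)) (2 * Thb t)"
      using kap_mono[OF _ d] Th_le_Thb[OF r1] Th_le_Thb[OF s1] by (intro min.mono) auto
    finally show ?thesis using True M by (simp add: Wf_eq bN_def)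
  next
    case False
    then show ?thesis
      using M integral_abs_xi_le[of ?r] Th_le_Thb[OF r1] Thb_nonneg[of t] by (simp add: Wf_eq bN_def)
  qed
next
  case False
  then have "\<lfloor>real N * t\<rfloor> \<notin> win N" using win_mono[OF N(2) _ N(1)] by blast
  with False show ?thesis using bN_range(1)[of N t] by (simp add: Wf_eq)
qed

lemma nn_integral_Vf_diff_le:
  assumes N: "1 \<le> N" "N \<le> M"
  shows "(\<integral>\<^sup>+\<omega>. ennreal (norm (Vf M (xi \<omega>) - Vf N (xi \<omega>))) \<partial>noise) \<le> ennreal (\<integral>t. bN N t \<partial>lborel)"
proof -
  have M: "1 \<le> M" using N by simp
  have "norm (Vf M (xi \<omega>) - Vf N (xi \<omega>)) = (\<integral>t. \<bar>Wf M (xi \<omega>) t - Wf N (xi \<omega>) t\<bar> \<partial>lborel)" for \<omega>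
    using integrable_Wf[OF N(1), of "xi \<omega>"] integrable_Wf[OF M, of "xi \<omega>"]
    by (simp add: Vf_eq[OF N(1)] Vf_eq[OF M] diff_abs_l1 norm_abs_l1)
  then have "(\<integral>\<^sup>+\<omega>. ennreal (norm (Vf M (xi \<omega>) - Vf N (xi \<omega>))) \<partial>noise)
     = (\<integral>\<^sup>+\<omega>. ennreal (\<integral>t. \<bar>Wf M (xi \<omega>) t - Wf N (xi \<omega>) t\<bar> \<partial>lborel) \<partial>noise)" by simp
  also have "\<dots> \<le> (\<integral>\<^sup>+t. ennreal (bN N t) \<partial>lborel)"
  proof (rule Q.nn_integral_l1_swap_le)
    have xm: "(\<lambda>z. xi (fst z) r) \<in> borel_measurable (noise \<Otimes>\<^sub>M lborel)" for r
      by (rule measurable_compose[OF measurable_fst xi_measurable])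
    have "(\<lambda>(\<omega>, t). Wf n (xi \<omega>) t) \<in> borel_measurable (noise \<Otimes>\<^sub>M lborel)" for n
      unfolding Wf_def case_prod_beta
      by (intro borel_measurable_sum borel_measurable_times xm) measurable
    then show "(\<lambda>(\<omega>, t). Wf M (xi \<omega>) t - Wf N (xi \<omega>) t) \<in> borel_measurable (noise \<Otimes>\<^sub>M lborel)"
      unfolding case_prod_beta by (intro borel_measurable_diff)
    show "integrable lborel (\<lambda>t. Wf M (xi \<omega>) t - Wf N (xi \<omega>) t)" for \<omega>
      by (intro Bochner_Integration.integrable_diff integrable_Wf N M)
    show "integrable noise (\<lambda>\<omega>. Wf M (xi \<omega>) t - Wf N (xi \<omega>) t)" for t
      unfolding Wf_def by (intro Bochner_Integration.integrable_diff Bochner_Integration.integrable_sum integrable_mult_left integrable_xi)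
    show "(\<integral>\<omega>. \<bar>Wf M (xi \<omega>) t - Wf N (xi \<omega>) t\<bar> \<partial>noise) \<le> bN N t" for t by (rule integral_abs_Wf_diff_le[OF N])
  qed
  also have "\<dots> = ennreal (\<integral>t. bN N t \<partial>lborel)"
    using integrable_bN bN_range by (intro nn_integral_eq_integral) auto
  finally show ?thesis .
qed

lemma Vf_xi_measurable: "(\<lambda>\<omega>. Vf N (xi \<omega>)) \<in> borel_measurable noise"
  by (rule measurable_compose[OF xi_borel borel_measurable_continuous_onI[OF continuous_Vf]])

text \<open>Along a sparse sequence of meshes the expected increments of the step functions are at
  most \<open>(1/2) ^ j\<close>. They are therefore almost surely summable in norm, and completeness
  gives a limit.\<close>

lemma Gaussian_limit_exists:
  obtains G :: "(nat \<Rightarrow> real) \<Rightarrow> l1" and r :: "nat \<Rightarrow> nat"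
  where "G \<in> borel_measurable noise" "\<And>j. 1 \<le> r j" "filterlim r at_top sequentially"
    "AE \<omega> in noise. (\<lambda>j. Vf (r j) (xi \<omega>)) \<longlonglongrightarrow> G \<omega>"
proof -
  have "\<forall>j. \<exists>N0. \<forall>N\<ge>N0. (\<integral>t. bN N t \<partial>lborel) \<le> (1/2) ^ j"
  proof
    fix j :: nat
    have "\<forall>\<^sub>F N in sequentially. (\<integral>t. bN N t \<partial>lborel) < (1/2) ^ j"
      using integral_bN_tendsto_0 by (intro order_tendstoD(2)) auto
    then show "\<exists>N0. \<forall>N\<ge>N0. (\<integral>t. bN N t \<partial>lborel) \<le> (1/2) ^ j"
      by (auto simp: eventually_sequentially intro: less_imp_le)
  qed
  then obtain N0 where N0: "\<And>j N. N \<ge> N0 j \<Longrightarrow> (\<integral>t. bN N t \<partial>lborel) \<le> (1/2) ^ j" by metis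
  \<comment> \<open>The sum exceeds each \<open>N0 j\<close> and is monotone in \<open>j\<close>;
    the summand \<open>j + 1\<close> makes \<open>r\<close> positive and divergent.\<close>
  define r where "r j = j + 1 + (\<Sum>i\<le>j. N0 i)" for j
  have r1: "1 \<le> r j" and rS: "r j \<le> r (Suc j)" for j by (auto simp: r_def)
  have r0: "N0 j \<le> r j" for j
    unfolding r_def by (rule order_trans[OF member_le_sum[of j "{..j}" N0]]) auto
  have rlim: "filterlim r at_top sequentially"
    by (rule filterlim_at_top_mono[OF filterlim_ident]) (simp add: r_def)
  define g where "g j \<omega> = Vf (r j) (xi \<omega>)" for j \<omega>
  define d where "d j \<omega> = norm (g (Suc j) \<omega> - g j \<omega>)" for j \<omega>
  have gm: "g j \<in> borel_measurable noise" for j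
    unfolding g_def[abs_def] by (rule Vf_xi_measurable)
  \<comment> \<open>Measurability goes through a continuous function of the coordinates; subtracting
    measurable maps into \<open>l1\<close> would call for separability.\<close>
  have dm [measurable]: "d j \<in> borel_measurable noise" for j
  proof -
    have "continuous_on UNIV (\<lambda>x. norm (Vf (r (Suc j)) x - Vf (r j) x))"
      by (intro continuous_intros continuous_Vf)
    from measurable_compose[OF xi_borel borel_measurable_continuous_onI[OF this]]
    show ?thesis by (simp add: d_def[abs_def] g_def)
  qed
  have "(\<integral>\<^sup>+\<omega>. (\<Sum>j. ennreal (d j \<omega>)) \<partial>noise) = (\<Sum>j. \<integral>\<^sup>+\<omega>. ennreal (d j \<omega>) \<partial>noise)"
    by (rule nn_integral_suminf) measurable
  also have "\<dots> \<le> (\<Sum>j. ennreal ((1/2) ^ j))"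
  proof (rule suminf_le)
    fix j
    have "(\<integral>\<^sup>+\<omega>. ennreal (d j \<omega>) \<partial>noise) \<le> ennreal (\<integral>t. bN (r j) t \<partial>lborel)"
      unfolding d_def g_def by (rule nn_integral_Vf_diff_le[OF r1 rS])
    also have "\<dots> \<le> ennreal ((1/2) ^ j)" by (rule ennreal_leI[OF N0[OF r0]])
    finally show "(\<integral>\<^sup>+\<omega>. ennreal (d j \<omega>) \<partial>noise) \<le> ennreal ((1/2) ^ j)" .
  qed auto
  also have "\<dots> = ennreal (\<Sum>j. (1/2) ^ j)" by (rule suminf_ennreal2) (auto intro: summable_geometric)
  also have "\<dots> < \<infinity>" by simp
  finally have fin: "(\<integral>\<^sup>+\<omega>. (\<Sum>j. ennreal (d j \<omega>)) \<partial>noise) \<noteq> \<infinity>" by simp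
  define A where "A = {\<omega> \<in> space noise. (\<Sum>j. ennreal (d j \<omega>)) \<noteq> \<infinity>}"
  have A: "A \<in> sets noise" unfolding A_def by measurable
  have aeA: "AE \<omega> in noise. \<omega> \<in> A"
    using nn_integral_noteq_infinite[OF _ fin] AE_space by (auto simp: A_def elim!: eventually_elim2)
  have conv: "convergent (\<lambda>j. g j \<omega>)" if "\<omega> \<in> A" for \<omega>
  proof -
    have "summable (\<lambda>j. d j \<omega>)"
      using that unfolding A_def by (intro summable_suminf_not_top) (auto simp: d_def)
    then have "summable (\<lambda>j. g (Suc j) \<omega> - g j \<omega>)" unfolding d_def by (rule l1_complete)
    then have "convergent (\<lambda>n. \<Sum>j<n. g (Suc j) \<omega> - g j \<omega>)" by (simp add: summable_iff_convergent)
    moreover have "(\<Sum>j<n. g (Suc j) \<omega> - g j \<omega>) = g n \<omega> - g 0 \<omega>" for n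
      by (induction n) auto
    ultimately have "convergent (\<lambda>n. g n \<omega> - g 0 \<omega>)" by simp
    from convergent_add[OF this convergent_const[of "g 0 \<omega>"]] show ?thesis by simp
  qed
  \<comment> \<open>The value 0 off \<open>A\<close> makes \<open>G\<close> a limit of measurable
    maps at every point, not merely almost everywhere.\<close>
  define G where "G \<omega> = (if \<omega> \<in> A then lim (\<lambda>j. g j \<omega>) else 0)" for \<omega>
  have lim: "(\<lambda>j. if \<omega> \<in> A then g j \<omega> else 0) \<longlonglongrightarrow> G \<omega>" for \<omega>
    using conv[of \<omega>] by (simp add: G_def convergent_LIMSEQ_iff)
  have Gm: "G \<in> borel_measurable noise"
  proof (rule borel_measurable_LIMSEQ_metric)
    show "(\<lambda>\<omega>. if \<omega> \<in> A then g j \<omega> else 0) \<in> borel_measurable noise" for j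
      using A gm by (intro measurable_If_set) auto
    show "(\<lambda>j. if \<omega> \<in> A then g j \<omega> else 0) \<longlonglongrightarrow> G \<omega>" for \<omega> by (rule lim)
  qed
  have "AE \<omega> in noise. (\<lambda>j. Vf (r j) (xi \<omega>)) \<longlonglongrightarrow> G \<omega>"
    using aeA
  proof eventually_elim
    case (elim \<omega>)
    then show ?case using lim[of \<omega>] by (simp add: g_def)
  qed
  then show ?thesis using that[OF Gm r1 rlim] by blast
qed

subsection \<open>The covariance of the limit\<close>

definition CN :: "nat \<Rightarrow> real \<Rightarrow> real \<Rightarrow> real" where
  "CN N s t = (\<Sum>i\<in>win N. \<Sum>j\<in>win N. C (of_rat (grid N i)) (of_rat (grid N j)) * (indicator (cell N i) s * indicator (cell N j) t))"

lemma CN_eq: "CN N s t = (if \<lfloor>real N * s\<rfloor> \<in> win N \<and> \<lfloor>real N * t\<rfloor> \<in> win N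
   then C (of_rat (grid N \<lfloor>real N * s\<rfloor>)) (of_rat (grid N \<lfloor>real N * t\<rfloor>)) else 0)"
proof -
  have "CN N s t = (\<Sum>i\<in>win N. if i = \<lfloor>real N * s\<rfloor> then (\<Sum>j\<in>win N. if j = \<lfloor>real N * t\<rfloor> then C (of_rat (grid N i)) (of_rat (grid N j)) else 0) else 0)"
    unfolding CN_def by (intro sum.cong refl) (auto simp: cell_def indicator_def intro!: sum.cong sum.neutral)
  then show ?thesis using finite_win by simp
qed

lemma CN_measurable [measurable]: "(\<lambda>(s, t). CN N s t) \<in> borel_measurable (lborel \<Otimes>\<^sub>M lborel)"
  unfolding CN_def case_prod_beta by measurable

lemma CN_bound: assumes "1 \<le> N" shows "\<bar>CN N s t\<bar> \<le> Thb s * Thb t"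
proof -
  have *: "Th (of_rat (grid N \<lfloor>real N * u\<rfloor>)) \<le> Thb u" for u
  proof (rule Th_le_Thb)
    have "1 / real N \<le> 1" using assms by simp
    with grid_error(1)[OF assms, of u] show "\<bar>of_rat (grid N \<lfloor>real N * u\<rfloor>) - u\<bar> \<le> 1"
      by (simp add: abs_minus_commute)
  qed
  have "\<bar>C (of_rat (grid N \<lfloor>real N * s\<rfloor>)) (of_rat (grid N \<lfloor>real N * t\<rfloor>))\<bar> \<le> Thb s * Thb t"
    by (rule order_trans[OF C_bound mult_mono[OF * *]]) (auto intro: Th_nonneg Thb_nonneg)
  then show ?thesis using Thb_nonneg by (simp add: CN_eq)
qed

text \<open>The arguments are moved to the grid one at a time, each at a cost of
  \<open>kap (1 / real N)\<close>; symmetry of \<open>C\<close> reduces the second move to the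
  first.\<close>

lemma CN_tendsto: "(\<lambda>N. CN N s t) \<longlonglongrightarrow> C s t"
proof (rule LIM_zero_cancel, rule Lim_null_comparison)
  show "(\<lambda>N. kap (1 / real N) * (Thb t + Th s)) \<longlonglongrightarrow> 0"
    by (rule tendsto_mult_left_zero[OF kap_tendsto_0])
  show "\<forall>\<^sub>F N in sequentially. norm (CN N s t - C s t) \<le> kap (1 / real N) * (Thb t + Th s)"
    using eventually_win[of s] eventually_win[of t] eventually_ge_at_top[of 1]
  proof eventually_elim
    case (elim N)
    let ?s = "of_rat (grid N \<lfloor>real N * s\<rfloor>) :: real" and ?t = "of_rat (grid N \<lfloor>real N * t\<rfloor>) :: real"
    have s: "\<bar>s - ?s\<bar> \<le> 1 / real N" and t: "\<bar>t - ?t\<bar> \<le> 1 / real N"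
      using grid_error(1)[OF elim(3)] by auto
    have "1 / real N \<le> 1" using elim(3) by simp
    with t have t1: "\<bar>?t - t\<bar> \<le> 1" by (simp add: abs_minus_commute)
    have "\<bar>C s ?t - C ?s ?t\<bar> \<le> kap (1 / real N) * Thb t"
      by (rule order_trans[OF C_diff_bound mult_mono[OF kap_mono[OF _ s] Th_le_Thb[OF t1]]]) (auto intro: kap_nonneg Th_nonneg)
    moreover have "\<bar>C t s - C ?t s\<bar> \<le> kap (1 / real N) * Th s"
      by (rule order_trans[OF C_diff_bound mult_right_mono[OF kap_mono[OF _ t]]]) (auto intro: Th_nonneg)
    ultimately show ?case
      using elim C_sym[of t s] C_sym[of ?t s] by (simp add: CN_eq distrib_left)
  qed
qed

text \<open>Joint measurability comes from the step functions \<open>CN\<close> and needs no look at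
  the series that defines \<open>C\<close>.\<close>

lemma C_measurable [measurable]: "(\<lambda>(s, t). C s t) \<in> borel_measurable (lborel \<Otimes>\<^sub>M lborel)"
proof (rule borel_measurable_LIMSEQ_real)
  show "(\<lambda>N. case z of (s, t) \<Rightarrow> CN N s t) \<longlonglongrightarrow> (case z of (s, t) \<Rightarrow> C s t)" for z
    by (cases z) (simp add: CN_tendsto)
qed (rule CN_measurable)

lemma C_le_Thb: "\<bar>C s t\<bar> \<le> Thb s * Thb t"
  by (rule order_trans[OF C_bound mult_mono[OF Th_le_Thb Th_le_Thb]]) (auto intro: Th_nonneg Thb_nonneg)

lemma integrable_envelope2:
  assumes "f \<in> L_infty" "g \<in> L_infty"
  shows "integrable (lborel \<Otimes>\<^sub>M lborel) (\<lambda>(s, t). \<bar>f s * Thb s\<bar> * \<bar>g t * Thb t\<bar>)"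
  using assms by (intro integrable_tensor(1) integrable_abs integrable_L_infty_mult integrable_Thb)

lemma L_infty_measurable_pair:
  assumes "f \<in> L_infty" "g \<in> L_infty"
  shows "(\<lambda>(s, t). f s * g t) \<in> borel_measurable (lborel \<Otimes>\<^sub>M lborel)"
proof -
  have [measurable]: "f \<in> borel_measurable borel" "g \<in> borel_measurable borel"
    using assms by (auto simp: L_infty_def)
  show ?thesis by measurable
qed

lemma integrable_C:
  assumes fg: "f \<in> L_infty" "g \<in> L_infty"
  shows "integrable (lborel \<Otimes>\<^sub>M lborel) (\<lambda>(s, t). f s * g t * C s t)"
proof (rule Bochner_Integration.integrable_bound[OF integrable_envelope2[OF fg]])
  show "(\<lambda>(s, t). f s * g t * C s t) \<in> borel_measurable (lborel \<Otimes>\<^sub>M lborel)"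
    using borel_measurable_times[OF L_infty_measurable_pair[OF fg] C_measurable] by (simp add: case_prod_beta)
  show "AE z in lborel \<Otimes>\<^sub>M lborel. norm (case z of (s, t) \<Rightarrow> f s * g t * C s t) \<le> norm (case z of (s, t) \<Rightarrow> \<bar>f s * Thb s\<bar> * \<bar>g t * Thb t\<bar>)"
  proof (rule AE_I2, clarify)
    fix s t
    have "\<bar>f s * g t\<bar> * \<bar>C s t\<bar> \<le> \<bar>f s * g t\<bar> * (Thb s * Thb t)" by (intro mult_left_mono C_le_Thb) auto
    then show "norm (f s * g t * C s t) \<le> norm (\<bar>f s * Thb s\<bar> * \<bar>g t * Thb t\<bar>)"
      using Thb_nonneg[of s] Thb_nonneg[of t] by (simp add: abs_mult mult_ac)
  qed
qed

text \<open>The covariance form of the theorem.\<close>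

definition BF :: "(real \<Rightarrow> real) \<Rightarrow> (real \<Rightarrow> real) \<Rightarrow> real" where
  "BF f g = (\<integral>(s, t). f s * g t * C s t \<partial>(lborel \<Otimes>\<^sub>M lborel))"

lemma integral_CN_tendsto:
  assumes f: "f \<in> L_infty" and r: "filterlim r at_top sequentially" "\<And>j. 1 \<le> r j"
  shows "(\<lambda>j. \<integral>(s, t). f s * f t * CN (r j) s t \<partial>(lborel \<Otimes>\<^sub>M lborel)) \<longlonglongrightarrow> BF f f"
  unfolding BF_def
proof (rule integral_dominated_convergence[where w="\<lambda>(s, t). \<bar>f s * Thb s\<bar> * \<bar>f t * Thb t\<bar>"])
  show "(\<lambda>(s, t). f s * f t * C s t) \<in> borel_measurable (lborel \<Otimes>\<^sub>M lborel)"
    by (rule borel_measurable_integrable[OF integrable_C[OF f f]])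
  show "(\<lambda>(s, t). f s * f t * CN (r j) s t) \<in> borel_measurable (lborel \<Otimes>\<^sub>M lborel)" for j
    using borel_measurable_times[OF L_infty_measurable_pair[OF f f] CN_measurable] by (simp add: case_prod_beta)
  show "integrable (lborel \<Otimes>\<^sub>M lborel) (\<lambda>(s, t). \<bar>f s * Thb s\<bar> * \<bar>f t * Thb t\<bar>)" by (rule integrable_envelope2[OF f f])
  show "AE z in lborel \<Otimes>\<^sub>M lborel. (\<lambda>j. case z of (s, t) \<Rightarrow> f s * f t * CN (r j) s t) \<longlonglongrightarrow> (case z of (s, t) \<Rightarrow> f s * f t * C s t)"
  proof (rule AE_I2, clarify)
    fix s t
    show "(\<lambda>j. f s * f t * CN (r j) s t) \<longlonglongrightarrow> f s * f t * C s t"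
      by (intro tendsto_mult tendsto_const filterlim_compose[OF CN_tendsto r(1)])
  qed
  show "AE z in lborel \<Otimes>\<^sub>M lborel. norm (case z of (s, t) \<Rightarrow> f s * f t * CN (r j) s t) \<le> (case z of (s, t) \<Rightarrow> \<bar>f s * Thb s\<bar> * \<bar>f t * Thb t\<bar>)" for j
  proof (rule AE_I2, clarify)
    fix s t
    have "\<bar>f s * f t\<bar> * \<bar>CN (r j) s t\<bar> \<le> \<bar>f s * f t\<bar> * (Thb s * Thb t)" by (intro mult_left_mono CN_bound r) auto
    then show "norm (f s * f t * CN (r j) s t) \<le> \<bar>f s * Thb s\<bar> * \<bar>f t * Thb t\<bar>"
      using Thb_nonneg[of s] Thb_nonneg[of t] by (simp add: abs_mult mult_ac)
  qed
qed

text \<open>On a step function \<open>f\<close> acts only through its integrals \<open>w\<close>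
  over the cells, so the double integral is the quadratic form of \<open>C\<close> at the grid
  points: the variance of the pairing with \<open>Vf N (xi \<omega>)\<close>.\<close>

lemma integral_CN:
  assumes f: "f \<in> L_infty" and N: "1 \<le> N"
  defines "w \<equiv> \<lambda>i. \<integral>t. f t * indicator (cell N i) t \<partial>lborel"
  shows "(\<integral>(s, t). f s * f t * CN N s t \<partial>(lborel \<Otimes>\<^sub>M lborel))
     = (\<Sum>i\<in>win N. \<Sum>j\<in>win N. w i * w j * C (of_rat (grid N i)) (of_rat (grid N j)))"
proof -
  let ?u = "\<lambda>i t. f t * indicator (cell N i) t"
  let ?c = "\<lambda>i j. C (of_rat (grid N i)) (of_rat (grid N j))"
  have u: "integrable lborel (?u i)" for i by (intro integrable_L_infty_mult f integrable_cell N)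
  note t = integrable_tensor[OF u u]
  have "(\<lambda>(s, t). f s * f t * CN N s t) = (\<lambda>z. \<Sum>i\<in>win N. \<Sum>j\<in>win N. ?c i j * (case z of (s, t) \<Rightarrow> ?u i s * ?u j t))"
    by (auto simp: CN_def sum_distrib_left mult_ac intro!: sum.cong)
  then have "(\<integral>(s, t). f s * f t * CN N s t \<partial>(lborel \<Otimes>\<^sub>M lborel))
    = (\<integral>z. (\<Sum>i\<in>win N. \<Sum>j\<in>win N. ?c i j * (case z of (s, t) \<Rightarrow> ?u i s * ?u j t)) \<partial>(lborel \<Otimes>\<^sub>M lborel))" by simp
  also have "\<dots> = (\<Sum>i\<in>win N. \<integral>z. (\<Sum>j\<in>win N. ?c i j * (case z of (s, t) \<Rightarrow> ?u i s * ?u j t)) \<partial>(lborel \<Otimes>\<^sub>M lborel))"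
    by (intro Bochner_Integration.integral_sum Bochner_Integration.integrable_sum integrable_mult_right t)
  also have "\<dots> = (\<Sum>i\<in>win N. \<Sum>j\<in>win N. \<integral>z. ?c i j * (case z of (s, t) \<Rightarrow> ?u i s * ?u j t) \<partial>(lborel \<Otimes>\<^sub>M lborel))"
    by (intro sum.cong refl Bochner_Integration.integral_sum integrable_mult_right t)
  also have "\<dots> = (\<Sum>i\<in>win N. \<Sum>j\<in>win N. w i * w j * ?c i j)"
    using t(2) by (intro sum.cong refl) (simp add: w_def)
  finally show ?thesis .
qed

lemma char_dual_pairing_Vf:
  assumes f: "f \<in> L_infty" and N: "1 \<le> N"
  shows "(\<integral>\<omega>. iexp (u * dual_pairing f (Vf N (xi \<omega>))) \<partial>noise)
     = complex_of_real (exp (- ((\<integral>(s, t). f s * f t * CN N s t \<partial>(lborel \<Otimes>\<^sub>M lborel)) * u\<^sup>2) / 2))"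
proof -
  define w where "w i = (\<integral>t. f t * indicator (cell N i) t \<partial>lborel)" for i
  interpret bl: bounded_linear "dual_pairing f" by (rule bounded_linear_dual_pairing[OF f])
  have e: "u * dual_pairing f (Vf N x) = (\<Sum>i\<in>win N. (u * w i) * x (grid N i))" for x
    using dual_pairing_abs_l1[OF f integrable_cell[OF N]]
    by (simp add: Vf_def bl.sum bl.scaleR w_def sum_distrib_left mult_ac)
  have "(\<integral>\<omega>. iexp (u * dual_pairing f (Vf N (xi \<omega>))) \<partial>noise)
    = complex_of_real (exp (- (\<Sum>i\<in>win N. \<Sum>j\<in>win N. (u * w i) * (u * w j) * C (of_rat (grid N i)) (of_rat (grid N j))) / 2))"
    unfolding e by (rule char_xi[OF finite_win])
  also have "(\<Sum>i\<in>win N. \<Sum>j\<in>win N. (u * w i) * (u * w j) * C (of_rat (grid N i)) (of_rat (grid N j)))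
     = (\<integral>(s, t). f s * f t * CN N s t \<partial>(lborel \<Otimes>\<^sub>M lborel)) * u\<^sup>2"
    unfolding integral_CN[OF f N] w_def[symmetric] sum_distrib_right
    by (intro sum.cong refl) (simp add: power2_eq_square)
  finally show ?thesis .
qed

text \<open>Convergence in \<open>l1\<close> carries the pairings along, and those with step
  functions are Gaussian with variances tending to \<open>BF f f\<close> by dominated convergence.
  The limit of their characteristic functions identifies the law, and with it the second
  moment.\<close>

lemma dual_pairing_law:
  assumes f: "f \<in> L_infty" and G: "G \<in> borel_measurable noise"
    and r: "\<And>j. 1 \<le> r j" "filterlim r at_top sequentially"
    and lim: "AE \<omega> in noise. (\<lambda>j. Vf (r j) (xi \<omega>)) \<longlonglongrightarrow> G \<omega>"
  shows "0 \<le> BF f f" and "(\<lambda>\<omega>. dual_pairing f (G \<omega>)) \<in> borel_measurable noise"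
    and "distr noise borel (\<lambda>\<omega>. dual_pairing f (G \<omega>)) = centered_normal (sqrt (BF f f))"
    and "integrable noise (\<lambda>\<omega>. (dual_pairing f (G \<omega>))\<^sup>2)"
    and "(\<integral>\<omega>. (dual_pairing f (G \<omega>))\<^sup>2 \<partial>noise) = BF f f"
proof -
  let ?v = "\<lambda>j. \<integral>(s, t). f s * f t * CN (r j) s t \<partial>(lborel \<Otimes>\<^sub>M lborel)"
  have v: "?v \<longlonglongrightarrow> BF f f" by (rule integral_CN_tendsto[OF f r(2,1)])
  note cdp = continuous_dual_pairing[OF f]
  have m: "(\<lambda>\<omega>. dual_pairing f (X \<omega>)) \<in> borel_measurable noise" if "X \<in> borel_measurable noise" for X
    by (rule measurable_compose[OF that borel_measurable_continuous_onI[OF cdp]])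
  show mG: "(\<lambda>\<omega>. dual_pairing f (G \<omega>)) \<in> borel_measurable noise" by (rule m[OF G])
  show nn: "0 \<le> BF f f"
  proof (rule LIMSEQ_le_const[OF v])
    have "0 \<le> ?v j" for j
    proof -
      have "0 \<le> (\<Sum>i\<in>win (r j). \<Sum>k\<in>win (r j). w i * w k * C (of_rat (grid (r j) i)) (of_rat (grid (r j) k)))" for w
        by (rule C_psd)
      then show ?thesis unfolding integral_CN[OF f r(1)] .
    qed
    then show "\<exists>N. \<forall>n\<ge>N. 0 \<le> ?v n" by blast
  qed
  have ch: "(\<integral>\<omega>. iexp (u * dual_pairing f (G \<omega>)) \<partial>noise) = complex_of_real (exp (- ((sqrt (BF f f))\<^sup>2 * u\<^sup>2) / 2))" for u
  proof (rule LIMSEQ_unique)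
    have ci: "continuous_on UNIV (\<lambda>x. iexp (u * x))" by (intro continuous_intros)
    have mi: "(\<lambda>x. iexp (u * x)) \<in> borel_measurable borel" by (rule borel_measurable_continuous_onI[OF ci])
    show "(\<lambda>j. \<integral>\<omega>. iexp (u * dual_pairing f (Vf (r j) (xi \<omega>))) \<partial>noise) \<longlonglongrightarrow> (\<integral>\<omega>. iexp (u * dual_pairing f (G \<omega>)) \<partial>noise)"
    proof (rule integral_dominated_convergence[where w="\<lambda>_. 1"])
      show "(\<lambda>\<omega>. iexp (u * dual_pairing f (G \<omega>))) \<in> borel_measurable noise"
        by (rule measurable_compose[OF mG mi])
      show "(\<lambda>\<omega>. iexp (u * dual_pairing f (Vf (r j) (xi \<omega>)))) \<in> borel_measurable noise" for j
        by (rule measurable_compose[OF m[OF Vf_xi_measurable] mi])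
      show "AE \<omega> in noise. (\<lambda>j. iexp (u * dual_pairing f (Vf (r j) (xi \<omega>)))) \<longlonglongrightarrow> iexp (u * dual_pairing f (G \<omega>))"
        using lim
      proof eventually_elim
        case (elim \<omega>)
        have "(\<lambda>j. dual_pairing f (Vf (r j) (xi \<omega>))) \<longlonglongrightarrow> dual_pairing f (G \<omega>)"
          by (rule bounded_linear.tendsto[OF bounded_linear_dual_pairing[OF f] elim])
        then show ?case by (intro tendsto_intros)
      qed
    qed simp_all
    have "(\<lambda>j. complex_of_real (exp (- (?v j * u\<^sup>2) / 2))) \<longlonglongrightarrow> complex_of_real (exp (- (BF f f * u\<^sup>2) / 2))"
      by (intro tendsto_intros v) simp
    then show "(\<lambda>j. \<integral>\<omega>. iexp (u * dual_pairing f (Vf (r j) (xi \<omega>))) \<partial>noise) \<longlonglongrightarrow> complex_of_real (exp (- ((sqrt (BF f f))\<^sup>2 * u\<^sup>2) / 2))"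
      unfolding char_dual_pairing_Vf[OF f r(1)] using nn by simp
  qed
  have s: "0 \<le> sqrt (BF f f)" using nn by simp
  note d = Q.distr_eq_centered_normal[OF mG s ch]
  show "distr noise borel (\<lambda>\<omega>. dual_pairing f (G \<omega>)) = centered_normal (sqrt (BF f f))" by (rule d(1))
  show "integrable noise (\<lambda>\<omega>. (dual_pairing f (G \<omega>))\<^sup>2)" by (rule d(2))
  show "(\<integral>\<omega>. (dual_pairing f (G \<omega>))\<^sup>2 \<partial>noise) = BF f f" using d(3) nn by simp
qed

lemma BF_sym: assumes "f \<in> L_infty" "g \<in> L_infty" shows "BF f g = BF g f"
proof -
  have "BF f g = (\<integral>(s, t). (case (t, s) of (s, t) \<Rightarrow> f s * g t * C s t) \<partial>(lborel \<Otimes>\<^sub>M lborel))"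
    unfolding BF_def
    by (rule lborel_pair.integral_product_swap[symmetric]) (rule borel_measurable_integrable[OF integrable_C[OF assms]])
  then show ?thesis unfolding BF_def by (simp add: C_sym[of _ "fst _"] case_prod_beta mult_ac C_sym)
qed

lemma BF_add: assumes fg: "f \<in> L_infty" "g \<in> L_infty"
  shows "BF (\<lambda>t. f t + g t) (\<lambda>t. f t + g t) = BF f f + 2 * BF f g + BF g g"
proof -
  note i = integrable_C[OF fg(1) fg(1)] integrable_C[OF fg(1) fg(2)] integrable_C[OF fg(2) fg(1)] integrable_C[OF fg(2) fg(2)]
  have "BF (\<lambda>t. f t + g t) (\<lambda>t. f t + g t) = (\<integral>z. (case z of (s, t) \<Rightarrow> f s * f t * C s t) + (case z of (s, t) \<Rightarrow> f s * g t * C s t)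
     + (case z of (s, t) \<Rightarrow> g s * f t * C s t) + (case z of (s, t) \<Rightarrow> g s * g t * C s t) \<partial>(lborel \<Otimes>\<^sub>M lborel))"
    unfolding BF_def by (intro Bochner_Integration.integral_cong) (auto simp: algebra_simps)
  also have "\<dots> = BF f f + BF f g + BF g f + BF g g"
    unfolding BF_def using i by simp
  finally show ?thesis using BF_sym[OF fg] by simp
qed

subsection \<open>Convergence in law\<close>

text \<open>The empirical process is a finite sum of values of this continuous map, hence measurable as a map into \<open>l1\<close>.\<close>

definition jump :: "real \<Rightarrow> l1" where "jump y = abs_l1 (\<lambda>t. indicator {y..} t - F t)"

lemma integrable_jump: "integrable lborel (\<lambda>t. indicator {y..} t - F t)"
proof -
  have e: "indicator {y..} t - F t = (indicator {y..} t - indicator {lin a x 0..} t) + (Ind a t 0 x - F t)" for t x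
    by (auto simp: Ind_def indicator_def)
  have "integrable lborel (\<lambda>t. indicator {y..} t - indicator {z..} t :: real)" for z
  proof (rule Bochner_Integration.integrable_bound)
    show "integrable lborel (indicator {min y z..max y z} :: real \<Rightarrow> real)" by simp
    show "AE t in lborel. norm (indicator {y..} t - indicator {z..} t :: real) \<le> norm (indicator {min y z..max y z} t :: real)"
      by (auto simp: indicator_def)
  qed measurable
  then show ?thesis
    unfolding e[of _ "\<lambda>_. 0"] by (intro Bochner_Integration.integrable_add integrable_Ind_F)
qed

lemma continuous_jump: "continuous_on UNIV jump"
proof (rule continuous_onI)
  fix x e :: real assume e: "0 < e"
  have "dist (jump y) (jump x) \<le> \<bar>y - x\<bar>" for y
  proof -
    have "dist (jump y) (jump x) = (\<integral>t. \<bar>indicator {y..} t - indicator {x..} t\<bar> \<partial>lborel)"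
      using integrable_jump Bochner_Integration.integrable_diff[OF integrable_jump[of y] integrable_jump[of x]]
      by (simp add: dist_norm jump_def diff_abs_l1 norm_abs_l1)
    also have "\<dots> \<le> (\<integral>t. indicator {min y x..max y x} t \<partial>lborel)"
    proof (rule Bochner_Integration.integral_mono')
      show "integrable lborel (indicator {min y x..max y x} :: real \<Rightarrow> real)" by simp
    qed (auto simp: indicator_def)
    also have "\<dots> = \<bar>y - x\<bar>" by (simp add: min_def max_def)
    finally show ?thesis .
  qed
  then show "\<exists>d>0. \<forall>y\<in>UNIV. dist y x < d \<longrightarrow> dist (jump y) (jump x) \<le> e"
    using e by (intro exI[of _ e]) (auto simp: dist_real_def intro: order_trans less_imp_le)
qed

lemma Z_eq_jump: "abs_l1 (\<lambda>t. Z n t x) = (1 / sqrt (real n)) *\<^sub>R (\<Sum>j\<in>{1..int n}. jump (lin a x j))"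
proof -
  have "(\<Sum>j\<in>{1..int n}. jump (lin a x j)) = abs_l1 (\<lambda>t. \<Sum>j\<in>{1..int n}. indicator {lin a x j..} t - F t)"
    unfolding jump_def by (rule sum_abs_l1) (auto intro: integrable_jump)
  moreover have "integrable lborel (\<lambda>t. \<Sum>j\<in>{1..int n}. indicator {lin a x j..} t - F t)"
    by (intro Bochner_Integration.integrable_sum integrable_jump)
  ultimately have "(1 / sqrt (real n)) *\<^sub>R (\<Sum>j\<in>{1..int n}. jump (lin a x j))
     = abs_l1 (\<lambda>t. 1 / sqrt (real n) * (\<Sum>j\<in>{1..int n}. indicator {lin a x j..} t - F t))"
    by (simp add: scaleR_abs_l1)
  moreover have "(\<lambda>t. Z n t x) = (\<lambda>t. 1 / sqrt (real n) * (\<Sum>j\<in>{1..int n}. indicator {lin a x j..} t - F t))"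
    by (auto simp: Z_def Ind_def indicator_def)
  ultimately show ?thesis by simp
qed

lemma Z_l1_measurable: "(\<lambda>x. abs_l1 (\<lambda>t. Z n t x)) \<in> borel_measurable P"
proof -
  have "continuous_on UNIV (\<lambda>y :: int \<Rightarrow> real. (1 / sqrt (real n)) *\<^sub>R (\<Sum>j\<in>{1..int n}. jump (y j)))"
    by (intro continuous_intros continuous_on_compose2[OF continuous_jump continuous_on_product_coordinates]) auto
  note c = borel_measurable_continuous_onI[OF this]
  have "(\<lambda>x. lin a x) \<in> borel_measurable P"
    by (rule measurable_coordinatewise_then_product) (rule lin_measurable_P)
  from measurable_compose[OF this c] show ?thesis unfolding Z_eq_jump .
qed

text \<open>A Lipschitz function turns the mean error in \<open>l1\<close> into an error of its
  integrals, uniformly in \<open>n\<close>. For a fixed mesh it becomes a function of finitely many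
  values \<open>Zr n x\<close>, to which finite-dimensional convergence applies; refining the mesh
  leads to \<open>G\<close>.\<close>

lemma emp_process_l1_converges:
  assumes G: "G \<in> borel_measurable noise"
    and r: "\<And>j. 1 \<le> r j" "filterlim r at_top sequentially"
    and lim: "AE \<omega> in noise. (\<lambda>j. Vf (r j) (xi \<omega>)) \<longlonglongrightarrow> G \<omega>"
  shows "converges_in_law P (\<lambda>n x. abs_l1 (\<lambda>t. Z n t x)) (distr noise borel G)"
proof (rule converges_in_lawI_Lipschitz)
  show "prob_space P" by (rule P.prob_space_axioms)
  show "prob_space (distr noise borel G)" by (rule Q.prob_space_distr[OF G])
  show "sets (distr noise borel G) = sets borel" by simp
  show "(\<lambda>x. abs_l1 (\<lambda>t. Z n t x)) \<in> borel_measurable P" for n by (rule Z_l1_measurable)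
  interpret cf: cf_convergence P noise Zr xi by (rule cf_convergence)
  fix \<phi> :: "l1 \<Rightarrow> real" and k B :: real
  assume k: "0 \<le> k" and Lip: "\<And>x y. \<bar>\<phi> x - \<phi> y\<bar> \<le> k * dist x y" and B: "\<And>x. \<bar>\<phi> x\<bar> \<le> B"
  have c\<phi>: "continuous_on UNIV \<phi>"
  proof (rule continuous_onI)
    fix x :: l1 and e :: real assume e: "0 < e"
    have "dist (\<phi> y) (\<phi> x) \<le> e" if "dist y x < e / (k + 1)" for y
    proof -
      have "dist (\<phi> y) (\<phi> x) \<le> k * dist y x" using Lip by (simp add: dist_real_def)
      also have "\<dots> \<le> (k + 1) * (e / (k + 1))" using that k by (intro mult_mono) auto
      finally show ?thesis using k by simp
    qed
    then show "\<exists>d>0. \<forall>y\<in>UNIV. dist y x < d \<longrightarrow> dist (\<phi> y) (\<phi> x) \<le> e"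
      using e k by (intro exI[of _ "e / (k + 1)"]) auto
  qed
  note m\<phi> = borel_measurable_continuous_onI[OF c\<phi>]
  have mZ: "(\<lambda>x. \<phi> (abs_l1 (\<lambda>t. Z n t x))) \<in> borel_measurable P" for n
    by (rule measurable_compose[OF Z_l1_measurable m\<phi>])
  have mG: "(\<lambda>\<omega>. \<phi> (G \<omega>)) \<in> borel_measurable noise" by (rule measurable_compose[OF G m\<phi>])
  have cV: "continuous_on UNIV (\<lambda>x. \<phi> (Vf N x))" for N
    by (rule continuous_on_compose2[OF c\<phi> continuous_Vf]) simp
  have mV: "(\<lambda>x. \<phi> (Vf N (Zr n x))) \<in> borel_measurable P" for N n by (rule cf.comp_borel(1)[OF cV])
  have approx: "\<bar>(\<integral>x. \<phi> (abs_l1 (\<lambda>t. Z n t x)) \<partial>P) - (\<integral>x. \<phi> (Vf N (Zr n x)) \<partial>P)\<bar> \<le> (k + 1) * (\<integral>t. bN N t \<partial>lborel)"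
    if N: "1 \<le> N" for n N
  proof -
    let ?d = "\<lambda>x. \<bar>\<phi> (abs_l1 (\<lambda>t. Z n t x)) - \<phi> (Vf N (Zr n x))\<bar>"
    have i: "integrable P (\<lambda>x. \<phi> (abs_l1 (\<lambda>t. Z n t x)))" "integrable P (\<lambda>x. \<phi> (Vf N (Zr n x)))"
      using P.integrable_const_bound[OF _ mZ, where B=B] P.integrable_const_bound[OF _ mV, where B=B] B by auto
    \<comment> \<open>The divisor is \<open>k + 1\<close> and not \<open>k\<close> because the
      Lipschitz constant may be 0.\<close>
    have id: "integrable P (\<lambda>x. ?d x / (k + 1))" using i by auto
    have bi: "0 \<le> (\<integral>t. bN N t \<partial>lborel)" by (intro Bochner_Integration.integral_nonneg bN_range)
    have "ennreal (\<integral>x. ?d x / (k + 1) \<partial>P) = (\<integral>\<^sup>+x. ennreal (?d x / (k + 1)) \<partial>P)"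
      using id k by (intro nn_integral_eq_integral[symmetric]) auto
    also have "\<dots> \<le> (\<integral>\<^sup>+x. ennreal (norm (abs_l1 (\<lambda>t. Z n t x) - Vf N (Zr n x))) \<partial>P)"
    proof (intro nn_integral_mono ennreal_leI)
      fix x
      have "?d x \<le> k * dist (abs_l1 (\<lambda>t. Z n t x)) (Vf N (Zr n x))" by (rule Lip)
      also have "\<dots> \<le> (k + 1) * norm (abs_l1 (\<lambda>t. Z n t x) - Vf N (Zr n x))"
        by (simp add: dist_norm mult_right_mono)
      finally show "?d x / (k + 1) \<le> norm (abs_l1 (\<lambda>t. Z n t x) - Vf N (Zr n x))"
        using k by (simp add: field_simps)
    qed
    also have "\<dots> \<le> ennreal (\<integral>t. bN N t \<partial>lborel)" by (rule l1_approx[OF N])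
    finally have "(\<integral>x. ?d x / (k + 1) \<partial>P) \<le> (\<integral>t. bN N t \<partial>lborel)" using bi by simp
    then have 1: "(\<integral>x. ?d x \<partial>P) \<le> (k + 1) * (\<integral>t. bN N t \<partial>lborel)" using k by (simp add: field_simps)
    have "\<bar>(\<integral>x. \<phi> (abs_l1 (\<lambda>t. Z n t x)) \<partial>P) - (\<integral>x. \<phi> (Vf N (Zr n x)) \<partial>P)\<bar> = \<bar>\<integral>x. \<phi> (abs_l1 (\<lambda>t. Z n t x)) - \<phi> (Vf N (Zr n x)) \<partial>P\<bar>"
      using i by simp
    also have "\<dots> \<le> (\<integral>x. ?d x \<partial>P)" by (rule integral_abs_bound)
    finally show ?thesis using 1 by simp
  qed
  have limG: "(\<lambda>j. \<integral>\<omega>. \<phi> (Vf (r j) (xi \<omega>)) \<partial>noise) \<longlonglongrightarrow> (\<integral>\<omega>. \<phi> (G \<omega>) \<partial>noise)"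
  proof (rule integral_dominated_convergence[where w="\<lambda>_. B"])
    show "AE \<omega> in noise. (\<lambda>j. \<phi> (Vf (r j) (xi \<omega>))) \<longlonglongrightarrow> \<phi> (G \<omega>)"
      using lim
    proof eventually_elim
      case (elim \<omega>)
      then show ?case by (rule continuous_on_tendsto_compose[OF c\<phi>]) auto
    qed
    show "(\<lambda>\<omega>. \<phi> (Vf (r j) (xi \<omega>))) \<in> borel_measurable noise" for j by (rule cf.comp_borel(2)[OF cV])
  qed (use mG B in auto)
  have limb: "(\<lambda>j. (k + 1) * (\<integral>t. bN (r j) t \<partial>lborel)) \<longlonglongrightarrow> 0"
    by (rule tendsto_mult_right_zero[OF filterlim_compose[OF integral_bN_tendsto_0 r(2)]])
  have "(\<lambda>n. \<integral>x. \<phi> (abs_l1 (\<lambda>t. Z n t x)) \<partial>P) \<longlonglongrightarrow> (\<integral>\<omega>. \<phi> (G \<omega>) \<partial>noise)"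
  proof (rule LIMSEQ_I)
    fix e :: real assume e: "0 < e"
    \<comment> \<open>The mesh is fixed before \<open>n\<close>: both approximation errors, that of
      the empirical process and that of the limit, are made small at once.\<close>
    have "\<forall>\<^sub>F j in sequentially. (k + 1) * (\<integral>t. bN (r j) t \<partial>lborel) < e / 3 \<and> dist (\<integral>\<omega>. \<phi> (Vf (r j) (xi \<omega>)) \<partial>noise) (\<integral>\<omega>. \<phi> (G \<omega>) \<partial>noise) < e / 3"
      using order_tendstoD(2)[OF limb, of "e / 3"] tendstoD[OF limG, of "e / 3"] e by (auto intro: eventually_conj)
    then obtain j where j: "(k + 1) * (\<integral>t. bN (r j) t \<partial>lborel) < e / 3"
      "\<bar>(\<integral>\<omega>. \<phi> (Vf (r j) (xi \<omega>)) \<partial>noise) - (\<integral>\<omega>. \<phi> (G \<omega>) \<partial>noise)\<bar> < e / 3"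
      by (auto simp: eventually_sequentially dist_real_def)
    have "(\<lambda>n. \<integral>x. \<phi> (Vf (r j) (Zr n x)) \<partial>P) \<longlonglongrightarrow> (\<integral>\<omega>. \<phi> (Vf (r j) (xi \<omega>)) \<partial>noise)"
    proof (rule cf.finite_dim_convergence[OF cV, where B=B and J="grid (r j) ` win (r j)"])
      show "\<phi> (Vf (r j) x) = \<phi> (Vf (r j) y)" if "\<And>i. i \<in> grid (r j) ` win (r j) \<Longrightarrow> x i = y i" for x y
        unfolding Vf_def using that by (intro arg_cong[where f=\<phi>] sum.cong refl) simp
    qed (use B finite_win in auto)
    from LIMSEQ_D[OF this, of "e / 3"] e obtain n0
      where n0: "\<And>n. n \<ge> n0 \<Longrightarrow> \<bar>(\<integral>x. \<phi> (Vf (r j) (Zr n x)) \<partial>P) - (\<integral>\<omega>. \<phi> (Vf (r j) (xi \<omega>)) \<partial>noise)\<bar> < e / 3" by auto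
    have "norm ((\<integral>x. \<phi> (abs_l1 (\<lambda>t. Z n t x)) \<partial>P) - (\<integral>\<omega>. \<phi> (G \<omega>) \<partial>noise)) < e" if "n \<ge> n0" for n
      using n0[OF that] approx[OF r(1), of n j] j unfolding real_norm_def by linarith
    then show "\<exists>no. \<forall>n\<ge>no. norm ((\<integral>x. \<phi> (abs_l1 (\<lambda>t. Z n t x)) \<partial>P) - (\<integral>\<omega>. \<phi> (G \<omega>) \<partial>noise)) < e" by blast
  qed
  also have "(\<integral>\<omega>. \<phi> (G \<omega>) \<partial>noise) = (\<integral>x. \<phi> x \<partial>distr noise borel G)"
    by (rule integral_distr[OF G m\<phi>, symmetric])
  finally show "(\<lambda>n. \<integral>x. \<phi> (abs_l1 (\<lambda>t. Z n t x)) \<partial>P) \<longlonglongrightarrow> (\<integral>x. \<phi> x \<partial>distr noise borel G)" .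
qed

theorem empirical_clt:
  "\<exists>\<mu>. centered_gaussian_l1 \<mu> \<and>
      converges_in_law P (\<lambda>n x. abs_l1 (emp_process P Yp n x)) \<mu> \<and>
      (\<forall>f\<in>L_infty. \<forall>g\<in>L_infty.
        integrable (lborel \<Otimes>\<^sub>M lborel) (\<lambda>(s, t). f s * g t * limit_cov P Yp s t) \<and>
        gaussian_covariance \<mu> f g = (\<integral>(s, t). f s * g t * limit_cov P Yp s t \<partial>(lborel \<Otimes>\<^sub>M lborel)))"
proof -
  obtain G r where G: "G \<in> borel_measurable noise" and r: "\<And>j. 1 \<le> r j" "filterlim r at_top sequentially"
    and lim: "AE \<omega> in noise. (\<lambda>j. Vf (r j) (xi \<omega>)) \<longlonglongrightarrow> G \<omega>"
    by (rule Gaussian_limit_exists) blast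
  note law = dual_pairing_law[OF _ G r lim]
  let ?\<mu> = "distr noise borel G"
  have dm: "dual_pairing f \<in> borel_measurable borel" if "f \<in> L_infty" for f
    by (rule borel_measurable_continuous_onI[OF continuous_dual_pairing[OF that]])
  have "centered_gaussian_l1 ?\<mu>"
    unfolding centered_gaussian_l1_def
  proof (intro conjI ballI)
    show "prob_space ?\<mu>" by (rule Q.prob_space_distr[OF G])
    fix f assume f: "f \<in> L_infty"
    show "dual_pairing f \<in> borel_measurable ?\<mu>" using dm[OF f] by simp
    have "distr ?\<mu> borel (dual_pairing f) = distr noise borel (dual_pairing f \<circ> G)"
      by (rule distr_distr[OF dm[OF f] G])
    also have "\<dots> = centered_normal (sqrt (BF f f))" using law(3)[OF f] by (simp add: comp_def)
    finally show "\<exists>\<sigma>\<ge>0. distr ?\<mu> borel (dual_pairing f) = centered_normal \<sigma>"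
      using law(1)[OF f] by (intro exI[of _ "sqrt (BF f f)"]) simp
  qed simp
  moreover have "converges_in_law P (\<lambda>n x. abs_l1 (emp_process P Yp n x)) ?\<mu>"
  proof -
    have "emp_process P Yp n x = (\<lambda>t. Z n t x)" for n x by (rule ext) (rule emp_process_eq)
    then show ?thesis using emp_process_l1_converges[OF G r lim] by simp
  qed
  moreover have "gaussian_covariance ?\<mu> f g = BF f g" if f: "f \<in> L_infty" and g: "g \<in> L_infty" for f g
  proof -
    let ?f = "\<lambda>\<omega>. dual_pairing f (G \<omega>)" and ?g = "\<lambda>\<omega>. dual_pairing g (G \<omega>)"
    \<comment> \<open>The laws of single pairings only give variances; applying them to
      \<open>f\<close>, \<open>g\<close> and \<open>f + g\<close> recovers the covariance by
      polarization.\<close>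
    have i: "integrable noise (\<lambda>\<omega>. (?f \<omega> + ?g \<omega>)\<^sup>2)" "integrable noise (\<lambda>\<omega>. (?f \<omega>)\<^sup>2)" "integrable noise (\<lambda>\<omega>. (?g \<omega>)\<^sup>2)"
      using law(4)[OF L_infty_add[OF f g]] law(4)[OF f] law(4)[OF g] by (simp_all add: dual_pairing_add_fun[OF f g])
    have s: "(\<integral>\<omega>. (?f \<omega> + ?g \<omega>)\<^sup>2 \<partial>noise) = BF f f + 2 * BF f g + BF g g"
      using law(5)[OF L_infty_add[OF f g]] by (simp add: dual_pairing_add_fun[OF f g] BF_add[OF f g])
    have "gaussian_covariance ?\<mu> f g = (\<integral>\<omega>. ?f \<omega> * ?g \<omega> \<partial>noise)"
      unfolding gaussian_covariance_def
      by (rule integral_distr[OF G]) (intro borel_measurable_times dm f g)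
    also have "\<dots> = (\<integral>\<omega>. ((?f \<omega> + ?g \<omega>)\<^sup>2 - (?f \<omega>)\<^sup>2 - (?g \<omega>)\<^sup>2) / 2 \<partial>noise)"
      by (intro Bochner_Integration.integral_cong) (auto simp: power2_eq_square algebra_simps)
    also have "\<dots> = BF f g"
      using i by (simp add: s law(5)[OF f] law(5)[OF g])
    finally show ?thesis .
  qed
  ultimately show ?thesis
    using integrable_C unfolding BF_def C_def by (intro exI[of _ ?\<mu>] conjI ballI) auto
qed

lemma integrable_emp_process: "integrable lborel (emp_process P Yp n x)"
proof -
  have "emp_process P Yp n x = (\<lambda>t. Z n t x)" by (rule ext) (rule emp_process_eq)
  then show ?thesis by (simp add: integrable_Z)
qed

end

section \<open>Transfer from the sequence space to the given probability space\<close>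

lemma density_interval_bound:
  assumes D: "D = density lborel (\<lambda>x. ennreal (h x))" and h: "h \<in> borel_measurable borel"
    and K: "\<And>x. 0 \<le> h x \<and> h x \<le> K" and uv: "u \<le> v"
  shows "measure D {u..v} \<le> K * (v - u)"
proof -
  have K0: "0 \<le> K" using K[of 0] by linarith
  have "emeasure D {u..v} = (\<integral>\<^sup>+x. ennreal (h x) * indicator {u..v} x \<partial>lborel)"
    unfolding D using h by (intro emeasure_density) auto
  also have "\<dots> \<le> (\<integral>\<^sup>+x. ennreal K * indicator {u..v} x \<partial>lborel)"
    using K by (intro nn_integral_mono mult_right_mono ennreal_leI) auto
  also have "\<dots> = ennreal (K * (v - u))"
    using uv K0 by (simp add: nn_integral_cmult_indicator ennreal_mult)
  finally have "emeasure D {u..v} \<le> ennreal (K * (v - u))" .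
  then show ?thesis
    using K0 uv by (simp add: measure_def enn2real_leI)
qed

theorem corollary3p11:
  fixes M :: "'a measure"
    and \<epsilon> Y :: "int \<Rightarrow> 'a \<Rightarrow> real"
    and a :: "nat \<Rightarrow> real"
    and K :: real
  assumes "prob_space M"
    and "prob_space.indep_vars M (\<lambda>_. borel) \<epsilon> UNIV"
    and "\<And>i. distr M borel (\<epsilon> i) = distr M borel (\<epsilon> 0)"
    and "\<And>i. integrable M (\<lambda>\<omega>. (\<epsilon> i \<omega>)\<^sup>2)"
    and "summable (\<lambda>j. \<bar>a j\<bar>)"
    and "\<And>k \<omega>. Y k \<omega> = (\<Sum>j. a j * \<epsilon> (k - int j) \<omega>)"
    and "\<exists>h :: real \<Rightarrow> real.
           distributed M lborel (\<epsilon> 0) (\<lambda>x. ennreal (h x)) \<and> (\<forall>x. 0 \<le> h x \<and> h x \<le> K)"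
    and "\<bar>a 0\<bar> \<noteq> 0"
    and "(\<Sum>k. \<integral>\<^sup>+u\<in>{0<..(a k)\<^sup>2}. ennreal (abs_quantile M (Y 0) u / sqrt u) \<partial>lborel) < \<infinity>"
  shows "(\<forall>n. \<forall>\<omega>\<in>space M. integrable lborel (emp_process M Y n \<omega>)) \<and>
    (\<forall>s t. summable (\<lambda>k. lag_cov M Y s t (Suc k))) \<and>
    (\<exists>\<mu>. centered_gaussian_l1 \<mu> \<and>
      converges_in_law M (\<lambda>n \<omega>. abs_l1 (emp_process M Y n \<omega>)) \<mu> \<and>
      (\<forall>f\<in>L_infty. \<forall>g\<in>L_infty.
        integrable (lborel \<Otimes>\<^sub>M lborel) (\<lambda>(s, t). f s * g t * limit_cov M Y s t) \<and>
        gaussian_covariance \<mu> f g =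
          (\<integral>(s, t). f s * g t * limit_cov M Y s t \<partial>(lborel \<Otimes>\<^sub>M lborel))))"
proof -
  interpret M: prob_space M by fact
  define D where "D = distr M borel (\<epsilon> 0)"
  have \<epsilon>: "\<epsilon> i \<in> borel_measurable M" for i
    using assms(2) by (auto simp: M.indep_vars_def)
  obtain h where h: "distributed M lborel (\<epsilon> 0) (\<lambda>x. ennreal (h x))" "\<And>x. 0 \<le> h x \<and> h x \<le> K"
    using assms(7) by blast
  have hm: "h \<in> borel_measurable borel"
    using distributed_real_measurable[OF _ h(1)] h(2) by simp
  have Dd: "D = density lborel (\<lambda>x. ennreal (h x))"
    using distributed_distr_eq_density[OF h(1)] unfolding D_def
    by (metis distr_cong sets_lborel)
  have locD: "lin_proc D a K"
  proof (rule lin_proc.intro)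
    show "iid_seq D"
      unfolding iid_seq_def iid_seq_axioms_def D_def by (simp add: M.prob_space_distr \<epsilon>)
    show "lin_proc_axioms D a K"
    proof
      show "integrable D (\<lambda>x. x\<^sup>2)"
        unfolding D_def using assms(4)[of 0] by (subst integrable_distr_eq[OF \<epsilon>]) auto
      show "summable (\<lambda>k. \<bar>a k\<bar>)" by fact
      show "a 0 \<noteq> 0" using assms(8) by simp
      show "measure D {u..v} \<le> K * (v - u)" if "u \<le> v" for u v
        by (rule density_interval_bound[OF Dd hm h(2) that])
    qed
  qed
  interpret lp: lin_proc D a K by (rule locD)
  let ?E = "\<lambda>\<omega> i. \<epsilon> i \<omega>"
  have E: "?E \<in> measurable M lp.P" by (rule lp.measurable_into_P) (rule \<epsilon>)
  \<comment> \<open>Independence and equality of the marginals say exactly that the whole sequence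
    of innovations has the product law, so every quantity in the claim can be computed on the
    sequence space.\<close>
  have law: "distr M lp.P ?E = lp.P"
  proof -
    have "distr M lp.P ?E = distr M (PiM UNIV (\<lambda>_. borel)) (\<lambda>x. \<lambda>i\<in>UNIV. \<epsilon> i x)"
      by (rule distr_cong) (auto simp: lp.P_def restrict_UNIV cong: sets_PiM_cong)
    also have "\<dots> = PiM UNIV (\<lambda>i. distr M borel (\<epsilon> i))"
      using M.indep_vars_iff_distr_eq_PiM[where I=UNIV and M'="\<lambda>_. borel" and X=\<epsilon>] assms(2) \<epsilon> by simp
    also have "(\<lambda>i. distr M borel (\<epsilon> i)) = (\<lambda>_. D)" unfolding D_def by (rule ext) (rule assms(3))
    also have "PiM UNIV (\<lambda>_. D) = lp.P" by (simp add: lp.P_def)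
    finally show ?thesis .
  qed
  \<comment> \<open>This holds at every point, also where the series diverges, because both sides
    are the same \<open>suminf\<close>.\<close>
  have Y: "Y k \<omega> = lp.Yp k (?E \<omega>)" for k \<omega>
    by (simp add: assms(6) lp.Yp_def lp.lin_def)
  have prob: "measure M {\<omega> \<in> space M. Q (?E \<omega>)} = measure lp.P {x \<in> space lp.P. Q x}"
    if "{x \<in> space lp.P. Q x} \<in> sets lp.P" for Q
  proof -
    have "measure (distr M lp.P ?E) {x \<in> space lp.P. Q x} = measure M (?E -` {x \<in> space lp.P. Q x} \<inter> space M)"
      by (rule measure_distr[OF E that])
    also have "?E -` {x \<in> space lp.P. Q x} \<inter> space M = {\<omega> \<in> space M. Q (?E \<omega>)}" by auto
    finally show ?thesis by (simp only: law)
  qed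
  note [measurable] = lp.Yp_measurable
  have quant: "abs_quantile M (Y 0) u = abs_quantile lp.P (lp.Yp 0) u" for u
  proof -
    have "measure M {\<omega> \<in> space M. x < \<bar>lp.Yp 0 (?E \<omega>)\<bar>} = measure lp.P {\<omega> \<in> space lp.P. x < \<bar>lp.Yp 0 \<omega>\<bar>}" for x
      by (rule prob) measurable
    then show ?thesis unfolding abs_quantile_def Y by simp
  qed
  have df: "dist_fun M (Y 0) t = dist_fun lp.P (lp.Yp 0) t" for t
  proof -
    have Y0: "Y 0 = (\<lambda>\<omega>. lp.Yp 0 (?E \<omega>))" by (rule ext) (rule Y)
    have "distr M borel (Y 0) = distr (distr M lp.P ?E) borel (lp.Yp 0)"
      unfolding Y0 by (subst distr_distr[OF lp.Yp_measurable E]) (simp add: comp_def)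
    then show ?thesis by (simp only: dist_fun_def law)
  qed
  have lag: "lag_cov M Y s t k = lag_cov lp.P lp.Yp s t k" for s t k
  proof -
    have "measure M {\<omega> \<in> space M. lp.Yp 0 (?E \<omega>) \<le> t \<and> lp.Yp (int k) (?E \<omega>) \<le> s}
       = measure lp.P {\<omega> \<in> space lp.P. lp.Yp 0 \<omega> \<le> t \<and> lp.Yp (int k) \<omega> \<le> s}" for s t
      by (rule prob) measurable
    then show ?thesis unfolding lag_cov_def df Y by simp
  qed
  have lim: "limit_cov M Y s t = limit_cov lp.P lp.Yp s t" for s t
    unfolding limit_cov_def df lag ..
  have emp: "emp_process M Y n \<omega> = emp_process lp.P lp.Yp n (?E \<omega>)" for n \<omega>
    by (rule ext) (simp only: emp_process_def emp_cdf_def df Y)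
  \<comment> \<open>The quantile function depends only on the law of \<open>Y 0\<close>, so the
    integrability assumption is now available on the sequence space.\<close>
  interpret lq: lin_proc_q D a K
    by unfold_locales (use assms(9) in \<open>simp only: quant\<close>)
  obtain \<mu> where \<mu>: "centered_gaussian_l1 \<mu>"
    "converges_in_law lp.P (\<lambda>n x. abs_l1 (emp_process lp.P lp.Yp n x)) \<mu>"
    "\<forall>f\<in>L_infty. \<forall>g\<in>L_infty.
        integrable (lborel \<Otimes>\<^sub>M lborel) (\<lambda>(s, t). f s * g t * limit_cov lp.P lp.Yp s t) \<and>
        gaussian_covariance \<mu> f g = (\<integral>(s, t). f s * g t * limit_cov lp.P lp.Yp s t \<partial>(lborel \<Otimes>\<^sub>M lborel))"
    using lq.empirical_clt by blast
  have "converges_in_law M (\<lambda>n \<omega>. abs_l1 (emp_process M Y n \<omega>)) \<mu>"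
    unfolding converges_in_law_def
  proof (intro conjI allI impI)
    have m: "(\<lambda>x. abs_l1 (emp_process lp.P lp.Yp n x)) \<in> borel_measurable lp.P" for n
      using \<mu>(2) by (simp add: converges_in_law_def)
    show "(\<lambda>\<omega>. abs_l1 (emp_process M Y n \<omega>)) \<in> borel_measurable M" for n
      unfolding emp by (rule measurable_compose[OF E m])
    fix \<phi> :: "l1 \<Rightarrow> real" assume \<phi>: "continuous_on UNIV \<phi>" "bounded (range \<phi>)"
    have "(\<integral>\<omega>. \<phi> (abs_l1 (emp_process M Y n \<omega>)) \<partial>M) = (\<integral>x. \<phi> (abs_l1 (emp_process lp.P lp.Yp n x)) \<partial>lp.P)" for n
    proof -
      have "(\<integral>x. \<phi> (abs_l1 (emp_process lp.P lp.Yp n x)) \<partial>distr M lp.P ?E)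
          = (\<integral>\<omega>. \<phi> (abs_l1 (emp_process lp.P lp.Yp n (?E \<omega>))) \<partial>M)"
        by (rule integral_distr[OF E measurable_compose[OF m borel_measurable_continuous_onI[OF \<phi>(1)]]])
      then show ?thesis by (simp only: law emp)
    qed
    then show "(\<lambda>n. \<integral>\<omega>. \<phi> (abs_l1 (emp_process M Y n \<omega>)) \<partial>M) \<longlonglongrightarrow> (\<integral>x. \<phi> x \<partial>\<mu>)"
      using \<mu>(2) \<phi> by (simp add: converges_in_law_def)
  qed
  with \<mu> show ?thesis
    using lq.integrable_emp_process lp.summable_lag_cov by (auto simp: emp lag lim)
qed

end
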